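(* Let $(X,\omega)$ be a complex Hermitian manifold with $\dim_{\mathbb C}X=n\ge2$. For any $C^\infty$ function $\eta$ on $X$ such that $\eta>0$ or $\eta<0$ and any $k\in\{0,\dots,2n\}$, the following refined $\eta$-Bochner-Kodaira-Nakano identity holds on the $C^\infty$ $k$-forms on $X$: $$\Delta''_\eta=\Big[\overline{D^{0,1}_\eta}+\overline{\tau^{0,1}_\eta},\ \overline{D^{0,1}_\eta}^{\,\star}+\overline{\tau^{0,1}_\eta}^{\,\star}\Big]+T_\omega^{(\eta)''}+i\,\Big[[D^{0,1}_\eta,\overline{D^{0,1}_\eta}],\Lambda\Big]+n\,\Big[\overline{D^{0,1}_\eta}+\overline{\tau^{0,1}_\eta},\ \tfrac1\eta(\partial\eta\wedge\cdot)^\star\Big]-n\,\Big[D^{0,1}_\eta,\ \tfrac1\eta(\bar\partial\eta\wedge\cdot)^\star\Big],$$ where $T_\omega^{(\eta)''}$ is the zero-th order operator $$T_\omega^{(\eta)''}:=-\frac i2\,\big[\Lambda,[\Lambda,\,D^{0,1}_\eta\overline{D^{0,1}_\eta}\omega\wedge\cdot\,]\big]-\big[\overline{D^{0,1}_\eta}\omega\wedge\cdot\,,\ (\overline{D^{0,1}_\eta}\omega\wedge\cdot)^\star\big].$$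
   Context: $\eta$ is real-valued and $\eta>0$ (resp. $\eta<0$) means at every point. The Hermitian metric is identified with its positive definite $(1,1)$-form $\omega$, normalized so that $\omega=i\sum_j\zeta_j\wedge\bar\zeta_j$ for a local orthonormal coframe of $(1,0)$-forms. $\star$ denotes the formal adjoint for the $L^2$-inner product induced by $\omega$ (pointwise adjoint for zero-order operators); $\Lambda$ is the adjoint of $L=\omega\wedge\cdot$; $[A,B]=AB-(-1)^{ab}BA$ is the graded commutator of operators of degrees $a,b$. The conjugate of an operator $P$ is $\overline P u=\overline{P\bar u}$. On $(p,q)$-forms, $D^{0,1}_\eta=\bar\partial-\frac p\eta\,\bar\partial\eta\wedge\cdot$, hence $\overline{D^{0,1}_\eta}=\partial-\frac q\eta\,\partial\eta\wedge\cdot$. Further, $\tau^{0,1}_\eta:=[\Lambda,\,D^{0,1}_\eta\omega\wedge\cdot\,]$, $\overline{\tau^{0,1}_\eta}$ is its conjugate, and $\Delta''_\eta:=[D^{0,1}_\eta,(D^{0,1}_\eta)^\star]$. *)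

theory Defs
  imports "HOL-Analysis.Analysis" "HOL-Library.Function_Algebras"
begin

text \<open>
  Complex manifolds of dimension \<open>CARD('n)\<close>: the underlying space is a Hausdorff second countable
  type \<open>'a\<close>, the structure is a holomorphic atlas of charts \<open>(U, \<phi>)\<close> with \<open>\<phi>\<close> mapping \<open>U\<close> onto an
  open subset of \<open>complex ^ 'n\<close>.  The values of \<open>\<phi>\<close> outside \<open>U\<close> are irrelevant.
\<close>

type_synonym ('a, 'n) chart = "'a set \<times> ('a \<Rightarrow> complex ^ 'n)"

definition chart_dom :: "('a, 'n::finite) chart \<Rightarrow> 'a set" where
  "chart_dom c = fst c"

definition chart_img :: "('a, 'n::finite) chart \<Rightarrow> (complex ^ 'n) set" where
  "chart_img c = snd c ` fst c"

definition chart_inv :: "('a, 'n::finite) chart \<Rightarrow> complex ^ 'n \<Rightarrow> 'a" where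
  "chart_inv c = inv_into (fst c) (snd c)"

definition holomorphic_map_on ::
    "(complex ^ 'n::finite) set \<Rightarrow> (complex ^ 'n \<Rightarrow> complex ^ 'n) \<Rightarrow> bool" where
  "holomorphic_map_on S f \<longleftrightarrow>
     (\<forall>z\<in>S. \<exists>f'. (f has_derivative f') (at z) \<and> (\<forall>a v. f' (a *s v) = a *s f' v))"

definition complex_manifold ::
    "('a::{t2_space,second_countable_topology}, 'n::finite) chart set \<Rightarrow> bool" where
  "complex_manifold A \<longleftrightarrow>
     (\<Union>c\<in>A. chart_dom c) = UNIV \<and>
     (\<forall>c\<in>A. open (chart_dom c) \<and> open (chart_img c) \<and>
            homeomorphism (chart_dom c) (chart_img c) (snd c) (chart_inv c)) \<and>
     (\<forall>c\<in>A. \<forall>c'\<in>A. holomorphic_map_on (snd c ` (chart_dom c \<inter> chart_dom c'))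
                       (\<lambda>z. snd c' (chart_inv c z)))"

fun Ck_on :: "nat \<Rightarrow> 'v::real_normed_vector set \<Rightarrow> ('v \<Rightarrow> 'w::real_normed_vector) \<Rightarrow> bool" where
  "Ck_on 0 S f \<longleftrightarrow> continuous_on S f"
| "Ck_on (Suc k) S f \<longleftrightarrow> (\<forall>z\<in>S. f differentiable (at z)) \<and>
     (\<forall>v. Ck_on k S (\<lambda>z. frechet_derivative f (at z) v))"

text \<open>Only used for open \<open>S\<close>.\<close>

definition smooth_on :: "'v::real_normed_vector set \<Rightarrow> ('v \<Rightarrow> 'w::real_normed_vector) \<Rightarrow> bool" where
  "smooth_on S f \<longleftrightarrow> (\<forall>k. Ck_on k S f)"

definition smooth_fun :: "('a, 'n::finite) chart set \<Rightarrow> ('a \<Rightarrow> 'w::real_normed_vector) \<Rightarrow> bool" where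
  "smooth_fun A f \<longleftrightarrow> (\<forall>c\<in>A. smooth_on (chart_img c) (\<lambda>z. f (chart_inv c z)))"

text \<open>
  Indices of the complexified tangent frame in local coordinates: \<open>Inl j\<close> stands for
  \<open>\<partial>/\<partial>z\<^sub>j\<close> and \<open>Inr j\<close> for \<open>\<partial>/\<partial>(cnj z\<^sub>j)\<close>.  At a point, a complex-valued exterior form (possibly of
  mixed degree) is given by its components \<open>\<alpha> as = \<alpha>(e(a\<^sub>1), \<dots>, e(a\<^sub>k))\<close> for \<open>as = [a\<^sub>1, \<dots>, a\<^sub>k]\<close>, \<open>e\<close> being the frame,
  the part of degree \<open>k\<close> being the restriction of \<open>\<alpha>\<close> to lists of length \<open>k\<close>.
\<close>

type_synonym 'n cform = "('n + 'n) list \<Rightarrow> complex"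

definition alternating :: "'n cform \<Rightarrow> bool" where
  "alternating \<alpha> \<longleftrightarrow> (\<forall>as a b bs. \<alpha> (as @ a # b # bs) = - \<alpha> (as @ b # a # bs))"

text \<open>
  The wedge product as a sum over shuffles, \<open>S\<close> being the set of positions whose entries go into the
  first factor, normalized so that \<open>(\<alpha> \<and> \<beta>)(v, w) = \<alpha>(v) \<beta>(w) - \<alpha>(w) \<beta>(v)\<close> for 1-forms.
\<close>

definition cwedge :: "'n cform \<Rightarrow> 'n cform \<Rightarrow> 'n cform" where
  "cwedge \<alpha> \<beta> as =
     (\<Sum>S\<in>Pow {..<length as}.
        (-1) ^ card {(i, j). i < j \<and> j < length as \<and> i \<notin> S \<and> j \<in> S} *
        \<alpha> (nths as S) * \<beta> (nths as (- S)))"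

definition cconj :: "'n cform \<Rightarrow> 'n cform" where
  "cconj \<alpha> as = cnj (\<alpha> (map (case_sum Inr Inl) as))"

definition cpart :: "nat \<Rightarrow> nat \<Rightarrow> 'n cform \<Rightarrow> 'n cform" where
  "cpart p q \<alpha> as =
     (if length (filter isl as) = p \<and> length (filter (Not \<circ> isl) as) = q then \<alpha> as else 0)"

text \<open>
  The matrix \<open>h\<close> of a (1,1)-form \<open>\<i> \<Sum> h\<^bsub>jk\<^esub> dz\<^sub>j \<and> cnj dz\<^sub>k\<close>.
\<close>

definition hmat :: "'n::finite cform \<Rightarrow> complex ^ 'n ^ 'n" where
  "hmat \<omega> = (\<chi> j k. - \<i> * \<omega> [Inl j, Inr k])"

text \<open>
  The Hermitian products of the 1-forms \<open>dz\<^sub>j\<close>, \<open>cnj dz\<^sub>j\<close>, for which \<open>\<omega> = \<i> \<Sum> \<zeta>\<^sub>j \<and> cnj \<zeta>\<^sub>j\<close> holds for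
  orthonormal (1,0)-coframes \<open>\<zeta>\<close>: if \<open>\<zeta>\<^sub>a = \<Sum> T\<^bsub>aj\<^esub> dz\<^sub>j\<close> then \<open>h = transpose T ** cnj T\<close>, whence
  \<open>\<langle>dz\<^sub>j, dz\<^sub>k\<rangle>\<close> is the \<open>(k, j)\<close> entry of the inverse of \<open>h\<close>.
\<close>

fun cometric :: "'n::finite cform \<Rightarrow> 'n + 'n \<Rightarrow> 'n + 'n \<Rightarrow> complex" where
  "cometric \<omega> (Inl j) (Inl k) = matrix_inv (hmat \<omega>) $ k $ j"
| "cometric \<omega> (Inr j) (Inr k) = matrix_inv (hmat \<omega>) $ j $ k"
| "cometric \<omega> _ _ = 0"

text \<open>
  The induced Hermitian product on exterior forms, for which the wedge products of members of an
  orthonormal coframe are orthonormal.  The factor \<open>1/k!\<close> accounts for summing over all index lists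
  rather than increasing ones.
\<close>

definition cinner :: "'n::finite cform \<Rightarrow> 'n cform \<Rightarrow> 'n cform \<Rightarrow> complex" where
  "cinner \<omega> \<alpha> \<beta> =
     (\<Sum>k\<le>2 * CARD('n). 1 / fact k *
        (\<Sum>as\<in>{as. length as = k}. \<Sum>bs\<in>{bs. length bs = k}.
           (\<Prod>i<k. cometric \<omega> (as ! i) (bs ! i)) * \<alpha> as * cnj (\<beta> bs)))"

text \<open>Directional derivatives along \<open>\<partial>/\<partial>z\<^sub>j = (\<partial>/\<partial>x\<^sub>j - \<i> \<partial>/\<partial>y\<^sub>j)/2\<close> and its conjugate.\<close>

fun wirtinger :: "'n + 'n \<Rightarrow> (complex ^ 'n::finite \<Rightarrow> complex) \<Rightarrow> complex ^ 'n \<Rightarrow> complex" where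
  "wirtinger (Inl j) f z =
     (frechet_derivative f (at z) (axis j 1) - \<i> * frechet_derivative f (at z) (axis j \<i>)) / 2"
| "wirtinger (Inr j) f z =
     (frechet_derivative f (at z) (axis j 1) + \<i> * frechet_derivative f (at z) (axis j \<i>)) / 2"

text \<open>
  A differential form on the manifold is a family of forms on the coordinate images, related by the
  tensor transformation law; it is set to 0 off the coordinate images, so that it is determined
  as a function.  The entries of \<open>chart_jac\<close> are the derivatives of the coordinates \<open>w\<^sub>k\<close>, \<open>cnj w\<^sub>k\<close>
  of the second chart along the frame vectors of the first one.
\<close>

type_synonym ('a, 'n) form = "('a, 'n) chart \<Rightarrow> complex ^ 'n \<Rightarrow> 'n cform"

fun coord :: "'n + 'n \<Rightarrow> complex ^ 'n::finite \<Rightarrow> complex" where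
  "coord (Inl k) w = w $ k"
| "coord (Inr k) w = cnj (w $ k)"

definition chart_jac ::
    "('a, 'n::finite) chart \<Rightarrow> ('a, 'n) chart \<Rightarrow> 'a \<Rightarrow> 'n + 'n \<Rightarrow> 'n + 'n \<Rightarrow> complex" where
  "chart_jac c c' x a b = wirtinger a (\<lambda>z. coord b (snd c' (chart_inv c z))) (snd c x)"

definition smooth_form :: "('a, 'n::finite) chart set \<Rightarrow> ('a, 'n) form \<Rightarrow> bool" where
  "smooth_form A u \<longleftrightarrow>
     (\<forall>c z. c \<notin> A \<or> z \<notin> chart_img c \<longrightarrow> u c z = (\<lambda>_. 0)) \<and>
     (\<forall>c\<in>A. \<forall>z\<in>chart_img c. alternating (u c z)) \<and>
     (\<forall>c\<in>A. \<forall>as. smooth_on (chart_img c) (\<lambda>z. u c z as)) \<and>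
     (\<forall>c\<in>A. \<forall>c'\<in>A. \<forall>x\<in>chart_dom c \<inter> chart_dom c'. \<forall>as.
        u c (snd c x) as =
          (\<Sum>bs\<in>{bs. length bs = length as}.
             (\<Prod>i<length as. chart_jac c c' x (as ! i) (bs ! i)) * u c' (snd c' x) bs))"

definition has_degree :: "nat \<Rightarrow> ('a, 'n::finite) form \<Rightarrow> bool" where
  "has_degree k u \<longleftrightarrow> (\<forall>c z as. length as \<noteq> k \<longrightarrow> u c z as = 0)"

definition compactly_supported ::
    "('a::topological_space, 'n::finite) chart set \<Rightarrow> ('a, 'n) form \<Rightarrow> bool" where
  "compactly_supported A u \<longleftrightarrow>
     compact (closure {x. \<exists>c\<in>A. x \<in> chart_dom c \<and> u c (snd c x) \<noteq> (\<lambda>_. 0)})"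

definition wedge :: "('a, 'n::finite) form \<Rightarrow> ('a, 'n) form \<Rightarrow> ('a, 'n) form" where
  "wedge u v c z = cwedge (u c z) (v c z)"

definition conj_form :: "('a, 'n::finite) form \<Rightarrow> ('a, 'n) form" where
  "conj_form u c z = cconj (u c z)"

definition pq_part :: "nat \<Rightarrow> nat \<Rightarrow> ('a, 'n::finite) form \<Rightarrow> ('a, 'n) form" where
  "pq_part p q u c z = cpart p q (u c z)"

definition fmult :: "('a \<Rightarrow> complex) \<Rightarrow> ('a, 'n::finite) form \<Rightarrow> ('a, 'n) form" where
  "fmult f u c z as = f (chart_inv c z) * u c z as"

definition fun_form :: "('a \<Rightarrow> complex) \<Rightarrow> ('a, 'n::finite) form" where
  "fun_form f c z as = (if as = [] then f (chart_inv c z) else 0)"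

text \<open>
  The parts of \<open>(du)(e(a\<^sub>0), \<dots>, e(a\<^sub>k)) = \<Sum> (-1)\<^sup>i e(a\<^sub>i) (u(\<dots>, omit e(a\<^sub>i), \<dots>))\<close> in which the
  differentiation is along a (1,0), respectively (0,1), direction.
\<close>

definition del :: "('a, 'n::finite) form \<Rightarrow> ('a, 'n) form" where
  "del u c z as =
     (\<Sum>i\<in>{i. i < length as \<and> isl (as ! i)}.
        (-1) ^ i * wirtinger (as ! i) (\<lambda>w. u c w (take i as @ drop (Suc i) as)) z)"

definition delbar :: "('a, 'n::finite) form \<Rightarrow> ('a, 'n) form" where
  "delbar u c z as =
     (\<Sum>i\<in>{i. i < length as \<and> \<not> isl (as ! i)}.
        (-1) ^ i * wirtinger (as ! i) (\<lambda>w. u c w (take i as @ drop (Suc i) as)) z)"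

definition hermitian_manifold ::
    "('a::{t2_space,second_countable_topology}, 'n::finite) chart set \<Rightarrow> ('a, 'n) form \<Rightarrow> bool" where
  "hermitian_manifold A \<omega> \<longleftrightarrow>
     complex_manifold A \<and> smooth_form A \<omega> \<and> pq_part 1 1 \<omega> = \<omega> \<and> conj_form \<omega> = \<omega> \<and>
     (\<forall>c\<in>A. \<forall>z\<in>chart_img c. \<forall>v. v \<noteq> 0 \<longrightarrow>
        0 < Re (\<Sum>j\<in>UNIV. \<Sum>k\<in>UNIV. hmat (\<omega> c z) $ j $ k * v $ j * cnj (v $ k)))"

text \<open>
  The volume measure of \<open>\<omega>\<^sup>n/n!\<close>, which in coordinates is \<open>2\<^sup>n det h\<close> times Lebesgue measure.
  The coordinate measures agree on overlaps; their supremum in the lattice of Borel measures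
  on \<open>'a\<close> is the measure that restricts to each of them.
\<close>

definition chart_volume ::
    "('a::topological_space, 'n::finite) form \<Rightarrow> ('a, 'n) chart \<Rightarrow> 'a measure" where
  "chart_volume \<omega> c =
     distr (density (restrict_space lborel (chart_img c))
                    (\<lambda>z. ennreal (2 ^ CARD('n) * Re (det (hmat (\<omega> c z))))))
           borel (chart_inv c)"

definition volume ::
    "('a::topological_space, 'n::finite) chart set \<Rightarrow> ('a, 'n) form \<Rightarrow> 'a measure" where
  "volume A \<omega> = (SUP c\<in>A. chart_volume \<omega> c)"

text \<open>The pointwise product does not depend on the chart around \<open>x\<close> in which it is computed.\<close>

definition pt_inner ::
    "('a, 'n::finite) chart set \<Rightarrow> ('a, 'n) form \<Rightarrow> ('a, 'n) form \<Rightarrow> ('a, 'n) form \<Rightarrow> 'a \<Rightarrow> complex" where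
  "pt_inner A \<omega> u v x =
     (let c = (SOME c. c \<in> A \<and> x \<in> chart_dom c)
      in cinner (\<omega> c (snd c x)) (u c (snd c x)) (v c (snd c x)))"

definition L2_inner ::
    "('a::topological_space, 'n::finite) chart set \<Rightarrow> ('a, 'n) form \<Rightarrow> ('a, 'n) form \<Rightarrow> ('a, 'n) form \<Rightarrow> complex"
  where "L2_inner A \<omega> u v = (LINT x|volume A \<omega>. pt_inner A \<omega> u v x)"

type_synonym ('a, 'n) oper = "('a, 'n) form \<Rightarrow> ('a, 'n) form"

text \<open>
  The formal adjoint: \<open>adj A \<omega> P v\<close> is the smooth form representing the functional
  \<open>u \<mapsto> \<langle>\<langle>P u, v\<rangle>\<rangle>\<close> on compactly supported smooth forms.  Operators act on forms of mixed degree,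
  on which forms of different degrees are orthogonal.  For operators of order zero this is the
  pointwise adjoint.
\<close>

definition adj ::
    "('a::topological_space, 'n::finite) chart set \<Rightarrow> ('a, 'n) form \<Rightarrow> ('a, 'n) oper \<Rightarrow> ('a, 'n) oper" where
  "adj A \<omega> P v =
     (THE w. smooth_form A w \<and>
        (\<forall>u. smooth_form A u \<and> compactly_supported A u \<longrightarrow>
             L2_inner A \<omega> (P u) v = L2_inner A \<omega> u w))"

text \<open>The graded commutator of operators \<open>P\<close>, \<open>Q\<close> of degrees \<open>a\<close>, \<open>b\<close>.\<close>

definition gcomm :: "int \<Rightarrow> int \<Rightarrow> ('a, 'n::finite) oper \<Rightarrow> ('a, 'n) oper \<Rightarrow> ('a, 'n) oper" where
  "gcomm a b P Q u = P (Q u) - fmult (\<lambda>_. (-1) powi (a * b)) (Q (P u))"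

definition conj_op :: "('a, 'n::finite) oper \<Rightarrow> ('a, 'n) oper" where
  "conj_op P u = conj_form (P (conj_form u))"

definition scale_op :: "('a \<Rightarrow> complex) \<Rightarrow> ('a, 'n::finite) oper \<Rightarrow> ('a, 'n) oper" (infixr "\<odot>" 75) where
  "(f \<odot> P) u = fmult f (P u)"

text \<open>Equality of forms on the manifold, disregarding the junk values off the coordinate images.\<close>

definition form_eq :: "('a, 'n::finite) chart set \<Rightarrow> ('a, 'n) form \<Rightarrow> ('a, 'n) form \<Rightarrow> bool" where
  "form_eq A u v \<longleftrightarrow> (\<forall>c\<in>A. \<forall>z\<in>chart_img c. u c z = v c z)"

text \<open>Linearity over smooth functions, for operators on smooth forms.\<close>

definition zeroth_order :: "('a, 'n::finite) chart set \<Rightarrow> ('a, 'n) oper \<Rightarrow> bool" where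
  "zeroth_order A P \<longleftrightarrow>
     (\<forall>u v. smooth_form A u \<and> smooth_form A v \<longrightarrow> form_eq A (P (u + v)) (P u + P v)) \<and>
     (\<forall>f u. smooth_fun A f \<and> smooth_form A u \<longrightarrow> form_eq A (P (fmult f u)) (fmult f (P u)))"

text \<open>The adjoint of \<open>L = \<omega> \<and> \<cdot>\<close>.\<close>

definition Lam :: "('a::topological_space, 'n::finite) chart set \<Rightarrow> ('a, 'n) form \<Rightarrow> ('a, 'n) oper" where
  "Lam A \<omega> = adj A \<omega> (wedge \<omega>)"

definition D01 :: "('a \<Rightarrow> real) \<Rightarrow> ('a, 'n::finite) oper" where
  "D01 \<eta> u =
     delbar u - (\<Sum>p\<le>CARD('n). \<Sum>q\<le>CARD('n).
       fmult (\<lambda>x. of_nat p / of_real (\<eta> x))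
         (wedge (delbar (fun_form (\<lambda>x. of_real (\<eta> x)))) (pq_part p q u)))"

definition tau01 ::
    "('a::topological_space, 'n::finite) chart set \<Rightarrow> ('a, 'n) form \<Rightarrow> ('a \<Rightarrow> real) \<Rightarrow> ('a, 'n) oper" where
  "tau01 A \<omega> \<eta> = gcomm (-2) 3 (Lam A \<omega>) (wedge (D01 \<eta> \<omega>))"

definition Laplace01 ::
    "('a::topological_space, 'n::finite) chart set \<Rightarrow> ('a, 'n) form \<Rightarrow> ('a \<Rightarrow> real) \<Rightarrow> ('a, 'n) oper" where
  "Laplace01 A \<omega> \<eta> = gcomm 1 (-1) (D01 \<eta>) (adj A \<omega> (D01 \<eta>))"

definition T_op ::
    "('a::topological_space, 'n::finite) chart set \<Rightarrow> ('a, 'n) form \<Rightarrow> ('a \<Rightarrow> real) \<Rightarrow> ('a, 'n) oper" where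
  "T_op A \<omega> \<eta> =
     (\<lambda>_. - (\<i> / 2)) \<odot>
        gcomm (-2) 2 (Lam A \<omega>)
          (gcomm (-2) 4 (Lam A \<omega>) (wedge (D01 \<eta> (conj_op (D01 \<eta>) \<omega>))))
     - gcomm 3 (-3) (wedge (conj_op (D01 \<eta>) \<omega>)) (adj A \<omega> (wedge (conj_op (D01 \<eta>) \<omega>)))"

end

theory Submission
  imports Defs "HOL-Complex_Analysis.Complex_Analysis"
begin

text \<open>
  Write \<open>D\<close> for \<open>D01 \<eta>\<close>, \<open>D'\<close> for its conjugate, \<open>\<alpha> = D' \<omega>\<close>, \<open>\<tau>' = [\<Lambda>, \<alpha> \<and> \<cdot>]\<close> with conjugate \<open>\<tau>\<close>, and \<open>\<theta>' = \<partial>\<eta> / \<eta>\<close>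
  with conjugate \<open>\<theta>\<close>.  Integration by parts in coordinates gives the commutation relation
  \<open>\<i> [\<Lambda>, D] = D'\<^sup>\<star> + \<tau>'\<^sup>\<star> + n \<theta>'\<^sup>\<star>\<close>, the term with \<open>\<theta>'\<close> coming from the weights
  \<open>p\<close> and \<open>q\<close> in \<open>D\<close> and \<open>D'\<close>.  Its conjugate turns the Laplacian \<open>[D, D\<^sup>\<star>]\<close> into
  \<open>- \<i> [D, [\<Lambda>, D']] - [D, \<tau>\<^sup>\<star>] - n [D, \<theta>\<^sup>\<star>]\<close>, where \<open>\<tau>\<^sup>\<star> = (\<i>/2) [\<Lambda>, [\<Lambda>, \<alpha>]]\<close> by linear algebra.  The graded
  Jacobi identity moves \<open>D\<close> inside the commutators; the rest follows from \<open>[D, \<alpha>] = D \<alpha>\<close>,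
  \<open>[\<Lambda>, D'\<^sup>\<star>] = \<alpha>\<^sup>\<star>\<close>, \<open>[\<Lambda>, \<tau>'\<^sup>\<star>] = - 3 \<alpha>\<^sup>\<star>\<close> and \<open>[\<Lambda>, \<theta>'\<^sup>\<star>] = 0\<close>.

  The formal adjoint is determined by testing against forms supported near a point, and a partition of unity
  reduces integration by parts to a chart, on whose domain the volume measure is \<open>2\<^sup>n det h\<close> times Lebesgue
  measure by the change of variables formula.
\<close>

section \<open>Exterior algebra in components\<close>

text \<open>A Hermitian metric has torsion: in general no coordinates make the first derivatives of
  h vanish at a point, so the commutation relation cannot be read off from flat space. All
  derivatives of \<open>det h\<close>, of the inverse of h and of \<Lambda> are kept, and the point
  is that they add up to \<open>[\<Lambda>, \<partial>\<omega>]\<close>.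

  The factor n is the n of \<open>[\<Lambda>, L] = n - p - q\<close>. As \<omega> has weight q = 1,
  the form \<alpha> contains \<open>- \<theta>' \<and> \<omega>\<close>; its commutator with
  \<Lambda> produces just the number operators that make up for the different weights of D and its
  conjugate, and n times \<theta>' is left over. The 3 is the degree of \<alpha>, and 1 - 3 = -2
  explains the halves in the final computation.

  A form is a function on lists of frame indices. Every algebraic operator is characterized by its
  commutation with contraction by the head of the list, so exterior algebra becomes induction on
  lists, without bases or orthonormal frames.

  Adjoints are given by a definite description. They are therefore handled as a relation, with
  explicit candidates, until all operators of the theorem have been replaced by concrete ones; the
  rest is algebra of words in noncommuting operators.\<close>

no_notation fps_nth (infixl "$" 75)

declare zero_fun_def [simp del] plus_fun_def [simp del] fun_diff_def [simp del] fun_Compl_def [simp del]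

lemma sum_fun_apply: "(\<Sum>x\<in>S. f x) y = (\<Sum>x\<in>S. f x y)"
  by (induction S rule: infinite_finite_induct) auto

definition csc :: "complex \<Rightarrow> 'n cform \<Rightarrow> 'n cform" where
  "csc c \<alpha> = (\<lambda>as. c * \<alpha> as)"

definition iot :: "'n + 'n \<Rightarrow> 'n cform \<Rightarrow> 'n cform" where
  "iot a \<alpha> = (\<lambda>as. \<alpha> (a # as))"

definition par :: "'n cform \<Rightarrow> 'n cform" where
  "par \<alpha> = (\<lambda>as. (-1) ^ length as * \<alpha> as)"

text \<open>Exterior multiplication by the covector dual to the frame vector \<open>a\<close>. The
  recursion is the Leibniz rule for contraction with the first entry (see \<open>iot_ext\<close>),
  which replaces the sum over positions.\<close>

fun ext :: "'n + 'n \<Rightarrow> 'n cform \<Rightarrow> 'n cform" where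
  "ext a \<alpha> [] = 0"
| "ext a \<alpha> (c # as) = (if c = a then \<alpha> as else 0) - ext a (\<lambda>bs. \<alpha> (c # bs)) as"

definition clin :: "('n cform \<Rightarrow> 'm cform) \<Rightarrow> bool" where
  "clin X \<longleftrightarrow> (\<forall>\<alpha> \<beta>. X (\<alpha> + \<beta>) = X \<alpha> + X \<beta>) \<and> (\<forall>c \<alpha>. X (csc c \<alpha>) = csc c (X \<alpha>))"

lemma clinI:
  assumes "\<And>\<alpha> \<beta>. X (\<alpha> + \<beta>) = X \<alpha> + X \<beta>" "\<And>c \<alpha>. X (csc c \<alpha>) = csc c (X \<alpha>)"
  shows "clin X"
  using assms by (auto simp: clin_def)

lemma csc_add: "csc c (\<alpha> + \<beta>) = csc c \<alpha> + csc c \<beta>"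
  and csc_csc [simp]: "csc c (csc d \<alpha>) = csc (c * d) \<alpha>"
  and csc_0 [simp]: "csc 0 \<alpha> = 0"
  and csc_0_right [simp]: "csc c 0 = 0"
  and csc_1 [simp]: "csc 1 \<alpha> = \<alpha>"
  and csc_diff: "csc c (\<alpha> - \<beta>) = csc c \<alpha> - csc c \<beta>"
  and csc_minus: "csc c (- \<alpha>) = csc (- c) \<alpha>"
  and csc_m1: "csc (-1) \<alpha> = - \<alpha>"
  and csc_minus1: "csc (- c) \<alpha> = - csc c \<alpha>"
  and csc_add_left: "csc (c + d) \<alpha> = csc c \<alpha> + csc d \<alpha>"
  and csc_diff_left: "csc (c - d) \<alpha> = csc c \<alpha> - csc d \<alpha>"
  by (auto simp: csc_def fun_eq_iff algebra_simps)

lemma csc_sum: "csc c (\<Sum>x\<in>S. f x) = (\<Sum>x\<in>S. csc c (f x))"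
  using sum_comp_morphism[of "csc c" f S, OF csc_0_right csc_add] by (simp add: o_def)

lemma csc_sum_left: "csc (\<Sum>x\<in>S. f x) \<alpha> = (\<Sum>x\<in>S. csc (f x) \<alpha>)"
  using sum_comp_morphism[of "\<lambda>c. csc c \<alpha>" f S, OF csc_0 csc_add_left] by (simp add: o_def)

lemma csc_apply: "csc c \<alpha> as = c * \<alpha> as"
  by (simp add: csc_def)

lemma clin_add: "clin X \<Longrightarrow> X (\<alpha> + \<beta>) = X \<alpha> + X \<beta>"
  and clin_csc: "clin X \<Longrightarrow> X (csc c \<alpha>) = csc c (X \<alpha>)"
  by (auto simp: clin_def)

lemma clin_0: "clin X \<Longrightarrow> X 0 = 0"
  using clin_csc[of X 0 0] by simp

lemma clin_minus: "clin X \<Longrightarrow> X (- \<alpha>) = - X \<alpha>"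
  using clin_csc[of X "-1" \<alpha>] by (simp add: csc_m1)

lemma clin_diff: "clin X \<Longrightarrow> X (\<alpha> - \<beta>) = X \<alpha> - X \<beta>"
  using clin_add[of X \<alpha> "- \<beta>"] clin_minus[of X \<beta>] by simp

lemma clin_sum: "clin X \<Longrightarrow> X (\<Sum>x\<in>S. f x) = (\<Sum>x\<in>S. X (f x))"
  using sum_comp_morphism[of X f S] clin_0[of X] clin_add[of X] by (simp add: o_def)

lemmas clins = clin_add clin_csc clin_0 clin_minus clin_diff clin_sum

lemma clin_iot: "clin (iot a)"
  by (rule clinI) (auto simp: iot_def csc_def fun_eq_iff)

lemma clin_par: "clin par"
  by (rule clinI) (auto simp: par_def csc_def fun_eq_iff algebra_simps)

lemma iot_ext: "iot b (ext a \<alpha>) = (if b = a then \<alpha> else 0) - ext a (iot b \<alpha>)"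
  by (auto simp: iot_def fun_eq_iff)

lemma ext_add_apply: "ext a (\<alpha> + \<beta>) as = ext a \<alpha> as + ext a \<beta> as"
proof (induction as arbitrary: \<alpha> \<beta>)
  case (Cons c as)
  have "ext a (\<lambda>bs. (\<alpha> + \<beta>) (c # bs)) as = ext a ((\<lambda>bs. \<alpha> (c # bs)) + (\<lambda>bs. \<beta> (c # bs))) as"
    by (simp add: plus_fun_def)
  then show ?case using Cons by simp
qed simp

lemma ext_csc_apply: "ext a (csc x \<alpha>) as = x * ext a \<alpha> as"
proof (induction as arbitrary: \<alpha>)
  case (Cons c as)
  have "ext a (\<lambda>bs. csc x \<alpha> (c # bs)) as = ext a (csc x (\<lambda>bs. \<alpha> (c # bs))) as"
    by (simp add: csc_def)
  then show ?case using Cons by (simp add: csc_apply algebra_simps)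
qed simp

lemma clin_ext: "clin (ext a)"
  by (rule clinI) (auto simp: fun_eq_iff ext_add_apply ext_csc_apply csc_apply)

lemmas iot_lin [simp] = clins[OF clin_iot]
lemmas ext_lin [simp] = clins[OF clin_ext]
lemmas par_lin [simp] = clins[OF clin_par]

section \<open>Anticommutation relations and alternating forms\<close>

lemma cform_eqI:
  assumes "\<alpha> [] = \<beta> []" "\<And>a. iot a \<alpha> = iot a \<beta>"
  shows "\<alpha> = \<beta>"
proof
  fix as show "\<alpha> as = \<beta> as"
    using assms(1) fun_cong[OF assms(2)] by (cases as) (auto simp: iot_def)
qed

lemma apply_Cons: "\<alpha> (c # as) = iot c \<alpha> as"
  by (simp add: iot_def)

lemma ext_ext: "ext a (ext b \<alpha>) = - ext b (ext a \<alpha>)"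
proof
  fix as show "ext a (ext b \<alpha>) as = (- ext b (ext a \<alpha>)) as"
  proof (induction as arbitrary: \<alpha>)
    case (Cons c as)
    then show ?case
      unfolding apply_Cons iot_lin by (simp only: iot_ext ext_lin) (auto simp: Cons)
  qed simp
qed

lemma iot_par: "iot a (par \<alpha>) = - par (iot a \<alpha>)"
  by (auto simp: iot_def par_def fun_eq_iff)

lemma par_par [simp]: "par (par \<alpha>) = \<alpha>"
  by (auto simp: par_def fun_eq_iff simp flip: power_add mult.assoc)

lemma alternating_iot: "alternating \<alpha> \<Longrightarrow> alternating (iot a \<alpha>)"
  unfolding alternating_def iot_def by (metis append_Cons)

lemma iot_iot: "alternating \<alpha> \<Longrightarrow> iot a (iot b \<alpha>) = - iot b (iot a \<alpha>)"
  unfolding alternating_def iot_def fun_eq_iff using append_Nil by (metis uminus_apply)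

text \<open>A coinduction principle: contracting away the prefix \<open>as\<close> brings a
  transposition deep in the list to its head, so an invariant stable under contraction need only
  control double contractions.\<close>

lemma alternatingI:
  assumes "P \<alpha>"
    and "\<And>\<alpha> a b. P \<alpha> \<Longrightarrow> iot a (iot b \<alpha>) = - iot b (iot a \<alpha>)"
    and "\<And>\<alpha> a. P \<alpha> \<Longrightarrow> P (iot a \<alpha>)"
  shows "alternating \<alpha>"
  unfolding alternating_def
proof (intro allI)
  fix as a b bs
  show "\<alpha> (as @ a # b # bs) = - \<alpha> (as @ b # a # bs)"
    using assms(1)
  proof (induction as arbitrary: \<alpha>)
    case Nil
    then show ?case using fun_cong[OF assms(2)[OF Nil, of b a], of bs] by (simp add: iot_def)
  next
    case (Cons c as)
    then show ?case using Cons.IH[OF assms(3)[OF Cons.prems, of c]] by (simp add: iot_def)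
  qed
qed

lemma alternating_add: "alternating \<alpha> \<Longrightarrow> alternating \<beta> \<Longrightarrow> alternating (\<alpha> + \<beta>)"
  and alternating_diff: "alternating \<alpha> \<Longrightarrow> alternating \<beta> \<Longrightarrow> alternating (\<alpha> - \<beta>)"
  and alternating_minus: "alternating \<alpha> \<Longrightarrow> alternating (- \<alpha>)"
  and alternating_csc: "alternating \<alpha> \<Longrightarrow> alternating (csc c \<alpha>)"
  and alternating_0: "alternating 0"
  unfolding alternating_def csc_def plus_fun_def fun_diff_def fun_Compl_def zero_fun_def
  by (metis add.inverse_distrib_swap add.commute,
      metis minus_diff_eq minus_diff_minus, metis, metis mult_minus_right, simp)

lemma alternating_sum: "(\<And>x. x \<in> S \<Longrightarrow> alternating (f x)) \<Longrightarrow> alternating (\<Sum>x\<in>S. f x)"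
  by (induction S rule: infinite_finite_induct) (auto simp: alternating_0 alternating_add)

lemma alternating_par:
  assumes "alternating \<alpha>"
  shows "alternating (par \<alpha>)"
  unfolding alternating_def
proof (intro allI)
  fix as a b bs
  have "\<alpha> (as @ a # b # bs) = - \<alpha> (as @ b # a # bs)"
    using assms unfolding alternating_def by blast
  then show "par \<alpha> (as @ a # b # bs) = - par \<alpha> (as @ b # a # bs)"
    by (simp add: par_def)
qed

lemma alternating_ext: "alternating \<alpha> \<Longrightarrow> alternating (ext a \<alpha>)"
\<comment> \<open>Contracting \<open>ext a \<alpha>\<close> leaves a term without
  \<open>ext\<close>, so the invariant has to allow an alternating summand.\<close>
proof (rule alternatingI[where P = "\<lambda>\<gamma>. \<exists>\<alpha> \<beta>. alternating \<alpha> \<and> alternating \<beta> \<and> \<gamma> = \<beta> + ext a \<alpha>"], goal_cases)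
  case 1 then show ?case by (metis alternating_0 add_0)
next
  case (2 \<gamma> c b)
  then show ?case by (auto simp: iot_ext iot_iot[of _ c b])
next
  case (3 \<gamma> c)
  then obtain \<alpha> \<beta> where *: "alternating \<alpha>" "alternating \<beta>" "\<gamma> = \<beta> + ext a \<alpha>" by auto
  then have "iot c \<gamma> = (iot c \<beta> + (if c = a then \<alpha> else 0)) + ext a (- iot c \<alpha>)"
    by (simp add: iot_ext)
  moreover have "alternating (iot c \<beta> + (if c = a then \<alpha> else 0))" "alternating (- iot c \<alpha>)"
    using * by (auto intro!: alternating_add alternating_iot alternating_0 alternating_minus)
  ultimately show ?case by blast
qed

lemma alternating_not_distinct:
  assumes "alternating \<alpha>" "\<not> distinct as"
  shows "\<alpha> as = 0"
proof -
  have *: "\<alpha> (xs @ y # ys @ y # zs) = 0" if "alternating \<alpha>" for xs y ys zs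
  proof (induction ys arbitrary: xs)
    case Nil
    have "\<alpha> (xs @ y # y # zs) = - \<alpha> (xs @ y # y # zs)"
      using that unfolding alternating_def by blast
    then show ?case by simp
  next
    case (Cons c ys)
    have "\<alpha> (xs @ y # c # (ys @ y # zs)) = - \<alpha> (xs @ c # y # (ys @ y # zs))"
      using that unfolding alternating_def by blast
    then show ?case using Cons[of "xs @ [c]"] by simp
  qed
  then show ?thesis using assms not_distinct_decomp[of as] by fastforce
qed

lemma alternating_long:
  fixes \<alpha> :: "'n::finite cform"
  assumes "alternating \<alpha>" "length as > 2 * CARD('n)"
  shows "\<alpha> as = 0"
proof (rule alternating_not_distinct[OF assms(1)])
  have "card (set as) \<le> CARD('n + 'n)" by (rule card_mono) auto
  also have "\<dots> = 2 * CARD('n)" by simp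
  finally show "\<not> distinct as" using assms(2) distinct_card[of as] by auto
qed

section \<open>The induced Hermitian product\<close>

text \<open>The degree k sum of \<open>cinner\<close> without its factorial, unrolled one index pair
  at a time so that induction on the degree runs along \<open>iot\<close>.\<close>

fun hk :: "('n + 'n \<Rightarrow> 'n + 'n \<Rightarrow> complex) \<Rightarrow> nat \<Rightarrow> 'n::finite cform \<Rightarrow> 'n cform \<Rightarrow> complex" where
  "hk G 0 \<alpha> \<beta> = \<alpha> [] * cnj (\<beta> [])"
| "hk G (Suc k) \<alpha> \<beta> = (\<Sum>a\<in>UNIV. \<Sum>b\<in>UNIV. G a b * hk G k (iot a \<alpha>) (iot b \<beta>))"

definition hin :: "('n + 'n \<Rightarrow> 'n + 'n \<Rightarrow> complex) \<Rightarrow> 'n::finite cform \<Rightarrow> 'n cform \<Rightarrow> complex" where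
  "hin G \<alpha> \<beta> = (\<Sum>k\<le>2 * CARD('n). 1 / fact k * hk G k \<alpha> \<beta>)"

lemma sum_lists_Suc:
  "(\<Sum>as\<in>{as::'i::finite list. length as = Suc k}. f as) = (\<Sum>a\<in>UNIV. \<Sum>as\<in>{as. length as = k}. f (a # as))"
proof -
  have "bij_betw (\<lambda>(a, as). a # as) (UNIV \<times> {as. length as = k}) {as::'i list. length as = Suc k}"
    by (auto simp: bij_betw_def inj_on_def length_Suc_conv)
  then have "(\<Sum>as\<in>{as::'i list. length as = Suc k}. f as)
      = (\<Sum>(a, as)\<in>UNIV \<times> {as. length as = k}. f (a # as))"
    by (subst sum.reindex_bij_betw[symmetric]) (auto simp: case_prod_unfold)
  then show ?thesis by (simp add: sum.cartesian_product)
qed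

lemma hk_eq:
  "(\<Sum>as\<in>{as. length as = k}. \<Sum>bs\<in>{bs. length bs = k}.
           (\<Prod>i<k. G (as ! i) (bs ! i)) * \<alpha> as * cnj (\<beta> bs)) = hk G k \<alpha> \<beta>"
proof (induction k arbitrary: \<alpha> \<beta>)
  case (Suc k)
  show ?case
    unfolding sum_lists_Suc hk.simps Suc[symmetric]
    by (subst sum.swap) (simp add: sum_distrib_left prod.lessThan_Suc_shift iot_def mult.assoc
        sum.swap[of _ UNIV "{as. length as = k}"] del: prod.lessThan_Suc)
qed simp

lemma cinner_eq: "cinner \<omega> = hin (cometric \<omega>)"
  by (simp add: cinner_def hin_def hk_eq fun_eq_iff)

lemma hk_add_left: "hk G k (\<alpha> + \<alpha>') \<beta> = hk G k \<alpha> \<beta> + hk G k \<alpha>' \<beta>"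
  by (induction k arbitrary: \<alpha> \<alpha>' \<beta>) (auto simp: algebra_simps sum.distrib)

lemma hk_add_right: "hk G k \<alpha> (\<beta> + \<beta>') = hk G k \<alpha> \<beta> + hk G k \<alpha> \<beta>'"
  by (induction k arbitrary: \<alpha> \<beta> \<beta>') (auto simp: algebra_simps sum.distrib)

lemma hk_csc_left: "hk G k (csc c \<alpha>) \<beta> = c * hk G k \<alpha> \<beta>"
  by (induction k arbitrary: \<alpha> \<beta>) (auto simp: csc_apply sum_distrib_left algebra_simps)

lemma hk_csc_right: "hk G k \<alpha> (csc c \<beta>) = cnj c * hk G k \<alpha> \<beta>"
  by (induction k arbitrary: \<alpha> \<beta>) (auto simp: csc_apply sum_distrib_left algebra_simps)

lemma hin_add_left: "hin G (\<alpha> + \<alpha>') \<beta> = hin G \<alpha> \<beta> + hin G \<alpha>' \<beta>"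
  and hin_add_right: "hin G \<alpha> (\<beta> + \<beta>') = hin G \<alpha> \<beta> + hin G \<alpha> \<beta>'"
  and hin_csc_left: "hin G (csc c \<alpha>) \<beta> = c * hin G \<alpha> \<beta>"
  and hin_csc_right: "hin G \<alpha> (csc c \<beta>) = cnj c * hin G \<alpha> \<beta>"
  by (auto simp: hin_def hk_add_left hk_add_right hk_csc_left hk_csc_right sum.distrib
      sum_distrib_left algebra_simps)

lemma hin_0_left: "hin G 0 \<beta> = 0"
  and hin_0_right: "hin G \<alpha> 0 = 0"
  and hin_minus_left: "hin G (- \<alpha>) \<beta> = - hin G \<alpha> \<beta>"
  and hin_minus_right: "hin G \<alpha> (- \<beta>) = - hin G \<alpha> \<beta>"
  using hin_csc_left[of G 0 0 \<beta>] hin_csc_right[of G \<alpha> 0 0] hin_csc_left[of G "-1" \<alpha> \<beta>]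
    hin_csc_right[of G \<alpha> "-1" \<beta>] by (auto simp: csc_m1)

lemma hin_diff_left: "hin G (\<alpha> - \<alpha>') \<beta> = hin G \<alpha> \<beta> - hin G \<alpha>' \<beta>"
  and hin_diff_right: "hin G \<alpha> (\<beta> - \<beta>') = hin G \<alpha> \<beta> - hin G \<alpha> \<beta>'"
  using hin_add_left[of G \<alpha> "- \<alpha>'" \<beta>] hin_add_right[of G \<alpha> \<beta> "- \<beta>'"]
  by (auto simp: hin_minus_left hin_minus_right)

lemma hin_sum_left: "hin G (\<Sum>x\<in>S. f x) \<beta> = (\<Sum>x\<in>S. hin G (f x) \<beta>)"
  and hin_sum_right: "hin G \<beta> (\<Sum>x\<in>S. f x) = (\<Sum>x\<in>S. hin G \<beta> (f x))"
  by (induction S rule: infinite_finite_induct)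
    (auto simp: hin_0_left hin_0_right hin_add_left hin_add_right)

lemmas hin_lin = hin_add_left hin_add_right hin_csc_left hin_csc_right hin_0_left hin_0_right
  hin_minus_left hin_minus_right hin_diff_left hin_diff_right hin_sum_left hin_sum_right

lemma hk_cnj:
  assumes "\<And>a b. G b a = cnj (G a b)"
  shows "hk G k \<beta> \<alpha> = cnj (hk G k \<alpha> \<beta>)"
proof (induction k arbitrary: \<alpha> \<beta>)
  case 0 show ?case by simp
next
  case (Suc k)
  have "hk G (Suc k) \<beta> \<alpha> = (\<Sum>a\<in>UNIV. \<Sum>b\<in>UNIV. G b a * hk G k (iot b \<beta>) (iot a \<alpha>))"
    by (subst sum.swap) simp
  also have "\<dots> = (\<Sum>a\<in>UNIV. \<Sum>b\<in>UNIV. cnj (G a b * hk G k (iot a \<alpha>) (iot b \<beta>)))"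
    unfolding complex_cnj_mult by (intro sum.cong refl arg_cong2[of _ _ _ _ "(*)"] assms Suc)
  also have "\<dots> = cnj (hk G (Suc k) \<alpha> \<beta>)" by simp
  finally show ?case .
qed

lemma hin_cnj:
  assumes "\<And>a b. G b a = cnj (G a b)"
  shows "hin G \<beta> \<alpha> = cnj (hin G \<alpha> \<beta>)"
proof -
  have "hk G k \<beta> \<alpha> = cnj (hk G k \<alpha> \<beta>)" for k
    by (rule hk_cnj) (rule assms)
  then show ?thesis by (simp only: hin_def) simp
qed

lemma hk_zero_right: "(\<And>as. length as = k \<Longrightarrow> \<beta> as = 0) \<Longrightarrow> hk G k \<alpha> \<beta> = 0"
proof (induction k arbitrary: \<alpha> \<beta>)
  case 0
  then show ?case by simp
next
  case (Suc k)
  have "hk G k (iot a \<alpha>) (iot b \<beta>) = 0" for a b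
    by (rule Suc.IH) (simp add: iot_def Suc.prems)
  then show ?case by simp
qed

lemma sum3_rot: "(\<Sum>a\<in>A. \<Sum>b\<in>B. \<Sum>c\<in>C. f a b c) = (\<Sum>c\<in>C. \<Sum>a\<in>A. \<Sum>b\<in>B. f a b c)"
proof -
  have "(\<Sum>a\<in>A. \<Sum>b\<in>B. \<Sum>c\<in>C. f a b c) = (\<Sum>a\<in>A. \<Sum>c\<in>C. \<Sum>b\<in>B. f a b c)"
    by (intro sum.cong refl sum.swap)
  also have "\<dots> = (\<Sum>c\<in>C. \<Sum>a\<in>A. \<Sum>b\<in>B. f a b c)"
    by (rule sum.swap)
  finally show ?thesis .
qed

text \<open>On k + 1 entries \<open>ext a\<close> is a signed sum over the position that receives
  \<open>a\<close>. Since \<beta> alternates, every position contributes the same; hence the factor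
  k + 1, which the weights \<open>1 / fact k\<close> of the inner product absorb.\<close>

lemma hk_ext:
  assumes "alternating \<beta>"
  shows "hk G (Suc k) (ext a \<alpha>) \<beta> = of_nat (Suc k) * (\<Sum>b\<in>UNIV. G a b * hk G k \<alpha> (iot b \<beta>))"
  using assms
proof (induction k arbitrary: \<alpha> \<beta>)
  case 0
  have "hk G (Suc 0) (ext a \<alpha>) \<beta> = (\<Sum>b\<in>UNIV. \<Sum>c\<in>UNIV. if c = a then G a b * hk G 0 \<alpha> (iot b \<beta>) else 0)"
    unfolding hk.simps(2) by (subst sum.swap) (intro sum.cong refl, simp add: iot_ext)
  then show ?case by simp
next
  case (Suc k)
  have zl: "hk G m 0 \<gamma> = 0" for m \<gamma> using hk_csc_left[of G m 0 0 \<gamma>] by simp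
  have dl: "hk G m (x - y) \<gamma> = hk G m x \<gamma> - hk G m y \<gamma>" for m x y \<gamma>
    using hk_add_left[of G m "x - y" y \<gamma>] by simp
  have mr: "hk G m \<gamma> (- x) = - hk G m \<gamma> x" for m x \<gamma>
    using hk_csc_right[of G m \<gamma> "-1" x] by (simp add: csc_m1)
  have "hk G (Suc (Suc k)) (ext a \<alpha>) \<beta> =
      (\<Sum>c\<in>UNIV. \<Sum>d\<in>UNIV. G c d * ((if c = a then hk G (Suc k) \<alpha> (iot d \<beta>) else 0)
         - hk G (Suc k) (ext a (iot c \<alpha>)) (iot d \<beta>)))"
    unfolding hk.simps(2)[of G "Suc k"]
    by (intro sum.cong refl) (auto simp: iot_ext dl zl simp del: hk.simps)
  also have "\<dots> = (\<Sum>c\<in>UNIV. \<Sum>d\<in>UNIV. G c d * (if c = a then hk G (Suc k) \<alpha> (iot d \<beta>) else 0))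
      - (\<Sum>c\<in>UNIV. \<Sum>d\<in>UNIV. G c d * hk G (Suc k) (ext a (iot c \<alpha>)) (iot d \<beta>))"
    by (simp add: right_diff_distrib sum_subtractf del: hk.simps)
  also have "(\<Sum>c\<in>UNIV. \<Sum>d\<in>UNIV. G c d * (if c = a then hk G (Suc k) \<alpha> (iot d \<beta>) else 0))
      = (\<Sum>d\<in>UNIV. G a d * hk G (Suc k) \<alpha> (iot d \<beta>))"
    by (subst sum.swap) (simp add: if_distrib[of "\<lambda>x. _ * x"] cong: if_cong del: hk.simps)
  also have "(\<Sum>c\<in>UNIV. \<Sum>d\<in>UNIV. G c d * hk G (Suc k) (ext a (iot c \<alpha>)) (iot d \<beta>))
      = (\<Sum>c\<in>UNIV. \<Sum>d\<in>UNIV. G c d * (of_nat (Suc k) *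
          (\<Sum>b\<in>UNIV. G a b * hk G k (iot c \<alpha>) (iot b (iot d \<beta>)))))"
    using Suc by (simp add: alternating_iot del: hk.simps)
  also have "\<dots> = - (of_nat (Suc k) * (\<Sum>b\<in>UNIV. G a b *
      (\<Sum>c\<in>UNIV. \<Sum>d\<in>UNIV. G c d * hk G k (iot c \<alpha>) (iot d (iot b \<beta>)))))"
  proof -
    have "(\<Sum>c\<in>UNIV. \<Sum>d\<in>UNIV. G c d * (of_nat (Suc k) *
          (\<Sum>b\<in>UNIV. G a b * hk G k (iot c \<alpha>) (iot b (iot d \<beta>)))))
       = (\<Sum>c\<in>UNIV. \<Sum>d\<in>UNIV. \<Sum>b\<in>UNIV. - (of_nat (Suc k) * (G a b * (G c d * hk G k (iot c \<alpha>) (iot d (iot b \<beta>))))))"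
      unfolding sum_distrib_left
      by (intro sum.cong refl) (subst iot_iot[OF Suc.prems], simp add: mr algebra_simps del: of_nat_Suc)
    also have "\<dots> = (\<Sum>b\<in>UNIV. \<Sum>c\<in>UNIV. \<Sum>d\<in>UNIV. - (of_nat (Suc k) * (G a b * (G c d * hk G k (iot c \<alpha>) (iot d (iot b \<beta>))))))"
      by (rule sum3_rot)
    finally show ?thesis by (simp add: sum_distrib_left sum_negf del: of_nat_Suc)
  qed
  also have "(\<Sum>d\<in>UNIV. G a d * hk G (Suc k) \<alpha> (iot d \<beta>)) - - (of_nat (Suc k) * (\<Sum>b\<in>UNIV. G a b *
      (\<Sum>c\<in>UNIV. \<Sum>d\<in>UNIV. G c d * hk G k (iot c \<alpha>) (iot d (iot b \<beta>)))))
     = of_nat (Suc (Suc k)) * (\<Sum>b\<in>UNIV. G a b * hk G (Suc k) \<alpha> (iot b \<beta>))"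
    by (simp only: hk.simps(2)[of G k, symmetric]) (simp add: distrib_right del: hk.simps)
  finally show ?case .
qed

lemma hin_ext:
  fixes \<alpha> \<beta> :: "'n::finite cform"
  assumes "alternating \<beta>"
  shows "hin G (ext a \<alpha>) \<beta> = (\<Sum>b\<in>UNIV. G a b * hin G \<alpha> (iot b \<beta>))"
proof -
  define N where "N = 2 * CARD('n)"
  have N: "{..N} = insert 0 (Suc ` {..<N})" 
    unfolding lessThan_Suc_atMost[symmetric] by (rule lessThan_Suc_eq_insert_0)
  \<comment> \<open>The shift of the degree by one would lose the top summand. It vanishes, because
    it evaluates \<beta> on lists longer than 2n.\<close>
  have top: "hk G N \<alpha> (iot b \<beta>) = 0" for b
    by (rule hk_zero_right) (auto simp: iot_def N_def intro!: alternating_long[OF assms])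
  have "hin G (ext a \<alpha>) \<beta> = (\<Sum>k<N. 1 / fact (Suc k) * hk G (Suc k) (ext a \<alpha>) \<beta>)"
    unfolding hin_def N_def[symmetric] N by (subst sum.insert) (auto simp: sum.reindex)
  also have "\<dots> = (\<Sum>k<N. \<Sum>b\<in>UNIV. G a b * (1 / fact k * hk G k \<alpha> (iot b \<beta>)))"
    unfolding hk_ext[OF assms] by (intro sum.cong refl)
      (simp add: sum_distrib_left fact_Suc field_simps del: of_nat_Suc)
  also have "\<dots> = (\<Sum>b\<in>UNIV. G a b * (\<Sum>k<N. 1 / fact k * hk G k \<alpha> (iot b \<beta>)))"
    by (subst sum.swap) (simp add: sum_distrib_left)
  also have "\<dots> = (\<Sum>b\<in>UNIV. G a b * hin G \<alpha> (iot b \<beta>))"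
    unfolding hin_def N_def[symmetric] using top
    by (simp add: lessThan_Suc_atMost[symmetric])
  finally show ?thesis .
qed

text \<open>The adjoint of \<open>ext a\<close>: contraction with the vector that \<open>G\<close>
  assigns to the covector \<open>a\<close>. The conjugate appears because the inner product is
  antilinear in its second argument.\<close>

definition est :: "('n + 'n \<Rightarrow> 'n + 'n \<Rightarrow> complex) \<Rightarrow> 'n + 'n \<Rightarrow> 'n::finite cform \<Rightarrow> 'n cform" where
  "est G a \<beta> = (\<Sum>b\<in>UNIV. csc (cnj (G a b)) (iot b \<beta>))"

lemma clin_est: "clin (est G a)"
  by (rule clinI) (auto simp: est_def csc_add sum.distrib csc_sum mult.commute)

lemmas est_lin [simp] = clins[OF clin_est]

lemma hin_ext_left: "alternating \<beta> \<Longrightarrow> hin G (ext a \<alpha>) \<beta> = hin G \<alpha> (est G a \<beta>)"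
  by (simp add: hin_ext est_def hin_lin)

lemma hin_ext_right:
  assumes "\<And>a b. G b a = cnj (G a b)" "alternating \<alpha>"
  shows "hin G \<alpha> (ext a \<beta>) = hin G (est G a \<alpha>) \<beta>"
  using hin_ext_left[OF assms(2), of G a \<beta>] hin_cnj[of G, OF assms(1)] by metis

text \<open>With \<open>ext_ext\<close> and \<open>est_est\<close> these are the canonical
  anticommutation relations, to which the commutators below reduce.\<close>

lemma est_ext: "est G a (ext b \<alpha>) = csc (cnj (G a b)) \<alpha> - ext b (est G a \<alpha>)"
  by (simp add: est_def iot_ext csc_diff sum_subtractf if_distrib[of "csc _"] cong: if_cong)

lemma est_est:
  assumes "alternating \<alpha>"
  shows "est G a (est G b \<alpha>) = - est G b (est G a \<alpha>)"
proof -
  have *: "est G a (est G b \<alpha>) = (\<Sum>c\<in>UNIV. \<Sum>d\<in>UNIV. csc (cnj (G a c) * cnj (G b d)) (iot c (iot d \<alpha>)))" for a b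
    by (simp add: est_def csc_sum)
  have "est G a (est G b \<alpha>) = (\<Sum>d\<in>UNIV. \<Sum>c\<in>UNIV. csc (cnj (G a c) * cnj (G b d)) (iot c (iot d \<alpha>)))"
    unfolding * by (rule sum.swap)
  also have "\<dots> = (\<Sum>d\<in>UNIV. \<Sum>c\<in>UNIV. - csc (cnj (G b d) * cnj (G a c)) (iot d (iot c \<alpha>)))"
    by (intro sum.cong refl, subst iot_iot[OF assms]) (simp add: csc_minus csc_minus1 mult.commute)
  also have "\<dots> = - est G b (est G a \<alpha>)"
    unfolding * by (simp add: sum_negf)
  finally show ?thesis .
qed

lemma alternating_est: "alternating \<alpha> \<Longrightarrow> alternating (est G a \<alpha>)"
  unfolding est_def by (intro alternating_sum alternating_csc alternating_iot)

declare hk.simps(2) [simp del]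

section \<open>Lefschetz operators and the commutation relations\<close>

lemma sum_UNIV_sum:
  "(\<Sum>a\<in>(UNIV::('a::finite + 'b::finite) set). f a) = (\<Sum>j\<in>UNIV. f (Inl j)) + (\<Sum>j\<in>UNIV. f (Inr j))"
  by (simp add: UNIV_Plus_UNIV[symmetric] sum.Plus del: UNIV_Plus_UNIV)

lemma sum_if_const: "(\<Sum>b\<in>B. if P then f b else 0) = (if P then \<Sum>b\<in>B. f b else 0)"
  by simp

text \<open>\<open>cometric\<close> as a function of the inverse matrix. It is linear in that
  matrix, so its derivative is again of the form \<open>met\<close>, with the derivative of the
  inverse inserted.\<close>

fun met :: "complex ^ 'n ^ 'n \<Rightarrow> 'n::finite + 'n \<Rightarrow> 'n + 'n \<Rightarrow> complex" where
  "met g (Inl j) (Inl k) = g $ k $ j"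
| "met g (Inr j) (Inr k) = g $ j $ k"
| "met g _ _ = 0"

lemma cometric_eq: "cometric \<omega> = met (matrix_inv (hmat \<omega>))"
proof (intro ext)
  fix a b show "cometric \<omega> a b = met (matrix_inv (hmat \<omega>)) a b"
    by (cases a; cases b) auto
qed

definition Lop :: "complex ^ 'n ^ 'n \<Rightarrow> 'n::finite cform \<Rightarrow> 'n cform" where
  "Lop h \<alpha> = (\<Sum>j\<in>UNIV. \<Sum>k\<in>UNIV. csc (\<i> * h $ j $ k) (ext (Inl j) (ext (Inr k) \<alpha>)))"

text \<open>The candidate for \<Lambda> in arbitrary coordinates; \<open>hin_Lop\<close> identifies
  it as the adjoint of \<open>Lop h\<close> when \<open>g\<close> is inverse to \<open>h\<close>.
  Plain contractions with explicit coefficients can be differentiated directly.\<close>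

definition lam :: "complex ^ 'n ^ 'n \<Rightarrow> 'n::finite cform \<Rightarrow> 'n cform" where
  "lam g \<alpha> = (\<Sum>k\<in>UNIV. \<Sum>b\<in>UNIV. csc (\<i> * g $ b $ k) (iot (Inl k) (iot (Inr b) \<alpha>)))"

text \<open>Number operators replace the decomposition into bidegrees: the weights p and q of the
  theorem act as \<open>np\<close> and \<open>nq\<close> on forms of mixed type.\<close>

definition np :: "'n cform \<Rightarrow> 'n cform" where
  "np \<alpha> = (\<lambda>as. of_nat (length (filter isl as)) * \<alpha> as)"

definition nq :: "'n cform \<Rightarrow> 'n cform" where
  "nq \<alpha> = (\<lambda>as. of_nat (length (filter (Not \<circ> isl) as)) * \<alpha> as)"

lemma clin_Lop: "clin (Lop h)"
  by (rule clinI) (simp_all add: Lop_def csc_add sum.distrib csc_sum mult_ac)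

lemma clin_lam: "clin (lam g)"
  by (rule clinI) (simp_all add: lam_def csc_add sum.distrib csc_sum mult_ac)

lemma clin_np: "clin np"
  by (rule clinI) (auto simp: np_def csc_def fun_eq_iff algebra_simps)

lemma clin_nq: "clin nq"
  by (rule clinI) (auto simp: nq_def csc_def fun_eq_iff algebra_simps)

lemmas Lop_lin [simp] = clins[OF clin_Lop]
lemmas lam_lin [simp] = clins[OF clin_lam]
lemmas np_lin [simp] = clins[OF clin_np]
lemmas nq_lin [simp] = clins[OF clin_nq]

lemma iot_np: "iot a (np \<alpha>) = np (iot a \<alpha>) + (if isl a then iot a \<alpha> else 0)"
  by (auto simp: iot_def np_def fun_eq_iff algebra_simps)

lemma iot_nq: "iot a (nq \<alpha>) = nq (iot a \<alpha>) + (if isl a then 0 else iot a \<alpha>)"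
  by (auto simp: iot_def nq_def fun_eq_iff algebra_simps)

lemma np_ext: "np (ext a \<alpha>) = ext a (np \<alpha>) + (if isl a then ext a \<alpha> else 0)"
proof
  fix as show "np (ext a \<alpha>) as = (ext a (np \<alpha>) + (if isl a then ext a \<alpha> else 0)) as"
  proof (induction as arbitrary: \<alpha>)
    case (Cons c as)
    show ?case
      unfolding apply_Cons iot_np iot_ext iot_lin
      by (auto simp: iot_ext iot_np Cons)
  qed (simp add: np_def)
qed

lemma nq_ext: "nq (ext a \<alpha>) = ext a (nq \<alpha>) + (if isl a then 0 else ext a \<alpha>)"
proof
  fix as show "nq (ext a \<alpha>) as = (ext a (nq \<alpha>) + (if isl a then 0 else ext a \<alpha>)) as"
  proof (induction as arbitrary: \<alpha>)
    case (Cons c as)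
    show ?case
      unfolding apply_Cons iot_nq iot_ext iot_lin
      by (auto simp: iot_ext iot_nq Cons)
  qed (simp add: nq_def)
qed

lemma alternating_np: "alternating \<alpha> \<Longrightarrow> alternating (np \<alpha>)"
  and alternating_nq: "alternating \<alpha> \<Longrightarrow> alternating (nq \<alpha>)"
proof -
  assume \<alpha>: "alternating \<alpha>"
  have *: "\<alpha> (as @ a # b # bs) = - \<alpha> (as @ b # a # bs)" for as a b bs
    using \<alpha> unfolding alternating_def by blast
  show "alternating (np \<alpha>)" "alternating (nq \<alpha>)"
    unfolding alternating_def
    by (intro allI, subst np_def, subst *, simp add: np_def)
      (intro allI, subst nq_def, subst *, simp add: nq_def)
qed

lemma alternating_Lop: "alternating \<alpha> \<Longrightarrow> alternating (Lop h \<alpha>)"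
  unfolding Lop_def by (intro alternating_sum alternating_csc alternating_ext)

lemma alternating_lam: "alternating \<alpha> \<Longrightarrow> alternating (lam g \<alpha>)"
  unfolding lam_def by (intro alternating_sum alternating_csc alternating_iot)

lemmas alternating_simps [simp] = alternating_add alternating_diff alternating_minus alternating_csc
  alternating_0 alternating_par alternating_ext alternating_iot alternating_est alternating_np
  alternating_nq alternating_Lop alternating_lam

lemma est_iot: "alternating \<alpha> \<Longrightarrow> est G a (iot b \<alpha>) = - iot b (est G a \<alpha>)"
  unfolding est_def iot_lin sum_negf[symmetric]
  by (intro sum.cong refl, subst iot_iot) (simp_all add: csc_minus csc_minus1)

text \<open>Contracting both sides with the head \<open>c\<close> produces one extra copy of
  \<open>iot c \<alpha>\<close>, from the summand whose index is \<open>c\<close>, exactly when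
  \<open>c\<close> is of type (1,0). This is the recursion of the counting operator.\<close>

lemma euler_np:
  assumes "alternating \<alpha>"
  shows "(\<Sum>k\<in>UNIV. ext (Inl k) (iot (Inl k) \<alpha>)) = np (\<alpha> :: 'n::finite cform)"
proof
  fix as show "(\<Sum>k\<in>UNIV. ext (Inl k) (iot (Inl k) \<alpha>)) as = np \<alpha> as"
    using assms
  proof (induction as arbitrary: \<alpha>)
    case Nil then show ?case by (simp add: sum_fun_apply np_def)
  next
    case (Cons c as)
    have "iot c (\<Sum>k\<in>UNIV. ext (Inl k) (iot (Inl k) \<alpha>)) =
      (\<Sum>k\<in>UNIV. (if c = Inl k then iot c \<alpha> else 0)) + (\<Sum>k\<in>UNIV. ext (Inl k) (iot (Inl k) (iot c \<alpha>)))"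
      unfolding iot_lin sum.distrib[symmetric]
      by (intro sum.cong refl, subst iot_iot[OF Cons.prems]) (auto simp: iot_ext)
    also have "(\<Sum>k\<in>UNIV. (if c = Inl k then iot c \<alpha> else 0)) = (if isl c then iot c \<alpha> else 0)"
      by (cases c) auto
    finally show ?case
      unfolding apply_Cons iot_np using Cons.IH[of "iot c \<alpha>"] Cons.prems by simp
  qed
qed

lemma euler_nq:
  assumes "alternating \<alpha>"
  shows "(\<Sum>k\<in>UNIV. ext (Inr k) (iot (Inr k) \<alpha>)) = nq (\<alpha> :: 'n::finite cform)"
proof
  fix as show "(\<Sum>k\<in>UNIV. ext (Inr k) (iot (Inr k) \<alpha>)) as = nq \<alpha> as"
    using assms
  proof (induction as arbitrary: \<alpha>)
    case Nil then show ?case by (simp add: sum_fun_apply nq_def)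
  next
    case (Cons c as)
    have "iot c (\<Sum>k\<in>UNIV. ext (Inr k) (iot (Inr k) \<alpha>)) =
      (\<Sum>k\<in>UNIV. (if c = Inr k then iot c \<alpha> else 0)) + (\<Sum>k\<in>UNIV. ext (Inr k) (iot (Inr k) (iot c \<alpha>)))"
      unfolding iot_lin sum.distrib[symmetric]
      by (intro sum.cong refl, subst iot_iot[OF Cons.prems]) (auto simp: iot_ext)
    also have "(\<Sum>k\<in>UNIV. (if c = Inr k then iot c \<alpha> else 0)) = (if isl c then 0 else iot c \<alpha>)"
      by (cases c) auto
    finally show ?case
      unfolding apply_Cons iot_nq using Cons.IH[of "iot c \<alpha>"] Cons.prems by simp
  qed
qed

lemma Lop_ext: "Lop h (ext a \<alpha>) = ext a (Lop h \<alpha>)"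
proof -
  have "ext (Inl j) (ext (Inr k) (ext a \<alpha>)) = ext a (ext (Inl j) (ext (Inr k) \<alpha>))" for j k
    using ext_ext[of "Inr k" a \<alpha>] ext_ext[of "Inl j" a] by simp
  then show ?thesis by (simp add: Lop_def)
qed

locale hmetric =
  fixes h g :: "complex ^ 'n::finite ^ 'n"
  assumes hg: "h ** g = mat 1" and gh: "g ** h = mat 1"
    and h_herm: "\<And>j k. cnj (h $ j $ k) = h $ k $ j"
    and g_herm: "\<And>j k. cnj (g $ j $ k) = g $ k $ j"
begin

abbreviation "G \<equiv> met g"
abbreviation "es j \<equiv> est G (Inl j)"
abbreviation "ebs j \<equiv> est G (Inr j)"
abbreviation "e j \<equiv> ext (Inl j) :: 'n cform \<Rightarrow> 'n cform"
abbreviation "eb j \<equiv> ext (Inr j) :: 'n cform \<Rightarrow> 'n cform"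
abbreviation "H \<equiv> hin G"

lemma G_herm: "G b a = cnj (G a b)"
  by (cases a; cases b) (auto simp: g_herm)

lemma hg_sum: "(\<Sum>k\<in>UNIV. h $ i $ k * g $ k $ j) = (if i = j then 1 else 0)"
  using arg_cong[OF hg, of "\<lambda>m. m $ i $ j"] by (simp add: matrix_matrix_mult_def mat_def)

lemma gh_sum: "(\<Sum>k\<in>UNIV. g $ i $ k * h $ k $ j) = (if i = j then 1 else 0)"
  using arg_cong[OF gh, of "\<lambda>m. m $ i $ j"] by (simp add: matrix_matrix_mult_def mat_def)

lemma es_eq: "es q \<alpha> = (\<Sum>k\<in>UNIV. csc (g $ q $ k) (iot (Inl k) \<alpha>))"
  by (simp add: est_def sum_UNIV_sum g_herm)

lemma ebs_eq: "ebs q \<alpha> = (\<Sum>k\<in>UNIV. csc (g $ k $ q) (iot (Inr k) \<alpha>))"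
  by (simp add: est_def sum_UNIV_sum g_herm)

lemma hin_est_left: "alternating \<alpha> \<Longrightarrow> H (est G a \<alpha>) \<beta> = H \<alpha> (ext a \<beta>)"
  using hin_ext_right[of G, OF G_herm] by metis

lemmas hadj = hin_ext_left hin_est_left

lemma est_e: "est G (Inl q) (e j \<alpha>) = csc (g $ q $ j) \<alpha> - e j (es q \<alpha>)"
  and ebs_e: "ebs q (e j \<alpha>) = - e j (ebs q \<alpha>)"
  and es_eb: "es q (eb j \<alpha>) = - eb j (es q \<alpha>)"
  and ebs_eb: "ebs q (eb j \<alpha>) = csc (g $ j $ q) \<alpha> - eb j (ebs q \<alpha>)"
  by (simp_all add: est_ext g_herm)

lemma lam_e: "lam g (e j \<alpha>) = e j (lam g \<alpha>) - csc \<i> (ebs j \<alpha>)"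
proof -
  have "lam g (e j \<alpha>) = (\<Sum>k\<in>UNIV. \<Sum>b\<in>UNIV. csc (\<i> * g $ b $ k) (e j (iot (Inl k) (iot (Inr b) \<alpha>)))
      - (if k = j then csc (\<i> * g $ b $ k) (iot (Inr b) \<alpha>) else 0))"
    unfolding lam_def by (intro sum.cong refl) (simp add: iot_ext csc_diff csc_minus csc_minus1)
  then show ?thesis
    by (simp add: ebs_eq csc_sum sum_subtractf lam_def sum_if_const)
qed

lemma lam_eb: "lam g (eb q \<alpha>) = eb q (lam g \<alpha>) + csc \<i> (es q \<alpha>)"
proof -
  have "lam g (eb q \<alpha>) = (\<Sum>k\<in>UNIV. \<Sum>b\<in>UNIV. csc (\<i> * g $ b $ k) (eb q (iot (Inl k) (iot (Inr b) \<alpha>)))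
      + (if b = q then csc (\<i> * g $ b $ k) (iot (Inl k) \<alpha>) else 0))"
    unfolding lam_def by (intro sum.cong refl) (simp add: iot_ext csc_diff csc_add csc_minus csc_minus1)
  then show ?thesis
    by (simp add: es_eq csc_sum sum.distrib lam_def)
qed

lemma lam_est: "alternating \<alpha> \<Longrightarrow> lam g (est G a \<alpha>) = est G a (lam g \<alpha>)"
  unfolding lam_def est_lin by (intro sum.cong refl) (simp add: est_iot)

lemma Lop_es: "Lop h (es q \<alpha>) = es q (Lop h \<alpha>) - csc \<i> (eb q \<alpha>)"
proof -
  have "es q (Lop h \<alpha>) = (\<Sum>j\<in>UNIV. \<Sum>k\<in>UNIV. csc (\<i> * h $ j $ k) (e j (eb k (es q \<alpha>)))
     + csc (\<i> * (g $ q $ j * h $ j $ k)) (eb k \<alpha>))"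
    unfolding Lop_def est_lin
    by (intro sum.cong refl) (simp add: est_e es_eb csc_diff csc_add csc_minus csc_minus1 mult_ac)
  also have "\<dots> = Lop h (es q \<alpha>) + (\<Sum>k\<in>UNIV. csc (\<i> * (\<Sum>j\<in>UNIV. g $ q $ j * h $ j $ k)) (eb k \<alpha>))"
    unfolding sum.distrib csc_sum_left sum_distrib_left by (simp add: Lop_def, rule sum.swap)
  also have "\<dots> = Lop h (es q \<alpha>) + csc \<i> (eb q \<alpha>)"
    by (simp add: gh_sum if_distrib[of "\<lambda>x. \<i> * x"] if_distrib[of "\<lambda>x. csc x _"] cong: if_cong)
  finally show ?thesis by simp
qed

lemma Lop_ebs: "Lop h (ebs q \<alpha>) = ebs q (Lop h \<alpha>) + csc \<i> (e q \<alpha>)"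
proof -
  have "ebs q (Lop h \<alpha>) = (\<Sum>j\<in>UNIV. \<Sum>k\<in>UNIV. csc (\<i> * h $ j $ k) (e j (eb k (ebs q \<alpha>)))
     - csc (\<i> * (h $ j $ k * g $ k $ q)) (e j \<alpha>))"
    unfolding Lop_def est_lin
    by (intro sum.cong refl) (simp add: ebs_e ebs_eb csc_diff csc_add csc_minus csc_minus1 mult_ac)
  also have "\<dots> = Lop h (ebs q \<alpha>) - (\<Sum>j\<in>UNIV. csc (\<i> * (\<Sum>k\<in>UNIV. h $ j $ k * g $ k $ q)) (e j \<alpha>))"
    unfolding sum_subtractf by (simp add: Lop_def csc_sum_left sum_distrib_left)
  also have "\<dots> = Lop h (ebs q \<alpha>) - csc \<i> (e q \<alpha>)"
    by (simp add: hg_sum if_distrib[of "\<lambda>x. \<i> * x"] if_distrib[of "\<lambda>x. csc x _"] cong: if_cong)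
  finally show ?thesis by simp
qed

text \<open>Lowering the index that \<open>est\<close> has raised. With \<open>h_ebs\<close> this
  recovers plain contractions from metric ones, both for the adjoint of L and for
  nondegeneracy.\<close>

lemma h_es: "(\<Sum>k\<in>UNIV. csc (h $ j $ k) (es k \<alpha>)) = iot (Inl j) \<alpha>"
proof -
  have "(\<Sum>k\<in>UNIV. csc (h $ j $ k) (es k \<alpha>)) = (\<Sum>l\<in>UNIV. csc (\<Sum>k\<in>UNIV. h $ j $ k * g $ k $ l) (iot (Inl l) \<alpha>))"
    unfolding es_eq csc_sum csc_sum_left by (subst sum.swap) simp
  then show ?thesis by (simp add: hg_sum if_distrib[of "\<lambda>x. csc x _"] cong: if_cong)
qed

lemma h_ebs: "(\<Sum>j\<in>UNIV. csc (h $ j $ k) (ebs j \<alpha>)) = iot (Inr k) \<alpha>"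
proof -
  have "(\<Sum>j\<in>UNIV. csc (h $ j $ k) (ebs j \<alpha>)) = (\<Sum>l\<in>UNIV. csc (\<Sum>j\<in>UNIV. g $ l $ j * h $ j $ k) (iot (Inr l) \<alpha>))"
    unfolding ebs_eq csc_sum csc_sum_left by (subst sum.swap) (simp add: mult.commute)
  then show ?thesis by (simp add: gh_sum if_distrib[of "\<lambda>x. csc x _"] cong: if_cong)
qed

text \<open>Moving both exterior factors across the inner product gives metric contractions weighted
  by h; \<open>h_ebs\<close> cancels h against one inverse, and the other inverse supplies the
  coefficients of \<open>lam\<close>.\<close>

lemma hin_Lop:
  assumes "alternating \<beta>"
  shows "H (Lop h \<alpha>) \<beta> = H \<alpha> (lam g \<beta>)"
proof -
  have "H (Lop h \<alpha>) \<beta> = (\<Sum>j\<in>UNIV. \<Sum>k\<in>UNIV. H \<alpha> (csc (- \<i> * h $ k $ j) (ebs k (es j \<beta>))))"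
    using assms by (simp add: Lop_def hin_lin hadj h_herm)
  also have "\<dots> = H \<alpha> (\<Sum>j\<in>UNIV. csc (- \<i>) (\<Sum>k\<in>UNIV. csc (h $ k $ j) (ebs k (es j \<beta>))))"
    by (simp add: hin_sum_right csc_sum)
  also have "(\<Sum>j\<in>UNIV. csc (- \<i>) (\<Sum>k\<in>UNIV. csc (h $ k $ j) (ebs k (es j \<beta>)))) = lam g \<beta>"
    unfolding h_ebs es_eq csc_sum iot_lin lam_def
    by (subst sum.swap) (intro sum.cong refl, subst iot_iot[OF assms], simp add: csc_minus mult.commute)
  finally show ?thesis .
qed

text \<open>The sl(2) relation \<open>[\<Lambda>, L] = n - p - q\<close>: the full contraction is
  the trace of \<open>h ** g\<close>, the two single contractions are the Euler sums for p and q.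
  This is the source of the dimension in the theorem.\<close>

lemma lam_Lop:
  assumes "alternating \<alpha>"
  shows "lam g (Lop h \<alpha>) = Lop h (lam g \<alpha>) + csc (of_nat CARD('n)) \<alpha> - np \<alpha> - nq \<alpha>"
proof -
  have "lam g (Lop h \<alpha>) = (\<Sum>j\<in>UNIV. \<Sum>k\<in>UNIV. csc (\<i> * h $ j $ k) (e j (eb k (lam g \<alpha>)))
      + csc (h $ j $ k * g $ k $ j) \<alpha> - eb k (csc (h $ j $ k) (ebs j \<alpha>)) - e j (csc (h $ j $ k) (es k \<alpha>)))"
    unfolding Lop_def lam_lin
    by (intro sum.cong refl) (simp add: lam_e lam_eb ebs_eb csc_diff csc_add csc_minus csc_minus1 mult_ac)
  also have "\<dots> = Lop h (lam g \<alpha>) + csc (\<Sum>j\<in>UNIV. \<Sum>k\<in>UNIV. h $ j $ k * g $ k $ j) \<alpha>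
      - (\<Sum>k\<in>UNIV. eb k (\<Sum>j\<in>UNIV. csc (h $ j $ k) (ebs j \<alpha>)))
      - (\<Sum>j\<in>UNIV. e j (\<Sum>k\<in>UNIV. csc (h $ j $ k) (es k \<alpha>)))"
    unfolding sum_subtractf sum.distrib ext_lin(6) csc_sum_left
    by (simp add: Lop_def, rule sum.swap)
  finally show ?thesis
    unfolding h_es h_ebs hg_sum euler_np[OF assms] euler_nq[OF assms] by (simp add: algebra_simps)
qed

lemma hin_np: "alternating \<alpha> \<Longrightarrow> alternating \<beta> \<Longrightarrow> H (np \<alpha>) \<beta> = H \<alpha> (np \<beta>)"
proof -
  assume a: "alternating \<alpha>" "alternating \<beta>"
  have "H (np \<alpha>) \<beta> = (\<Sum>k\<in>UNIV. \<Sum>l\<in>UNIV. g $ l $ k * H (iot (Inl k) \<alpha>) (iot (Inl l) \<beta>))"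
    using a by (simp add: euler_np[symmetric] hin_lin hadj es_eq g_herm)
  also have "\<dots> = (\<Sum>l\<in>UNIV. \<Sum>k\<in>UNIV. g $ l $ k * H (iot (Inl k) \<alpha>) (iot (Inl l) \<beta>))"
    by (rule sum.swap)
  also have "\<dots> = H \<alpha> (np \<beta>)"
    using a by (simp add: euler_np[symmetric] hin_lin hin_est_left[symmetric]) (simp add: es_eq hin_lin)
  finally show ?thesis .
qed

end

text \<open>An ungraded commutator suffices, since its first entry is always \<Lambda>, of even
  degree.\<close>

definition ocomm :: "('v \<Rightarrow> 'v) \<Rightarrow> ('v \<Rightarrow> 'v) \<Rightarrow> 'v \<Rightarrow> 'v::ab_group_add" where
  "ocomm A B x = A (B x) - B (A x)"

text \<open>\<open>tri t\<close> is the wedge product with the (2,1)-form \<open>\<i> \<Sum> t\<^bsub>jpq\<^esub> dz\<^sub>j \<and> dz\<^sub>p \<and> cnj dz\<^sub>q\<close>, \<open>thl \<theta>\<close> that with the (1,0)-form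
  \<open>\<Sum> \<theta>\<^sub>j dz\<^sub>j\<close>; \<open>trib t\<close> and \<open>thr \<theta>\<close> belong to the conjugate forms.\<close>

definition tri :: "('n::finite \<Rightarrow> 'n \<Rightarrow> 'n \<Rightarrow> complex) \<Rightarrow> 'n cform \<Rightarrow> 'n cform" where
  "tri t \<alpha> = (\<Sum>j\<in>UNIV. \<Sum>p\<in>UNIV. \<Sum>q\<in>UNIV. csc (\<i> * t j p q) (ext (Inl j) (ext (Inl p) (ext (Inr q) \<alpha>))))"

definition trib :: "('n::finite \<Rightarrow> 'n \<Rightarrow> 'n \<Rightarrow> complex) \<Rightarrow> 'n cform \<Rightarrow> 'n cform" where
  "trib t \<alpha> = (\<Sum>j\<in>UNIV. \<Sum>p\<in>UNIV. \<Sum>q\<in>UNIV. csc (- \<i> * cnj (t j p q)) (ext (Inr j) (ext (Inr p) (ext (Inl q) \<alpha>))))"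

definition thl :: "('n::finite \<Rightarrow> complex) \<Rightarrow> 'n cform \<Rightarrow> 'n cform" where
  "thl \<theta> \<alpha> = (\<Sum>j\<in>UNIV. csc (\<theta> j) (ext (Inl j) \<alpha>))"

definition thr :: "('n::finite \<Rightarrow> complex) \<Rightarrow> 'n cform \<Rightarrow> 'n cform" where
  "thr \<theta> \<alpha> = (\<Sum>j\<in>UNIV. csc (cnj (\<theta> j)) (ext (Inr j) \<alpha>))"

lemma clin_tri: "clin (tri t)" and clin_trib: "clin (trib t)" and clin_thl: "clin (thl \<theta>)" and clin_thr: "clin (thr \<theta>)"
  by (rule clinI, simp_all add: tri_def csc_add sum.distrib csc_sum mult_ac)
    (rule clinI, simp_all add: trib_def thl_def thr_def csc_add sum.distrib csc_sum mult_ac sum_negf sum_subtractf csc_minus csc_minus1)+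

lemmas tri_lin [simp] = clins[OF clin_tri]
lemmas trib_lin [simp] = clins[OF clin_trib]
lemmas thl_lin [simp] = clins[OF clin_thl]
lemmas thr_lin [simp] = clins[OF clin_thr]

lemma alternating_tri [simp]: "alternating \<alpha> \<Longrightarrow> alternating (tri t \<alpha>)"
  unfolding tri_def by (intro alternating_sum alternating_csc alternating_ext)

lemma alternating_trib [simp]: "alternating \<alpha> \<Longrightarrow> alternating (trib t \<alpha>)"
  unfolding trib_def by (intro alternating_sum alternating_csc alternating_ext)

lemma alternating_thl [simp]: "alternating \<alpha> \<Longrightarrow> alternating (thl t \<alpha>)"
  unfolding thl_def by (intro alternating_sum alternating_csc alternating_ext)

context hmetric
begin

lemma ocomm_lam_eee:
  "ocomm (lam g) (\<lambda>\<alpha>. e j (e p (eb q \<alpha>))) \<alpha> =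
    csc (- \<i>) (ebs j (e p (eb q \<alpha>))) - csc \<i> (e j (ebs p (eb q \<alpha>))) + csc \<i> (e j (e p (es q \<alpha>)))"
  by (simp add: ocomm_def lam_e lam_eb csc_minus csc_minus1)

lemma ocomm_lam_eeeb:
  "ocomm (lam g) (\<lambda>\<alpha>. eb j (eb p (e q \<alpha>))) \<alpha> =
    csc \<i> (es j (eb p (e q \<alpha>))) + csc \<i> (eb j (es p (e q \<alpha>))) - csc \<i> (eb j (eb p (ebs q \<alpha>)))"
  by (simp add: ocomm_def lam_e lam_eb csc_minus csc_minus1)

text \<open>Ordered to match the divergence formula: the two scalar terms arise there from
  \<open>det h\<close> and from \<open>est\<close>, the next two from the derivative of the metric
  on forms, the last one from the derivative of \<Lambda>.\<close>

lemma torsion_term: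
  "csc \<i> (ocomm (lam g) (\<lambda>\<alpha>. e j (e p (eb q \<alpha>))) \<alpha>) =
     csc (g $ q $ p) (e j \<alpha>) - csc (g $ q $ j) (e p \<alpha>) - e j (e p (es q \<alpha>))
      - e j (eb q (ebs p \<alpha>)) - eb q (e p (ebs j \<alpha>))"
  unfolding ocomm_lam_eee
  by (simp add: csc_add csc_diff ebs_e ebs_eb csc_minus csc_minus1 ext_ext[of "Inl p" "Inr q"])

text \<open>Commuting with \<Lambda> turns one exterior factor into a contraction. Doing so twice
  picks two of the three factors, in either order, whence the 2. Moving the single commutator of the
  conjugate monomial across \<open>H\<close> turns its two remaining factors into contractions, so
  the same three terms arise.\<close>

lemma double_lam_term:
  assumes "alternating u" "alternating v"
  shows "H u (ocomm (lam g) (ocomm (lam g) (\<lambda>\<alpha>. e j (e p (eb q \<alpha>)))) v)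
     = 2 * \<i> * H (ocomm (lam g) (\<lambda>\<alpha>. eb j (eb p (e q \<alpha>))) u) v"
proof -
  have lhs: "ocomm (lam g) (ocomm (lam g) (\<lambda>\<alpha>. e j (e p (eb q \<alpha>)))) v
     = csc 2 (- ebs j (ebs p (eb q v)) + ebs j (e p (es q v)) + e j (ebs p (es q v)))"
  proof -
    have 1: "ocomm (lam g) (ocomm (lam g) (\<lambda>\<alpha>. e j (e p (eb q \<alpha>)))) v =
      lam g (ocomm (lam g) (\<lambda>\<alpha>. e j (e p (eb q \<alpha>))) v) - ocomm (lam g) (\<lambda>\<alpha>. e j (e p (eb q \<alpha>))) (lam g v)"
      by (simp only: ocomm_def)
    have two: "csc 2 x = x + x" for x :: "'n cform"
      by (simp add: csc_def fun_eq_iff)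
    show ?thesis
      unfolding 1 ocomm_lam_eee two using assms(2) est_est[of "eb q v" G "Inr j" "Inr p"]
      by (simp add: lam_e lam_eb lam_est csc_add csc_diff csc_minus csc_minus1 ebs_e)
  qed
  have rhs: "H (ocomm (lam g) (\<lambda>\<alpha>. eb j (eb p (e q \<alpha>))) u) v
      = \<i> * (H u (es q (ebs p (e j v))) + H u (es q (e p (ebs j v))) - H u (eb q (ebs p (ebs j v))))"
    unfolding ocomm_lam_eeeb using assms by (simp add: hin_lin hadj algebra_simps)
  have n1: "ebs j (ebs p (eb q v)) = csc (g $ q $ p) (ebs j v) - csc (g $ q $ j) (ebs p v) - eb q (ebs p (ebs j v))"
    using est_est[OF assms(2), of G "Inr j" "Inr p"] by (simp add: ebs_eb)
  have n2: "ebs j (e p (es q v)) = e p (es q (ebs j v))"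
    using est_est[OF assms(2), of G "Inr j" "Inl q"] by (simp add: ebs_e)
  have n3: "e j (ebs p (es q v)) = - e j (es q (ebs p v))"
    using est_est[OF assms(2), of G "Inr p" "Inl q"] by simp
  have m1: "es q (ebs p (e j v)) = - csc (g $ q $ j) (ebs p v) + e j (es q (ebs p v))"
    by (simp add: ebs_e est_e)
  have m2: "es q (e p (ebs j v)) = csc (g $ q $ p) (ebs j v) - e p (es q (ebs j v))"
    by (simp add: est_e)
  show ?thesis
    unfolding lhs rhs n1 n2 n3 m1 m2 by (simp add: hin_lin algebra_simps)
qed

lemma ocomm_tri: "ocomm (lam g) (tri t) \<alpha> = (\<Sum>j\<in>UNIV. \<Sum>p\<in>UNIV. \<Sum>q\<in>UNIV. csc (\<i> * t j p q)
    (ocomm (lam g) (\<lambda>\<alpha>. e j (e p (eb q \<alpha>))) \<alpha>))"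
  by (simp add: ocomm_def tri_def csc_diff sum_subtractf)

lemma ocomm_trib: "ocomm (lam g) (trib t) \<alpha> = (\<Sum>j\<in>UNIV. \<Sum>p\<in>UNIV. \<Sum>q\<in>UNIV. csc (- \<i> * cnj (t j p q))
    (ocomm (lam g) (\<lambda>\<alpha>. eb j (eb p (e q \<alpha>))) \<alpha>))"
  by (simp add: ocomm_def trib_def csc_diff sum_subtractf)

lemma double_lam:
  assumes "alternating u" "alternating v"
  shows "H u (ocomm (lam g) (ocomm (lam g) (tri t)) v) = 2 * \<i> * H (ocomm (lam g) (trib t) u) v"
proof -
  have *: "ocomm (lam g) (ocomm (lam g) (tri t)) v = (\<Sum>j\<in>UNIV. \<Sum>p\<in>UNIV. \<Sum>q\<in>UNIV. csc (\<i> * t j p q)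
    (ocomm (lam g) (ocomm (lam g) (\<lambda>\<alpha>. e j (e p (eb q \<alpha>)))) v))"
    unfolding ocomm_def[of "lam g" "ocomm (lam g) (tri t)"] ocomm_tri lam_lin sum_subtractf[symmetric]
    by (intro sum.cong refl) (simp add: ocomm_def[of "lam g" "ocomm _ _"] csc_diff)
  show ?thesis
    unfolding * ocomm_trib hin_lin by (simp add: double_lam_term[OF assms] sum_distrib_left mult_ac)
qed

text \<open>As L commutes with wedge products, the Jacobi identity reduces the left side to the
  commutator with \<open>[L, \<Lambda>]\<close>, which is the degree up to a constant; so the 3 is
  the degree of the form. In the computation, \<open>Lop_es\<close> and \<open>Lop_ebs\<close>
  restore each of the three contracted factors.\<close>

lemma Lop_ocomm_tri:
  assumes "alternating \<alpha>"
  shows "Lop h (ocomm (lam g) (tri t) \<alpha>) - ocomm (lam g) (tri t) (Lop h \<alpha>) = csc 3 (tri t \<alpha>)"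
proof -
  have three: "csc 3 x = x + x + x" for x :: "'n cform"
    by (simp add: csc_def fun_eq_iff)
  have "Lop h (ocomm (lam g) (\<lambda>\<alpha>. e j (e p (eb q \<alpha>))) \<alpha>) - ocomm (lam g) (\<lambda>\<alpha>. e j (e p (eb q \<alpha>))) (Lop h \<alpha>)
     = csc 3 (e j (e p (eb q \<alpha>)))" for j p q
    unfolding ocomm_lam_eee three
    by (simp add: Lop_ext Lop_es Lop_ebs csc_add csc_diff csc_minus csc_minus1)
  then have *: "csc (\<i> * t j p q) (Lop h (ocomm (lam g) (\<lambda>\<alpha>. e j (e p (eb q \<alpha>))) \<alpha>) - ocomm (lam g) (\<lambda>\<alpha>. e j (e p (eb q \<alpha>))) (Lop h \<alpha>))
    = csc 3 (csc (\<i> * t j p q) (e j (e p (eb q \<alpha>))))" for j p q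
    by (simp add: mult_ac)
  show ?thesis
    unfolding ocomm_tri Lop_lin sum_subtractf[symmetric] csc_diff[symmetric] * by (simp add: tri_def csc_sum)
qed

definition thls :: "('n \<Rightarrow> complex) \<Rightarrow> 'n cform \<Rightarrow> 'n cform" where
  "thls \<theta> \<alpha> = (\<Sum>j\<in>UNIV. csc (cnj (\<theta> j)) (es j \<alpha>))"

definition thrs :: "('n \<Rightarrow> complex) \<Rightarrow> 'n cform \<Rightarrow> 'n cform" where
  "thrs \<theta> \<alpha> = (\<Sum>j\<in>UNIV. csc (\<theta> j) (ebs j \<alpha>))"

lemma lam_thl: "lam g (thl \<theta> \<alpha>) = thl \<theta> (lam g \<alpha>) - csc \<i> (thrs \<theta> \<alpha>)"
  by (simp add: thl_def thrs_def lam_e csc_diff sum_subtractf csc_sum mult_ac)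

lemma lam_thr: "lam g (thr \<theta> \<alpha>) = thr \<theta> (lam g \<alpha>) + csc \<i> (thls \<theta> \<alpha>)"
  by (simp add: thr_def thls_def lam_eb csc_add sum.distrib csc_sum mult_ac)

lemma hin_thl: "alternating \<beta> \<Longrightarrow> H (thl \<theta> \<alpha>) \<beta> = H \<alpha> (thls \<theta> \<beta>)"
  by (simp add: thl_def thls_def hin_lin hadj)

lemma hin_thr: "alternating \<beta> \<Longrightarrow> H (thr \<theta> \<alpha>) \<beta> = H \<alpha> (thrs \<theta> \<beta>)"
  by (simp add: thr_def thrs_def hin_lin hadj)

lemma hin_thrs_left: "alternating \<alpha> \<Longrightarrow> H (thrs \<theta> \<alpha>) \<beta> = H \<alpha> (thr \<theta> \<beta>)"
  by (simp add: thr_def thrs_def hin_lin hadj)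

lemma np_lam: "np (lam g \<alpha>) = lam g (np \<alpha>) - lam g \<alpha>"
  by (simp add: lam_def iot_np csc_add sum.distrib)

text \<open>The comparison of weights: q for the conjugate operator against p for D. The commutator
  with \<open>thl \<theta>\<close> after L is what the term
  \<open>- \<theta> \<and> \<omega>\<close> of \<alpha> contributes to the torsion, and
  \<open>lam_Lop\<close> evaluates it to n - p - q up to terms that cancel. The remaining multiple
  of \<open>thl \<theta>\<close> is the n of the theorem.\<close>

lemma twist:
  assumes "alternating \<alpha>" "alternating \<beta>"
  shows "H (nq (thl \<theta> \<alpha>)) \<beta> = H \<alpha> (csc \<i> (lam g (np (thr \<theta> \<beta>)) - np (thr \<theta> (lam g \<beta>))))
     - H (ocomm (lam g) (\<lambda>\<alpha>. thl \<theta> (Lop h \<alpha>)) \<alpha>) \<beta> + of_nat CARD('n) * H (thl \<theta> \<alpha>) \<beta>"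
proof -
  have np_thr: "np (thr \<theta> x) = thr \<theta> (np x)" for x
    by (simp add: thr_def np_ext)
  have np_thl: "np (thl \<theta> x) = thl \<theta> (np x) + thl \<theta> x" for x
    by (simp add: thl_def np_ext csc_add sum.distrib)
  have nq_thl: "nq (thl \<theta> x) = thl \<theta> (nq x)" for x
    by (simp add: thl_def nq_ext)
  have thrs_Lop: "thrs \<theta> (Lop h x) = Lop h (thrs \<theta> x) - csc \<i> (thl \<theta> x)" for x
    by (simp add: thrs_def thl_def Lop_ebs csc_add sum.distrib csc_sum mult.commute)
  have 1: "csc \<i> (lam g (np (thr \<theta> \<beta>)) - np (thr \<theta> (lam g \<beta>)))
      = - thls \<theta> (np \<beta>) + csc \<i> (thr \<theta> (lam g \<beta>))"
    by (simp add: np_thr lam_thr np_lam csc_diff csc_add csc_minus csc_minus1)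
  have 2: "ocomm (lam g) (\<lambda>\<alpha>. thl \<theta> (Lop h \<alpha>)) \<alpha>
     = thl \<theta> (csc (of_nat CARD('n)) \<alpha> - np \<alpha> - nq \<alpha>) - csc \<i> (Lop h (thrs \<theta> \<alpha>)) - thl \<theta> \<alpha>"
    using assms(1) by (simp add: ocomm_def lam_thl lam_Lop thrs_Lop csc_diff csc_minus csc_minus1 csc_m1)
  have 3: "H \<alpha> (thls \<theta> (np \<beta>)) = H (thl \<theta> (np \<alpha>)) \<beta> + H (thl \<theta> \<alpha>) \<beta>"
    using assms by (simp add: hin_thl[symmetric] hin_np[symmetric] np_thl hin_lin)
  have 4: "H \<alpha> (thr \<theta> (lam g \<beta>)) = H (Lop h (thrs \<theta> \<alpha>)) \<beta>"
    using assms by (simp add: hin_Lop hin_thrs_left)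
  show ?thesis
    unfolding 1 2 nq_thl by (simp add: hin_lin 3 4 algebra_simps)
qed

text \<open>Taking the outermost factor off the test monomial replaces \<open>w\<close> by its
  metric contractions, and these span all contractions because h inverts g. Monomials are the right
  test vectors since \<open>test_form\<close> realizes their multiples as values of global smooth
  forms.\<close>

lemma hin_zero_iff:
  assumes "\<And>as. H (foldr ext as (\<lambda>xs. if xs = [] then 1 else 0)) w = 0"
  shows "alternating w \<Longrightarrow> w = 0"
proof -
  assume w: "alternating w"
  let ?o = "(\<lambda>xs. if xs = [] then 1 else 0) :: 'n cform"
  have iot_o: "iot a ?o = 0" for a by (auto simp: iot_def fun_eq_iff)
  have hk0: "hk G k 0 \<beta> = 0" for k and \<beta> :: "'n cform"
    using hk_csc_left[of G k 0 0 \<beta>] by simp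
  have Ho: "H ?o \<beta> = cnj (\<beta> [])" for \<beta> :: "'n cform"
  proof -
    have "hk G k ?o \<beta> = (if k = 0 then cnj (\<beta> []) else 0)" for k
      by (cases k) (simp_all add: hk.simps(2) iot_o hk0)
    then have "H ?o \<beta> = (\<Sum>k\<le>2 * CARD('n). if k = 0 then cnj (\<beta> []) else 0)"
      unfolding hin_def by (intro sum.cong refl) (simp only:, simp)
    then show ?thesis by simp
  qed
  have inv: "\<exists>F. \<forall>\<beta>. iot b \<beta> = (\<Sum>a\<in>UNIV. csc (F a) (est G a (\<beta>::'n cform)))" for b
  proof (cases b)
    case (Inl j)
    show ?thesis
      by (rule exI[of _ "case_sum (\<lambda>k. h $ j $ k) (\<lambda>_. 0)"]) (simp add: sum_UNIV_sum h_es Inl)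
  next
    case (Inr j)
    show ?thesis
      by (rule exI[of _ "case_sum (\<lambda>_. 0) (\<lambda>k. h $ k $ j)"]) (simp add: sum_UNIV_sum h_ebs Inr)
  qed
  have "w bs = 0" if "alternating w" "\<And>as. H (foldr ext as ?o) w = 0" for bs w
    using that
  proof (induction bs arbitrary: w)
    case Nil
    then show ?case using Nil.prems(2)[of "[]"] by (simp add: Ho)
  next
    case (Cons b bs)
    obtain F where F: "iot b w = (\<Sum>a\<in>UNIV. csc (F a) (est G a w))" using inv[of b] by blast
    have "est G a w bs = 0" for a
    proof (rule Cons.IH)
      show "H (foldr ext as ?o) (est G a w) = 0" for as
        using Cons.prems(2)[of "a # as"] by (simp add: hin_ext_left Cons.prems(1))
    qed (simp add: Cons.prems)
    then show ?case unfolding apply_Cons F by (simp add: sum_fun_apply csc_apply)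
  qed
  then show ?thesis using w assms by (auto simp: fun_eq_iff)
qed

text \<open>The terms of the divergence formula below in which \<open>u\<close> and \<open>v\<close> are not differentiated.\<close>

lemma divergence_algebra:
  assumes "alternating u" "alternating v"
  shows "(\<Sum>j\<in>UNIV. \<Sum>p\<in>UNIV. \<Sum>q\<in>UNIV. t j p q *
     (g $ q $ p * H u (es j v) - g $ q $ j * H u (es p v) - H (e p (es q u) + eb q (ebs p u)) (es j v)
       - H (eb q (e p (ebs j u))) v)) = H (ocomm (lam g) (tri t) u) v"
proof -
  have *: "t j p q * (g $ q $ p * H u (es j v) - g $ q $ j * H u (es p v) - H (e p (es q u) + eb q (ebs p u)) (es j v)
       - H (eb q (e p (ebs j u))) v) = \<i> * t j p q * H (ocomm (lam g) (\<lambda>\<alpha>. e j (e p (eb q \<alpha>))) u) v" for j p q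
  proof -
    have "\<i> * H (ocomm (lam g) (\<lambda>\<alpha>. e j (e p (eb q \<alpha>))) u) v
      = H (csc \<i> (ocomm (lam g) (\<lambda>\<alpha>. e j (e p (eb q \<alpha>))) u)) v"
      by (simp add: hin_lin)
    also have "\<dots> = g $ q $ p * H u (es j v) - g $ q $ j * H u (es p v) - H (e p (es q u) + eb q (ebs p u)) (es j v)
       - H (eb q (e p (ebs j u))) v"
      unfolding torsion_term using assms by (simp add: hin_lin hadj)
    finally have E: "\<i> * H (ocomm (lam g) (\<lambda>\<alpha>. e j (e p (eb q \<alpha>))) u) v = \<dots>" .
    show ?thesis unfolding E[symmetric] by simp
  qed
  show ?thesis unfolding * ocomm_tri hin_sum_left hin_csc_left ..
qed

text \<open>The derivative of the inverse of h is \<open>- (g ** t ** g)\<close> with t the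
  derivative of h. Each of the outer factors g merges with a plain contraction into a metric one,
  and one of the two metric contractions then moves across \<open>H\<close>.\<close>

lemma deriv_met:
  assumes "alternating u" "alternating v"
  shows "(\<Sum>a\<in>UNIV. \<Sum>b\<in>UNIV. met (- (g ** t ** g)) a b * H (iot a u) (iot b v))
    = - (\<Sum>p\<in>UNIV. \<Sum>q\<in>UNIV. t $ p $ q * H (e p (es q u) + eb q (ebs p u)) v)"
proof -
  let ?D = "\<lambda>a b. \<Sum>p\<in>UNIV. \<Sum>q\<in>UNIV. g $ a $ p * t $ p $ q * g $ q $ b"
  have gtg: "(g ** t ** g) $ a $ b = ?D a b" for a b
    unfolding matrix_matrix_mult_def by (simp add: sum_distrib_right) (rule sum.swap)
  have 1: "(\<Sum>a\<in>UNIV. \<Sum>b\<in>UNIV. ?D b a * H (iot (Inl a) u) (iot (Inl b) v))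
     = (\<Sum>p\<in>UNIV. \<Sum>q\<in>UNIV. t $ p $ q * H (es q u) (es p v))"
  proof -
    have "(\<Sum>p\<in>UNIV. \<Sum>q\<in>UNIV. t $ p $ q * H (es q u) (es p v)) =
      (\<Sum>p\<in>UNIV. \<Sum>q\<in>UNIV. \<Sum>a\<in>UNIV. \<Sum>b\<in>UNIV. g $ b $ p * t $ p $ q * g $ q $ a * H (iot (Inl a) u) (iot (Inl b) v))"
      by (simp add: es_eq hin_lin g_herm sum_distrib_left mult_ac)
        (rule sum.cong[OF refl], rule sum.cong[OF refl], rule sum.swap)
    also have "\<dots> = (\<Sum>a\<in>UNIV. \<Sum>p\<in>UNIV. \<Sum>q\<in>UNIV. \<Sum>b\<in>UNIV. g $ b $ p * t $ p $ q * g $ q $ a * H (iot (Inl a) u) (iot (Inl b) v))"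
      by (rule sum3_rot)
    also have "\<dots> = (\<Sum>a\<in>UNIV. \<Sum>b\<in>UNIV. \<Sum>p\<in>UNIV. \<Sum>q\<in>UNIV. g $ b $ p * t $ p $ q * g $ q $ a * H (iot (Inl a) u) (iot (Inl b) v))"
      by (intro sum.cong refl sum3_rot)
    finally show ?thesis by (simp add: sum_distrib_right)
  qed
  have 2: "(\<Sum>a\<in>UNIV. \<Sum>b\<in>UNIV. ?D a b * H (iot (Inr a) u) (iot (Inr b) v))
     = (\<Sum>p\<in>UNIV. \<Sum>q\<in>UNIV. t $ p $ q * H (ebs p u) (ebs q v))"
  proof -
    have "(\<Sum>p\<in>UNIV. \<Sum>q\<in>UNIV. t $ p $ q * H (ebs p u) (ebs q v)) =
      (\<Sum>p\<in>UNIV. \<Sum>q\<in>UNIV. \<Sum>a\<in>UNIV. \<Sum>b\<in>UNIV. g $ a $ p * t $ p $ q * g $ q $ b * H (iot (Inr a) u) (iot (Inr b) v))"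
      by (simp add: ebs_eq hin_lin g_herm sum_distrib_left mult_ac)
        (rule sum.cong[OF refl], rule sum.cong[OF refl], rule sum.swap)
    also have "\<dots> = (\<Sum>a\<in>UNIV. \<Sum>p\<in>UNIV. \<Sum>q\<in>UNIV. \<Sum>b\<in>UNIV. g $ a $ p * t $ p $ q * g $ q $ b * H (iot (Inr a) u) (iot (Inr b) v))"
      by (rule sum3_rot)
    also have "\<dots> = (\<Sum>a\<in>UNIV. \<Sum>b\<in>UNIV. \<Sum>p\<in>UNIV. \<Sum>q\<in>UNIV. g $ a $ p * t $ p $ q * g $ q $ b * H (iot (Inr a) u) (iot (Inr b) v))"
      by (intro sum.cong refl sum3_rot)
    finally show ?thesis by (simp add: sum_distrib_right)
  qed
  have "(\<Sum>a\<in>UNIV. \<Sum>b\<in>UNIV. met (- (g ** t ** g)) a b * H (iot a u) (iot b v))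
    = - (\<Sum>a\<in>UNIV. \<Sum>b\<in>UNIV. ?D b a * H (iot (Inl a) u) (iot (Inl b) v))
      - (\<Sum>a\<in>UNIV. \<Sum>b\<in>UNIV. ?D a b * H (iot (Inr a) u) (iot (Inr b) v))"
    by (simp only: sum_UNIV_sum met.simps) (simp add: gtg sum_negf)
  also have "\<dots> = - (\<Sum>p\<in>UNIV. \<Sum>q\<in>UNIV. t $ p $ q * H (es q u) (es p v)) - (\<Sum>p\<in>UNIV. \<Sum>q\<in>UNIV. t $ p $ q * H (ebs p u) (ebs q v))"
    unfolding 1 2 ..
  finally show ?thesis
    using assms by (simp add: hadj hin_lin distrib_left sum.distrib)
qed

end

section \<open>Wedge product, conjugation and pullback in components\<close>

lemma cwedge_Nil [simp]: "cwedge \<alpha> \<beta> [] = \<alpha> [] * \<beta> []"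
  by (simp add: cwedge_def)

lemma Pow_lessThan_Suc_split:
  "(\<Sum>S\<in>Pow {..<Suc n}. f S) = (\<Sum>T\<in>Pow {..<n}. f (insert 0 (Suc ` T))) + (\<Sum>T\<in>Pow {..<n}. f (Suc ` T))"
proof -
  have inj: "inj_on ((`) Suc) (Pow {..<n})"
    by (rule inj_onI) (simp add: inj_image_eq_iff)
  have inj0: "inj_on (insert 0) (Pow (Suc ` {..<n}))"
  proof (rule inj_onI)
    fix x y assume "x \<in> Pow (Suc ` {..<n})" "y \<in> Pow (Suc ` {..<n})" "insert 0 x = insert 0 y"
    moreover from this have "0 \<notin> x" "0 \<notin> y" by auto
    ultimately show "x = y" by (metis insert_ident)
  qed
  have dj: "Pow (Suc ` {..<n}) \<inter> insert 0 ` Pow (Suc ` {..<n}) = {}" by auto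
  have im: "Pow (Suc ` {..<n}) = (`) Suc ` Pow {..<n}" by (simp add: image_Pow_surj)
  have "(\<Sum>S\<in>Pow {..<Suc n}. f S) = (\<Sum>S\<in>Pow (Suc ` {..<n}). f S) + (\<Sum>S\<in>insert 0 ` Pow (Suc ` {..<n}). f S)"
    unfolding lessThan_Suc_eq_insert_0 Pow_insert by (rule sum.union_disjoint) (use dj in auto)
  also have "\<dots> = (\<Sum>S\<in>Pow (Suc ` {..<n}). f S) + (\<Sum>S\<in>Pow (Suc ` {..<n}). f (insert 0 S))"
    by (simp add: sum.reindex[OF inj0])
  finally show ?thesis
    unfolding im by (simp add: sum.reindex[OF inj] add.commute)
qed

text \<open>The first position belongs either to the first factor or to the second. In the latter
  case it forms an inversion with every position of the first factor, and the sign is the degree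
  sign \<open>par \<alpha>\<close>. This recursion replaces shuffle sums from here on.\<close>

lemma cwedge_Cons:
  "cwedge \<alpha> \<beta> (c # as) = cwedge (iot c \<alpha>) \<beta> as + cwedge (par \<alpha>) (iot c \<beta>) as"
proof -
  define n where "n = length as"
  define inv where "inv = (\<lambda>S n. {(i, j). i < j \<and> j < n \<and> i \<notin> S \<and> j \<in> (S::nat set)})"
  have fold: "{(i, j). i < j \<and> j < m \<and> i \<notin> S \<and> j \<in> S} = inv S m" for S m
    by (simp add: inv_def)
  have fin: "finite (inv S m)" for S m
    by (rule finite_subset[of _ "{..m} \<times> {..m}"]) (auto simp: inv_def)
  have injS: "inj_on (\<lambda>(i, j). (Suc i, Suc j)) A" for A
    by (auto simp: inj_on_def)
  have cin: "card (inv (insert 0 (Suc ` T)) (Suc n)) = card (inv T n)" for T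
  proof -
    have "inv (insert 0 (Suc ` T)) (Suc n) = (\<lambda>(i, j). (Suc i, Suc j)) ` inv T n"
      by (auto simp: inv_def image_iff gr0_conv_Suc)
    then show ?thesis by (simp add: card_image[OF injS] card_image inj_on_def)
  qed
  \<comment> \<open>The inversions are those of \<open>T\<close>, shifted, and the pairs of the new
    position 0 with each element of \<open>T\<close>.\<close>
  have cout: "card (inv (Suc ` T) (Suc n)) = card T + card (inv T n)" if "T \<in> Pow {..<n}" for T
  proof -
    have "inv (Suc ` T) (Suc n) = (\<lambda>(i, j). (Suc i, Suc j)) ` inv T n \<union> (\<lambda>j. (0::nat, Suc j)) ` T"
    proof (intro set_eqI)
      fix x :: "nat \<times> nat"
      obtain i j where x: "x = (i, j)" by (cases x)
      show "x \<in> inv (Suc ` T) (Suc n) \<longleftrightarrow> x \<in> (\<lambda>(i, j). (Suc i, Suc j)) ` inv T n \<union> (\<lambda>j. (0::nat, Suc j)) ` T"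
        unfolding x by (cases i; cases j) (use that in \<open>auto simp: inv_def image_iff\<close>)
    qed
    moreover have "card ((\<lambda>(i, j). (Suc i, Suc j)) ` inv T n \<union> (\<lambda>j. (0::nat, Suc j)) ` T)
       = card ((\<lambda>(i, j). (Suc i, Suc j)) ` inv T n) + card ((\<lambda>j. (0::nat, Suc j)) ` T)"
      by (rule card_Un_disjoint) (use that finite_subset[of T "{..<n}"] in \<open>auto simp: fin\<close>)
    ultimately show ?thesis by (simp add: card_image[OF injS] card_image inj_on_def)
  qed
  have len: "length (nths as T) = card T" if "T \<in> Pow {..<n}" for T
    using that unfolding length_nths by (intro arg_cong[of _ _ card]) (auto simp: n_def)
  have S1: "{j. Suc j \<in> insert 0 (Suc ` T)} = T" "{j. Suc j \<in> - insert 0 (Suc ` T)} = - T"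
    "{j. Suc j \<in> Suc ` T} = T" "{j. Suc j \<in> - Suc ` T} = - T" for T by auto
  have "cwedge \<alpha> \<beta> (c # as) = (\<Sum>T\<in>Pow {..<n}. (-1) ^ card (inv T n) * iot c \<alpha> (nths as T) * \<beta> (nths as (- T)))
     + (\<Sum>T\<in>Pow {..<n}. (-1) ^ card (inv T n) * par \<alpha> (nths as T) * iot c \<beta> (nths as (- T)))"
    unfolding cwedge_def length_Cons n_def[symmetric] fold Pow_lessThan_Suc_split
    by (intro arg_cong2[of _ _ _ _ "(+)"] sum.cong refl, simp_all only: cin cout nths_Cons S1)
      (simp_all add: iot_def par_def len power_add)
  then show ?thesis unfolding cwedge_def n_def inv_def .
qed

lemma iot_cwedge: "iot c (cwedge \<alpha> \<beta>) = cwedge (iot c \<alpha>) \<beta> + cwedge (par \<alpha>) (iot c \<beta>)"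
  by (auto simp: iot_def fun_eq_iff cwedge_Cons)

lemma clin_cwedge_right: "clin (cwedge \<alpha>)"
  by (rule clinI) (auto simp: fun_eq_iff cwedge_def csc_apply algebra_simps sum.distrib sum_distrib_left)

lemma clin_cwedge_left: "clin (\<lambda>\<alpha>. cwedge \<alpha> \<beta>)"
  by (rule clinI) (auto simp: fun_eq_iff cwedge_def csc_apply algebra_simps sum.distrib sum_distrib_left)

lemmas cwedge_lin [simp] = clins[OF clin_cwedge_right] clins[OF clin_cwedge_left]

lemma par_np: "par (np \<alpha>) = np (par \<alpha>)"
  by (auto simp: par_def np_def fun_eq_iff)

lemma np_cwedge: "np (cwedge \<alpha> \<beta>) = cwedge (np \<alpha>) \<beta> + cwedge \<alpha> (np \<beta>)"
proof
  fix as show "np (cwedge \<alpha> \<beta>) as = (cwedge (np \<alpha>) \<beta> + cwedge \<alpha> (np \<beta>)) as"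
  proof (induction as arbitrary: \<alpha> \<beta>)
    case (Cons c as)
    show ?case unfolding apply_Cons iot_np iot_lin iot_cwedge
      by (simp add: Cons iot_np par_np algebra_simps)
  qed (simp add: np_def)
qed

lemma alternating_cwedge [simp]:
  assumes "alternating \<alpha>" "alternating \<beta>"
  shows "alternating (cwedge \<alpha> \<beta>)"
  unfolding alternating_def
proof (intro allI)
  fix as a b bs
  show "cwedge \<alpha> \<beta> (as @ a # b # bs) = - cwedge \<alpha> \<beta> (as @ b # a # bs)"
    using assms
  proof (induction as arbitrary: \<alpha> \<beta>)
    case Nil
    have "iot b (iot a (cwedge \<alpha> \<beta>)) = - iot a (iot b (cwedge \<alpha> \<beta>))"
      by (simp add: iot_cwedge iot_par iot_iot[OF Nil(1), of b a] iot_iot[OF Nil(2), of b a])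
    then show ?case using fun_cong[of _ _ bs] by (fastforce simp: iot_def)
  next
    case (Cons c as)
    then show ?case by (simp add: cwedge_Cons)
  qed
qed

lemma par_ext: "par (ext a \<alpha>) = - ext a (par \<alpha>)"
proof
  fix as show "par (ext a \<alpha>) as = (- ext a (par \<alpha>)) as"
  proof (induction as arbitrary: \<alpha>)
    case (Cons c as)
    show ?case unfolding apply_Cons iot_par iot_lin iot_ext par_lin by (simp add: Cons iot_par)
  qed (simp add: par_def)
qed

lemma cwedge_ext_left: "cwedge (ext a \<alpha>) \<beta> = ext a (cwedge \<alpha> \<beta>)"
proof
  fix as show "cwedge (ext a \<alpha>) \<beta> as = ext a (cwedge \<alpha> \<beta>) as"
  proof (induction as arbitrary: \<alpha> \<beta>)
    case (Cons c as)
    show ?case unfolding apply_Cons iot_cwedge iot_ext by (simp add: Cons iot_cwedge par_ext)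
  qed simp
qed

lemma cwedge_ext_right: "cwedge \<alpha> (ext a \<beta>) = ext a (cwedge (par \<alpha>) \<beta>)"
proof
  fix as show "cwedge \<alpha> (ext a \<beta>) as = ext a (cwedge (par \<alpha>) \<beta>) as"
  proof (induction as arbitrary: \<alpha> \<beta>)
    case (Cons c as)
    show ?case unfolding apply_Cons iot_cwedge iot_ext by (simp add: Cons iot_cwedge iot_par iot_ext)
  qed simp
qed

definition cunit :: "'n cform" where
  "cunit = (\<lambda>as. if as = [] then 1 else 0)"

lemma iot_cunit [simp]: "iot a cunit = 0"
  by (auto simp: cunit_def iot_def fun_eq_iff)

lemma par_cunit [simp]: "par cunit = cunit"
  by (auto simp: cunit_def par_def fun_eq_iff)

lemma alternating_cunit [simp]: "alternating cunit"
  by (simp add: alternating_def cunit_def)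

lemma cwedge_cunit [simp]: "cwedge cunit \<beta> = \<beta>"
proof
  fix as show "cwedge cunit \<beta> as = \<beta> as"
  proof (induction as arbitrary: \<beta>)
    case (Cons c as)
    show ?case unfolding apply_Cons iot_cwedge by (simp add: Cons)
  qed (simp add: cunit_def)
qed

text \<open>A form that vanishes off degree 2 is determined by its double contractions, which are
  compared entry by entry. It turns the wedge product with \<omega> into \<open>Lop\<close>.\<close>

lemma form11_eq:
  assumes alt: "alternating \<omega>" and pq: "cpart 1 1 \<omega> = \<omega>"
  shows "\<omega> = Lop (hmat \<omega>) (cunit :: 'n::finite cform)"
proof -
  have len: "\<omega> as = 0" if "length as \<noteq> 2" for as
  proof -
    have "length as = length (filter isl as) + length (filter (Not \<circ> isl) as)"
      by (simp add: sum_length_filter_compl[of isl as, symmetric] comp_def)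
    then have "cpart 1 1 \<omega> as = 0" using that by (auto simp: cpart_def)
    then show ?thesis using pq by simp
  qed
  have z: "\<omega> [Inl j, Inl k] = 0" "\<omega> [Inr j, Inr k] = 0" for j k
    using fun_cong[OF pq, of "[Inl j, Inl k]"] fun_cong[OF pq, of "[Inr j, Inr k]"] by (simp_all add: cpart_def)
  have sw: "\<omega> [Inr k, Inl j] = - \<omega> [Inl j, Inr k]" for j k
    using alt unfolding alternating_def by (metis append_Nil)
  have ii: "iot b (iot a \<omega>) = csc (\<omega> [a, b]) cunit" for a b
    using len by (auto simp: iot_def csc_def cunit_def fun_eq_iff)
  have mm: "csc (\<i> * hmat \<omega> $ j $ k) = csc (\<omega> [Inl j, Inr k])" for j k
    by (simp add: hmat_def)
  show ?thesis
  proof (rule cform_eqI)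
    show "\<omega> [] = Lop (hmat \<omega>) cunit []" by (simp add: len Lop_def sum_fun_apply csc_apply)
    fix a
    show "iot a \<omega> = iot a (Lop (hmat \<omega>) cunit)"
    proof (rule cform_eqI)
      show "iot a \<omega> [] = iot a (Lop (hmat \<omega>) cunit) []"
        unfolding Lop_def iot_lin sum_fun_apply csc_apply
        by (auto simp: len iot_def[of a \<omega>] iot_ext intro!: sum.neutral)
      fix b
      have *: "iot b (iot a (Lop (hmat \<omega>) cunit)) = (\<Sum>j\<in>UNIV. \<Sum>k\<in>UNIV.
        (if a = Inl j then if b = Inr k then csc (\<omega> [Inl j, Inr k]) cunit else 0 else 0)
        - (if b = Inl j then if a = Inr k then csc (\<omega> [Inl j, Inr k]) cunit else 0 else 0))"
        unfolding Lop_def iot_lin mm by (intro sum.cong refl) (auto simp: iot_ext csc_diff)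
      show "iot b (iot a \<omega>) = iot b (iot a (Lop (hmat \<omega>) cunit))"
        unfolding ii * sum_subtractf
        by (cases a; cases b; simp add: z sw csc_minus1 sum_if_const)
    qed
  qed
qed

lemma cwedge_Lop_cunit: "cwedge (Lop h cunit) \<beta> = Lop h \<beta>"
  by (simp add: Lop_def cwedge_ext_left)

subsection \<open>Conjugation\<close>

definition flip :: "'n + 'n \<Rightarrow> 'n + 'n" where "flip = case_sum Inr Inl"

lemma flip_simps [simp]: "flip (Inl j) = Inr j" "flip (Inr j) = Inl j" "flip (flip a) = a"
  by (auto simp: flip_def split: sum.splits)

lemma flip_eq_iff: "flip a = b \<longleftrightarrow> a = flip b" by (metis flip_simps(3))

lemma cconj_add [simp]: "cconj (\<alpha> + \<beta>) = cconj \<alpha> + cconj \<beta>"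
  and cconj_diff [simp]: "cconj (\<alpha> - \<beta>) = cconj \<alpha> - cconj \<beta>"
  and cconj_minus [simp]: "cconj (- \<alpha>) = - cconj \<alpha>"
  and cconj_0 [simp]: "cconj 0 = 0"
  and cconj_csc [simp]: "cconj (csc c \<alpha>) = csc (cnj c) (cconj \<alpha>)"
  by (auto simp: cconj_def fun_eq_iff csc_def)

lemma cconj_sum [simp]: "cconj (\<Sum>x\<in>S. f x) = (\<Sum>x\<in>S. cconj (f x))"
  using sum_comp_morphism[of cconj f S] by (simp add: o_def)

lemma cconj_cconj [simp]: "cconj (cconj \<alpha>) = \<alpha>"
  by (auto simp: cconj_def fun_eq_iff comp_def flip_def[symmetric])

lemma iot_cconj: "iot a (cconj \<alpha>) = cconj (iot (flip a) \<alpha>)"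
  by (auto simp: cconj_def iot_def flip_def)

lemma cconj_par: "cconj (par \<alpha>) = par (cconj \<alpha>)"
  by (auto simp: cconj_def par_def)

lemma isl_flip [simp]: "isl (flip a) \<longleftrightarrow> \<not> isl a"
  by (cases a) auto

lemma cconj_np: "cconj (np \<alpha>) = nq (cconj \<alpha>)"
  and cconj_nq: "cconj (nq \<alpha>) = np (cconj \<alpha>)"
  by (auto simp: cconj_def np_def nq_def filter_map comp_def flip_def[symmetric])

lemma cconj_ext: "cconj (ext a \<alpha>) = ext (flip a) (cconj \<alpha>)"
proof
  fix as show "cconj (ext a \<alpha>) as = ext (flip a) (cconj \<alpha>) as"
  proof (induction as arbitrary: \<alpha>)
    case (Cons c as)
    show ?case unfolding apply_Cons iot_cconj iot_ext by (auto simp: Cons flip_eq_iff iot_cconj)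
  qed (simp add: cconj_def)
qed

lemma cconj_cwedge: "cconj (cwedge \<alpha> \<beta>) = cwedge (cconj \<alpha>) (cconj \<beta>)"
proof
  fix as show "cconj (cwedge \<alpha> \<beta>) as = cwedge (cconj \<alpha>) (cconj \<beta>) as"
  proof (induction as arbitrary: \<alpha> \<beta>)
    case (Cons c as)
    show ?case unfolding apply_Cons iot_cconj iot_cwedge by (simp add: Cons iot_cconj cconj_par)
  qed (simp add: cconj_def)
qed

lemma alternating_cconj [simp]: "alternating \<alpha> \<Longrightarrow> alternating (cconj \<alpha>)"
  by (rule alternatingI[where P = "\<lambda>\<gamma>. alternating (cconj \<gamma>)"], simp)
    (metis alternating_iot cconj_cconj cconj_minus iot_cconj iot_iot,
     metis alternating_iot flip_simps(3) iot_cconj)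

lemma cconj_thl: "cconj (thl \<theta> \<alpha>) = thr \<theta> (cconj \<alpha>)"
  and cconj_tri: "cconj (tri t \<alpha>) = trib t (cconj \<alpha>)"
  by (simp_all add: thl_def thr_def tri_def trib_def cconj_ext)

text \<open>\<Lambda> is a real operator: the sign from conjugating \<i> cancels against the sign
  from exchanging the two contractions.\<close>

lemma (in hmetric) cconj_lam: "alternating \<alpha> \<Longrightarrow> cconj (lam g \<alpha>) = lam g (cconj \<alpha>)"
proof -
  assume a: "alternating \<alpha>"
  have "cconj (lam g \<alpha>) = (\<Sum>k\<in>UNIV. \<Sum>b\<in>UNIV. csc (\<i> * g $ k $ b) (cconj (- iot (Inl k) (iot (Inr b) \<alpha>))))"
    by (simp add: lam_def g_herm csc_minus)
  also have "\<dots> = (\<Sum>k\<in>UNIV. \<Sum>b\<in>UNIV. csc (\<i> * g $ k $ b) (iot (Inl b) (iot (Inr k) (cconj \<alpha>))))"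
    by (intro sum.cong refl, subst iot_iot[OF a, symmetric]) (simp add: iot_cconj)
  also have "\<dots> = lam g (cconj \<alpha>)"
    unfolding lam_def by (rule sum.swap)
  finally show ?thesis .
qed

lemma sum_flip: "(\<Sum>a\<in>UNIV. f (flip a)) = (\<Sum>a\<in>(UNIV::('n::finite + 'n) set). f a)"
  by (simp add: sum_UNIV_sum add.commute)

lemma (in hmetric) hin_cconj: "H (cconj \<alpha>) (cconj \<beta>) = cnj (H \<alpha> \<beta>)"
proof -
  have Gf: "G (flip a) (flip b) = cnj (G a b)" for a b
    by (cases a; cases b) (auto simp: g_herm)
  have "hk G k (cconj \<alpha>) (cconj \<beta>) = cnj (hk G k \<alpha> \<beta>)" for k
  proof (induction k arbitrary: \<alpha> \<beta>)
    case 0 show ?case by (simp add: cconj_def)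
  next
    case (Suc k)
    have "hk G (Suc k) (cconj \<alpha>) (cconj \<beta>) = (\<Sum>a\<in>UNIV. \<Sum>b\<in>UNIV. G a b * cnj (hk G k (iot (flip a) \<alpha>) (iot (flip b) \<beta>)))"
      by (simp add: hk.simps(2) iot_cconj Suc)
    also have "\<dots> = (\<Sum>a\<in>UNIV. \<Sum>b\<in>UNIV. G (flip a) (flip b) * cnj (hk G k (iot a \<alpha>) (iot b \<beta>)))"
      by (subst sum_flip[symmetric], subst sum_flip[symmetric]) simp
    finally show ?case by (simp add: hk.simps(2) Gf)
  qed
  then show ?thesis by (simp add: hin_def)
qed

subsection \<open>Pullback\<close>

definition pull :: "('n + 'n \<Rightarrow> 'n + 'n \<Rightarrow> complex) \<Rightarrow> 'n::finite cform \<Rightarrow> 'n cform" where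
  "pull J \<alpha> as = (\<Sum>bs\<in>{bs. length bs = length as}. (\<Prod>i<length as. J (as ! i) (bs ! i)) * \<alpha> bs)"

lemma pull_Nil [simp]: "pull J \<alpha> [] = \<alpha> []"
  by (simp add: pull_def)

lemma clin_pull: "clin (pull J)"
  by (rule clinI) (auto simp: fun_eq_iff pull_def csc_apply algebra_simps sum.distrib sum_distrib_left)

lemmas pull_lin [simp] = clins[OF clin_pull]

lemma iot_pull: "iot a (pull J \<alpha>) = (\<Sum>b\<in>UNIV. csc (J a b) (pull J (iot b \<alpha>)))"
  by (auto simp: fun_eq_iff iot_def pull_def sum_lists_Suc sum_fun_apply csc_apply sum_distrib_left
      prod.lessThan_Suc_shift mult.assoc simp del: prod.lessThan_Suc)

lemma pull_ext: "pull J (ext b \<alpha>) = (\<Sum>a\<in>UNIV. csc (J a b) (ext a (pull J \<alpha>)))"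
proof
  fix as show "pull J (ext b \<alpha>) as = (\<Sum>a\<in>UNIV. csc (J a b) (ext a (pull J \<alpha>))) as"
  proof (induction as arbitrary: \<alpha>)
    case (Cons c as)
    have "iot c (\<Sum>a\<in>UNIV. csc (J a b) (ext a (pull J \<alpha>))) = csc (J c b) (pull J \<alpha>)
      - (\<Sum>a\<in>UNIV. \<Sum>d\<in>UNIV. csc (J a b * J c d) (ext a (pull J (iot d \<alpha>))))"
      by (simp add: iot_ext iot_pull csc_diff sum_subtractf csc_sum if_distrib[of "csc _"] cong: if_cong)
    also have "(\<Sum>a\<in>UNIV. \<Sum>d\<in>UNIV. csc (J a b * J c d) (ext a (pull J (iot d \<alpha>))))
      = (\<Sum>d\<in>UNIV. csc (J c d) (\<Sum>a\<in>UNIV. csc (J a b) (ext a (pull J (iot d \<alpha>)))))"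
      by (subst sum.swap) (simp add: csc_sum mult.commute)
    finally have 1: "iot c (\<Sum>a\<in>UNIV. csc (J a b) (ext a (pull J \<alpha>))) = csc (J c b) (pull J \<alpha>)
      - (\<Sum>d\<in>UNIV. csc (J c d) (\<Sum>a\<in>UNIV. csc (J a b) (ext a (pull J (iot d \<alpha>)))))" .
    show ?case unfolding apply_Cons 1 iot_pull
      by (simp add: iot_ext csc_diff sum_subtractf if_distrib[of "csc _"] if_distrib[of "pull J"] sum_fun_apply csc_apply Cons cong: if_cong)
  qed (simp add: sum_fun_apply csc_apply)
qed

lemma pull_par: "pull J (par \<alpha>) = par (pull J \<alpha>)"
  by (auto simp: fun_eq_iff pull_def par_def sum_distrib_left mult_ac intro!: sum.cong)

lemma pull_cwedge: "pull J (cwedge \<alpha> \<beta>) = cwedge (pull J \<alpha>) (pull J \<beta>)"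
proof
  fix as show "pull J (cwedge \<alpha> \<beta>) as = cwedge (pull J \<alpha>) (pull J \<beta>) as"
  proof (induction as arbitrary: \<alpha> \<beta>)
    case (Cons c as)
    show ?case unfolding apply_Cons iot_cwedge
      by (simp add: iot_pull sum_fun_apply csc_apply iot_cwedge Cons pull_par distrib_left sum.distrib)
  qed simp
qed

lemma hk_pull:
  assumes "\<And>c d. G' c d = (\<Sum>a\<in>UNIV. \<Sum>b\<in>UNIV. J a c * G a b * cnj (J b d))"
  shows "hk G k (pull J \<alpha>) (pull J \<beta>) = hk G' k \<alpha> \<beta>"
proof (induction k arbitrary: \<alpha> \<beta>)
  case (Suc k)
  have sl: "hk G k (\<Sum>x\<in>S. f x) \<gamma> = (\<Sum>x\<in>S. hk G k (f x) \<gamma>)" for S :: "('a + 'a) set" and f \<gamma>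
    using sum_comp_morphism[of "\<lambda>x. hk G k x \<gamma>" f S] hk_csc_left[of G k 0 0 \<gamma>] by (simp add: o_def hk_add_left)
  have sr: "hk G k \<gamma> (\<Sum>x\<in>S. f x) = (\<Sum>x\<in>S. hk G k \<gamma> (f x))" for S :: "('a + 'a) set" and f \<gamma>
    using sum_comp_morphism[of "\<lambda>x. hk G k \<gamma> x" f S] hk_csc_right[of G k \<gamma> 0 0] by (simp add: o_def hk_add_right)
  have "hk G (Suc k) (pull J \<alpha>) (pull J \<beta>) = (\<Sum>a\<in>UNIV. \<Sum>b\<in>UNIV. \<Sum>c\<in>UNIV. \<Sum>d\<in>UNIV.
      J a c * G a b * cnj (J b d) * hk G' k (iot c \<alpha>) (iot d \<beta>))"
    by (simp add: hk.simps(2) iot_pull sl sr hk_csc_left hk_csc_right Suc sum_distrib_left mult_ac)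
      (intro sum.cong refl sum.swap)
  also have "\<dots> = (\<Sum>c\<in>UNIV. \<Sum>d\<in>UNIV. \<Sum>a\<in>UNIV. \<Sum>b\<in>UNIV.
      J a c * G a b * cnj (J b d) * hk G' k (iot c \<alpha>) (iot d \<beta>))"
    by (subst sum3_rot) (intro sum.cong refl sum3_rot)
  also have "\<dots> = hk G' (Suc k) \<alpha> \<beta>"
    by (simp only: hk.simps(2) sum_distrib_right[symmetric] assms[symmetric])
  finally show ?case .
qed simp

lemma hin_pull:
  assumes "\<And>c d. G' c d = (\<Sum>a\<in>UNIV. \<Sum>b\<in>UNIV. J a c * G a b * cnj (J b d))"
  shows "hin G (pull J \<alpha>) (pull J \<beta>) = hin G' \<alpha> \<beta>"
  unfolding hin_def hk_pull[OF assms] ..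

lemma cconj_pull:
  assumes "\<And>a b. J (flip a) (flip b) = cnj (J a b)"
  shows "cconj (pull J \<alpha>) = pull J (cconj \<alpha>)"
proof
  fix as show "cconj (pull J \<alpha>) as = pull J (cconj \<alpha>) as"
  proof (induction as arbitrary: \<alpha>)
    case Nil show ?case by (simp add: cconj_def)
  next
    case (Cons c as)
    have "iot c (cconj (pull J \<alpha>)) = (\<Sum>b\<in>UNIV. csc (cnj (J (flip c) (flip b))) (cconj (pull J (iot (flip b) \<alpha>))))"
      by (subst sum_flip) (simp add: iot_cconj iot_pull)
    then show ?case unfolding apply_Cons
      by (simp add: iot_pull assms iot_cconj sum_fun_apply csc_apply Cons)
  qed
qed

text \<open>The shape of the Jacobian of a holomorphic map. It keeps types apart, which is what
  makes the number operators and \<Lambda> commute with pullback.\<close>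

definition blockJ :: "('n + 'n \<Rightarrow> 'n + 'n \<Rightarrow> complex) \<Rightarrow> bool" where
  "blockJ J \<longleftrightarrow> (\<forall>a b. isl a \<noteq> isl b \<longrightarrow> J a b = 0)"

lemma np_pull:
  assumes "blockJ J"
  shows "np (pull J \<alpha>) = pull J (np \<alpha>)"
proof
  fix as show "np (pull J \<alpha>) as = pull J (np \<alpha>) as"
  proof (induction as arbitrary: \<alpha>)
    case (Cons c as)
    have *: "J c b * (if isl b then x else 0) as = (if isl c then J c b * x as else 0)" for b x
      using assms by (auto simp: blockJ_def)
    show ?case unfolding apply_Cons iot_pull iot_np
      by (cases "isl c") (simp_all add: * iot_pull iot_np csc_add sum_fun_apply csc_apply Cons distrib_left sum.distrib if_distrib[of "pull J"] cong: if_cong)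
  qed (simp add: np_def)
qed

lemma lam_pull:
  fixes g g' :: "complex ^ 'n::finite ^ 'n"
  assumes "blockJ J"
    and g': "\<And>b' k'. g' $ b' $ k' = (\<Sum>b\<in>UNIV. \<Sum>k\<in>UNIV. J (Inr b) (Inr b') * g $ b $ k * J (Inl k) (Inl k'))"
  shows "lam g (pull J \<alpha>) = pull J (lam g' \<alpha>)"
proof -
  have *: "J (Inl j) (Inr k) = 0" "J (Inr j) (Inl k) = 0" for j k
    using assms(1) by (auto simp: blockJ_def)
  have "lam g (pull J \<alpha>) = (\<Sum>k\<in>UNIV. \<Sum>b\<in>UNIV. \<Sum>k'\<in>UNIV. \<Sum>b'\<in>UNIV.
     csc (\<i> * (J (Inr b) (Inr b') * g $ b $ k * J (Inl k) (Inl k'))) (pull J (iot (Inl k') (iot (Inr b') \<alpha>))))"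
    unfolding lam_def
    by (intro sum.cong refl) (simp add: iot_pull sum_UNIV_sum * csc_sum mult_ac, rule sum.swap)
  also have "\<dots> = (\<Sum>k'\<in>UNIV. \<Sum>b'\<in>UNIV. \<Sum>k\<in>UNIV. \<Sum>b\<in>UNIV. 
     csc (\<i> * (J (Inr b) (Inr b') * g $ b $ k * J (Inl k) (Inl k'))) (pull J (iot (Inl k') (iot (Inr b') \<alpha>))))"
    by (subst sum3_rot) (intro sum.cong refl sum3_rot)
  also have "\<dots> = (\<Sum>k'\<in>UNIV. \<Sum>b'\<in>UNIV. \<Sum>b\<in>UNIV. \<Sum>k\<in>UNIV. 
     csc (\<i> * (J (Inr b) (Inr b') * g $ b $ k * J (Inl k) (Inl k'))) (pull J (iot (Inl k') (iot (Inr b') \<alpha>))))"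
    by (intro sum.cong[OF refl] sum.swap)
  finally show ?thesis
    by (simp add: lam_def g' csc_sum_left sum_distrib_left)
qed

section \<open>Smooth functions\<close>

lemma Ck_onD: "Ck_on (Suc k) S f \<Longrightarrow> z \<in> S \<Longrightarrow> (f has_derivative frechet_derivative f (at z)) (at z)"
  by (simp add: frechet_derivative_works[symmetric])

lemma Ck_on_cong:
  assumes "open S" "\<And>z. z \<in> S \<Longrightarrow> f z = g z" "Ck_on k S f"
  shows "Ck_on k S g"
  using assms(2,3)
proof (induction k arbitrary: f g)
  case 0
  then show ?case using continuous_on_cong[of S S f g] by simp
next
  case (Suc k)
  have d: "(g has_derivative frechet_derivative f (at z)) (at z)" if "z \<in> S" for z
    by (rule has_derivative_transform_within_open[OF Ck_onD[OF Suc.prems(2) that] assms(1) that Suc.prems(1)])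
  have e: "frechet_derivative g (at z) = frechet_derivative f (at z)" if "z \<in> S" for z
    using d[OF that] frechet_derivative_at by metis
  have "Ck_on k S (\<lambda>z. frechet_derivative g (at z) v)" for v
    by (rule Suc.IH[of "\<lambda>z. frechet_derivative f (at z) v"]) (use Suc.prems(2) e in auto)
  then show ?case using d by (auto simp: differentiable_def)
qed

lemma Ck_onI:
  assumes "open S" "\<And>z. z \<in> S \<Longrightarrow> (f has_derivative f' z) (at z)" "\<And>v. Ck_on k S (\<lambda>z. f' z v)"
  shows "Ck_on (Suc k) S f"
proof -
  have "Ck_on k S (\<lambda>z. frechet_derivative f (at z) v)" for v
    by (rule Ck_on_cong[OF assms(1) _ assms(3)[of v]]) (metis assms(2) frechet_derivative_at)
  then show ?thesis using assms(2) by (auto simp: differentiable_def)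
qed

lemma Ck_on_continuous: "Ck_on k S f \<Longrightarrow> continuous_on S f"
  by (cases k) (auto intro!: continuous_at_imp_continuous_on differentiable_imp_continuous_within)

lemma Ck_on_Suc: "Ck_on (Suc k) S f \<Longrightarrow> Ck_on k S f"
proof (induction k arbitrary: f)
  case 0 then show ?case using Ck_on_continuous[OF 0] by simp
next
  case (Suc k)
  have "\<forall>z\<in>S. f differentiable (at z)" using Suc.prems by simp
  moreover have "Ck_on k S (\<lambda>z. frechet_derivative f (at z) v)" for v
    using Suc.IH Suc.prems by simp
  ultimately show ?case by simp
qed

lemma Ck_on_subset: "Ck_on k S f \<Longrightarrow> T \<subseteq> S \<Longrightarrow> Ck_on k T f"
  by (induction k arbitrary: f) (auto intro: continuous_on_subset)

lemma Ck_on_const [simp]: "open S \<Longrightarrow> Ck_on k S (\<lambda>_. c)"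
proof (induction k arbitrary: c)
  case (Suc k)
  show ?case by (rule Ck_onI[where f' = "\<lambda>_ _. 0"]) (use Suc in auto)
qed simp

lemma Ck_on_add: "open S \<Longrightarrow> Ck_on k S f \<Longrightarrow> Ck_on k S g \<Longrightarrow> Ck_on k S (\<lambda>z. f z + g z)"
proof (induction k arbitrary: f g)
  case 0 then show ?case by (auto intro: continuous_on_add)
next
  case (Suc k)
  show ?case
    by (rule Ck_onI[OF Suc.prems(1) has_derivative_add[OF Ck_onD[OF Suc.prems(2)] Ck_onD[OF Suc.prems(3)]]])
      (use Suc in auto)
qed

lemma Ck_on_linear: "open S \<Longrightarrow> bounded_linear L \<Longrightarrow> Ck_on k S f \<Longrightarrow> Ck_on k S (\<lambda>z. L (f z))"
proof (induction k arbitrary: f)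
  case 0 then show ?case by (auto intro: bounded_linear.continuous_on)
next
  case (Suc k)
  show ?case
    by (rule Ck_onI[OF Suc.prems(1) bounded_linear.has_derivative[OF Suc.prems(2) Ck_onD[OF Suc.prems(3)]]])
      (use Suc in auto)
qed

lemma Ck_on_id [simp]: "open S \<Longrightarrow> Ck_on k S (\<lambda>z. z)"
proof (cases k)
  case (Suc m)
  assume "open S"
  then show ?thesis unfolding Suc by (intro Ck_onI[where f' = "\<lambda>_ v. v"]) auto
qed simp

lemma Ck_on_bilinear:
  assumes "bounded_bilinear B" "open S"
  shows "Ck_on k S f \<Longrightarrow> Ck_on k S g \<Longrightarrow> Ck_on k S (\<lambda>z. B (f z) (g z))"
proof (induction k arbitrary: f g)
  case 0 then show ?case using bounded_bilinear.continuous_on[OF assms(1)] by auto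
next
  case (Suc k)
  have "Ck_on k S f" "Ck_on k S g" using Suc.prems Ck_on_Suc by blast+
  then show ?case
    by (intro Ck_onI[OF assms(2) bounded_bilinear.FDERIV[OF assms(1) Ck_onD[OF Suc.prems(1)] Ck_onD[OF Suc.prems(2)]]])
      (use Suc.prems in \<open>auto intro!: Ck_on_add Suc.IH assms(2)\<close>)
qed

lemma Ck_on_sum:
  assumes "open S" "\<And>i. i \<in> I \<Longrightarrow> Ck_on k S (f i)"
  shows "Ck_on k S (\<lambda>z. \<Sum>i\<in>I. f i z)"
  using assms(2) by (induction I rule: infinite_finite_induct) (auto intro!: Ck_on_add simp: assms(1))

lemma Ck_on_compose:
  fixes f :: "'v::euclidean_space \<Rightarrow> 'w::real_normed_vector" and g :: "'u::real_normed_vector \<Rightarrow> 'v"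
  assumes "open S" "open T" "g ` S \<subseteq> T"
  shows "Ck_on k T f \<Longrightarrow> Ck_on k S g \<Longrightarrow> Ck_on k S (\<lambda>z. f (g z))"
proof (induction k arbitrary: f)
  case 0
  then show ?case using assms(3) continuous_on_compose2[of T f S g] by auto
next
  case (Suc k)
  let ?Df = "\<lambda>w. frechet_derivative f (at w)" and ?Dg = "\<lambda>z. frechet_derivative g (at z)"
  have gT: "g z \<in> T" if "z \<in> S" for z using that assms(3) by auto
  have d: "((\<lambda>z. f (g z)) has_derivative (\<lambda>v. ?Df (g z) (?Dg z v))) (at z)" if "z \<in> S" for z
    using has_derivative_compose[OF Ck_onD[OF Suc.prems(2) that] Ck_onD[OF Suc.prems(1) gT[OF that]]] .
  have lin: "linear (?Df (g z))" if "z \<in> S" for z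
    using has_derivative_linear[OF Ck_onD[OF Suc.prems(1) gT[OF that]]] .
  \<comment> \<open>The inner derivative supplies a direction that varies with \<open>z\<close>,
    while \<open>Ck_on\<close> speaks of derivatives in fixed directions only; so the direction is
    expanded in a basis.\<close>
  have e: "(\<Sum>b\<in>Basis. (?Dg z v \<bullet> b) *\<^sub>R ?Df (g z) b) = ?Df (g z) (?Dg z v)" if "z \<in> S" for z v
  proof -
    have "?Df (g z) (\<Sum>b\<in>Basis. (?Dg z v \<bullet> b) *\<^sub>R b) = (\<Sum>b\<in>Basis. (?Dg z v \<bullet> b) *\<^sub>R ?Df (g z) b)"
      by (simp add: linear_sum[OF lin[OF that]] linear_scale[OF lin[OF that]])
    then show ?thesis by (simp add: euclidean_representation)
  qed
  have "Ck_on k S (\<lambda>z. ?Df (g z) (?Dg z v))" for v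
  proof (rule Ck_on_cong[OF assms(1) e])
    show "Ck_on k S (\<lambda>z. \<Sum>b\<in>Basis. (?Dg z v \<bullet> b) *\<^sub>R ?Df (g z) b)"
    proof (intro Ck_on_sum[OF assms(1)] Ck_on_bilinear[OF bounded_bilinear_scaleR assms(1)])
      fix b :: 'v assume "b \<in> Basis"
      show "Ck_on k S (\<lambda>z. ?Dg z v \<bullet> b)"
        using Ck_on_linear[OF assms(1) bounded_linear_inner_left, of k "\<lambda>z. ?Dg z v" b] Suc.prems(2) by simp
      show "Ck_on k S (\<lambda>z. ?Df (g z) b)"
        using Suc.IH[of "\<lambda>w. ?Df w b"] Suc.prems(1) Ck_on_Suc[OF Suc.prems(2)] by simp
    qed
  qed
  then show ?case by (intro Ck_onI[OF assms(1) d]) auto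
qed

lemma Ck_on_inverse:
  fixes f :: "'v::real_normed_vector \<Rightarrow> 'w::real_normed_field"
  assumes "open S" "\<And>z. z \<in> S \<Longrightarrow> f z \<noteq> 0"
  shows "Ck_on k S f \<Longrightarrow> Ck_on k S (\<lambda>z. inverse (f z))"
proof (induction k)
  case 0 then show ?case using assms(2) by (auto intro: continuous_on_inverse)
next
  case (Suc k)
  have i: "Ck_on k S (\<lambda>z. inverse (f z))" using Suc.IH Ck_on_Suc[OF Suc.prems] by blast
  show ?case
  proof (rule Ck_onI[OF assms(1) Deriv.has_derivative_inverse[OF assms(2) Ck_onD[OF Suc.prems]]])
    fix v
    have "Ck_on k S (\<lambda>z. inverse (f z) * frechet_derivative f (at z) v * inverse (f z))"
      using Suc.prems by (intro Ck_on_bilinear[OF bounded_bilinear_mult assms(1)] i) auto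
    from Ck_on_linear[OF assms(1) bounded_linear_minus[OF bounded_linear_ident] this]
    show "Ck_on k S (\<lambda>z. - (inverse (f z) * frechet_derivative f (at z) v * inverse (f z)))" .
  qed auto
qed

lemma Ck_on_Union:
  assumes "open S" "open T"
  shows "Ck_on k S f \<Longrightarrow> Ck_on k T f \<Longrightarrow> Ck_on k (S \<union> T) f"
  by (induction k arbitrary: f) (use assms in \<open>auto intro: continuous_on_open_Un\<close>)

lemma smooth_on_continuous: "smooth_on S f \<Longrightarrow> continuous_on S f"
  by (auto simp: smooth_on_def intro: Ck_on_continuous[of 0])

lemma smooth_onD: "smooth_on S f \<Longrightarrow> z \<in> S \<Longrightarrow> (f has_derivative frechet_derivative f (at z)) (at z)"
  unfolding smooth_on_def using Ck_onD by blast

lemma smooth_on_deriv: "smooth_on S f \<Longrightarrow> smooth_on S (\<lambda>z. frechet_derivative f (at z) v)"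
  unfolding smooth_on_def by (metis Ck_on.simps(2))

lemma smooth_on_differentiable: "smooth_on S f \<Longrightarrow> z \<in> S \<Longrightarrow> f differentiable (at z)"
  using smooth_onD differentiable_def by blast

lemma smooth_on_cong: "open S \<Longrightarrow> smooth_on S f \<Longrightarrow> (\<And>z. z \<in> S \<Longrightarrow> f z = g z) \<Longrightarrow> smooth_on S g"
  unfolding smooth_on_def using Ck_on_cong by blast

lemma smooth_on_subset: "smooth_on S f \<Longrightarrow> T \<subseteq> S \<Longrightarrow> smooth_on T f"
  unfolding smooth_on_def using Ck_on_subset by blast

lemma smooth_on_const: "open S \<Longrightarrow> smooth_on S (\<lambda>_. c)"
  and smooth_on_id: "open S \<Longrightarrow> smooth_on S (\<lambda>z. z)"
  and smooth_on_add: "open S \<Longrightarrow> smooth_on S f \<Longrightarrow> smooth_on S g \<Longrightarrow> smooth_on S (\<lambda>z. f z + g z)"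
  and smooth_on_linear: "bounded_linear L \<Longrightarrow> open S \<Longrightarrow> smooth_on S f \<Longrightarrow> smooth_on S (\<lambda>z. L (f z))"
  unfolding smooth_on_def by (simp_all, (blast intro: Ck_on_add Ck_on_linear)+)

lemma smooth_on_bilinear:
  "bounded_bilinear B \<Longrightarrow> open S \<Longrightarrow> smooth_on S f \<Longrightarrow> smooth_on S g \<Longrightarrow> smooth_on S (\<lambda>z. B (f z) (g z))"
  unfolding smooth_on_def by (blast intro: Ck_on_bilinear)

lemmas smooth_on_mult = smooth_on_bilinear[OF bounded_bilinear_mult]
lemmas smooth_on_scaleR = smooth_on_bilinear[OF bounded_bilinear_scaleR]
lemmas smooth_on_minus = smooth_on_linear[OF bounded_linear_minus[OF bounded_linear_ident]]
lemmas smooth_on_cnj = smooth_on_linear[OF bounded_linear_cnj]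
lemmas smooth_on_of_real = smooth_on_linear[OF bounded_linear_of_real]
lemmas smooth_on_Re = smooth_on_linear[OF bounded_linear_Re]

lemma smooth_on_diff: 
  "open S \<Longrightarrow> smooth_on S f \<Longrightarrow> smooth_on S g \<Longrightarrow> smooth_on S (\<lambda>z. f z - g z)"
  using smooth_on_add[of S f "\<lambda>z. - g z"] smooth_on_minus[of S g] by simp

lemma smooth_on_sum:
  "open S \<Longrightarrow> (\<And>i. i \<in> I \<Longrightarrow> smooth_on S (f i)) \<Longrightarrow> smooth_on S (\<lambda>z. \<Sum>i\<in>I. f i z)"
  unfolding smooth_on_def by (intro allI Ck_on_sum) auto

lemma smooth_on_prod:
  fixes f :: "'i \<Rightarrow> 'v::real_normed_vector \<Rightarrow> 'w::{real_normed_algebra,comm_monoid_mult}"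
  shows "open S \<Longrightarrow> (\<And>i. i \<in> I \<Longrightarrow> smooth_on S (f i)) \<Longrightarrow> smooth_on S (\<lambda>z. \<Prod>i\<in>I. f i z)"
  by (induction I rule: infinite_finite_induct) (auto intro!: smooth_on_const smooth_on_mult)

lemma smooth_on_compose:
  fixes f :: "'v::euclidean_space \<Rightarrow> 'w::real_normed_vector"
  shows "open S \<Longrightarrow> open T \<Longrightarrow> g ` S \<subseteq> T \<Longrightarrow> smooth_on T f \<Longrightarrow> smooth_on S g \<Longrightarrow> smooth_on S (\<lambda>z. f (g z))"
  using Ck_on_compose[of S T g _ f] unfolding smooth_on_def by simp

lemma smooth_on_inverse:
  fixes f :: "'v::real_normed_vector \<Rightarrow> 'w::real_normed_field"
  shows "open S \<Longrightarrow> (\<And>z. z \<in> S \<Longrightarrow> f z \<noteq> 0) \<Longrightarrow> smooth_on S f \<Longrightarrow> smooth_on S (\<lambda>z. inverse (f z))"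
  using Ck_on_inverse[of S f] unfolding smooth_on_def by simp

lemma smooth_on_divide:
  fixes f :: "'v::real_normed_vector \<Rightarrow> 'w::real_normed_field"
  shows "open S \<Longrightarrow> (\<And>z. z \<in> S \<Longrightarrow> g z \<noteq> 0) \<Longrightarrow> smooth_on S f \<Longrightarrow> smooth_on S g \<Longrightarrow> smooth_on S (\<lambda>z. f z / g z)"
  unfolding divide_inverse by (intro smooth_on_mult smooth_on_inverse)

lemma smooth_on_Un: "open S \<Longrightarrow> open T \<Longrightarrow> smooth_on S f \<Longrightarrow> smooth_on T f \<Longrightarrow> smooth_on (S \<union> T) f"
  unfolding smooth_on_def using Ck_on_Union by blast

text \<open>A class of functions closed under taking directional derivatives consists of smooth
  functions. Meant for the class of holomorphic functions.\<close>

lemma smooth_on_coinduct: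
  assumes "P f" "open S"
    and "\<And>f. P f \<Longrightarrow> \<exists>f'. (\<forall>z\<in>S. (f has_derivative f' z) (at z)) \<and> (\<forall>v. P (\<lambda>z. f' z v))"
  shows "smooth_on S f"
  unfolding smooth_on_def
proof
  fix k show "Ck_on k S f" using assms(1)
  proof (induction k arbitrary: f)
    case 0
    obtain f' where "\<forall>z\<in>S. (f has_derivative f' z) (at z)"
      using assms(3)[OF 0] by blast
    then show ?case
      using has_derivative_continuous continuous_at_imp_continuous_on by (metis Ck_on.simps(1))
  next
    case (Suc k)
    obtain f' where "\<forall>z\<in>S. (f has_derivative f' z) (at z)" "\<forall>v. P (\<lambda>z. f' z v)"
      using assms(3)[OF Suc.prems] by blast
    then show ?case by (intro Ck_onI[OF assms(2)]) (auto intro: Suc.IH)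
  qed
qed

subsection \<open>Bump functions\<close>

text \<open>The standard flat function is the case m = 0. The powers in front make the family closed
  under differentiation up to linear combinations, as the induction in \<open>psi_smooth\<close>
  requires.\<close>

definition psi :: "nat \<Rightarrow> real \<Rightarrow> real" where
  "psi m x = (if x > 0 then inverse x ^ m * exp (- inverse x) else 0)"

lemma psi_tendsto_0: "(psi m \<longlongrightarrow> 0) (at 0)"
proof -
  have r: "((\<lambda>x. inverse x ^ m * exp (- inverse x)) \<longlongrightarrow> (0::real)) (at_right 0)"
  proof -
    have "((\<lambda>y::real. y ^ m / exp y) \<longlongrightarrow> 0) at_top" by (rule tendsto_power_div_exp_0)
    from filterlim_compose[OF this filterlim_inverse_at_top_right]
    show ?thesis by (simp add: exp_minus divide_inverse)
  qed
  have "(psi m \<longlongrightarrow> 0) (at_right 0)"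
    by (rule Lim_transform_eventually[OF r]) (auto simp: psi_def eventually_at_filter)
  moreover have "(psi m \<longlongrightarrow> 0) (at_left 0)"
    by (rule Lim_transform_eventually[OF tendsto_const]) (auto simp: psi_def eventually_at_filter)
  ultimately show ?thesis using filterlim_at_split by blast
qed

lemma psi_has_derivative: "(psi m has_real_derivative (psi (m + 2) x - real m * psi (m + 1) x)) (at x)"
proof -
  consider "x > 0" | "x < 0" | "x = 0" by linarith
  then show ?thesis
  proof cases
    case 1
    have "((\<lambda>x. inverse x ^ m * exp (- inverse x)) has_real_derivative
        (psi (m + 2) x - real m * psi (m + 1) x)) (at x)"
      using 1 by (auto intro!: derivative_eq_intros simp: psi_def power2_eq_square)
        (cases m, auto simp: field_simps power2_eq_square)
    then show ?thesis
      by (rule has_field_derivative_transform_within_open[where S = "{0<..}"]) (use 1 in \<open>auto simp: psi_def\<close>)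
  next
    case 2
    have "((\<lambda>x. 0) has_real_derivative 0) (at x)" by simp
    then have "(psi m has_real_derivative 0) (at x)"
      by (rule has_field_derivative_transform_within_open[where S = "{..<0}"]) (use 2 in \<open>auto simp: psi_def\<close>)
    then show ?thesis using 2 by (simp add: psi_def)
  next
    case 3
    \<comment> \<open>At 0 the difference quotient of \<open>psi m\<close> is
      \<open>psi (Suc m)\<close>, which tends to 0.\<close>
    have "((\<lambda>y. (psi m y - psi m 0) / (y - 0)) \<longlongrightarrow> 0) (at 0)"
      by (rule Lim_transform_eventually[OF psi_tendsto_0[of "Suc m"]])
        (auto simp: psi_def eventually_at_filter divide_inverse mult_ac)
    then show ?thesis using 3 by (simp add: has_field_derivative_iff psi_def)
  qed
qed

lemma psi_smooth: "smooth_on UNIV (psi m)"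
  unfolding smooth_on_def
proof
  fix k show "Ck_on k UNIV (psi m)"
  proof (induction k arbitrary: m)
    case 0
    show ?case using psi_has_derivative
      by (auto intro!: continuous_at_imp_continuous_on DERIV_isCont)
  next
    case (Suc k)
    show ?case
    proof (rule Ck_onI[OF open_UNIV psi_has_derivative[unfolded has_field_derivative_def]])
      fix v
      have "Ck_on k UNIV (\<lambda>z. psi (m + 2) z + (- (real m)) * psi (m + 1) z)"
        by (intro Ck_on_add Ck_on_bilinear[OF bounded_bilinear_mult] Suc) auto
      from Ck_on_linear[OF open_UNIV bounded_linear_mult_left[of v] this]
      show "Ck_on k UNIV (\<lambda>z. (psi (m + 2) z - real m * psi (m + 1) z) * v)" by simp
    qed
  qed
qed

definition bump :: "real \<Rightarrow> 'v::euclidean_space \<Rightarrow> 'v \<Rightarrow> real" where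
  "bump r z0 z = psi 0 (r\<^sup>2 - (z - z0) \<bullet> (z - z0))"

lemma bump_smooth: "smooth_on UNIV (bump r z0)"
proof -
  have "smooth_on UNIV (\<lambda>z. r\<^sup>2 - (z - z0) \<bullet> (z - z0))"
    by (intro smooth_on_diff smooth_on_bilinear[OF bounded_bilinear_inner] smooth_on_const smooth_on_id) auto
  from smooth_on_compose[OF _ _ _ psi_smooth this, of 0] show ?thesis
    by (simp add: bump_def[abs_def])
qed

lemma bump_nonneg: "bump r z0 z \<ge> 0"
  by (simp add: bump_def psi_def)

lemma bump_pos_iff:
  assumes "r > 0"
  shows "bump r z0 z > 0 \<longleftrightarrow> z \<in> ball z0 r"
proof -
  have "r\<^sup>2 - (z - z0) \<bullet> (z - z0) > 0 \<longleftrightarrow> (norm (z - z0))\<^sup>2 < r\<^sup>2"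
    by (simp add: power2_norm_eq_inner)
  also have "\<dots> \<longleftrightarrow> norm (z - z0) < r"
    using assms by (metis abs_norm_cancel abs_of_pos power2_less_imp_less power_strict_mono norm_ge_zero less_imp_le zero_less_numeral)
  finally show ?thesis by (auto simp: bump_def psi_def dist_norm norm_minus_commute)
qed

lemma bump_eq_0: "r > 0 \<Longrightarrow> z \<notin> ball z0 r \<Longrightarrow> bump r z0 z = 0"
  using bump_pos_iff[of r z0 z] bump_nonneg[of r z0 z] by linarith

section \<open>Holomorphic functions of several variables\<close>

lemma norm_complex_scale: "norm (a *s v) = norm a * norm (v :: complex ^ 'n::finite)"
  by (simp add: norm_vec_def norm_mult L2_set_right_distrib)

lemma bounded_linear_scale_vec: "bounded_linear (\<lambda>a. a *s (v :: complex ^ 'n::finite))"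
  by (rule bounded_linear_intro[where K = "norm v"])
    (auto simp: norm_complex_scale vec_eq_iff algebra_simps)

text \<open>Transition maps are assumed to be complex differentiable and nothing more. Their
  smoothness, and the symmetry of their second derivatives, must be obtained from Cauchy's
  formula.\<close>

definition chol :: "(complex ^ 'n::finite) set \<Rightarrow> (complex ^ 'n \<Rightarrow> complex) \<Rightarrow> bool" where
  "chol S f \<longleftrightarrow> (\<forall>z\<in>S. \<exists>f'. (f has_derivative f') (at z) \<and> (\<forall>a v. f' (a *s v) = a * f' v))"

abbreviation "fd f z \<equiv> frechet_derivative f (at z)"

lemma chol_fd:
  assumes "chol S f" "z \<in> S"
  shows "(f has_derivative fd f z) (at z)" "fd f z (a *s v) = a * fd f z v"
proof -
  obtain f' where f': "(f has_derivative f') (at z)" "\<forall>a v. f' (a *s v) = a * f' v"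
    using assms by (auto simp: chol_def)
  then have "fd f z = f'" using frechet_derivative_at by metis
  then show "(f has_derivative fd f z) (at z)" "fd f z (a *s v) = a * fd f z v" using f' by auto
qed

lemma holomorphic_map_on_chol: "holomorphic_map_on S F \<Longrightarrow> chol S (\<lambda>z. F z $ k)"
  unfolding holomorphic_map_on_def chol_def
proof (intro ballI)
  fix z assume "\<forall>z\<in>S. \<exists>f'. (F has_derivative f') (at z) \<and> (\<forall>a v. f' (a *s v) = a *s f' v)" "z \<in> S"
  then obtain f' where "(F has_derivative f') (at z)" "\<forall>a v. f' (a *s v) = a *s f' v" by blast
  then show "\<exists>f'. ((\<lambda>z. F z $ k) has_derivative f') (at z) \<and> (\<forall>a v. f' (a *s v) = a * f' v)"
    by (intro exI[of _ "\<lambda>v. f' v $ k"])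
      (auto intro: bounded_linear.has_derivative[OF bounded_linear_vec_nth])
qed

text \<open>Restriction to the complex line through \<open>z\<close> in the direction
  \<open>v\<close> reduces this to one variable. On the circle \<open>c\<close> the measure of
  Cauchy's formula for the derivative is \<open>2 * pi * \<i> * dt / c t\<close>. The derivative is
  thus an average of values of f, so it inherits the regularity of f.\<close>

lemma chol_Cauchy:
  fixes f :: "complex ^ 'n::finite \<Rightarrow> complex"
  assumes "chol S f" "r > 0" "\<And>\<zeta>. norm \<zeta> \<le> r \<Longrightarrow> z + \<zeta> *s v \<in> S"
  defines "c \<equiv> \<lambda>t::real. of_real r * exp (2 * of_real pi * \<i> * of_real t)"
  shows "fd f z v = integral (cbox 0 1) (\<lambda>t. f (z + c t *s v) / c t)"
proof -
  let ?\<phi> = "\<lambda>\<zeta>. f (z + \<zeta> *s v)"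
  have der: "(?\<phi> has_field_derivative fd f (z + \<zeta> *s v) v) (at \<zeta>)" if "norm \<zeta> \<le> r" for \<zeta>
  proof -
    have "((\<lambda>\<zeta>. z + \<zeta> *s v) has_derivative (\<lambda>h. h *s v)) (at \<zeta>)"
      using has_derivative_add[OF has_derivative_const[of z] bounded_linear.has_derivative[OF bounded_linear_scale_vec[of v] has_derivative_ident]]
      by simp
    from has_derivative_compose[OF this chol_fd(1)[OF assms(1) assms(3)[OF that]]]
    have "(?\<phi> has_derivative (\<lambda>h. fd f (z + \<zeta> *s v) (h *s v))) (at \<zeta>)" .
    then show ?thesis
      unfolding has_field_derivative_def chol_fd(2)[OF assms(1) assms(3)[OF that]] by (simp add: mult_commute_abs)
  qed
  have hol: "?\<phi> holomorphic_on cball 0 r"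
    unfolding holomorphic_on_def field_differentiable_def
    by (intro ballI exI, rule has_field_derivative_at_within, rule der) simp
  then have "?\<phi> holomorphic_on ball 0 r" "continuous_on (cball 0 r) ?\<phi>"
    using holomorphic_on_subset ball_subset_cball holomorphic_on_imp_continuous_on by blast+
  then have "(?\<phi> has_field_derivative (1 / (2 * of_real pi * \<i>) * contour_integral (circlepath 0 r) (\<lambda>u. ?\<phi> u / (u-0)^2))) (at 0)"
    using assms(2) by (intro Cauchy_derivative_integral_circlepath) auto
  moreover have "(?\<phi> has_field_derivative fd f z v) (at 0)"
    using der[of 0] assms(2) by simp
  ultimately have "fd f z v = 1 / (2 * of_real pi * \<i>) * contour_integral (circlepath 0 r) (\<lambda>u. ?\<phi> u / (u-0)^2)"
    using DERIV_unique by blast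
  also have "\<dots> = 1 / (2 * of_real pi * \<i>) * integral {0..1} (\<lambda>t. (2 * of_real pi * \<i>) * (?\<phi> (c t) / c t))"
  proof -
    have "?\<phi> (circlepath 0 r t) / (circlepath 0 r t - 0)\<^sup>2 * vector_derivative (circlepath 0 r) (at t)
      = (2 * of_real pi * \<i>) * (?\<phi> (c t) / c t)" for t
    proof -
      have "vector_derivative (circlepath 0 r) (at t) = (2 * of_real pi * \<i>) * c t" "circlepath 0 r t = c t"
        by (simp add: vector_derivative_circlepath c_def, simp add: circlepath c_def)
      moreover have "c t \<noteq> 0" using assms(2) by (simp add: c_def)
      ultimately show ?thesis by (simp add: power2_eq_square)
    qed
    then show ?thesis unfolding contour_integral_integral by presburger
  qed
  also have "\<dots> = integral (cbox 0 1) (\<lambda>t. ?\<phi> (c t) / c t)"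
    by (simp only: integral_mult_right) (simp add: cbox_interval)
  finally show ?thesis .
qed

lemma chol_deriv_local:
  fixes f :: "complex ^ 'n::finite \<Rightarrow> complex"
  assumes "chol S f" "open S" "z0 \<in> S"
  obtains r U where "r > 0" "open U" "convex U" "z0 \<in> U" "U \<subseteq> S"
    "\<And>z \<zeta>. z \<in> U \<Longrightarrow> norm \<zeta> \<le> r \<Longrightarrow> z + \<zeta> *s v \<in> S"
proof -
  obtain \<rho> where \<rho>: "\<rho> > 0" "ball z0 \<rho> \<subseteq> S" using assms(2,3) open_contains_ball by blast
  \<comment> \<open>One half of \<rho> is left for moving \<open>z\<close>, the other for the circle
    around it; the \<open>+ 1\<close> covers \<open>v = 0\<close>.\<close>
  define r where "r = \<rho> / (2 * (norm v + 1))"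
  have r: "r > 0" using \<rho> by (simp add: r_def add_nonneg_pos)
  have rv: "r * norm v \<le> \<rho> / 2"
  proof -
    have "norm v / (norm v + 1) \<le> 1" by (simp add: divide_le_eq_1 add_nonneg_pos)
    from mult_left_mono[OF this, of "\<rho> / 2"] show ?thesis using \<rho>(1) by (simp add: r_def)
  qed
  show thesis
  proof (rule that[of r "ball z0 (\<rho>/2)"])
    fix z and \<zeta> :: complex assume "z \<in> ball z0 (\<rho>/2)" "norm \<zeta> \<le> r"
    then have "norm (\<zeta> *s v) \<le> \<rho> / 2"
      using rv mult_right_mono[of "norm \<zeta>" r "norm v"] by (simp add: norm_complex_scale)
    then have "dist z0 (z + \<zeta> *s v) < \<rho>"
      using \<open>z \<in> ball z0 (\<rho>/2)\<close> dist_triangle[of z0 "z + \<zeta> *s v" z] by (simp add: dist_norm)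
    then show "z + \<zeta> *s v \<in> S" using \<rho>(2) by auto
  qed (use r \<rho> in auto)
qed

text \<open>Needed before any second derivative exists: differentiating under Cauchy's integral asks
  for a jointly continuous derivative of the integrand.\<close>

lemma chol_fd_continuous:
  fixes f :: "complex ^ 'n::finite \<Rightarrow> complex"
  assumes "chol S f" "open S"
  shows "continuous_on S (\<lambda>z. fd f z v)"
proof (rule continuous_at_imp_continuous_on, rule ballI)
  fix z0 assume "z0 \<in> S"
  from chol_deriv_local[OF assms this, of v] obtain r U where rU: "r > 0" "open U" "convex U" "z0 \<in> U" "U \<subseteq> S"
    "\<And>z \<zeta>. z \<in> U \<Longrightarrow> norm \<zeta> \<le> r \<Longrightarrow> z + \<zeta> *s v \<in> S" by metis
  define c where "c = (\<lambda>t::real. of_real r * exp (2 * of_real pi * \<i> * of_real t))"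
  have c: "norm (c t) = r" "c t \<noteq> 0" for t using rU(1) by (simp_all add: c_def norm_mult)
  have cf: "continuous_on S f"
    using chol_fd(1)[OF assms(1)] by (meson continuous_at_imp_continuous_on has_derivative_continuous)
  have cc: "continuous_on X c" for X unfolding c_def by (intro continuous_intros)
  have cs: "continuous_on (U \<times> cbox 0 1) (\<lambda>x. c (snd x) *s v)"
    using bounded_linear.continuous_on[OF bounded_linear_scale_vec continuous_on_compose2[OF cc[of UNIV] continuous_on_snd[OF continuous_on_id]]] by auto
  have "continuous_on (U \<times> cbox 0 1) (\<lambda>(z, t). f (z + c t *s v) / c t)"
    unfolding case_prod_beta
    by (intro continuous_on_divide continuous_on_compose2[OF cf] continuous_on_add continuous_on_fst
        continuous_on_id cs continuous_on_compose2[OF cc[of UNIV] continuous_on_snd])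
      (auto simp: c intro!: rU(6))
  then have "continuous_on U (\<lambda>z. integral (cbox 0 1) (\<lambda>t. f (z + c t *s v) / c t))"
    by (rule integral_continuous_on_param)
  moreover have "fd f z v = integral (cbox 0 1) (\<lambda>t. f (z + c t *s v) / c t)" if "z \<in> U" for z
    unfolding c_def by (rule chol_Cauchy[OF assms(1) rU(1)]) (use rU(6)[OF that] in auto)
  ultimately have "continuous_on U (\<lambda>z. fd f z v)" by simp
  then show "isCont (\<lambda>z. fd f z v) z0"
    using rU(2,4) continuous_on_eq_continuous_at by blast
qed

text \<open>Leibniz' rule for Cauchy's integral over a convex neighbourhood with a common radius.
  The integrand is differentiated as a bounded linear map, so \<open>F\<close> packages the
  derivatives as such.\<close>

lemma chol_fd_derivative:
  fixes f :: "complex ^ 'n::finite \<Rightarrow> complex"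
  assumes "chol S f" "open S" "z0 \<in> S"
  obtains r where "r > 0" "\<And>\<zeta>. norm \<zeta> \<le> r \<Longrightarrow> z0 + \<zeta> *s v \<in> S"
    "((\<lambda>z. fd f z v) has_derivative (\<lambda>w. integral (cbox 0 1) (\<lambda>t.
       fd f (z0 + (of_real r * exp (2 * of_real pi * \<i> * of_real t)) *s v) w
         / (of_real r * exp (2 * of_real pi * \<i> * of_real t))))) (at z0)"
proof -
  from chol_deriv_local[OF assms, of v] obtain r U where rU: "r > 0" "open U" "convex U" "z0 \<in> U" "U \<subseteq> S"
    "\<And>z \<zeta>. z \<in> U \<Longrightarrow> norm \<zeta> \<le> r \<Longrightarrow> z + \<zeta> *s v \<in> S" by metis
  define c where "c = (\<lambda>t::real. of_real r * exp (2 * of_real pi * \<i> * of_real t))"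
  have c: "norm (c t) = r" "c t \<noteq> 0" for t using rU(1) by (simp_all add: c_def norm_mult)
  have cS: "z + c t *s v \<in> S" if "z \<in> U" for z t using rU(6)[OF that] by (simp add: c)
  define F where "F = (\<lambda>z t. Blinfun (\<lambda>w. fd f (z + c t *s v) w / c t))"
  have bl: "bounded_linear (\<lambda>w. fd f (z + c t *s v) w / c t)" if "z \<in> U" for z t
    using bounded_linear_compose[OF bounded_linear_divide has_derivative_bounded_linear[OF chol_fd(1)[OF assms(1) cS[OF that]]]] .
  have F: "blinfun_apply (F z t) w = fd f (z + c t *s v) w / c t" if "z \<in> U" for z t w
    unfolding F_def using bounded_linear_Blinfun_apply[OF bl[OF that]] by simp
  have cc: "continuous_on X c" for X unfolding c_def by (intro continuous_intros)
  have cs: "continuous_on (U \<times> cbox 0 1) (\<lambda>x. c (snd x) *s v)"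
    using bounded_linear.continuous_on[OF bounded_linear_scale_vec continuous_on_compose2[OF cc[of UNIV] continuous_on_snd[OF continuous_on_id]]] by auto
  have cs1: "continuous_on (cbox 0 1) (\<lambda>x. c x *s v)"
    by (intro bounded_linear.continuous_on[OF bounded_linear_scale_vec] cc)
  have cf: "continuous_on S f"
    using chol_fd(1)[OF assms(1)] by (meson continuous_at_imp_continuous_on has_derivative_continuous)
  have int: "(\<lambda>t. f (z + c t *s v) / c t) integrable_on cbox 0 1" if "z \<in> U" for z
    by (intro integrable_continuous continuous_on_divide continuous_on_compose2[OF cf] continuous_on_add
        continuous_on_const cs1 cc) (auto simp: c intro!: cS that)
  have contF: "continuous_on (U \<times> cbox 0 1) (\<lambda>(z, t). F z t)"
  proof (rule continuous_on_blinfun_componentwise)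
    fix i :: "complex ^ 'n" assume "i \<in> Basis"
    have "continuous_on (U \<times> cbox 0 1) (\<lambda>x. fd f (fst x + c (snd x) *s v) i / c (snd x))"
      by (intro continuous_on_divide continuous_on_compose2[OF chol_fd_continuous[OF assms(1,2)]] continuous_on_add continuous_on_fst
          continuous_on_id cs continuous_on_compose2[OF cc[of UNIV] continuous_on_snd]) (auto simp: c intro!: cS)
    then show "continuous_on (U \<times> cbox 0 1) (\<lambda>x. blinfun_apply (case x of (z, t) \<Rightarrow> F z t) i)"
      by (rule continuous_on_eq) (auto simp: F)
  qed
  have "((\<lambda>z. integral (cbox 0 1) (\<lambda>t. f (z + c t *s v) / c t)) has_derivative
      blinfun_apply (integral (cbox 0 1) (F z0))) (at z0 within U)"
  proof (rule leibniz_rule[OF _ int contF rU(4,3)])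
    fix z and t :: real assume "z \<in> U"
    have "((\<lambda>z. z + c t *s v) has_derivative (\<lambda>h. h)) (at z within U)"
      by (auto intro!: derivative_eq_intros)
    from has_derivative_compose[OF this chol_fd(1)[OF assms(1) cS[OF \<open>z \<in> U\<close>]]]
    have "((\<lambda>z. f (z + c t *s v)) has_derivative fd f (z + c t *s v)) (at z within U)" .
    from bounded_linear.has_derivative[OF bounded_linear_divide[of "c t"] this]
    show "((\<lambda>z. f (z + c t *s v) / c t) has_derivative blinfun_apply (F z t)) (at z within U)"
      unfolding F[OF \<open>z \<in> U\<close>, abs_def] .
  qed
  then have "((\<lambda>z. integral (cbox 0 1) (\<lambda>t. f (z + c t *s v) / c t)) has_derivative
      blinfun_apply (integral (cbox 0 1) (F z0))) (at z0)"
    unfolding at_within_open[OF rU(4,2)] .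
  moreover have "fd f z v = integral (cbox 0 1) (\<lambda>t. f (z + c t *s v) / c t)" if "z \<in> U" for z
    unfolding c_def by (rule chol_Cauchy[OF assms(1) rU(1)]) (use rU(6)[OF that] in auto)
  ultimately have d: "((\<lambda>z. fd f z v) has_derivative blinfun_apply (integral (cbox 0 1) (F z0))) (at z0)"
    by (elim has_derivative_transform_within_open[OF _ rU(2,4)]) simp
  have "F z0 integrable_on cbox 0 1"
  proof (rule integrable_continuous)
    have "continuous_on (cbox 0 1) ((\<lambda>(z, t). F z t) \<circ> (\<lambda>t. (z0, t)))"
      by (rule continuous_on_compose[OF _ continuous_on_subset[OF contF]])
        (use rU(4) in \<open>auto intro!: continuous_intros\<close>)
    then show "continuous_on (cbox 0 1) (F z0)" by (simp add: o_def)
  qed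
  then have "blinfun_apply (integral (cbox 0 1) (F z0)) = (\<lambda>w. integral (cbox 0 1) (\<lambda>t. fd f (z0 + c t *s v) w / c t))"
    by (simp add: blinfun_apply_integral F rU(4) fun_eq_iff)
  with d show thesis
    by (intro that[of r]) (use rU(1) rU(6)[OF rU(4)] in \<open>auto simp: c_def\<close>)
qed

lemma chol_fd_chol:
  assumes "chol S f" "open S"
  shows "chol S (\<lambda>z. fd f z v)"
  unfolding chol_def
proof
  fix z0 assume z0: "z0 \<in> S"
  obtain r where r: "r > 0" "\<And>\<zeta>. norm \<zeta> \<le> r \<Longrightarrow> z0 + \<zeta> *s v \<in> S"
    "((\<lambda>z. fd f z v) has_derivative (\<lambda>w. integral (cbox 0 1) (\<lambda>t.
       fd f (z0 + (of_real r * exp (2 * of_real pi * \<i> * of_real t)) *s v) w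
         / (of_real r * exp (2 * of_real pi * \<i> * of_real t))))) (at z0)"
    by (rule chol_fd_derivative[OF assms z0, of v]) (rule that)
  have inS: "z0 + (of_real r * exp (2 * of_real pi * \<i> * of_real t)) *s v \<in> S" for t
    using r(1) by (intro r(2)) (simp add: norm_mult)
  show "\<exists>f'. ((\<lambda>z. fd f z v) has_derivative f') (at z0) \<and> (\<forall>a w. f' (a *s w) = a * f' w)"
    by (intro exI conjI, rule r(3)) (simp add: chol_fd(2)[OF assms(1) inS] times_divide_eq_right[symmetric] del: times_divide_eq_right)
qed

text \<open>The integral for the derivative along \<open>w\<close> of the derivative along
  \<open>v\<close> is at the same time Cauchy's formula, in direction \<open>v\<close>, for the
  holomorphic function \<open>\<lambda>z. fd f z w\<close>.\<close>

lemma chol_fd_commute: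
  assumes "chol S f" "open S" "z \<in> S"
  shows "fd (\<lambda>z. fd f z v) z w = fd (\<lambda>z. fd f z w) z v"
proof -
  obtain r where r: "r > 0" "\<And>\<zeta>. norm \<zeta> \<le> r \<Longrightarrow> z + \<zeta> *s v \<in> S"
    "((\<lambda>z. fd f z v) has_derivative (\<lambda>w. integral (cbox 0 1) (\<lambda>t.
       fd f (z + (of_real r * exp (2 * of_real pi * \<i> * of_real t)) *s v) w
         / (of_real r * exp (2 * of_real pi * \<i> * of_real t))))) (at z)"
    by (rule chol_fd_derivative[OF assms, of v]) (rule that)
  show ?thesis
    unfolding frechet_derivative_at[OF r(3), symmetric]
    by (rule chol_Cauchy[OF chol_fd_chol[OF assms(1,2), of w] r(1), symmetric]) (rule r(2))
qed

lemma chol_smooth: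
  assumes "chol S f" "open S"
  shows "smooth_on S f"
  using assms(1)
proof (rule smooth_on_coinduct[where P = "chol S"])
  show "\<exists>f'. (\<forall>z\<in>S. (f has_derivative f' z) (at z)) \<and> (\<forall>v. chol S (\<lambda>z. f' z v))" if "chol S f" for f
    by (intro exI[of _ "fd f"] conjI ballI allI chol_fd(1)[OF that] chol_fd_chol[OF that assms(2)])
qed (rule assms(2))

section \<open>Wirtinger derivatives\<close>

text \<open>The Wirtinger components of a real linear map, separated from differentiation so that
  product and chain rules become statements about linear maps.\<close>

fun wpart :: "'n + 'n \<Rightarrow> (complex ^ 'n::finite \<Rightarrow> complex) \<Rightarrow> complex" where
  "wpart (Inl j) D = (D (axis j 1) - \<i> * D (axis j \<i>)) / 2"
| "wpart (Inr j) D = (D (axis j 1) + \<i> * D (axis j \<i>)) / 2"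

lemma wirtinger_eq: "(f has_derivative D) (at z) \<Longrightarrow> wirtinger a f z = wpart a D"
  using frechet_derivative_at[of f D z] by (cases a) auto

lemma wirtinger_fd: "wirtinger a f z = wpart a (fd f z)"
  by (cases a) auto

lemma differentiable_fd: "f differentiable (at z) \<Longrightarrow> (f has_derivative fd f z) (at z)"
  using frechet_derivative_works by blast

lemma wirtinger_add:
  assumes "f differentiable (at z)" "g differentiable (at z)"
  shows "wirtinger a (\<lambda>w. f w + g w) z = wirtinger a f z + wirtinger a g z"
  using wirtinger_eq[OF has_derivative_add[OF assms[THEN differentiable_fd]]]
  by (cases a) (auto simp: field_simps)

lemma wirtinger_mult:
  assumes "f differentiable (at z)" "g differentiable (at z)"
  shows "wirtinger a (\<lambda>w. f w * g w) z = wirtinger a f z * g z + f z * wirtinger a g z"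
  using wirtinger_eq[OF has_derivative_mult[OF assms[THEN differentiable_fd]]]
  by (cases a) (auto simp: field_simps)

lemma wirtinger_const [simp]: "wirtinger a (\<lambda>_. c) z = 0"
  using wirtinger_eq[OF has_derivative_const, of a c] by (cases a) auto

lemma wirtinger_cmult: "f differentiable (at z) \<Longrightarrow> wirtinger a (\<lambda>w. c * f w) z = c * wirtinger a f z"
  using wirtinger_mult[of "\<lambda>_. c" z f a] by simp

lemma wirtinger_minus: "f differentiable (at z) \<Longrightarrow> wirtinger a (\<lambda>w. - f w) z = - wirtinger a f z"
  using wirtinger_cmult[of f z a "-1"] by simp

lemma wirtinger_diff:
  assumes "f differentiable (at z)" "g differentiable (at z)"
  shows "wirtinger a (\<lambda>w. f w - g w) z = wirtinger a f z - wirtinger a g z"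
  using wirtinger_add[OF assms(1) differentiable_minus[OF assms(2)], of a] wirtinger_minus[OF assms(2), of a] by simp

lemma wirtinger_sum:
  assumes "\<And>i. i \<in> I \<Longrightarrow> f i differentiable (at z)"
  shows "wirtinger a (\<lambda>w. \<Sum>i\<in>I. f i w) z = (\<Sum>i\<in>I. wirtinger a (f i) z)"
  using assms
  by (induction I rule: infinite_finite_induct) (auto simp: wirtinger_add differentiable_sum)

lemma wirtinger_cnj:
  assumes "f differentiable (at z)"
  shows "wirtinger a (\<lambda>w. cnj (f w)) z = cnj (wirtinger (flip a) f z)"
  using wirtinger_eq[OF bounded_linear.has_derivative[OF bounded_linear_cnj assms[THEN differentiable_fd]]]
  by (cases a) (auto simp: flip_def)

lemma wirtinger_cong:
  assumes "open S" "z \<in> S" "\<And>w. w \<in> S \<Longrightarrow> f w = g w" "f differentiable (at z)"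
  shows "wirtinger a f z = wirtinger a g z"
  using has_derivative_transform_within_open[OF differentiable_fd[OF assms(4)] assms(1,2,3)]
  by (simp add: wirtinger_eq[of g "fd f z" z] wirtinger_fd[of _ f])

lemma smooth_on_wirtinger: "open S \<Longrightarrow> smooth_on S f \<Longrightarrow> smooth_on S (wirtinger a f)"
proof -
  assume S: "open S" "smooth_on S f"
  have "smooth_on S (\<lambda>z. (fd f z (axis j 1) + c * fd f z (axis j \<i>)) * (1/2))" for j c
    by (intro smooth_on_add smooth_on_mult smooth_on_const S smooth_on_deriv)
  from this[of _ "- \<i>"] this[of _ \<i>] show ?thesis
    by (cases a) (simp_all add: wirtinger.simps[abs_def])
qed

lemma axis_expansion: "(\<Sum>k\<in>UNIV. Re (v $ k) *\<^sub>R axis k 1 + Im (v $ k) *\<^sub>R axis k \<i>) = (v :: complex ^ 'n::finite)"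
proof (rule vec_eq_iff[THEN iffD2], rule allI)
  fix i
  have "(\<Sum>k\<in>UNIV. Re (v $ k) *\<^sub>R axis k 1 + Im (v $ k) *\<^sub>R axis k \<i>) $ i
      = (\<Sum>k\<in>UNIV. if k = i then v $ k else 0)"
    unfolding sum_component by (intro sum.cong refl) (auto simp: axis_def complex_eq_iff)
  then show "(\<Sum>k\<in>UNIV. Re (v $ k) *\<^sub>R axis k 1 + Im (v $ k) *\<^sub>R axis k \<i>) $ i = v $ i" by simp
qed

lemma linear_wpart:
  assumes "linear D"
  shows "D v = (\<Sum>b\<in>UNIV. coord b v * wpart b (D :: complex ^ 'n::finite \<Rightarrow> complex))"
proof -
  have "D v = D (\<Sum>k\<in>UNIV. Re (v $ k) *\<^sub>R axis k 1 + Im (v $ k) *\<^sub>R axis k \<i>)"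
    unfolding axis_expansion ..
  also have "\<dots> = (\<Sum>k\<in>UNIV. Re (v $ k) *\<^sub>R D (axis k 1) + Im (v $ k) *\<^sub>R D (axis k \<i>))"
    by (simp add: linear_sum[OF assms] linear_add[OF assms] linear_scale[OF assms])
  also have "\<dots> = (\<Sum>k\<in>UNIV. v $ k * wpart (Inl k) D + cnj (v $ k) * wpart (Inr k) D)"
    by (intro sum.cong refl) (simp add: complex_eq_iff scaleR_conv_of_real field_simps)
  finally show ?thesis by (simp add: sum_UNIV_sum sum.distrib)
qed

lemma bounded_linear_coord: "bounded_linear (coord b)"
proof (cases b)
  case (Inl k) then show ?thesis using bounded_linear_vec_nth[of k] by (simp add: coord.simps[abs_def])
next
  case (Inr k) then show ?thesis
    using bounded_linear_compose[OF bounded_linear_cnj bounded_linear_vec_nth[of k]] by (simp add: coord.simps[abs_def])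
qed

lemma wirtinger_chain:
  fixes F :: "complex ^ 'n::finite \<Rightarrow> complex ^ 'm::finite"
  assumes "F differentiable (at z)" "f differentiable (at (F z))"
  shows "wirtinger a (\<lambda>w. f (F w)) z = (\<Sum>b\<in>UNIV. wirtinger a (\<lambda>w. coord b (F w)) z * wirtinger b f (F z))"
proof -
  let ?F' = "frechet_derivative F (at z)"
  have F: "(F has_derivative ?F') (at z)" using assms(1) frechet_derivative_works by blast
  have lin: "linear (fd f (F z))"
    using has_derivative_linear[OF differentiable_fd[OF assms(2)]] .
  have 1: "wirtinger a (\<lambda>w. coord b (F w)) z = wpart a (\<lambda>v. coord b (?F' v))" for b
    by (rule wirtinger_eq, rule bounded_linear.has_derivative[OF bounded_linear_coord F])
  have 2: "wirtinger a (\<lambda>w. f (F w)) z = wpart a (\<lambda>v. fd f (F z) (?F' v))"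
    by (rule wirtinger_eq, rule has_derivative_compose[OF F differentiable_fd[OF assms(2)]])
  show ?thesis
    unfolding 1 2 wirtinger_fd[of _ f] linear_wpart[OF lin, of "?F' _"]
    by (cases a) (simp_all add: sum_distrib_left sum_divide_distrib sum_subtractf[symmetric] sum.distrib[symmetric]
        left_diff_distrib distrib_right mult.assoc)
qed

subsection \<open>Local forms\<close>

definition lsm :: "(complex ^ 'n::finite) set \<Rightarrow> (complex ^ 'n \<Rightarrow> 'n cform) \<Rightarrow> bool" where
  "lsm S U \<longleftrightarrow> (\<forall>as. smooth_on S (\<lambda>z. U z as))"

definition ldf :: "(complex ^ 'n::finite \<Rightarrow> 'n cform) \<Rightarrow> complex ^ 'n \<Rightarrow> bool" where
  "ldf U z \<longleftrightarrow> (\<forall>as. (\<lambda>w. U w as) differentiable (at z))"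

definition wd :: "'n + 'n \<Rightarrow> (complex ^ 'n::finite \<Rightarrow> 'n cform) \<Rightarrow> complex ^ 'n \<Rightarrow> 'n cform" where
  "wd a U z = (\<lambda>as. wirtinger a (\<lambda>w. U w as) z)"

text \<open>The predicate selects the directions of differentiation: \<open>isl\<close> gives
  \<partial>, its negation the conjugate operator.\<close>

definition ld :: "('n + 'n \<Rightarrow> bool) \<Rightarrow> (complex ^ 'n::finite \<Rightarrow> 'n cform) \<Rightarrow> complex ^ 'n \<Rightarrow> 'n cform" where
  "ld P U z as = (\<Sum>i\<in>{i. i < length as \<and> P (as ! i)}.
        (-1) ^ i * wirtinger (as ! i) (\<lambda>w. U w (take i as @ drop (Suc i) as)) z)"

lemma del_ld: "del u c z = ld isl (u c) z"
  and delbar_ld: "delbar u c z = ld (\<lambda>a. \<not> isl a) (u c) z"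
  by (auto simp: del_def delbar_def ld_def)

lemma cform_self_neg:
  assumes "x = - (x :: 'n cform)"
  shows "x = 0"
proof
  fix as
  have "x as = - x as" using fun_cong[OF assms, of as] by simp
  then have "2 * x as = 0" unfolding mult_2 by (metis add.right_inverse)
  then show "x as = 0 as" by simp
qed

lemma iot_ld: "iot a (ld P U z) = (if P a then wd a U z else 0) - ld P (\<lambda>w. iot a (U w)) z"
proof
  fix as
  have s: "{i. i < length (a # as) \<and> P ((a # as) ! i)} =
      (if P a then {0} else {}) \<union> Suc ` {i. i < length as \<and> P (as ! i)}"
    by (auto simp: image_iff less_Suc_eq_0_disj)
  have "iot a (ld P U z) as = (\<Sum>i\<in>(if P a then {0} else {}).
        (-1) ^ i * wirtinger ((a # as) ! i) (\<lambda>w. U w (take i (a # as) @ drop (Suc i) (a # as))) z)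
     + (\<Sum>i\<in>Suc ` {i. i < length as \<and> P (as ! i)}.
        (-1) ^ i * wirtinger ((a # as) ! i) (\<lambda>w. U w (take i (a # as) @ drop (Suc i) (a # as))) z)"
    unfolding iot_def ld_def s by (rule sum.union_disjoint) auto
  then show "iot a (ld P U z) as = ((if P a then wd a U z else 0) - ld P (\<lambda>w. iot a (U w)) z) as"
    by (simp add: sum.reindex wd_def ld_def iot_def sum_negf)
qed

lemma wd_iot: "wd a (\<lambda>w. iot b (U w)) z = iot b (wd a U z)"
  by (simp add: wd_def iot_def)

text \<open>Both sides obey the same recursion under contraction with the head of the list. The sum
  of \<open>ext a\<close> after the partial derivatives fits the operator calculus, unlike the
  alternating sum over omitted positions.\<close>

lemma ld_eq: "ld P U z = (\<Sum>a\<in>{a. P a}. ext a (wd a U z))"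
proof
  fix as show "ld P U z as = (\<Sum>a\<in>{a. P a}. ext a (wd a U z)) as"
  proof (induction as arbitrary: U)
    case Nil show ?case by (simp add: ld_def sum_fun_apply)
  next
    case (Cons c as)
    have "iot c (\<Sum>a\<in>{a. P a}. ext a (wd a U z)) = (if P c then wd c U z else 0)
        - (\<Sum>a\<in>{a. P a}. ext a (wd a (\<lambda>w. iot c (U w)) z))"
      by (simp add: iot_ext sum_subtractf wd_iot)
    then show ?case unfolding apply_Cons iot_ld by (simp add: Cons)
  qed
qed

lemma lsm_ldf: "lsm S U \<Longrightarrow> z \<in> S \<Longrightarrow> ldf U z"
  by (auto simp: lsm_def ldf_def intro: smooth_on_differentiable)

lemma ldf_iot: "ldf U z \<Longrightarrow> ldf (\<lambda>w. iot a (U w)) z"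
  by (auto simp: ldf_def iot_def)

lemma ldf_csc: "f differentiable (at z) \<Longrightarrow> ldf U z \<Longrightarrow> ldf (\<lambda>w. csc (f w) (U w)) z"
  by (auto simp: ldf_def csc_apply intro: differentiable_mult)

lemma ldf_sum: "(\<And>i. i \<in> I \<Longrightarrow> ldf (U i) z) \<Longrightarrow> ldf (\<lambda>w. \<Sum>i\<in>I. U i w) z"
  unfolding ldf_def sum_fun_apply
  by (cases "finite I") (auto intro: differentiable_sum)

lemma wd_add: "ldf U z \<Longrightarrow> ldf V z \<Longrightarrow> wd a (\<lambda>w. U w + V w) z = wd a U z + wd a V z"
  by (auto simp: wd_def ldf_def wirtinger_add fun_eq_iff)

lemma wd_csc: "f differentiable (at z) \<Longrightarrow> ldf U z \<Longrightarrow>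
    wd a (\<lambda>w. csc (f w) (U w)) z = csc (wirtinger a f z) (U z) + csc (f z) (wd a U z)"
  by (auto simp: wd_def ldf_def wirtinger_mult fun_eq_iff csc_apply)

lemma wd_sum: "(\<And>i. i \<in> I \<Longrightarrow> ldf (U i) z) \<Longrightarrow> wd a (\<lambda>w. \<Sum>i\<in>I. U i w) z = (\<Sum>i\<in>I. wd a (U i) z)"
  by (auto simp: wd_def ldf_def sum_fun_apply wirtinger_sum fun_eq_iff)

lemma ldf_par: "ldf U z \<Longrightarrow> ldf (\<lambda>w. par (U w)) z"
  and wd_par: "ldf U z \<Longrightarrow> wd a (\<lambda>w. par (U w)) z = par (wd a U z)"
  by (auto simp: ldf_def par_def wd_def wirtinger_cmult intro: differentiable_mult)

lemma ldf_cconj: "ldf U z \<Longrightarrow> ldf (\<lambda>w. cconj (U w)) z"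
  unfolding ldf_def cconj_def differentiable_def
  using bounded_linear.has_derivative[OF bounded_linear_cnj] by blast

lemma wd_cconj: "ldf U z \<Longrightarrow> wd a (\<lambda>w. cconj (U w)) z = cconj (wd (flip a) U z)"
  by (auto simp: ldf_def cconj_def wd_def wirtinger_cnj)

lemma ldf_wd_cwedge:
  "ldf U z \<Longrightarrow> ldf V z \<Longrightarrow> (\<lambda>w. cwedge (U w) (V w) as) differentiable (at z) \<and>
    wirtinger a (\<lambda>w. cwedge (U w) (V w) as) z = (cwedge (wd a U z) (V z) + cwedge (U z) (wd a V z)) as"
proof (induction as arbitrary: U V)
  case Nil
  then show ?case by (auto simp: ldf_def wirtinger_mult wd_def)
next
  case (Cons c as)
  have 1: "(\<lambda>w. cwedge (U w) (V w) (c # as)) =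
      (\<lambda>w. cwedge (iot c (U w)) (V w) as + cwedge (par (U w)) (iot c (V w)) as)"
    by (simp add: cwedge_Cons)
  note IH = Cons.IH[OF ldf_iot[OF Cons.prems(1), of c] Cons.prems(2)] Cons.IH[OF ldf_par[OF Cons.prems(1)] ldf_iot[OF Cons.prems(2), of c]]
  show ?case
    unfolding 1 apply_Cons iot_lin iot_cwedge
    using IH Cons.prems by (auto simp: wirtinger_add wd_iot wd_par iot_par)
qed

lemma wd_cwedge: "ldf U z \<Longrightarrow> ldf V z \<Longrightarrow> 
    wd a (\<lambda>w. cwedge (U w) (V w)) z = cwedge (wd a U z) (V z) + cwedge (U z) (wd a V z)"
  using ldf_wd_cwedge[of U z V _ a] by (auto simp: ldf_def wd_def[of _ "\<lambda>w. cwedge (U w) (V w)"])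

lemma ld_add: "ldf U z \<Longrightarrow> ldf V z \<Longrightarrow> ld P (\<lambda>w. U w + V w) z = ld P U z + ld P V z"
  by (simp add: ld_eq wd_add sum.distrib)

lemma ld_cwedge:
  assumes "ldf U z" "ldf V z"
  shows "ld P (\<lambda>w. cwedge (U w) (V w)) z = cwedge (ld P U z) (V z) + cwedge (par (U z)) (ld P V z)"
  using assms by (simp add: ld_eq wd_cwedge sum.distrib cwedge_ext_left cwedge_ext_right)

lemma ld_cconj: "ldf U z \<Longrightarrow> ld P (\<lambda>w. cconj (U w)) z = cconj (ld (\<lambda>a. P (flip a)) U z)"
proof -
  assume U: "ldf U z"
  have "(\<Sum>a\<in>{a. P a}. ext a (cconj (wd (flip a) U z))) = (\<Sum>a\<in>{a. P (flip a)}. ext (flip a) (cconj (wd a U z)))"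
    by (rule sum.reindex_bij_witness[of _ flip flip]) auto
  then show ?thesis using U by (simp add: ld_eq wd_cconj cconj_ext)
qed

lemma alternating_wd:
  assumes "\<And>w. w \<in> S \<Longrightarrow> alternating (U w)" "open S" "z \<in> S" "ldf U z"
  shows "alternating (wd a U z)"
  unfolding alternating_def wd_def
proof (intro allI)
  fix as b c bs
  have "U w (as @ b # c # bs) = - U w (as @ c # b # bs)" if "w \<in> S" for w
    using assms(1)[OF that] unfolding alternating_def by blast
  moreover have "(\<lambda>w. U w (as @ b # c # bs)) differentiable (at z)"
    using assms(4) unfolding ldf_def by blast
  ultimately have "wirtinger a (\<lambda>w. U w (as @ b # c # bs)) z = wirtinger a (\<lambda>w. - U w (as @ c # b # bs)) z"
    by (rule wirtinger_cong[OF assms(2,3)])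
  then show "wirtinger a (\<lambda>w. U w (as @ b # c # bs)) z = - wirtinger a (\<lambda>w. U w (as @ c # b # bs)) z"
    using assms(4) by (simp add: wirtinger_minus ldf_def)
qed

lemma alternating_ld:
  assumes "\<And>w. w \<in> S \<Longrightarrow> alternating (U w)" "open S" "z \<in> S" "ldf U z"
  shows "alternating (ld P U z)"
  unfolding ld_eq by (intro alternating_sum alternating_ext alternating_wd[OF assms])

lemma wd_cong:
  assumes "open S" "z \<in> S" "\<And>w. w \<in> S \<Longrightarrow> U w = V w" "ldf U z"
  shows "wd a U z = wd a V z"
proof -
  have "wirtinger a (\<lambda>w. U w as) z = wirtinger a (\<lambda>w. V w as) z" for as
    using assms(4) unfolding ldf_def by (intro wirtinger_cong[OF assms(1,2)]) (simp_all add: assms(3))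
  then show ?thesis by (simp add: wd_def)
qed

lemma ld_cong:
  assumes "open S" "z \<in> S" "\<And>w. w \<in> S \<Longrightarrow> U w = V w" "ldf U z"
  shows "ld P U z = ld P V z"
  unfolding ld_eq using wd_cong[OF assms] by simp

subsection \<open>Behaviour under holomorphic coordinate changes\<close>

definition jac :: "(complex ^ 'n::finite \<Rightarrow> complex ^ 'n) \<Rightarrow> complex ^ 'n \<Rightarrow> 'n + 'n \<Rightarrow> 'n + 'n \<Rightarrow> complex" where
  "jac F z a b = wirtinger a (\<lambda>w. coord b (F w)) z"

lemma wirtinger_chol:
  assumes "chol S f" "z \<in> S"
  shows "wirtinger (Inl j) f z = fd f z (axis j 1)" "wirtinger (Inr j) f z = 0"
proof -
  have "axis j \<i> = \<i> *s axis j (1::complex)" by (simp add: axis_def vec_eq_iff)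
  then have "fd f z (axis j \<i>) = \<i> * fd f z (axis j 1)" using chol_fd(2)[OF assms] by simp
  then show "wirtinger (Inl j) f z = fd f z (axis j 1)" "wirtinger (Inr j) f z = 0" by simp_all
qed

locale hol_change =
  fixes S :: "(complex ^ 'n::finite) set" and F :: "complex ^ 'n \<Rightarrow> complex ^ 'n"
  assumes open_S: "open S" and hol_F: "holomorphic_map_on S F"
begin

lemma chol_F: "chol S (\<lambda>z. F z $ k)"
  using holomorphic_map_on_chol[OF hol_F] .

lemma smooth_coord: "smooth_on S (\<lambda>z. coord b (F z))"
  by (cases b) (auto intro!: smooth_on_cnj chol_smooth[OF chol_F] open_S)

lemma F_differentiable: "z \<in> S \<Longrightarrow> F differentiable (at z)"
  using hol_F unfolding holomorphic_map_on_def differentiable_def by blast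

lemma smooth_jac: "smooth_on S (\<lambda>z. jac F z a b)"
  unfolding jac_def[abs_def] by (intro smooth_on_wirtinger[OF open_S] smooth_coord)

lemma smooth_F: "smooth_on S F"
proof -
  have e: "(\<Sum>k\<in>UNIV. Re (F z $ k) *\<^sub>R axis k 1 + Im (F z $ k) *\<^sub>R axis k \<i>) = F z" for z
    by (rule axis_expansion)
  have "smooth_on S (\<lambda>z. \<Sum>k\<in>UNIV. Re (F z $ k) *\<^sub>R axis k 1 + Im (F z $ k) *\<^sub>R axis k \<i>)"
    by (intro smooth_on_sum smooth_on_add smooth_on_scaleR smooth_on_const open_S smooth_on_Re
        smooth_on_linear[OF bounded_linear_Im] chol_smooth[OF chol_F])
  then show ?thesis unfolding e .
qed

lemma jac_simps:
  assumes "z \<in> S"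
  shows "jac F z (Inl j) (Inl k) = fd (\<lambda>z. F z $ k) z (axis j 1)"
    "jac F z (Inr j) (Inr k) = cnj (fd (\<lambda>z. F z $ k) z (axis j 1))"
    "jac F z (Inl j) (Inr k) = 0" "jac F z (Inr j) (Inl k) = 0"
proof -
  have d: "(\<lambda>z. F z $ k) differentiable (at z)"
    using chol_fd(1)[OF chol_F assms] differentiable_def by blast
  show "jac F z (Inl j) (Inl k) = fd (\<lambda>z. F z $ k) z (axis j 1)"
    "jac F z (Inr j) (Inr k) = cnj (fd (\<lambda>z. F z $ k) z (axis j 1))"
    "jac F z (Inl j) (Inr k) = 0" "jac F z (Inr j) (Inl k) = 0"
    using wirtinger_chol[OF chol_F assms] wirtinger_cnj[OF d]
    by (simp_all add: jac_def del: wirtinger.simps)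
qed

lemma jac_block: "z \<in> S \<Longrightarrow> blockJ (jac F z)"
  unfolding blockJ_def
proof (intro allI impI)
  fix a b :: "'n + 'n" assume "z \<in> S" "isl a \<noteq> isl b"
  then show "jac F z a b = 0" by (cases a; cases b) (auto simp: jac_simps)
qed

lemma jac_flip: "z \<in> S \<Longrightarrow> jac F z (flip a) (flip b) = cnj (jac F z a b)"
  by (cases a; cases b) (auto simp: jac_simps)

lemma jac_deriv:
  assumes "z \<in> S"
  shows "wirtinger a (\<lambda>w. jac F w c b) z = wirtinger c (\<lambda>w. jac F w a b) z"
    "isl a \<noteq> isl c \<Longrightarrow> wirtinger a (\<lambda>w. jac F w c b) z = 0"
proof -
  let ?f = "\<lambda>j k w. fd (\<lambda>z. F z $ k) w (axis j 1)"
  have ch: "chol S (?f j k)" for j k by (rule chol_fd_chol[OF chol_F open_S])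
  have df: "?f j k differentiable (at z)" for j k
    using chol_fd(1)[OF ch assms] differentiable_def by blast
  have sm: "(\<lambda>w. jac F w c b) differentiable (at z)" for c b
    using smooth_on_differentiable[OF smooth_jac assms] .
  have ll: "wirtinger a (\<lambda>w. jac F w (Inl j) (Inl k)) z = wirtinger a (?f j k) z" for a j k
    by (rule wirtinger_cong[OF open_S assms _ sm]) (simp add: jac_simps)
  have rr: "wirtinger a (\<lambda>w. jac F w (Inr j) (Inr k)) z = cnj (wirtinger (flip a) (?f j k) z)" for a j k
    by (subst wirtinger_cnj[OF df, symmetric], rule wirtinger_cong[OF open_S assms _ sm]) (simp add: jac_simps)
  have lr: "wirtinger a (\<lambda>w. jac F w (Inl j) (Inr k)) z = 0" "wirtinger a (\<lambda>w. jac F w (Inr j) (Inl k)) z = 0" for a j k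
    by (subst wirtinger_const[of a 0 z, symmetric], rule wirtinger_cong[OF open_S assms _ sm], simp add: jac_simps)+
  note all = ll rr lr wirtinger_chol[OF ch assms] flip_simps
  show "wirtinger a (\<lambda>w. jac F w c b) z = wirtinger c (\<lambda>w. jac F w a b) z"
    using chol_fd_commute[OF chol_F open_S assms]
    by (cases a; cases b; cases c) (simp_all add: all del: wirtinger.simps)
  show "isl a \<noteq> isl c \<Longrightarrow> wirtinger a (\<lambda>w. jac F w c b) z = 0"
    by (cases a; cases b; cases c) (simp_all add: all del: wirtinger.simps)
qed

text \<open>The first sum collects the second derivatives of F. It is written with
  \<open>ext c\<close> in front so that, under a further \<open>ext a\<close>, it becomes the
  contraction of a symmetric with an antisymmetric expression.\<close>

lemma ldf_wd_pull:
  assumes z: "z \<in> S"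
  shows "ldf U (F z) \<Longrightarrow> alternating (U (F z)) \<Longrightarrow> (\<lambda>w. pull (jac F w) (U (F w)) as) differentiable (at z) \<and>
    wirtinger a (\<lambda>w. pull (jac F w) (U (F w)) as) z =
     ((\<Sum>c\<in>UNIV. \<Sum>b\<in>UNIV. csc (wirtinger a (\<lambda>w. jac F w c b) z) (ext c (pull (jac F z) (iot b (U (F z))))))
      + (\<Sum>b\<in>UNIV. csc (jac F z a b) (pull (jac F z) (wd b U (F z))))) as"
proof (induction as arbitrary: U)
  case Nil
  have d: "(\<lambda>w. U w []) differentiable (at (F z))" using Nil by (simp add: ldf_def)
  have "(\<lambda>w. U (F w) []) differentiable (at z)"
    using differentiable_chain_at[OF F_differentiable[OF z] d] by (simp add: o_def)
  moreover have "wirtinger a (\<lambda>w. U (F w) []) z = (\<Sum>b\<in>UNIV. jac F z a b * wd b U (F z) [])"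
    unfolding wirtinger_chain[OF F_differentiable[OF z] d] by (simp add: jac_def wd_def)
  ultimately show ?case by (simp add: sum_fun_apply csc_apply)
next
  case (Cons c as)
  let ?J = "jac F z" and ?D = "\<lambda>a c b. wirtinger a (\<lambda>w. jac F w c b) z" and ?u = "U (F z)"
  have 1: "(\<lambda>w. pull (jac F w) (U (F w)) (c # as)) = (\<lambda>w. \<Sum>b\<in>UNIV. jac F w c b * pull (jac F w) (iot b (U (F w))) as)"
    by (simp add: apply_Cons iot_pull sum_fun_apply csc_apply)
  have dj: "(\<lambda>w. jac F w c b) differentiable (at z)" for c b
    using smooth_on_differentiable[OF smooth_jac z] .
  have IH: "(\<lambda>w. pull (jac F w) (iot b (U (F w))) as) differentiable (at z)"
    "wirtinger a (\<lambda>w. pull (jac F w) (iot b (U (F w))) as) z =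
     ((\<Sum>c\<in>UNIV. \<Sum>d\<in>UNIV. csc (?D a c d) (ext c (pull ?J (iot d (iot b ?u)))))
      + (\<Sum>d\<in>UNIV. csc (?J a d) (pull ?J (iot b (wd d U (F z)))))) as" for b
    using Cons.IH[OF ldf_iot[OF Cons.prems(1), of b] alternating_iot[OF Cons.prems(2)]] by (simp_all add: wd_iot)
  have rhs: "iot c ((\<Sum>c\<in>UNIV. \<Sum>b\<in>UNIV. csc (?D a c b) (ext c (pull ?J (iot b ?u))))
      + (\<Sum>b\<in>UNIV. csc (?J a b) (pull ?J (wd b U (F z)))))
    = (\<Sum>b\<in>UNIV. csc (?D a c b) (pull ?J (iot b ?u)) + csc (?J c b)
       ((\<Sum>c\<in>UNIV. \<Sum>d\<in>UNIV. csc (?D a c d) (ext c (pull ?J (iot d (iot b ?u)))))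
        + (\<Sum>d\<in>UNIV. csc (?J a d) (pull ?J (iot b (wd d U (F z)))))))"
  proof -
    have A: "(\<Sum>c'\<in>UNIV. \<Sum>b\<in>UNIV. iot c (csc (?D a c' b) (ext c' (pull ?J (iot b ?u)))))
      = (\<Sum>b\<in>UNIV. csc (?D a c b) (pull ?J (iot b ?u)))
       + (\<Sum>b\<in>UNIV. csc (?J c b) (\<Sum>c\<in>UNIV. \<Sum>d\<in>UNIV. csc (?D a c d) (ext c (pull ?J (iot d (iot b ?u))))))"
    proof -
      have "(\<Sum>c'\<in>UNIV. \<Sum>b\<in>UNIV. iot c (csc (?D a c' b) (ext c' (pull ?J (iot b ?u)))))
        = (\<Sum>c'\<in>UNIV. \<Sum>b\<in>UNIV. if c = c' then csc (?D a c' b) (pull ?J (iot b ?u)) else 0)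
        + (\<Sum>c'\<in>UNIV. \<Sum>b\<in>UNIV. \<Sum>d\<in>UNIV. csc (?J c d * ?D a c' b) (ext c' (pull ?J (iot b (iot d ?u)))))"
        unfolding sum.distrib[symmetric]
      proof (intro sum.cong[OF refl])
        fix c' b
        have "iot c (csc (?D a c' b) (ext c' (pull ?J (iot b ?u))))
          = (if c = c' then csc (?D a c' b) (pull ?J (iot b ?u)) else 0)
            - (\<Sum>d\<in>UNIV. csc (?J c d * ?D a c' b) (ext c' (pull ?J (iot d (iot b ?u)))))"
          by (simp add: iot_ext csc_diff iot_pull csc_sum mult.commute)
        \<comment> \<open>This sign from exchanging contractions compensates the one from passing
          \<open>ext c'\<close>.\<close>
        also have "(\<Sum>d\<in>UNIV. csc (?J c d * ?D a c' b) (ext c' (pull ?J (iot d (iot b ?u)))))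
          = - (\<Sum>d\<in>UNIV. csc (?J c d * ?D a c' b) (ext c' (pull ?J (iot b (iot d ?u)))))"
          unfolding sum_negf[symmetric]
          by (intro sum.cong refl, subst iot_iot[OF Cons.prems(2)]) (simp add: csc_minus csc_minus1)
        finally show "iot c (csc (?D a c' b) (ext c' (pull ?J (iot b ?u))))
          = (if c = c' then csc (?D a c' b) (pull ?J (iot b ?u)) else 0)
            + (\<Sum>d\<in>UNIV. csc (?J c d * ?D a c' b) (ext c' (pull ?J (iot b (iot d ?u)))))"
          by (simp only: diff_minus_eq_add)
      qed
      also have "(\<Sum>c'\<in>UNIV. \<Sum>b\<in>UNIV. \<Sum>d\<in>UNIV. csc (?J c d * ?D a c' b) (ext c' (pull ?J (iot b (iot d ?u)))))
        = (\<Sum>d\<in>UNIV. \<Sum>c'\<in>UNIV. \<Sum>b\<in>UNIV. csc (?J c d * ?D a c' b) (ext c' (pull ?J (iot b (iot d ?u)))))"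
        by (rule sum3_rot)
      also have "(\<Sum>c'\<in>UNIV. \<Sum>b\<in>UNIV. if c = c' then csc (?D a c' b) (pull ?J (iot b ?u)) else 0)
        = (\<Sum>b\<in>UNIV. csc (?D a c b) (pull ?J (iot b ?u)))"
        by (simp add: sum_if_const)
      also have "(\<Sum>d\<in>UNIV. \<Sum>c'\<in>UNIV. \<Sum>b\<in>UNIV. csc (?J c d * ?D a c' b) (ext c' (pull ?J (iot b (iot d ?u)))))
        = (\<Sum>b\<in>UNIV. csc (?J c b) (\<Sum>c\<in>UNIV. \<Sum>d\<in>UNIV. csc (?D a c d) (ext c (pull ?J (iot d (iot b ?u))))))"
        by (simp add: csc_sum)
      finally show ?thesis .
    qed
    have B: "(\<Sum>b\<in>UNIV. csc (?J a b) (iot c (pull ?J (wd b U (F z)))))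
      = (\<Sum>b\<in>UNIV. csc (?J c b) (\<Sum>d\<in>UNIV. csc (?J a d) (pull ?J (iot b (wd d U (F z))))))"
      by (simp add: iot_pull csc_sum mult.commute) (rule sum.swap)
    show ?thesis using A B by (simp add: csc_add sum.distrib)
  qed
  have "wirtinger a (\<lambda>w. pull (jac F w) (U (F w)) (c # as)) z =
     (\<Sum>b\<in>UNIV. ?D a c b * pull ?J (iot b ?u) as + ?J c b * wirtinger a (\<lambda>w. pull (jac F w) (iot b (U (F w))) as) z)"
    unfolding 1 using dj IH(1) by (simp add: wirtinger_sum wirtinger_mult)
  moreover have "(\<lambda>w. pull (jac F w) (U (F w)) (c # as)) differentiable (at z)"
    unfolding 1 using dj IH(1) by (intro differentiable_sum ballI differentiable_mult) auto
  ultimately show ?case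
    unfolding apply_Cons rhs IH(2) by (simp add: sum_fun_apply csc_apply)
qed

text \<open>The second derivatives of F are symmetric while \<open>ext a\<close> and
  \<open>ext c\<close> anticommute, so their contribution equals its own negative. For \<partial>
  and its conjugate separately one also needs that mixed second derivatives vanish and that the
  Jacobian respects types.\<close>

lemma ld_pull:
  assumes "z \<in> S" "ldf U (F z)" "alternating (U (F z))" "P = isl \<or> P = (\<lambda>a. \<not> isl a)"
  shows "ld P (\<lambda>w. pull (jac F w) (U (F w))) z = pull (jac F z) (ld P U (F z))"
proof -
  let ?J = "jac F z" and ?D = "\<lambda>a c b. wirtinger a (\<lambda>w. jac F w c b) z" and ?u = "U (F z)"
  have w: "wd a (\<lambda>w. pull (jac F w) (U (F w))) z =
      (\<Sum>c\<in>UNIV. \<Sum>b\<in>UNIV. csc (?D a c b) (ext c (pull ?J (iot b ?u))))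
      + (\<Sum>b\<in>UNIV. csc (?J a b) (pull ?J (wd b U (F z))))" for a
    using ldf_wd_pull[OF assms(1-3)] by (auto simp: wd_def[of _ "\<lambda>w. pull (jac F w) (U (F w))"])
  let ?T = "\<lambda>a c. (\<Sum>b\<in>UNIV. csc (?D a c b) (ext a (ext c (pull ?J (iot b ?u)))))"
  have anti: "?T a c = - ?T c a" for a c
    unfolding sum_negf[symmetric]
    by (intro sum.cong refl) (simp only: jac_deriv(1)[OF assms(1), of a c] ext_ext[of a c] csc_minus csc_minus1)
  have mixed: "?T a c = 0" if "P a" "\<not> P c" for a c
    using jac_deriv(2)[OF assms(1), of a c] that assms(4) by auto
  have s0: "(\<Sum>a\<in>{a. P a}. \<Sum>c\<in>UNIV. ?T a c) = 0"
  proof -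
    have e1: "(\<Sum>a\<in>{a. P a}. \<Sum>c\<in>UNIV. ?T a c) = (\<Sum>a\<in>{a. P a}. \<Sum>c\<in>{a. P a}. ?T a c)"
      by (rule sum.cong[OF refl], rule sum.mono_neutral_right) (auto simp: mixed)
    have e2: "(\<Sum>a\<in>{a. P a}. \<Sum>c\<in>{a. P a}. ?T a c) = - (\<Sum>a\<in>{a. P a}. \<Sum>c\<in>{a. P a}. ?T c a)"
      unfolding sum_negf[symmetric] by (rule sum.cong[OF refl], rule sum.cong[OF refl]) (unfold sum_negf, rule anti)
    have e3: "(\<Sum>a\<in>{a. P a}. \<Sum>c\<in>{a. P a}. ?T c a) = (\<Sum>a\<in>{a. P a}. \<Sum>c\<in>{a. P a}. ?T a c)"
      by (rule sum.swap)
    show ?thesis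
      unfolding e1 by (rule cform_self_neg) (rule e2[unfolded e3])
  qed
  have "ld P (\<lambda>w. pull (jac F w) (U (F w))) z =
      (\<Sum>a\<in>{a. P a}. \<Sum>c\<in>UNIV. ?T a c) + (\<Sum>a\<in>{a. P a}. \<Sum>b\<in>UNIV. csc (?J a b) (ext a (pull ?J (wd b U (F z)))))"
    unfolding ld_eq w by (simp add: sum.distrib)
  also have "\<dots> = (\<Sum>b\<in>UNIV. \<Sum>a\<in>{a. P a}. csc (?J a b) (ext a (pull ?J (wd b U (F z)))))"
    unfolding s0 by (simp add: sum.swap[of _ UNIV])
  also have "\<dots> = (\<Sum>b\<in>{b. P b}. \<Sum>a\<in>UNIV. csc (?J a b) (ext a (pull ?J (wd b U (F z)))))"
  proof -
    have z1: "?J a b = 0" if "P a \<noteq> P b" for a b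
      using jac_block[OF assms(1)] that assms(4) by (auto simp: blockJ_def)
    have "(\<Sum>b\<in>UNIV. \<Sum>a\<in>{a. P a}. csc (?J a b) (ext a (pull ?J (wd b U (F z)))))
       = (\<Sum>b\<in>{b. P b}. \<Sum>a\<in>{a. P a}. csc (?J a b) (ext a (pull ?J (wd b U (F z)))))"
      by (rule sum.mono_neutral_right) (auto simp: z1 intro!: sum.neutral)
    also have "\<dots> = (\<Sum>b\<in>{b. P b}. \<Sum>a\<in>UNIV. csc (?J a b) (ext a (pull ?J (wd b U (F z)))))"
      by (intro sum.cong refl sum.mono_neutral_left) (auto simp: z1)
    finally show ?thesis .
  qed
  also have "\<dots> = pull ?J (ld P U (F z))"
    by (simp add: ld_eq pull_ext)
  finally show ?thesis .
qed

end

section \<open>The divergence formula\<close>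

lemma wirtinger_prod:
  assumes "finite I" "\<And>i. i \<in> I \<Longrightarrow> f i differentiable (at z)"
  shows "wirtinger a (\<lambda>w. \<Prod>i\<in>I. f i w) z = (\<Sum>i\<in>I. wirtinger a (f i) z * (\<Prod>j\<in>I - {i}. f j z)) \<and>
     (\<lambda>w. \<Prod>i\<in>I. f i w) differentiable (at z)"
  using assms
proof (induction I rule: finite_induct)
  case (insert x I)
  have 1: "insert x I - {i} = insert x (I - {i})" if "i \<in> I" for i using insert(2) that by auto
  have "(\<Sum>i\<in>insert x I. wirtinger a (f i) z * (\<Prod>j\<in>insert x I - {i}. f j z))
    = wirtinger a (f x) z * (\<Prod>j\<in>I. f j z) + f x z * (\<Sum>i\<in>I. wirtinger a (f i) z * (\<Prod>j\<in>I - {i}. f j z))"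
    using insert(1,2) by (simp add: 1 sum_distrib_left mult_ac)
  then show ?case using insert by (simp add: wirtinger_mult)
qed simp

lemma smooth_on_det:
  fixes m :: "'v::real_normed_vector \<Rightarrow> complex ^ 'n::finite ^ 'n"
  assumes "open S" "\<And>i j. smooth_on S (\<lambda>z. m z $ i $ j)"
  shows "smooth_on S (\<lambda>z. det (m z))"
  unfolding det_def
  by (intro smooth_on_sum smooth_on_mult smooth_on_const smooth_on_prod assms)

lemma matrix_inv_det:
  fixes A :: "complex ^ 'n::finite ^ 'n"
  assumes "det A \<noteq> 0"
  shows "A ** matrix_inv A = mat 1" "matrix_inv A ** A = mat 1"
proof -
  have "\<exists>A'. A ** A' = mat 1 \<and> A' ** A = mat 1"
    using assms invertible_det_nz[of A] unfolding invertible_def by blast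
  from someI_ex[OF this] show "A ** matrix_inv A = mat 1" "matrix_inv A ** A = mat 1"
    unfolding matrix_inv_def by blast+
qed

locale lmetric =
  fixes S :: "(complex ^ 'n::finite) set" and h :: "complex ^ 'n \<Rightarrow> complex ^ 'n ^ 'n"
  assumes open_S: "open S" and smooth_h: "\<And>i j. smooth_on S (\<lambda>z. h z $ i $ j)"
    and herm_h: "\<And>z i j. z \<in> S \<Longrightarrow> cnj (h z $ i $ j) = h z $ j $ i"
    and det_h: "\<And>z. z \<in> S \<Longrightarrow> det (h z) \<noteq> 0"
begin

definition g :: "complex ^ 'n \<Rightarrow> complex ^ 'n ^ 'n" where "g z = matrix_inv (h z)"

lemma h_g: "z \<in> S \<Longrightarrow> h z ** g z = mat 1" "z \<in> S \<Longrightarrow> g z ** h z = mat 1"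
  using det_h matrix_inv_det unfolding g_def by blast+

lemma herm_g:
  assumes z: "z \<in> S"
  shows "cnj (g z $ i $ j) = g z $ j $ i"
proof -
  let ?gH = "\<chi> i j. cnj (g z $ j $ i)"
  have "(h z ** ?gH) $ i $ j = cnj ((g z ** h z) $ j $ i)" for i j
    by (simp add: matrix_matrix_mult_def herm_h[OF z] mult.commute)
  then have "h z ** ?gH = mat 1"
    unfolding h_g[OF z] by (simp add: vec_eq_iff mat_def)
  then have "g z ** (h z ** ?gH) = g z" by simp
  then have "?gH = g z" unfolding matrix_mul_assoc h_g[OF z] by simp
  then have "?gH $ j $ i = g z $ j $ i" by simp
  then show ?thesis by simp
qed

lemma hmetric: "z \<in> S \<Longrightarrow> hmetric (h z) (g z)"
  using h_g herm_h herm_g by unfold_locales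

text \<open>By Cramer's rule the entries of the inverse are quotients of determinants in the entries
  of h.\<close>

lemma smooth_g: "smooth_on S (\<lambda>z. g z $ k $ j)"
proof -
  let ?m = "\<lambda>z. \<chi> i l. if l = k then axis j 1 $ i else h z $ i $ l"
  have "?m z $ i $ l = (if l = k then axis j 1 $ i else h z $ i $ l)" for z i l by simp
  have sm: "smooth_on S (\<lambda>z. ?m z $ i $ l)" for i l
    using smooth_h[of i l] by (cases "l = k") (auto intro: smooth_on_const open_S)
  have "smooth_on S (\<lambda>z. det (?m z) / det (h z))"
    by (intro smooth_on_divide smooth_on_det open_S sm smooth_h det_h)
  moreover have "det (?m z) / det (h z) = g z $ k $ j" if "z \<in> S" for z
  proof -
    have "h z *v column j (g z) = axis j 1"
      using h_g(1)[OF that]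
      by (simp add: vec_eq_iff matrix_vector_mult_def matrix_matrix_mult_def column_def mat_def axis_def)
    then have "column j (g z) = (\<chi> k. det (\<chi> i l. if l = k then axis j 1 $ i else h z $ i $ l) / det (h z))"
      using cramer[OF det_h[OF that]] by blast
    then show ?thesis by (simp add: column_def vec_eq_iff)
  qed
  ultimately show ?thesis by (rule smooth_on_cong[OF open_S])
qed

lemma dg: "z \<in> S \<Longrightarrow> (\<lambda>z. g z $ i $ j) differentiable (at z)"
  and dh: "z \<in> S \<Longrightarrow> (\<lambda>z. h z $ i $ j) differentiable (at z)"
  using smooth_on_differentiable smooth_g smooth_h by blast+

definition th :: "'n + 'n \<Rightarrow> complex ^ 'n \<Rightarrow> complex ^ 'n ^ 'n" where
  "th a z = (\<chi> p q. wirtinger a (\<lambda>w. h w $ p $ q) z)"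

text \<open>Differentiate \<open>g ** h = mat 1\<close> entrywise and multiply by g from the
  right.\<close>

lemma wirtinger_g:
  assumes z: "z \<in> S"
  shows "wirtinger a (\<lambda>w. g w $ i $ k) z = (- (g z ** th a z ** g z)) $ i $ k"
proof -
  define dgm where "dgm = (\<chi> i k. wirtinger a (\<lambda>w. g w $ i $ k) z)"
  have "(dgm ** h z + g z ** th a z) $ i $ k = 0" for i k
  proof -
    have "wirtinger a (\<lambda>w. \<Sum>j\<in>UNIV. g w $ i $ j * h w $ j $ k) z = wirtinger a (\<lambda>w. if i = k then 1 else 0) z"
    proof (rule wirtinger_cong[OF open_S z])
      fix w assume "w \<in> S"
      have "(g w ** h w) $ i $ k = (\<Sum>j\<in>UNIV. g w $ i $ j * h w $ j $ k)"
        by (simp add: matrix_matrix_mult_def)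
      then show "(\<Sum>j\<in>UNIV. g w $ i $ j * h w $ j $ k) = (if i = k then 1 else 0)"
        by (simp add: h_g[OF \<open>w \<in> S\<close>] mat_def)
    qed (use dg dh z in \<open>auto intro!: differentiable_sum differentiable_mult\<close>)
    then have "(\<Sum>j\<in>UNIV. wirtinger a (\<lambda>w. g w $ i $ j) z * h z $ j $ k + g z $ i $ j * wirtinger a (\<lambda>w. h w $ j $ k) z) = 0"
      using dg[OF z] dh[OF z] by (simp add: wirtinger_sum wirtinger_mult del: wirtinger.simps)
    then show ?thesis
      by (simp add: dgm_def th_def matrix_matrix_mult_def sum.distrib)
  qed
  then have "dgm ** h z + g z ** th a z = 0" by (simp add: vec_eq_iff)
  then have "(dgm ** h z + g z ** th a z) ** g z = 0"
    by (simp add: vec_eq_iff matrix_matrix_mult_def)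
  moreover have add_mult: "(A + B) ** C = A ** C + B ** C" for A B C :: "complex ^ 'n ^ 'n"
    by (simp add: vec_eq_iff matrix_matrix_mult_def distrib_right sum.distrib)
  ultimately have "dgm ** h z ** g z + g z ** th a z ** g z = 0" by simp
  then have "dgm + g z ** th a z ** g z = 0"
    by (simp add: matrix_mul_assoc[symmetric] h_g[OF z])
  then have "dgm = - (g z ** th a z ** g z)" by (simp add: eq_neg_iff_add_eq_0)
  from arg_cong[OF this, of "\<lambda>m. m $ i $ k"] show ?thesis by (simp add: dgm_def)
qed

lemma wirtinger_det:
  assumes z: "z \<in> S"
  shows "wirtinger a (\<lambda>w. det (h w)) z = det (h z) * (\<Sum>p\<in>UNIV. \<Sum>q\<in>UNIV. g z $ q $ p * th a z $ p $ q)"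
proof -
  \<comment> \<open>The differentiated row is a combination of the rows of h, with the coefficients
    in row k of \<open>th a z ** g z\<close>; only the multiple of row k itself survives in the
    determinant.\<close>
  have rw: "det (\<chi> i. if i = k then row k (th a z) else row i (h z)) = (th a z ** g z) $ k $ k * det (h z)" for k
  proof -
    let ?x = "\<chi> i. (th a z ** g z) $ k $ i"
    have "((th a z ** g z) ** h z) $ k = th a z $ k"
      by (simp add: matrix_mul_assoc[symmetric] h_g[OF z])
    then have "row k (th a z) = (\<Sum>i\<in>UNIV. ?x $ i *s row i (h z))"
      by (simp add: row_def vec_eq_iff sum_component matrix_matrix_mult_def[of "th a z ** g z"])
    then show ?thesis using cramer_lemma_transpose[of k ?x "h z"] by (simp only:) simp
  qed
  have "wirtinger a (\<lambda>w. det (h w)) z = (\<Sum>p | p permutes UNIV. of_int (sign p) *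
      (\<Sum>k\<in>UNIV. th a z $ k $ p k * (\<Prod>j\<in>UNIV - {k}. h z $ j $ p j)))"
    unfolding det_def using wirtinger_prod[of UNIV "\<lambda>i w. h w $ i $ _ i" z a] dh[OF z]
    by (simp add: wirtinger_sum wirtinger_cmult th_def del: wirtinger.simps)
  also have "\<dots> = (\<Sum>k\<in>UNIV. \<Sum>p | p permutes UNIV. of_int (sign p) *
       (th a z $ k $ p k * (\<Prod>j\<in>UNIV - {k}. h z $ j $ p j)))"
    by (subst sum.swap) (simp add: sum_distrib_left)
  also have "\<dots> = (\<Sum>k\<in>UNIV. det (\<chi> i. if i = k then row k (th a z) else row i (h z)))"
  proof (intro sum.cong refl)
    fix k
    have "(\<Prod>i\<in>UNIV. (\<chi> i. if i = k then row k (th a z) else row i (h z)) $ i $ p i)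
      = th a z $ k $ p k * (\<Prod>j\<in>UNIV - {k}. h z $ j $ p j)" for p
      by (subst prod.remove[of UNIV k]) (auto simp: row_def intro!: prod.cong)
    then show "(\<Sum>p | p permutes UNIV. of_int (sign p) * (th a z $ k $ p k * (\<Prod>j\<in>UNIV - {k}. h z $ j $ p j)))
      = det (\<chi> i. if i = k then row k (th a z) else row i (h z))"
      unfolding det_def by simp
  qed
  also have "\<dots> = det (h z) * (\<Sum>k\<in>UNIV. (th a z ** g z) $ k $ k)"
    unfolding rw by (simp add: sum_distrib_left mult.commute)
  finally show ?thesis
    by (simp add: matrix_matrix_mult_def mult.commute)
qed

lemma wirtinger_met:
  assumes z: "z \<in> S"
  shows "wirtinger a (\<lambda>w. met (g w) b c) z = met (- (g z ** th a z ** g z)) b c"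
    "(\<lambda>w. met (g w) b c) differentiable (at z)"
  by (cases b; cases c; simp add: wirtinger_g[OF z] del: wirtinger.simps)
    (cases b; cases c; simp add: dg[OF z])

lemma th_flip:
  assumes z: "z \<in> S"
  shows "th (Inr j) z $ p $ q = cnj (th (Inl j) z $ q $ p)"
proof -
  have "wirtinger (Inr j) (\<lambda>w. h w $ p $ q) z = wirtinger (Inr j) (\<lambda>w. cnj (h w $ q $ p)) z"
    by (rule wirtinger_cong[OF open_S z]) (use herm_h dh z in auto)
  then show ?thesis using wirtinger_cnj[OF dh[OF z]] by (simp add: th_def del: wirtinger.simps)
qed

text \<open>The metric occurs in k slots, and all of them contribute equally to the derivative. For
  k = 0 the factor \<open>of_nat k\<close> removes the term with the truncated \<open>k - 1\<close>.
  The direction is flipped on V because the product is antilinear there.\<close>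

lemma wirtinger_hk:
  assumes z: "z \<in> S"
  shows "ldf U z \<Longrightarrow> ldf V z \<Longrightarrow> alternating (U z) \<Longrightarrow> alternating (V z) \<Longrightarrow>
    (\<lambda>w. hk (met (g w)) k (U w) (V w)) differentiable (at z) \<and>
    wirtinger a (\<lambda>w. hk (met (g w)) k (U w) (V w)) z =
      hk (met (g z)) k (wd a U z) (V z) + hk (met (g z)) k (U z) (wd (flip a) V z)
      + of_nat k * (\<Sum>b\<in>UNIV. \<Sum>c\<in>UNIV. met (- (g z ** th a z ** g z)) b c * hk (met (g z)) (k - 1) (iot b (U z)) (iot c (V z)))"
proof (induction k arbitrary: U V)
  case 0
  have "(\<lambda>w. cnj (V w [])) differentiable (at z)" "(\<lambda>w. U w []) differentiable (at z)" "(\<lambda>w. V w []) differentiable (at z)"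
    using 0 ldf_cconj[OF 0(2)] by (auto simp: ldf_def cconj_def dest: spec[of _ "[]"])
  then show ?case by (simp add: wirtinger_mult wirtinger_cnj wd_def del: wirtinger.simps)
next
  case (Suc k)
  let ?G = "met (g z)" and ?D = "met (- (g z ** th a z ** g z))"
  have IH: "(\<lambda>w. hk (met (g w)) k (iot b (U w)) (iot c (V w))) differentiable (at z)"
    "wirtinger a (\<lambda>w. hk (met (g w)) k (iot b (U w)) (iot c (V w))) z =
      hk ?G k (iot b (wd a U z)) (iot c (V z)) + hk ?G k (iot b (U z)) (iot c (wd (flip a) V z))
      + of_nat k * (\<Sum>b'\<in>UNIV. \<Sum>c'\<in>UNIV. ?D b' c' * hk ?G (k - 1) (iot b' (iot b (U z))) (iot c' (iot c (V z))))" for b c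
    using Suc.IH[OF ldf_iot[OF Suc.prems(1)] ldf_iot[OF Suc.prems(2)] alternating_iot[OF Suc.prems(3)] alternating_iot[OF Suc.prems(4)]]
    by (simp_all add: wd_iot)
  have d1: "(\<lambda>w. met (g w) b c * hk (met (g w)) k (iot b (U w)) (iot c (V w))) differentiable (at z)" for b c
    using wirtinger_met(2)[OF z] IH(1) by (rule differentiable_mult)
  \<comment> \<open>A derivative in an inner slot is moved to the outer one by exchanging
    contractions in both arguments; the two signs cancel.\<close>
  have sw: "of_nat k * (\<Sum>b\<in>UNIV. \<Sum>c\<in>UNIV. ?G b c * (\<Sum>b'\<in>UNIV. \<Sum>c'\<in>UNIV. ?D b' c' * hk ?G (k - 1) (iot b' (iot b (U z))) (iot c' (iot c (V z)))))
     = of_nat k * (\<Sum>b\<in>UNIV. \<Sum>c\<in>UNIV. ?D b c * hk ?G k (iot b (U z)) (iot c (V z)))"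
  proof (cases k)
    case (Suc m)
    have mm: "hk ?G m (iot b' (iot b (U z))) (iot c' (iot c (V z))) = hk ?G m (iot b (iot b' (U z))) (iot c (iot c' (V z)))" for b b' c c'
      unfolding iot_iot[OF Suc.prems(3), of b' b] iot_iot[OF Suc.prems(4), of c' c]
      using hk_csc_left[of ?G m "-1"] hk_csc_right[of ?G m _ "-1"] by (simp add: csc_m1)
    have "(\<Sum>b\<in>UNIV. \<Sum>c\<in>UNIV. ?G b c * (\<Sum>b'\<in>UNIV. \<Sum>c'\<in>UNIV. ?D b' c' * hk ?G m (iot b' (iot b (U z))) (iot c' (iot c (V z)))))
      = (\<Sum>b\<in>UNIV. \<Sum>c\<in>UNIV. \<Sum>b'\<in>UNIV. \<Sum>c'\<in>UNIV. ?D b' c' * (?G b c * hk ?G m (iot b (iot b' (U z))) (iot c (iot c' (V z)))))"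
      by (simp add: sum_distrib_left mm mult_ac)
    also have "\<dots> = (\<Sum>b'\<in>UNIV. \<Sum>c'\<in>UNIV. \<Sum>b\<in>UNIV. \<Sum>c\<in>UNIV. ?D b' c' * (?G b c * hk ?G m (iot b (iot b' (U z))) (iot c (iot c' (V z)))))"
      by (subst sum3_rot) (rule sum.cong[OF refl], rule sum3_rot)
    also have "\<dots> = (\<Sum>b\<in>UNIV. \<Sum>c\<in>UNIV. ?D b c * hk ?G (Suc m) (iot b (U z)) (iot c (V z)))"
      by (simp add: hk.simps(2) sum_distrib_left)
    finally show ?thesis using Suc by simp
  qed simp
  have "wirtinger a (\<lambda>w. hk (met (g w)) (Suc k) (U w) (V w)) z = (\<Sum>b\<in>UNIV. \<Sum>c\<in>UNIV.
     ?D b c * hk ?G k (iot b (U z)) (iot c (V z)) + ?G b c * (hk ?G k (iot b (wd a U z)) (iot c (V z)) + hk ?G k (iot b (U z)) (iot c (wd (flip a) V z))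
      + of_nat k * (\<Sum>b'\<in>UNIV. \<Sum>c'\<in>UNIV. ?D b' c' * hk ?G (k - 1) (iot b' (iot b (U z))) (iot c' (iot c (V z))))))"
    unfolding hk.simps(2) using d1
    by (simp add: wirtinger_sum wirtinger_mult[OF wirtinger_met(2)[OF z] IH(1)] IH(2) wirtinger_met(1)[OF z] del: wirtinger.simps)
  also have "\<dots> = hk ?G (Suc k) (wd a U z) (V z) + hk ?G (Suc k) (U z) (wd (flip a) V z)
      + of_nat (Suc k) * (\<Sum>b\<in>UNIV. \<Sum>c\<in>UNIV. ?D b c * hk ?G k (iot b (U z)) (iot c (V z)))"
    using sw by (simp add: hk.simps(2) sum.distrib distrib_left distrib_right sum_distrib_left mult.left_commute[of "of_nat k"])
  finally show ?case using d1 unfolding hk.simps(2) by simp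
qed

lemma wirtinger_hin:
  assumes z: "z \<in> S" and UV: "ldf U z" "ldf V z" "alternating (U z)" "alternating (V z)"
  shows "(\<lambda>w. hin (met (g w)) (U w) (V w)) differentiable (at z)"
    "wirtinger a (\<lambda>w. hin (met (g w)) (U w) (V w)) z =
      hin (met (g z)) (wd a U z) (V z) + hin (met (g z)) (U z) (wd (flip a) V z)
      + (\<Sum>b\<in>UNIV. \<Sum>c\<in>UNIV. met (- (g z ** th a z ** g z)) b c * hin (met (g z)) (iot b (U z)) (iot c (V z)))"
proof -
  note hk = wirtinger_hk[OF z UV]
  let ?G = "met (g z)" and ?D = "met (- (g z ** th a z ** g z))"
  have d: "(\<lambda>w. 1 / fact k * hk (met (g w)) k (U w) (V w)) differentiable (at z)" for k
    using hk[of k] by simp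
  show "(\<lambda>w. hin (met (g w)) (U w) (V w)) differentiable (at z)"
    unfolding hin_def using d by (intro differentiable_sum ballI) auto
  define N where "N = 2 * CARD('n)"
  have N: "{..N} = insert 0 (Suc ` {..<N})"
    unfolding lessThan_Suc_atMost[symmetric] by (rule lessThan_Suc_eq_insert_0)
  have top: "hk ?G N (iot b (U z)) (iot c (V z)) = 0" for b c
    by (rule hk_zero_right) (auto simp: iot_def N_def intro!: alternating_long[OF UV(4)])
  have "(\<Sum>k\<le>N. 1 / fact k * (of_nat k * (\<Sum>b\<in>UNIV. \<Sum>c\<in>UNIV. ?D b c * hk ?G (k - 1) (iot b (U z)) (iot c (V z)))))
    = (\<Sum>k<N. 1 / fact k * (\<Sum>b\<in>UNIV. \<Sum>c\<in>UNIV. ?D b c * hk ?G k (iot b (U z)) (iot c (V z))))"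
    unfolding N by (subst sum.insert) (auto simp: sum.reindex fact_Suc simp del: of_nat_Suc)
  also have "\<dots> = (\<Sum>k\<le>N. 1 / fact k * (\<Sum>b\<in>UNIV. \<Sum>c\<in>UNIV. ?D b c * hk ?G k (iot b (U z)) (iot c (V z))))"
    by (simp add: lessThan_Suc_atMost[symmetric] top)
  also have "\<dots> = (\<Sum>b\<in>UNIV. \<Sum>c\<in>UNIV. ?D b c * hin ?G (iot b (U z)) (iot c (V z)))"
    unfolding hin_def N_def[symmetric] sum_distrib_left
    by (subst sum3_rot[symmetric]) (simp add: mult_ac)
  finally have s: "(\<Sum>k\<le>N. 1 / fact k * (of_nat k * (\<Sum>b\<in>UNIV. \<Sum>c\<in>UNIV. ?D b c * hk ?G (k - 1) (iot b (U z)) (iot c (V z)))))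
    = (\<Sum>b\<in>UNIV. \<Sum>c\<in>UNIV. ?D b c * hin ?G (iot b (U z)) (iot c (V z)))" .
  have "wirtinger a (\<lambda>w. hin (met (g w)) (U w) (V w)) z = (\<Sum>k\<le>N. 1 / fact k * (
      hk ?G k (wd a U z) (V z) + hk ?G k (U z) (wd (flip a) V z)
      + of_nat k * (\<Sum>b\<in>UNIV. \<Sum>c\<in>UNIV. ?D b c * hk ?G (k - 1) (iot b (U z)) (iot c (V z)))))"
    unfolding hin_def N_def[symmetric]
    by (subst wirtinger_sum[OF d], intro sum.cong refl, subst wirtinger_cmult) (use hk in auto)
  then show "wirtinger a (\<lambda>w. hin (met (g w)) (U w) (V w)) z =
      hin ?G (wd a U z) (V z) + hin ?G (U z) (wd (flip a) V z)
      + (\<Sum>b\<in>UNIV. \<Sum>c\<in>UNIV. ?D b c * hin ?G (iot b (U z)) (iot c (V z)))"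
    unfolding s[symmetric] by (simp add: hin_def N_def sum.distrib distrib_left)
qed

text \<open>Only the direction conjugate to the index is computed: in the divergence,
  \<open>est\<close> stands in the antilinear argument and is differentiated along
  \<open>Inl j\<close> outside.\<close>

lemma ldf_est:
  assumes z: "z \<in> S" and V: "ldf V z"
  shows "ldf (\<lambda>w. est (met (g w)) (Inl j) (V w)) z"
    "wd (Inr j) (\<lambda>w. est (met (g w)) (Inl j) (V w)) z = est (met (g z)) (Inl j) (wd (Inr j) V z)
      - (\<Sum>p\<in>UNIV. \<Sum>q\<in>UNIV. csc (g z $ j $ q * cnj (th (Inl j) z $ p $ q)) (est (met (g z)) (Inl p) (V z)))"
proof -
  interpret hmetric "h z" "g z" by (rule hmetric[OF z])
  have e: "est (met (g w)) (Inl j) (V w) = (\<Sum>k\<in>UNIV. csc (cnj (g w $ k $ j)) (iot (Inl k) (V w)))" for w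
    by (simp add: est_def sum_UNIV_sum)
  have dc: "(\<lambda>w. cnj (g w $ k $ j)) differentiable (at z)" for k
    using dg[OF z, of k j] unfolding differentiable_def by (metis bounded_linear.has_derivative[OF bounded_linear_cnj])
  show "ldf (\<lambda>w. est (met (g w)) (Inl j) (V w)) z"
    unfolding e by (intro ldf_sum ldf_csc dc ldf_iot V)
  have c: "wirtinger (Inr j) (\<lambda>w. cnj (g w $ k $ j)) z = - (\<Sum>p\<in>UNIV. \<Sum>q\<in>UNIV. g z $ j $ q * cnj (th (Inl j) z $ p $ q) * g z $ p $ k)" for k
  proof -
    have "wirtinger (Inr j) (\<lambda>w. cnj (g w $ k $ j)) z = cnj ((- (g z ** th (Inl j) z ** g z)) $ k $ j)"
      by (subst wirtinger_cnj[OF dg[OF z]]) (simp add: wirtinger_g[OF z] del: wirtinger.simps)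
    also have "\<dots> = - (\<Sum>q\<in>UNIV. \<Sum>p\<in>UNIV. g z $ j $ q * cnj (th (Inl j) z $ p $ q) * g z $ p $ k)"
      by (simp add: matrix_matrix_mult_def g_herm sum_distrib_right sum_distrib_left mult_ac)
    also have "\<dots> = - (\<Sum>p\<in>UNIV. \<Sum>q\<in>UNIV. g z $ j $ q * cnj (th (Inl j) z $ p $ q) * g z $ p $ k)"
      by (subst sum.swap) (rule refl)
    finally show ?thesis .
  qed
  have "wd (Inr j) (\<lambda>w. est (met (g w)) (Inl j) (V w)) z
     = (\<Sum>k\<in>UNIV. csc (wirtinger (Inr j) (\<lambda>w. cnj (g w $ k $ j)) z) (iot (Inl k) (V z)))
       + (\<Sum>k\<in>UNIV. csc (cnj (g z $ k $ j)) (iot (Inl k) (wd (Inr j) V z)))"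
    unfolding e
    by (subst wd_sum, intro ldf_csc dc ldf_iot V)
      (simp add: wd_csc[OF dc ldf_iot[OF V]] wd_iot sum.distrib del: wirtinger.simps)
  also have "(\<Sum>k\<in>UNIV. csc (wirtinger (Inr j) (\<lambda>w. cnj (g w $ k $ j)) z) (iot (Inl k) (V z)))
     = - (\<Sum>k\<in>UNIV. \<Sum>p\<in>UNIV. \<Sum>q\<in>UNIV. csc (g z $ j $ q * cnj (th (Inl j) z $ p $ q) * g z $ p $ k) (iot (Inl k) (V z)))"
    unfolding c by (simp add: csc_sum_left csc_minus1 sum_negf)
  also have "(\<Sum>k\<in>UNIV. \<Sum>p\<in>UNIV. \<Sum>q\<in>UNIV. csc (g z $ j $ q * cnj (th (Inl j) z $ p $ q) * g z $ p $ k) (iot (Inl k) (V z)))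
     = (\<Sum>p\<in>UNIV. \<Sum>q\<in>UNIV. csc (g z $ j $ q * cnj (th (Inl j) z $ p $ q)) (est (met (g z)) (Inl p) (V z)))"
    by (subst sum3_rot[symmetric]) (simp add: es_eq csc_sum)
  also have "- (\<Sum>p\<in>UNIV. \<Sum>q\<in>UNIV. csc (g z $ j $ q * cnj (th (Inl j) z $ p $ q)) (est (met (g z)) (Inl p) (V z)))
      + (\<Sum>k\<in>UNIV. csc (cnj (g z $ k $ j)) (iot (Inl k) (wd (Inr j) V z)))
    = est (met (g z)) (Inl j) (wd (Inr j) V z)
      - (\<Sum>p\<in>UNIV. \<Sum>q\<in>UNIV. csc (g z $ j $ q * cnj (th (Inl j) z $ p $ q)) (est (met (g z)) (Inl p) (V z)))"
    unfolding est_def[of _ "Inl j"] sum_UNIV_sum by simp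
  finally show "wd (Inr j) (\<lambda>w. est (met (g w)) (Inl j) (V w)) z = est (met (g z)) (Inl j) (wd (Inr j) V z)
      - (\<Sum>p\<in>UNIV. \<Sum>q\<in>UNIV. csc (g z $ j $ q * cnj (th (Inl j) z $ p $ q)) (est (met (g z)) (Inl p) (V z)))" .
qed

lemma ldf_lam:
  assumes z: "z \<in> S" and V: "ldf V z"
  shows "ldf (\<lambda>w. lam (g w) (V w)) z"
    "wd (Inr l) (\<lambda>w. lam (g w) (V w)) z = lam (g z) (wd (Inr l) V z)
      - csc \<i> (\<Sum>p\<in>UNIV. \<Sum>q\<in>UNIV. csc (cnj (th (Inl l) z $ p $ q)) (est (met (g z)) (Inl p) (est (met (g z)) (Inr q) (V z))))"
proof -
  interpret hmetric "h z" "g z" by (rule hmetric[OF z])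
  have di: "(\<lambda>w. \<i> * g w $ b $ k) differentiable (at z)" for b k
    using dg[OF z] by simp
  show "ldf (\<lambda>w. lam (g w) (V w)) z"
    unfolding lam_def by (intro ldf_sum ldf_csc di ldf_iot V)
  have c: "wirtinger (Inr l) (\<lambda>w. g w $ b $ k) z = - (\<Sum>p\<in>UNIV. \<Sum>q\<in>UNIV. g z $ b $ q * cnj (th (Inl l) z $ p $ q) * g z $ p $ k)" for b k
    unfolding wirtinger_g[OF z] by (simp add: matrix_matrix_mult_def sum_distrib_right th_flip[OF z])
  have "wd (Inr l) (\<lambda>w. lam (g w) (V w)) z = (\<Sum>k\<in>UNIV. \<Sum>b\<in>UNIV.
      csc (\<i> * wirtinger (Inr l) (\<lambda>w. g w $ b $ k) z) (iot (Inl k) (iot (Inr b) (V z)))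
      + csc (\<i> * g z $ b $ k) (iot (Inl k) (iot (Inr b) (wd (Inr l) V z))))"
    unfolding lam_def
    by (subst wd_sum, intro ldf_sum ldf_csc di ldf_iot V, rule sum.cong[OF refl],
        subst wd_sum, intro ldf_csc di ldf_iot V, rule sum.cong[OF refl])
      (simp add: wd_csc[OF di ldf_iot[OF ldf_iot[OF V]]] wd_iot wirtinger_cmult[OF dg[OF z]] del: wirtinger.simps)
  also have "\<dots> = (\<Sum>k\<in>UNIV. \<Sum>b\<in>UNIV. csc (\<i> * wirtinger (Inr l) (\<lambda>w. g w $ b $ k) z) (iot (Inl k) (iot (Inr b) (V z))))
      + lam (g z) (wd (Inr l) V z)"
    by (simp add: sum.distrib lam_def)
  also have "(\<Sum>k\<in>UNIV. \<Sum>b\<in>UNIV. csc (\<i> * wirtinger (Inr l) (\<lambda>w. g w $ b $ k) z) (iot (Inl k) (iot (Inr b) (V z))))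
     = - (\<Sum>k\<in>UNIV. \<Sum>b\<in>UNIV. \<Sum>p\<in>UNIV. \<Sum>q\<in>UNIV. csc (\<i> * (g z $ b $ q * cnj (th (Inl l) z $ p $ q) * g z $ p $ k)) (iot (Inl k) (iot (Inr b) (V z))))"
    unfolding c by (simp add: csc_sum_left csc_minus1 sum_negf sum_distrib_left)
  also have "(\<Sum>k\<in>UNIV. \<Sum>b\<in>UNIV. \<Sum>p\<in>UNIV. \<Sum>q\<in>UNIV. csc (\<i> * (g z $ b $ q * cnj (th (Inl l) z $ p $ q) * g z $ p $ k)) (iot (Inl k) (iot (Inr b) (V z))))
     = (\<Sum>p\<in>UNIV. \<Sum>q\<in>UNIV. \<Sum>k\<in>UNIV. \<Sum>b\<in>UNIV. csc (\<i> * (g z $ b $ q * cnj (th (Inl l) z $ p $ q) * g z $ p $ k)) (iot (Inl k) (iot (Inr b) (V z))))"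
    by (subst sum3_rot) (rule sum.cong[OF refl], rule sum3_rot)
  also have "\<dots> = csc \<i> (\<Sum>p\<in>UNIV. \<Sum>q\<in>UNIV. csc (cnj (th (Inl l) z $ p $ q)) (est (met (g z)) (Inl p) (est (met (g z)) (Inr q) (V z))))"
    by (simp add: es_eq ebs_eq csc_sum mult_ac) (rule sum.cong[OF refl], rule sum.cong[OF refl], rule sum.swap)
  also have "- csc \<i> (\<Sum>p\<in>UNIV. \<Sum>q\<in>UNIV. csc (cnj (th (Inl l) z $ p $ q)) (est (met (g z)) (Inl p) (est (met (g z)) (Inr q) (V z)))) + lam (g z) (wd (Inr l) V z) = lam (g z) (wd (Inr l) V z)
      - csc \<i> (\<Sum>p\<in>UNIV. \<Sum>q\<in>UNIV. csc (cnj (th (Inl l) z $ p $ q)) (est (met (g z)) (Inl p) (est (met (g z)) (Inr q) (V z))))"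
    by (rule uminus_add_conv_diff)
  finally show "wd (Inr l) (\<lambda>w. lam (g w) (V w)) z = lam (g z) (wd (Inr l) V z)
      - csc \<i> (\<Sum>p\<in>UNIV. \<Sum>q\<in>UNIV. csc (cnj (th (Inl l) z $ p $ q)) (est (met (g z)) (Inl p) (est (met (g z)) (Inr q) (V z))))" .
qed

text \<open>The left hand side is the divergence of a vector field, the density of the volume being \<open>det h\<close>.
  So the formula exhibits \<open>\<i>[\<Lambda>, \<partial>bar] - \<tau>\<^sup>\<star>\<close> as the formal adjoint of \<open>\<partial>\<close>.\<close>

lemma divergence:
  assumes z: "z \<in> S" and UV: "ldf U z" "ldf V z"
    and alt: "\<And>w. w \<in> S \<Longrightarrow> alternating (U w)" "\<And>w. w \<in> S \<Longrightarrow> alternating (V w)"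
  shows "(\<Sum>j\<in>UNIV. wirtinger (Inl j) (\<lambda>w. det (h w) * hin (met (g w)) (U w) (est (met (g w)) (Inl j) (V w))) z) =
    det (h z) * (hin (met (g z)) (ld isl U z) (V z)
      - hin (met (g z)) (U z) (csc \<i> (lam (g z) (ld (\<lambda>a. \<not> isl a) V z) - ld (\<lambda>a. \<not> isl a) (\<lambda>w. lam (g w) (V w)) z))
      + hin (met (g z)) (ocomm (lam (g z)) (tri (\<lambda>j p q. th (Inl j) z $ p $ q)) (U z)) (V z))"
proof -
  interpret hmetric "h z" "g z" by (rule hmetric[OF z])
  let ?u = "U z" and ?v = "V z" and ?t = "\<lambda>j p q. th (Inl j) z $ p $ q"
  have au: "alternating ?u" and av: "alternating ?v" using alt z by auto
  have awV: "alternating (wd a V z)" for a by (rule alternating_wd[OF alt(2) open_S z UV(2)])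
  have ev: "alternating (est (met (g w)) (Inl j) (V w))" if "w \<in> S" for w j using alt that by simp
  have ddet: "(\<lambda>w. det (h w)) differentiable (at z)"
    by (rule smooth_on_differentiable[OF smooth_on_det[OF open_S smooth_h] z])
  have hd: "(\<lambda>w. hin (met (g w)) (U w) (est (met (g w)) (Inl j) (V w))) differentiable (at z)" for j
    by (rule wirtinger_hin(1)[OF z UV(1) ldf_est(1)[OF z UV(2)] au ev[OF z]])
  \<comment> \<open>The terms with \<open>?t\<close> come, in this order, from \<open>det h\<close>,
    from the coefficients of \<open>est\<close>, and from the metric on forms. The remaining one,
    from \<Lambda>, enters with \<open>C\<close>.\<close>
  have tm: "wirtinger (Inl j) (\<lambda>w. det (h w) * hin (met (g w)) (U w) (est (met (g w)) (Inl j) (V w))) z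
    = det (h z) * (H (wd (Inl j) U z) (es j ?v) + H ?u (es j (wd (Inr j) V z))
       + (\<Sum>p\<in>UNIV. \<Sum>q\<in>UNIV. ?t j p q * (g z $ q $ p * H ?u (es j ?v) - g z $ q $ j * H ?u (es p ?v)
           - H (e p (es q ?u) + eb q (ebs p ?u)) (es j ?v))))" for j
  proof -
    have 1: "wirtinger (Inl j) (\<lambda>w. hin (met (g w)) (U w) (est (met (g w)) (Inl j) (V w))) z
      = H (wd (Inl j) U z) (es j ?v) + H ?u (es j (wd (Inr j) V z))
        - (\<Sum>p\<in>UNIV. \<Sum>q\<in>UNIV. ?t j p q * (g z $ q $ j * H ?u (es p ?v)))
        - (\<Sum>p\<in>UNIV. \<Sum>q\<in>UNIV. ?t j p q * H (e p (es q ?u) + eb q (ebs p ?u)) (es j ?v))"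
      unfolding wirtinger_hin(2)[OF z UV(1) ldf_est(1)[OF z UV(2)] au ev[OF z]]
        deriv_met[OF au alternating_est[OF av]] flip_simps ldf_est(2)[OF z UV(2)]
      by (simp add: hin_diff_right hin_sum_right hin_csc_right g_herm mult_ac)
    show ?thesis
      unfolding wirtinger_mult[OF ddet hd] 1 wirtinger_det[OF z]
      by (simp add: right_diff_distrib distrib_left sum_subtractf sum_distrib_left sum_distrib_right mult_ac)
  qed
  have lhs: "(\<Sum>j\<in>UNIV. wirtinger (Inl j) (\<lambda>w. det (h w) * hin (met (g w)) (U w) (est (met (g w)) (Inl j) (V w))) z)
    = det (h z) * ((\<Sum>j\<in>UNIV. H (wd (Inl j) U z) (es j ?v)) + (\<Sum>j\<in>UNIV. H ?u (es j (wd (Inr j) V z)))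
       + (\<Sum>j\<in>UNIV. \<Sum>p\<in>UNIV. \<Sum>q\<in>UNIV. ?t j p q * (g z $ q $ p * H ?u (es j ?v) - g z $ q $ j * H ?u (es p ?v)
           - H (e p (es q ?u) + eb q (ebs p ?u)) (es j ?v))))"
    unfolding tm sum_distrib_left[symmetric] sum.distrib ..
  have Pl: "(\<Sum>a\<in>{a. isl a}. f a) = (\<Sum>j\<in>UNIV. f (Inl j))" for f :: "'n + 'n \<Rightarrow> 'n cform"
    by (rule sum.reindex_bij_witness[of _ Inl projl]) auto
  have Pr: "(\<Sum>a\<in>{a. \<not> isl a}. f a) = (\<Sum>j\<in>UNIV. f (Inr j))" for f :: "'n + 'n \<Rightarrow> 'n cform"
    by (rule sum.reindex_bij_witness[of _ Inr projr]) auto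
  have A: "H (ld isl U z) ?v = (\<Sum>j\<in>UNIV. H (wd (Inl j) U z) (es j ?v))"
    unfolding ld_eq Pl using av by (simp add: hin_sum_left hadj)
  have B: "csc \<i> (lam (g z) (ld (\<lambda>a. \<not> isl a) V z) - ld (\<lambda>a. \<not> isl a) (\<lambda>w. lam (g w) (V w)) z)
     = - (\<Sum>j\<in>UNIV. es j (wd (Inr j) V z)) - (\<Sum>j\<in>UNIV. \<Sum>p\<in>UNIV. \<Sum>q\<in>UNIV. csc (cnj (?t j p q)) (eb j (es p (ebs q ?v))))"
    unfolding ld_eq Pr ldf_lam(2)[OF z UV(2)]
    by (simp add: lam_eb sum_subtractf[symmetric] sum_negf[symmetric] csc_sum csc_add csc_diff csc_minus csc_minus1)
      (simp add: sum.distrib sum_subtractf sum_negf csc_sum)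
  have C: "H ?u (eb j (es p (ebs q ?v))) = H (eb q (e p (ebs j ?u))) ?v" for j p q
    using au av by (simp add: hadj)
  have B': "H ?u (csc \<i> (lam (g z) (ld (\<lambda>a. \<not> isl a) V z) - ld (\<lambda>a. \<not> isl a) (\<lambda>w. lam (g w) (V w)) z))
     = - (\<Sum>j\<in>UNIV. H ?u (es j (wd (Inr j) V z))) - (\<Sum>j\<in>UNIV. \<Sum>p\<in>UNIV. \<Sum>q\<in>UNIV. ?t j p q * H (eb q (e p (ebs j ?u))) ?v)"
    unfolding B by (simp add: hin_lin C)
  show ?thesis
    unfolding lhs A B' divergence_algebra[OF au av, symmetric]
    by (simp add: right_diff_distrib sum_subtractf)
qed

end

section \<open>Change of variables in \<open>complex ^ 'n\<close>\<close>

text \<open>A permutation that moves an index outside the range of f meets a zero entry of M, so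
  only permutations of the range contribute. Used to evaluate the two diagonal blocks of a realified
  matrix.\<close>

lemma det_embed:
  fixes M :: "complex ^ 'm::finite ^ 'm" and A :: "complex ^ 'n::finite ^ 'n"
  assumes f: "inj f" and A: "\<And>i j. M $ f i $ f j = A $ i $ j"
    and d: "\<And>a b. a \<notin> range f \<Longrightarrow> M $ a $ b = (if a = b then 1 else 0)"
  shows "det M = det A"
proof -
  let ?R = "range f"
  have mp: "map_permutation UNIV f q = (\<lambda>x. if x \<in> ?R then f (q (inv f x)) else x)" for q
    by (auto simp: map_permutation_def restrict_id_def)
  have bij: "bij_betw f UNIV ?R" using f by (simp add: inj_on_imp_bij_betw)
  have "det M = (\<Sum>p | p permutes ?R. of_int (sign p) * (\<Prod>a\<in>UNIV. M $ a $ p a))"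
    unfolding det_def
  proof (rule sum.mono_neutral_right)
    show "{p. p permutes ?R} \<subseteq> {p. p permutes (UNIV::'m set)}" by (auto intro: permutes_subset)
    show "\<forall>p\<in>{p. p permutes (UNIV::'m set)} - {p. p permutes ?R}. of_int (sign p) * (\<Prod>a\<in>UNIV. M $ a $ p a) = 0"
    proof
      fix p assume p: "p \<in> {p. p permutes (UNIV::'m set)} - {p. p permutes ?R}"
      obtain a where a: "a \<notin> ?R" "p a \<noteq> a"
      proof -
        have "\<not> (\<forall>x. x \<notin> ?R \<longrightarrow> p x = x)"
          using p by (auto simp: permutes_def)
        then show ?thesis using that by blast
      qed
      then have "M $ a $ p a = 0" using d[of a "p a"] by simp
      then show "of_int (sign p) * (\<Prod>a\<in>UNIV. M $ a $ p a) = 0" by (auto intro!: prod_zero)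
    qed
  qed simp
  also have "\<dots> = (\<Sum>q | q permutes UNIV. of_int (sign (map_permutation UNIV f q)) * (\<Prod>a\<in>UNIV. M $ a $ map_permutation UNIV f q a))"
    using sum.reindex_bij_betw[OF bij_betw_permutations[OF bij],
        of "\<lambda>p. of_int (sign p) * (\<Prod>a\<in>UNIV. M $ a $ p a)", symmetric] by (simp add: mp)
  also have "\<dots> = det A"
    unfolding det_def
  proof (intro sum.cong refl)
    fix q :: "'n \<Rightarrow> 'n" assume "q \<in> {q. q permutes UNIV}"
    then have q: "q permutes UNIV" by simp
    have "(\<Prod>a\<in>UNIV. M $ a $ map_permutation UNIV f q a) = (\<Prod>a\<in>?R. M $ a $ map_permutation UNIV f q a)"
      by (rule prod.mono_neutral_right) (auto simp: d map_permutation_def restrict_id_def)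
    also have "\<dots> = (\<Prod>i\<in>UNIV. A $ i $ q i)"
      using f by (simp add: prod.reindex map_permutation_apply A)
    finally show "of_int (sign (map_permutation UNIV f q)) * (\<Prod>a\<in>UNIV. M $ a $ map_permutation UNIV f q a)
      = of_int (sign q) * (\<Prod>i\<in>UNIV. A $ i $ q i)"
      using f q by (simp add: sign_map_permutation)
  qed
  finally show ?thesis .
qed

lemma det_of_real:
  fixes R :: "real ^ 'm::finite ^ 'm"
  shows "det (\<chi> a b. complex_of_real (R $ a $ b)) = of_real (det R)"
  by (simp add: det_def)

text \<open>Conjugating by the coordinates \<open>(z, cnj z)\<close> turns the real matrix of \<open>T\<close> into the block diagonal
  matrix with blocks \<open>T\<close> and \<open>cnj T\<close>.\<close>

lemma det_realification:
  fixes R :: "real ^ 'm::finite ^ 'm" and T :: "complex ^ 'n::finite ^ 'n" and \<iota> :: "'n + 'n \<Rightarrow> 'm"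
  assumes bij: "bij \<iota>"
    and R: "\<And>i j. R $ \<iota> (Inl i) $ \<iota> (Inl j) = Re (T $ i $ j)" "\<And>i j. R $ \<iota> (Inl i) $ \<iota> (Inr j) = - Im (T $ i $ j)"
      "\<And>i j. R $ \<iota> (Inr i) $ \<iota> (Inl j) = Im (T $ i $ j)" "\<And>i j. R $ \<iota> (Inr i) $ \<iota> (Inr j) = Re (T $ i $ j)"
  shows "det R = (cmod (det T))\<^sup>2"
proof -
  define mk where "mk = (\<lambda>B :: 'n + 'n \<Rightarrow> 'n + 'n \<Rightarrow> complex. (\<chi> a b. B (inv \<iota> a) (inv \<iota> b)) :: complex ^ 'm ^ 'm)"
  have inv: "inv \<iota> (\<iota> a) = a" for a using bij by (simp add: bij_is_inj)
  have mk: "mk B $ \<iota> a $ \<iota> b = B a b" for B a b by (simp add: mk_def inv)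
  have mk_eq: "M = M'" if "\<And>a b. M $ \<iota> a $ \<iota> b = M' $ \<iota> a $ \<iota> b" for M M' :: "complex ^ 'm ^ 'm"
  proof -
    have "M $ a $ b = M' $ a $ b" for a b
      using that[of "inv \<iota> a" "inv \<iota> b"] bij by (simp add: bij_is_surj surj_f_inv_f)
    then show ?thesis by (simp add: vec_eq_iff)
  qed
  have mult: "(M ** M') $ \<iota> a $ \<iota> b = (\<Sum>c\<in>UNIV. M $ \<iota> a $ \<iota> c * M' $ \<iota> c $ \<iota> b)" for M M' :: "complex ^ 'm ^ 'm" and a b
    unfolding matrix_matrix_mult_def using sum.reindex_bij_betw[OF bij, of "\<lambda>k. M $ \<iota> a $ k * M' $ k $ \<iota> b"] by simp
  define Rc where "Rc = (\<chi> a b. complex_of_real (R $ a $ b))"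
  define Q where "Q = mk (\<lambda>a b. case (a, b) of (Inl i, Inl j) \<Rightarrow> (if i = j then 1 else 0) | (Inl i, Inr j) \<Rightarrow> (if i = j then \<i> else 0)
     | (Inr i, Inl j) \<Rightarrow> (if i = j then 1 else 0) | (Inr i, Inr j) \<Rightarrow> (if i = j then - \<i> else 0))"
  define Q' where "Q' = mk (\<lambda>a b. case (a, b) of (Inl i, Inl j) \<Rightarrow> (if i = j then 1/2 else 0) | (Inl i, Inr j) \<Rightarrow> (if i = j then 1/2 else 0)
     | (Inr i, Inl j) \<Rightarrow> (if i = j then - \<i>/2 else 0) | (Inr i, Inr j) \<Rightarrow> (if i = j then \<i>/2 else 0))"
  \<comment> \<open>The block diagonal matrix is split into two factors, each the identity on one
    block, so that \<open>det_embed\<close> applies to each.\<close>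
  define D1 where "D1 = mk (\<lambda>a b. case (a, b) of (Inl i, Inl j) \<Rightarrow> T $ i $ j | (Inr i, Inr j) \<Rightarrow> (if i = j then 1 else 0) | _ \<Rightarrow> 0)"
  define D2 where "D2 = mk (\<lambda>a b. case (a, b) of (Inl i, Inl j) \<Rightarrow> (if i = j then 1 else 0) | (Inr i, Inr j) \<Rightarrow> cnj (T $ i $ j) | _ \<Rightarrow> 0)"
  have io: "inj \<iota>" "\<And>a b. \<iota> a = \<iota> b \<longleftrightarrow> a = b" using bij by (auto simp: bij_def inj_eq)
  have QQ: "Q ** Q' = mat 1"
  proof (rule mk_eq)
    fix a b show "(Q ** Q') $ \<iota> a $ \<iota> b = mat 1 $ \<iota> a $ \<iota> b"
      unfolding mult by (cases a; cases b) (simp_all add: Q_def Q'_def mk sum_UNIV_sum mat_def io if_distrib[of "\<lambda>x. x * _"] cong: if_cong)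
  qed
  have RQ: "Q ** Rc = D1 ** D2 ** Q"
  proof (rule mk_eq)
    fix a b
    have dd: "(D1 ** D2) $ \<iota> a $ \<iota> b = (case (a, b) of (Inl i, Inl j) \<Rightarrow> T $ i $ j | (Inr i, Inr j) \<Rightarrow> cnj (T $ i $ j) | _ \<Rightarrow> 0)" for a b
      unfolding mult by (cases a; cases b) (simp_all add: D1_def D2_def mk sum_UNIV_sum if_distrib[of "\<lambda>x. x * _"] if_distrib[of "\<lambda>x. _ * x"] cong: if_cong)
    show "(Q ** Rc) $ \<iota> a $ \<iota> b = (D1 ** D2 ** Q) $ \<iota> a $ \<iota> b"
      unfolding mult[of Q] mult[of _ Q] dd
      by (cases a; cases b) (simp_all add: Q_def Rc_def mk sum_UNIV_sum R if_distrib[of "\<lambda>x. x * _"] if_distrib[of Re] if_distrib[of Im] if_distrib[of uminus] if_distrib[of "\<lambda>x. _ * x"] complex_eq_iff cong: if_cong)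
  qed
  have r: "\<exists>i. a = \<iota> (Inl i) \<or> a = \<iota> (Inr i)" for a
    using surjD[OF bij_is_surj[OF bij], of a] by (metis sumE)
  have "det D1 = det T"
  proof (rule det_embed[where f = "\<lambda>i. \<iota> (Inl i)"])
    fix a b assume "a \<notin> range (\<lambda>i. \<iota> (Inl i))"
    then obtain i where a: "a = \<iota> (Inr i)" using r[of a] by auto
    obtain j where "b = \<iota> (Inl j) \<or> b = \<iota> (Inr j)" using r[of b] by auto
    then show "D1 $ a $ b = (if a = b then 1 else 0)" unfolding a by (auto simp: D1_def mk io)
  qed (auto simp: inj_on_def io D1_def mk)
  moreover have "det D2 = det (\<chi> i j. cnj (T $ i $ j))"
  proof (rule det_embed[where f = "\<lambda>i. \<iota> (Inr i)"])
    fix a b assume "a \<notin> range (\<lambda>i. \<iota> (Inr i))"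
    then obtain i where a: "a = \<iota> (Inl i)" using r[of a] by auto
    obtain j where "b = \<iota> (Inl j) \<or> b = \<iota> (Inr j)" using r[of b] by auto
    then show "D2 $ a $ b = (if a = b then 1 else 0)" unfolding a by (auto simp: D2_def mk io)
  qed (auto simp: inj_on_def io D2_def mk)
  moreover have "det (\<chi> i j. cnj (T $ i $ j)) = cnj (det T)"
    by (simp add: det_def)
  moreover have "det Q \<noteq> 0"
    using arg_cong[OF QQ, of det] by (auto simp: det_mul)
  moreover have "det Q * det Rc = det D1 * det D2 * det Q"
    using arg_cong[OF RQ, of det] by (simp add: det_mul)
  ultimately have "det Rc = det T * cnj (det T)" by simp
  then have "complex_of_real (det R) = of_real ((cmod (det T))\<^sup>2)"
    unfolding Rc_def det_of_real complex_norm_square .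
  then show ?thesis unfolding of_real_eq_iff .
qed

text \<open>The change of variables theorem lives on \<open>real ^ 'm\<close> with a well-ordered
  index type, and \<open>'n bit0\<close> is such a type with 2n elements. Any bijection will do, as
  neither determinants nor Lebesgue measure depend on the labelling.\<close>

definition rcoord :: "'n::finite + 'n \<Rightarrow> 'n bit0" where
  "rcoord = (SOME \<iota>. bij \<iota>)"

lemma bij_rcoord: "bij (rcoord :: 'n::finite + 'n \<Rightarrow> 'n bit0)"
proof -
  have "card (UNIV :: ('n + 'n) set) = card (UNIV :: 'n bit0 set)" by simp
  then obtain \<iota> :: "'n + 'n \<Rightarrow> 'n bit0" where "bij \<iota>"
    using finite_same_card_bij[of "UNIV :: ('n + 'n) set" "UNIV :: 'n bit0 set"] by auto
  then show ?thesis unfolding rcoord_def by (rule someI[where P = bij])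
qed

lemma rcoord_eq [simp]: "rcoord a = rcoord b \<longleftrightarrow> a = b"
  using bij_rcoord by (metis bij_pointE)

section \<open>Real coordinates on complex n-space\<close>

fun bvec :: "'n + 'n \<Rightarrow> complex ^ 'n::finite" where
  "bvec (Inl k) = axis k 1"
| "bvec (Inr k) = axis k \<i>"

lemma bvec_inner: "z \<bullet> bvec (Inl k) = Re (z $ k)" "z \<bullet> bvec (Inr k) = Im (z $ k)"
  by (simp_all add: inner_axis)

lemma bij_bvec: "bij_betw bvec UNIV (Basis :: (complex ^ 'n::finite) set)"
proof -
  have "inj (bvec :: 'n + 'n \<Rightarrow> _)"
  proof (rule injI)
    fix a b :: "'n + 'n" assume "bvec a = bvec b"
    then show "a = b" by (cases a; cases b) (auto simp: axis_eq_axis)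
  qed
  moreover have "range bvec = (Basis :: (complex ^ 'n) set)"
  proof -
    have "range bvec = range (\<lambda>k::'n. bvec (Inl k)) \<union> range (\<lambda>k::'n. bvec (Inr k))"
      unfolding UNIV_sum image_Un image_image by simp
    also have "\<dots> = Basis" by (auto simp: Basis_vec_def Basis_complex_def)
    finally show ?thesis .
  qed
  ultimately show ?thesis by (simp add: bij_betw_def)
qed

definition r2c :: "real ^ ('n::finite bit0) \<Rightarrow> complex ^ 'n" where
  "r2c x = (\<chi> k. Complex (x $ rcoord (Inl k)) (x $ rcoord (Inr k)))"

definition c2r :: "complex ^ 'n::finite \<Rightarrow> real ^ ('n bit0)" where
  "c2r z = (\<chi> m. z \<bullet> bvec (inv rcoord m))"

lemma c2r_nth: "c2r z $ rcoord a = z \<bullet> bvec a"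
  by (simp add: c2r_def inv_f_f[OF bij_is_inj[OF bij_rcoord]])

lemma r2c_inner: "r2c x \<bullet> bvec a = x $ rcoord a"
  by (cases a) (simp_all add: bvec_inner r2c_def del: bvec.simps)

lemma r2c_c2r [simp]: "r2c (c2r z) = z"
proof -
  have "Complex (c2r z $ rcoord (Inl k)) (c2r z $ rcoord (Inr k)) = z $ k" for k
    unfolding c2r_nth bvec_inner by simp
  then show ?thesis by (simp add: r2c_def vec_eq_iff)
qed

lemma rcoord_cases: obtains a where "m = rcoord a"
  using surjD[OF bij_is_surj[OF bij_rcoord]] by metis

lemma c2r_r2c [simp]: "c2r (r2c x) = x"
proof -
  have "c2r (r2c x) $ m = x $ m" for m
    by (rule rcoord_cases[of m]) (simp add: c2r_nth r2c_inner)
  then show ?thesis by (simp add: vec_eq_iff)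
qed

lemma linear_r2c: "linear r2c"
  by (rule linearI) (auto simp: r2c_def vec_eq_iff complex_eq_iff)

lemma linear_c2r: "linear c2r"
  by (rule linearI) (auto simp: c2r_def vec_eq_iff inner_add_left)

lemmas bounded_linear_r2c = linear_r2c[unfolded linear_conv_bounded_linear]
lemmas bounded_linear_c2r = linear_c2r[unfolded linear_conv_bounded_linear]

lemma continuous_r2c: "continuous_on X r2c" and continuous_c2r: "continuous_on Y c2r"
  using linear_continuous_on bounded_linear_r2c bounded_linear_c2r by blast+

lemma bij_axis_rcoord: "bij_betw (\<lambda>a. axis (rcoord a) 1) UNIV (Basis :: (real ^ ('n::finite bit0)) set)"
proof -
  have "inj (\<lambda>a::'n+'n. axis (rcoord a) (1::real))" by (auto simp: inj_on_def axis_eq_axis)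
  moreover have "range (\<lambda>a::'n+'n. axis (rcoord a) (1::real)) = Basis"
  proof -
    have "range (\<lambda>a::'n+'n. axis (rcoord a) (1::real)) = (\<lambda>m. axis m 1) ` range (rcoord :: 'n + 'n \<Rightarrow> _)" by auto
    also have "\<dots> = Basis" unfolding bij_is_surj[OF bij_rcoord] by (auto simp: Basis_vec_def)
    finally show ?thesis .
  qed
  ultimately show ?thesis by (simp add: bij_betw_def)
qed

lemma distr_r2c: "distr lborel borel r2c = (lborel :: (complex ^ 'n::finite) measure)"
proof (rule sym, rule lborel_eqI)
  fix l u :: "complex ^ 'n" assume le: "\<And>b. b \<in> Basis \<Longrightarrow> l \<bullet> b \<le> u \<bullet> b"
  have B1: "(\<forall>b\<in>Basis. P b) \<longleftrightarrow> (\<forall>a. P (bvec a))" for P :: "complex ^ 'n \<Rightarrow> bool"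
    using bij_bvec unfolding bij_betw_def by (metis UNIV_I imageE rangeI)
  have B2: "(\<forall>b\<in>Basis. P b) \<longleftrightarrow> (\<forall>a. P (axis (rcoord a) 1))" for P :: "real ^ ('n bit0) \<Rightarrow> bool"
    using bij_axis_rcoord unfolding bij_betw_def by (metis (no_types, lifting) UNIV_I imageE rangeI)
  have ax: "x \<bullet> axis m 1 = x $ m" for x :: "real ^ ('n bit0)" and m by (simp add: inner_axis)
  have pre: "r2c -` box l u = box (c2r l) (c2r u)"
    unfolding box_def B1 B2 ax c2r_nth by (auto simp: r2c_inner)
  have "emeasure (distr lborel borel r2c) (box l u) = emeasure lborel (box (c2r l) (c2r u))"
    by (subst emeasure_distr) (auto simp: pre intro!: borel_measurable_continuous_onI continuous_r2c)
  also have "\<dots> = (\<Prod>b\<in>Basis. (c2r u - c2r l) \<bullet> b)"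
  proof (rule emeasure_lborel_box)
    have "\<forall>b\<in>Basis. l \<bullet> b \<le> u \<bullet> b" using le by blast
    then have "\<forall>b\<in>Basis. c2r l \<bullet> b \<le> c2r u \<bullet> b" unfolding B1 B2 ax c2r_nth .
    then show "\<And>b. b \<in> Basis \<Longrightarrow> c2r l \<bullet> b \<le> c2r u \<bullet> b" by blast
  qed
  also have "(\<Prod>b\<in>Basis. (c2r u - c2r l) \<bullet> b) = (\<Prod>a\<in>UNIV. (c2r u - c2r l) $ rcoord a)"
    by (subst prod.reindex_bij_betw[OF bij_axis_rcoord, symmetric]) (simp add: ax)
  also have "\<dots> = (\<Prod>a\<in>UNIV. (u - l) \<bullet> bvec a)"
    by (simp add: c2r_nth inner_diff_left)
  also have "\<dots> = (\<Prod>b\<in>Basis. (u - l) \<bullet> b)"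
    by (rule prod.reindex_bij_betw[OF bij_bvec])
  finally show "emeasure (distr lborel borel r2c) (box l u) = (\<Prod>b\<in>Basis. (u - l) \<bullet> b)" .
qed simp

lemma nn_integral_r2c:
  fixes f :: "complex ^ 'n::finite \<Rightarrow> ennreal"
  assumes "f \<in> borel_measurable borel"
  shows "(\<integral>\<^sup>+z. f z \<partial>lborel) = (\<integral>\<^sup>+x. f (r2c x) \<partial>lborel)"
proof -
  have "(\<integral>\<^sup>+z. f z \<partial>lborel) = (\<integral>\<^sup>+z. f z \<partial>distr lborel borel r2c)" by (simp only: distr_r2c)
  also have "\<dots> = (\<integral>\<^sup>+x. f (r2c x) \<partial>lborel)"
    by (rule nn_integral_distr) (use assms in \<open>auto intro!: borel_measurable_continuous_onI continuous_r2c\<close>)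
  finally show ?thesis .
qed

text \<open>The theorem for absolutely integrable functions is an equivalence, so it also transfers
  non-integrability. For nonnegative Borel functions this means that both integrals are infinite,
  and the formula holds without any integrability assumption.\<close>

lemma nn_integral_cov_real:
  fixes G :: "real ^ 'm::{finite,wellorder} \<Rightarrow> real ^ 'm::_" and f :: "real ^ 'm::_ \<Rightarrow> real"
  assumes B: "B \<in> sets lborel" and der: "\<And>x. x \<in> B \<Longrightarrow> (G has_derivative G' x) (at x)" and inj: "inj_on G B"
    and nonneg: "\<And>x. f x \<ge> 0"
    and m1: "(\<lambda>x. indicator B x * (\<bar>det (matrix (G' x))\<bar> * f (G x))) \<in> borel_measurable borel"
    and m2: "(\<lambda>y. indicator (G ` B) y * f y) \<in> borel_measurable borel"
  shows "(\<integral>\<^sup>+y. ennreal (f y) * indicator (G ` B) y \<partial>lborel)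
    = (\<integral>\<^sup>+x. ennreal (\<bar>det (matrix (G' x))\<bar> * f (G x)) * indicator B x \<partial>lborel)"
proof -
  let ?u = "\<lambda>x. \<bar>det (matrix (G' x))\<bar> * f (G x)"
  have iff: "(?u integrable_on B \<and> integral B ?u = b) \<longleftrightarrow> (f integrable_on (G ` B) \<and> integral (G ` B) f = b)" for b
  proof -
    have "B \<in> sets lebesgue" using B by simp
    \<comment> \<open>The cited theorem is about vector-valued functions, hence the passage through
      \<open>real ^ 1\<close>.\<close>
    from has_absolute_integral_change_of_variables[OF this has_derivative_at_withinI[OF der] inj, where f = "\<lambda>x. vec (f x) :: real ^ 1" and b = "vec b"]
    have "((\<lambda>x. ?u x) absolutely_integrable_on B \<and> integral B ?u = b) \<longleftrightarrow> (f absolutely_integrable_on (G ` B) \<and> integral (G ` B) f = b)"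
      by (simp add: absolutely_integrable_on_1_iff integral_on_1_eq)
    moreover have "?u absolutely_integrable_on B \<longleftrightarrow> ?u integrable_on B"
      by (rule absolutely_integrable_on_iff_nonneg) (simp add: nonneg)
    moreover have "f absolutely_integrable_on (G ` B) \<longleftrightarrow> f integrable_on (G ` B)"
      by (rule absolutely_integrable_on_iff_nonneg) (simp add: nonneg)
    ultimately show ?thesis by simp
  qed
  have conv: "(\<integral>\<^sup>+x. ennreal (v x) * indicator A x \<partial>lborel) = ennreal (integral A v)"
    if "v integrable_on A" "\<And>x. v x \<ge> 0" for v and A :: "(real ^ 'm::_) set"
    using nn_integral_has_integral_lebesgue'[where f = v and \<Omega> = A and I = "integral A v"] that by (simp add: has_integral_integral)
  have conv2: "v integrable_on A"
    if "(\<integral>\<^sup>+x. ennreal (v x) * indicator A x \<partial>lborel) < \<infinity>" "\<And>x. v x \<ge> 0"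
       "(\<lambda>x. indicator A x * v x) \<in> borel_measurable borel" for v and A :: "(real ^ 'm::_) set"
  proof -
    have "(\<lambda>x. indicator A x * v x) integrable_on UNIV"
    proof (rule nn_integral_integrable_on)
      have "(\<integral>\<^sup>+x. ennreal (indicator A x * v x) \<partial>lborel) = (\<integral>\<^sup>+x. ennreal (v x) * indicator A x \<partial>lborel)"
        by (intro nn_integral_cong) (auto simp: indicator_def)
      then show "(\<integral>\<^sup>+x. ennreal (indicator A x * v x) \<partial>lborel) < \<infinity>" using that(1) by simp
    qed (use that in auto)
    moreover have "(\<lambda>x. indicator A x * v x) = (\<lambda>x. if x \<in> A then v x else 0)" by (auto simp: indicator_def)
    ultimately show ?thesis by (simp add: integrable_restrict_UNIV)
  qed
  have un: "?u x \<ge> 0" for x using nonneg by simp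
  show ?thesis
  proof (cases "f integrable_on (G ` B)")
    case True
    then have "?u integrable_on B" "integral B ?u = integral (G ` B) f" using iff by blast+
    then show ?thesis using True conv[of ?u B, OF _ un] conv[of f "G ` B", OF _ nonneg] by simp
  next
    case False
    then have "\<not> ?u integrable_on B" using iff by blast
    then have "\<not> (\<integral>\<^sup>+x. ennreal (?u x) * indicator B x \<partial>lborel) < \<infinity>"
      using conv2[OF _ un m1] by blast
    moreover have "\<not> (\<integral>\<^sup>+y. ennreal (f y) * indicator (G ` B) y \<partial>lborel) < \<infinity>"
      using False conv2[OF _ nonneg m2] by blast
    ultimately show ?thesis by (simp only: infinity_ennreal_def not_less top.extremum_unique)
  qed
qed

lemma borel_image_homeomorphism:
  assumes "homeomorphism S T F K" "open S" "open T" "B \<in> sets borel" "B \<subseteq> S"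
  shows "F ` B \<in> sets borel"
proof -
  have "F ` B = T \<inter> K -` B"
    using assms(1,5) unfolding homeomorphism_def by (auto simp: subset_iff image_iff)
  moreover have "T \<inter> K -` B \<in> sets borel"
  proof -
    have "(\<lambda>x. K x) \<in> borel_measurable (restrict_space borel T)"
      using assms(1) by (intro borel_measurable_continuous_on_restrict) (simp add: homeomorphism_def)
    then have "K -` B \<inter> space (restrict_space borel T) \<in> sets (restrict_space borel T)"
      using assms(4) by (rule measurable_sets)
    then show ?thesis
      using assms(3) by (auto simp: sets_restrict_space_iff space_restrict_space Int_commute)
  qed
  ultimately show ?thesis by simp
qed

lemma nn_integral_cov_holomorphic:
  fixes F K :: "complex ^ 'n::finite \<Rightarrow> complex ^ 'n" and \<rho> :: "complex ^ 'n \<Rightarrow> real"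
  assumes hol: "holomorphic_map_on S F" and ho: "homeomorphism S T F K" and op: "open S" "open T"
    and B: "B \<in> sets borel" "B \<subseteq> S"
    and \<rho>: "continuous_on T \<rho>" "\<And>w. w \<in> T \<Longrightarrow> \<rho> w \<ge> 0"
  shows "(\<integral>\<^sup>+w. ennreal (\<rho> w) * indicator (F ` B) w \<partial>lborel)
    = (\<integral>\<^sup>+z. ennreal ((cmod (det (\<chi> j k. jac F z (Inl j) (Inl k))))\<^sup>2 * \<rho> (F z)) * indicator B z \<partial>lborel)"
proof -
  interpret hol_change S F by unfold_locales (use hol op in auto)
  define T' where "T' = (\<lambda>z. \<chi> k j. jac F z (Inl j) (Inl k))"
  have detT: "det (\<chi> j k. jac F z (Inl j) (Inl k)) = det (T' z)" for z
    using det_transpose[of "T' z"] by (simp add: T'_def transpose_def)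
  define F' where "F' = (\<lambda>z. frechet_derivative F (at z))"
  have F': "(F has_derivative F' z) (at z)" if "z \<in> S" for z
    using F_differentiable[OF that] unfolding F'_def using frechet_derivative_works by blast
  have F'c: "F' z (a *s v) = a *s F' z v" if "z \<in> S" for z a v
  proof -
    obtain f' where f': "(F has_derivative f') (at z)" "\<forall>a v. f' (a *s v) = a *s f' v"
      using hol \<open>z \<in> S\<close> unfolding holomorphic_map_on_def by blast
    then have "F' z = f'" using has_derivative_unique[OF F'[OF that]] by blast
    then show ?thesis using f' by simp
  qed
  have F'T: "F' z (axis j 1) $ k = T' z $ k $ j" if "z \<in> S" for z j k
  proof -
    have "((\<lambda>z. F z $ k) has_derivative (\<lambda>v. F' z v $ k)) (at z)"
      by (rule bounded_linear.has_derivative[OF bounded_linear_vec_nth F'[OF that]])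
    then have "fd (\<lambda>z. F z $ k) z = (\<lambda>v. F' z v $ k)" using frechet_derivative_at by metis
    then show ?thesis by (simp add: T'_def jac_simps[OF that])
  qed
  define G where "G = (\<lambda>x. c2r (F (r2c x)))"
  define G' where "G' = (\<lambda>x v. c2r (F' (r2c x) (r2c v)))"
  define B' where "B' = r2c -` B"
  \<comment> \<open>Extension by 0 off T, since the real version asks for nonnegativity
    everywhere.\<close>
  define f where "f = (\<lambda>x. if r2c x \<in> T then \<rho> (r2c x) else 0)"
  have FT: "F z \<in> T" if "z \<in> S" for z using ho that by (auto simp: homeomorphism_def)
  have GB: "G ` B' = r2c -` (F ` B)"
  proof (intro equalityI subsetI)
    fix y assume "y \<in> r2c -` (F ` B)"
    then obtain z where z: "z \<in> B" "r2c y = F z" by auto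
    then have "y = G (c2r z)" unfolding G_def by (metis c2r_r2c r2c_c2r)
    then show "y \<in> G ` B'" using z by (auto simp: B'_def)
  qed (auto simp: G_def B'_def)
  have Gder: "(G has_derivative G' x) (at x)" if "x \<in> B'" for x
  proof -
    have "r2c x \<in> S" using that B(2) by (auto simp: B'_def)
    from bounded_linear.has_derivative[OF bounded_linear_c2r has_derivative_compose[OF bounded_linear.has_derivative[OF bounded_linear_r2c has_derivative_ident] F'[OF this]]]
    show ?thesis unfolding G_def G'_def .
  qed
  have ax: "r2c (axis (rcoord b) 1) = bvec b" for b :: "'n + 'n"
  proof -
    have "bvec b \<bullet> bvec a = (if a = b then 1 else 0)" for a
    proof -
      have "bvec a \<in> Basis" "bvec b \<in> Basis" "bvec b = bvec a \<longleftrightarrow> a = b"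
        using bij_bvec[where 'n = 'n] unfolding bij_betw_def by (auto dest: injD)
      then show ?thesis by (simp only: inner_Basis)
    qed
    then have "c2r (bvec b) $ m = axis (rcoord b) 1 $ m" for m
      by (rule_tac m = m in rcoord_cases) (simp add: c2r_nth axis_def)
    then have "c2r (bvec b) = axis (rcoord b) 1" by (simp add: vec_eq_iff)
    then show ?thesis by (metis r2c_c2r)
  qed
  \<comment> \<open>Complex linearity of \<open>F'\<close> gives its real matrix the block pattern
    required by \<open>det_realification\<close>.\<close>
  have detG: "det (matrix (G' x)) = (cmod (det (T' (r2c x))))\<^sup>2" if "x \<in> B'" for x
  proof (rule det_realification[OF bij_rcoord])
    have z: "r2c x \<in> S" using that B(2) by (auto simp: B'_def)
    have m: "matrix (G' x) $ rcoord a $ rcoord b = F' (r2c x) (bvec b) \<bullet> bvec a" for a b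
      unfolding matrix_def G'_def by (simp add: ax c2r_nth)
    have "axis j \<i> = \<i> *s axis j (1::complex)" for j :: 'n by (simp add: axis_def vec_eq_iff)
    then have i: "F' (r2c x) (axis j \<i>) $ k = \<i> * F' (r2c x) (axis j 1) $ k" for j k
      using F'c[OF z] by simp
    show "matrix (G' x) $ rcoord (Inl i) $ rcoord (Inl j) = Re (T' (r2c x) $ i $ j)"
      "matrix (G' x) $ rcoord (Inl i) $ rcoord (Inr j) = - Im (T' (r2c x) $ i $ j)"
      "matrix (G' x) $ rcoord (Inr i) $ rcoord (Inl j) = Im (T' (r2c x) $ i $ j)"
      "matrix (G' x) $ rcoord (Inr i) $ rcoord (Inr j) = Re (T' (r2c x) $ i $ j)" for i j
      unfolding m bvec_inner by (simp_all add: i F'T[OF z])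
  qed
  have FB: "F ` B \<in> sets borel" by (rule borel_image_homeomorphism[OF ho op B])
  have mr2c: "r2c \<in> borel_measurable borel" by (intro borel_measurable_continuous_onI continuous_r2c)
  have B': "B' \<in> sets borel" unfolding B'_def using measurable_sets[OF mr2c B(1)] by simp
  define u where "u = (\<lambda>z. (cmod (det (T' z)))\<^sup>2 * \<rho> (F z))"
  have cu: "continuous_on S u"
  proof -
    have "continuous_on S F" using ho by (simp add: homeomorphism_def)
    moreover have "continuous_on S (\<lambda>z. det (T' z))"
      by (rule smooth_on_continuous, rule smooth_on_det[OF op(1)]) (simp add: T'_def smooth_jac)
    ultimately show ?thesis unfolding u_def
      by (intro continuous_intros continuous_on_compose2[OF \<rho>(1)]) (use FT in auto)
  qed
  have mu: "(\<lambda>z. indicator B z * u z) \<in> borel_measurable borel"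
  proof -
    have "(\<lambda>z. indicator S z *\<^sub>R u z) \<in> borel_measurable borel"
      by (rule borel_measurable_continuous_on_indicator) (use op cu in auto)
    then have "(\<lambda>z. indicator B z * (indicator S z *\<^sub>R u z)) \<in> borel_measurable borel" using B by measurable
    moreover have "(\<lambda>z. indicator B z * (indicator S z *\<^sub>R u z)) = (\<lambda>z. indicator B z * u z)"
      using B(2) by (auto simp: indicator_def fun_eq_iff)
    ultimately show ?thesis by simp
  qed
  have mr: "(\<lambda>w. indicator (F ` B) w * \<rho> w) \<in> borel_measurable borel"
  proof -
    have "(\<lambda>z. indicator T z *\<^sub>R \<rho> z) \<in> borel_measurable borel"
      by (rule borel_measurable_continuous_on_indicator) (use op \<rho> in auto)
    then have "(\<lambda>z. indicator (F ` B) z * (indicator T z *\<^sub>R \<rho> z)) \<in> borel_measurable borel" using FB by measurable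
    moreover have "(\<lambda>z. indicator (F ` B) z * (indicator T z *\<^sub>R \<rho> z)) = (\<lambda>z. indicator (F ` B) z * \<rho> z)"
      using B(2) FT by (auto simp: indicator_def fun_eq_iff)
    ultimately show ?thesis by simp
  qed
  have e1: "indicator B' x * (\<bar>det (matrix (G' x))\<bar> * f (G x)) = indicator B (r2c x) * u (r2c x)" for x
    using detG[of x] B(2) FT[of "r2c x"] by (auto simp: indicator_def B'_def u_def f_def G_def)
  have e2: "indicator (G ` B') y * f y = indicator (F ` B) (r2c y) * \<rho> (r2c y)" for y
    using B(2) FT by (auto simp: indicator_def GB f_def)
  have main: "(\<integral>\<^sup>+y. ennreal (f y) * indicator (G ` B') y \<partial>lborel)
    = (\<integral>\<^sup>+x. ennreal (\<bar>det (matrix (G' x))\<bar> * f (G x)) * indicator B' x \<partial>lborel)"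
  proof (rule nn_integral_cov_real[OF _ Gder])
    show "inj_on G B'"
    proof (rule inj_onI)
      fix x y assume "x \<in> B'" "y \<in> B'" "G x = G y"
      then have "F (r2c x) = F (r2c y)" "r2c x \<in> S" "r2c y \<in> S"
        using B(2) unfolding G_def B'_def by (metis r2c_c2r, auto)
      then have "r2c x = r2c y" using ho unfolding homeomorphism_def by metis
      then show "x = y" by (metis c2r_r2c)
    qed
    show "(\<lambda>x. indicator B' x * (\<bar>det (matrix (G' x))\<bar> * f (G x))) \<in> borel_measurable borel"
      unfolding e1 using measurable_compose[OF mr2c mu] by simp
    show "(\<lambda>y. indicator (G ` B') y * f y) \<in> borel_measurable borel"
      unfolding e2 using measurable_compose[OF mr2c mr] by simp
  qed (use B' \<rho>(2) in \<open>auto simp: f_def\<close>)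
  have mult_ind: "ennreal a * indicator A x = ennreal (indicator A x * a)" for a A and x :: "real ^ 'n bit0"
    by (simp add: indicator_def)
  have mult_ind2: "ennreal a * indicator A x = ennreal (indicator A x * a)" for a A and x :: "complex ^ 'n"
    by (simp add: indicator_def)
  have "(\<integral>\<^sup>+w. ennreal (indicator (F ` B) w * \<rho> w) \<partial>lborel)
    = (\<integral>\<^sup>+x. ennreal (indicator (F ` B) (r2c x) * \<rho> (r2c x)) \<partial>lborel)"
    by (rule nn_integral_r2c) (use mr in measurable)
  also have "\<dots> = (\<integral>\<^sup>+x. ennreal (indicator B (r2c x) * u (r2c x)) \<partial>lborel)"
    using main unfolding mult_ind e1 e2 .
  also have "\<dots> = (\<integral>\<^sup>+z. ennreal (indicator B z * u z) \<partial>lborel)"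
    by (rule nn_integral_r2c[symmetric]) (use mu in measurable)
  finally show ?thesis unfolding detT mult_ind2 u_def .
qed

section \<open>Smooth families of forms\<close>

lemma lsm_add: "open S \<Longrightarrow> lsm S U \<Longrightarrow> lsm S V \<Longrightarrow> lsm S (\<lambda>z. U z + V z)"
  by (auto simp: lsm_def plus_fun_def intro: smooth_on_add)

lemma lsm_csc: "open S \<Longrightarrow> smooth_on S f \<Longrightarrow> lsm S U \<Longrightarrow> lsm S (\<lambda>z. csc (f z) (U z))"
  by (auto simp: lsm_def csc_def intro: smooth_on_mult)

lemma lsm_sum: "open S \<Longrightarrow> (\<And>i. i \<in> I \<Longrightarrow> lsm S (U i)) \<Longrightarrow> lsm S (\<lambda>z. \<Sum>i\<in>I. U i z)"
  by (auto simp: lsm_def sum_fun_apply intro: smooth_on_sum)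

lemma lsm_iot: "lsm S U \<Longrightarrow> lsm S (\<lambda>z. iot a (U z))"
  by (auto simp: lsm_def iot_def)

lemma lsm_np: "open S \<Longrightarrow> lsm S U \<Longrightarrow> lsm S (\<lambda>z. np (U z))"
  by (auto simp: lsm_def np_def intro: smooth_on_mult smooth_on_const)

lemma lsm_cconj: "open S \<Longrightarrow> lsm S U \<Longrightarrow> lsm S (\<lambda>z. cconj (U z))"
  by (auto simp: lsm_def cconj_def intro: smooth_on_cnj)

lemma lsm_cwedge: "open S \<Longrightarrow> lsm S U \<Longrightarrow> lsm S V \<Longrightarrow> lsm S (\<lambda>z. cwedge (U z) (V z))"
  by (auto simp: lsm_def cwedge_def intro!: smooth_on_mult smooth_on_sum smooth_on_const)

lemma lsm_ext:
  assumes "open S" "lsm S U"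
  shows "lsm S (\<lambda>z. ext a (U z))"
proof -
  have "smooth_on S (\<lambda>z. ext a (U z) as)" if "lsm S U" for as U
    using that
  proof (induction as arbitrary: U)
    case Nil show ?case by (simp add: smooth_on_const[OF assms(1)])
  next
    case (Cons c as)
    have "smooth_on S (\<lambda>z. ext a (iot c (U z)) as)" by (rule Cons.IH[OF lsm_iot[OF Cons.prems]])
    moreover have "smooth_on S (\<lambda>z. if c = a then U z as else 0)"
      using Cons.prems smooth_on_const[OF assms(1)] by (cases "c = a") (auto simp: lsm_def)
    ultimately show ?case using smooth_on_diff[OF assms(1)] by (simp add: iot_def)
  qed
  then show ?thesis using assms(2) by (simp add: lsm_def)
qed

lemma lsm_wd: "open S \<Longrightarrow> lsm S U \<Longrightarrow> lsm S (wd a U)"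
  unfolding lsm_def wd_def using smooth_on_wirtinger by blast

lemma lsm_ld: "open S \<Longrightarrow> lsm S U \<Longrightarrow> lsm S (ld P U)"
  unfolding ld_eq[abs_def] by (intro lsm_sum lsm_ext lsm_wd)

lemma lsm_lam: "open S \<Longrightarrow> (\<And>k j. smooth_on S (\<lambda>z. g z $ k $ j)) \<Longrightarrow> lsm S U \<Longrightarrow> lsm S (\<lambda>z. lam (g z) (U z))"
  unfolding lam_def by (intro lsm_sum lsm_csc lsm_iot smooth_on_mult smooth_on_const)

lemma smooth_on_met: "open S \<Longrightarrow> (\<And>k j. smooth_on S (\<lambda>z. g z $ k $ j)) \<Longrightarrow> smooth_on S (\<lambda>z. met (g z) a b)"
  by (cases a; cases b) (auto intro: smooth_on_const)

lemma lsm_est: "open S \<Longrightarrow> (\<And>k j. smooth_on S (\<lambda>z. g z $ k $ j)) \<Longrightarrow> lsm S U \<Longrightarrow> lsm S (\<lambda>z. est (met (g z)) a (U z))"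
  unfolding est_def by (intro lsm_sum lsm_csc lsm_iot smooth_on_cnj smooth_on_met)

lemma smooth_on_hin:
  assumes S: "open S" and g: "\<And>k j. smooth_on S (\<lambda>z. g z $ k $ j)" and UV: "lsm S U" "lsm S V"
  shows "smooth_on S (\<lambda>z. hin (met (g z)) (U z) (V z))"
proof -
  have "smooth_on S (\<lambda>z. hk (met (g z)) k (U z) (V z))" if "lsm S U" "lsm S V" for k U V
    using that
  proof (induction k arbitrary: U V)
    case 0 then show ?case by (auto simp: lsm_def intro!: smooth_on_mult smooth_on_cnj S)
  next
    case (Suc k)
    show ?case unfolding hk.simps(2)
      by (intro smooth_on_sum smooth_on_mult smooth_on_met S g Suc.IH lsm_iot Suc.prems)
  qed
  from this[OF UV] show ?thesis unfolding hin_def by (intro smooth_on_sum smooth_on_mult smooth_on_const S)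
qed

lemma congruence_inverse:
  fixes T B g h' g' :: "complex ^ 'n::finite ^ 'n"
  assumes "g ** (T ** h' ** B) = mat 1" "det B \<noteq> 0" "h' ** g' = mat 1"
  shows "g' = B ** (g ** T)"
proof -
  have "B ** (g ** (T ** h' ** B)) ** matrix_inv B = B ** matrix_inv B" using assms(1) by simp
  then have "B ** g ** T ** h' ** (B ** matrix_inv B) = mat 1"
    unfolding matrix_inv_det(1)[OF assms(2)] by (simp only: matrix_mul_assoc[symmetric] matrix_inv_det(1)[OF assms(2)])
  then have "B ** g ** T ** h' ** g' = g'"
    unfolding matrix_inv_det(1)[OF assms(2)] matrix_mul_rid by simp
  then show ?thesis by (simp add: matrix_mul_assoc[symmetric] assms(3))
qed

section \<open>Positive definite matrices\<close>

definition posdef :: "complex ^ 'n::finite ^ 'n \<Rightarrow> bool" where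
  "posdef M \<longleftrightarrow> (\<forall>i j. cnj (M $ i $ j) = M $ j $ i) \<and>
     (\<forall>v. v \<noteq> 0 \<longrightarrow> 0 < Re (\<Sum>j\<in>UNIV. \<Sum>k\<in>UNIV. M $ j $ k * v $ j * cnj (v $ k)))"

lemma posdef_det_nonzero:
  assumes "posdef M"
  shows "det M \<noteq> 0"
proof
  assume "det M = 0"
  \<comment> \<open>The quadratic form pairs \<open>v\<close> with the first index of M, so the
    kernel vector is taken from the transpose.\<close>
  then have "\<not> invertible (transpose M)" by (simp add: invertible_det_nz)
  then obtain v where v: "v \<noteq> 0" "transpose M *v v = 0"
    using matrix_left_invertible_ker[of "transpose M"] invertible_left_inverse[of "transpose M"] by auto
  have "(\<Sum>j\<in>UNIV. M $ j $ k * v $ j) = 0" for k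
    using arg_cong[OF v(2), of "\<lambda>w. w $ k"] by (simp add: matrix_vector_mult_def transpose_def)
  then have "(\<Sum>k\<in>UNIV. cnj (v $ k) * (\<Sum>j\<in>UNIV. M $ j $ k * v $ j)) = 0" by simp
  moreover have "(\<Sum>j\<in>UNIV. \<Sum>k\<in>UNIV. M $ j $ k * v $ j * cnj (v $ k))
    = (\<Sum>k\<in>UNIV. cnj (v $ k) * (\<Sum>j\<in>UNIV. M $ j $ k * v $ j))"
    by (subst sum.swap) (simp add: sum_distrib_left mult_ac)
  ultimately have "(\<Sum>j\<in>UNIV. \<Sum>k\<in>UNIV. M $ j $ k * v $ j * cnj (v $ k)) = 0" by (simp only:)
  moreover have "0 < Re (\<Sum>j\<in>UNIV. \<Sum>k\<in>UNIV. M $ j $ k * v $ j * cnj (v $ k))"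
    using assms v(1) unfolding posdef_def by blast
  ultimately show False by (simp only: zero_complex.simps less_irrefl)
qed

lemma hermitian_det_real:
  assumes "\<And>i j. cnj (M $ i $ j) = M $ j $ i"
  shows "det M = complex_of_real (Re (det M))"
proof -
  have "cnj (det M) = det (\<chi> i j. cnj (M $ i $ j))" by (simp add: det_def)
  also have "(\<chi> i j. cnj (M $ i $ j)) = transpose M" by (simp add: assms transpose_def)
  finally show ?thesis by (simp add: complex_eq_iff)
qed

text \<open>The segment from the identity to \<open>M\<close> stays in the convex set of positive definite matrices.\<close>

lemma posdef_det_pos:
  assumes M: "posdef M"
  shows "0 < Re (det M)"
proof (rule ccontr)
  assume neg: "\<not> 0 < Re (det M)"
  define P where "P = (\<lambda>t::real. (\<chi> i j. of_real (1 - t) * (if i = j then 1 else 0) + of_real t * M $ i $ j))"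
  have P: "posdef (P t)" if "0 \<le> t" "t \<le> 1" for t
    unfolding posdef_def
  proof (intro conjI allI impI)
    fix i j show "cnj (P t $ i $ j) = P t $ j $ i" using M by (auto simp: P_def posdef_def)
  next
    fix v :: "complex ^ 'a" assume v: "v \<noteq> 0"
    have "P t $ j $ k * v $ j * cnj (v $ k) = (if j = k then of_real (1 - t) * (v $ j * cnj (v $ j)) else 0)
      + of_real t * (M $ j $ k * v $ j * cnj (v $ k))" for j k
      by (simp add: P_def algebra_simps)
    then have "(\<Sum>j\<in>UNIV. \<Sum>k\<in>UNIV. P t $ j $ k * v $ j * cnj (v $ k))
      = of_real (1 - t) * (\<Sum>j\<in>UNIV. v $ j * cnj (v $ j)) + of_real t * (\<Sum>j\<in>UNIV. \<Sum>k\<in>UNIV. M $ j $ k * v $ j * cnj (v $ k))"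
      by (simp add: sum.distrib flip: sum_distrib_left)
    also have "(\<Sum>j\<in>UNIV. v $ j * cnj (v $ j)) = of_real ((norm v)\<^sup>2)"
      by (simp add: norm_vec_def L2_set_def sum_nonneg complex_norm_square[symmetric])
    finally have "Re (\<Sum>j\<in>UNIV. \<Sum>k\<in>UNIV. P t $ j $ k * v $ j * cnj (v $ k))
      = (1 - t) * (norm v)\<^sup>2 + t * Re (\<Sum>j\<in>UNIV. \<Sum>k\<in>UNIV. M $ j $ k * v $ j * cnj (v $ k))"
      by (simp only: plus_complex.simps Re_complex_of_real times_complex.simps Im_complex_of_real mult_zero_left diff_zero)
    moreover have "0 < Re (\<Sum>j\<in>UNIV. \<Sum>k\<in>UNIV. M $ j $ k * v $ j * cnj (v $ k))"
      using M v unfolding posdef_def by blast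
    moreover have "0 < (norm v)\<^sup>2" using v by simp
    ultimately show "0 < Re (\<Sum>j\<in>UNIV. \<Sum>k\<in>UNIV. P t $ j $ k * v $ j * cnj (v $ k))"
      using that by (cases "t = 0") (auto intro: add_nonneg_pos)
  qed
  have cont: "continuous_on {0..1} (\<lambda>t. Re (det (P t)))"
    unfolding det_def P_def by (simp) (intro continuous_intros)
  have P0: "P 0 = mat 1" and P1: "P 1 = M" by (simp_all add: P_def mat_def vec_eq_iff)
  have "\<exists>t\<ge>0. t \<le> 1 \<and> Re (det (P t)) = 0"
    by (rule IVT2'[of "\<lambda>t. Re (det (P t))" 1 0 0]) (use neg cont in \<open>auto simp: P0 P1\<close>)
  then obtain t where t: "0 \<le> t" "t \<le> 1" "Re (det (P t)) = 0" by blast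
  then have "det (P t) = 0"
    using hermitian_det_real[of "P t"] P[OF t(1,2)] unfolding posdef_def by (metis of_real_0)
  then show False using posdef_det_nonzero[OF P[OF t(1,2)]] by blast
qed

section \<open>Forms on a Hermitian manifold\<close>

locale herm =
  fixes A :: "('a::{t2_space,second_countable_topology}, 'n::finite) chart set" and \<omega> :: "('a, 'n) form"
  assumes herm: "hermitian_manifold A \<omega>"
begin

abbreviation "cdom \<equiv> chart_dom :: ('a, 'n) chart \<Rightarrow> _"
abbreviation "img \<equiv> chart_img :: ('a, 'n) chart \<Rightarrow> _"
abbreviation "hm c z \<equiv> hmat (\<omega> c z)"
abbreviation "gm c z \<equiv> matrix_inv (hmat (\<omega> c z))"
abbreviation "tr \<equiv> \<lambda>(c::('a,'n) chart) (c'::('a,'n) chart) z. snd c' (chart_inv c z)"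
abbreviation "ov \<equiv> \<lambda>(c::('a,'n) chart) (c'::('a,'n) chart). snd c ` (chart_dom c \<inter> chart_dom c')"
abbreviation "J \<equiv> \<lambda>c c' z. jac (tr c c') z"

lemma mfd: "complex_manifold A" and smooth_\<omega>: "smooth_form A \<omega>" and \<omega>11: "pq_part 1 1 \<omega> = \<omega>"
  and \<omega>_real: "conj_form \<omega> = \<omega>"
  using herm by (auto simp: hermitian_manifold_def)

lemma covers: "\<exists>c\<in>A. x \<in> cdom c"
  using mfd unfolding complex_manifold_def by (metis UNIV_I UN_E)

lemma homeo: "c \<in> A \<Longrightarrow> homeomorphism (cdom c) (img c) (snd c) (chart_inv c)"
  and open_dom: "c \<in> A \<Longrightarrow> open (cdom c)" and open_img: "c \<in> A \<Longrightarrow> open (img c)"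
  using mfd by (auto simp: complex_manifold_def)

lemma inv_snd: "c \<in> A \<Longrightarrow> x \<in> cdom c \<Longrightarrow> chart_inv c (snd c x) = x"
  and snd_inv: "c \<in> A \<Longrightarrow> z \<in> img c \<Longrightarrow> snd c (chart_inv c z) = z"
  and inv_dom: "c \<in> A \<Longrightarrow> z \<in> img c \<Longrightarrow> chart_inv c z \<in> cdom c"
  and snd_img: "c \<in> A \<Longrightarrow> x \<in> cdom c \<Longrightarrow> snd c x \<in> img c"
  using homeo[of c] unfolding homeomorphism_def by auto

lemma ov_img: "c \<in> A \<Longrightarrow> z \<in> ov c c' \<Longrightarrow> z \<in> img c"
  using snd_img[of c] by auto

lemma ov_D: "c \<in> A \<Longrightarrow> z \<in> ov c c' \<Longrightarrow> chart_inv c z \<in> cdom c \<inter> cdom c'"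
  using inv_snd[of c] by auto

lemma tr_img: "c \<in> A \<Longrightarrow> c' \<in> A \<Longrightarrow> z \<in> ov c c' \<Longrightarrow> tr c c' z \<in> img c'"
  using ov_D snd_img by blast

lemma inv_tr: "c \<in> A \<Longrightarrow> c' \<in> A \<Longrightarrow> z \<in> ov c c' \<Longrightarrow> chart_inv c' (tr c c' z) = chart_inv c z"
  using ov_D inv_snd by blast

lemma snd_continuous: "c \<in> A \<Longrightarrow> continuous_on (cdom c) (snd c)"
  and inv_continuous: "c \<in> A \<Longrightarrow> continuous_on (img c) (chart_inv c)"
  using homeo[of c] unfolding homeomorphism_def by auto

lemma open_snd_image:
  assumes c: "c \<in> A" and V: "open V" "V \<subseteq> cdom c"
  shows "open (snd c ` V)"
proof -
  have "snd c ` V = img c \<inter> chart_inv c -` V"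
  proof (intro equalityI subsetI)
    fix z assume "z \<in> img c \<inter> chart_inv c -` V"
    then show "z \<in> snd c ` V" using snd_inv[OF c, of z] by (metis IntE imageI vimageE)
  qed (use V snd_img[OF c] inv_snd[OF c] in auto)
  moreover have "open (img c \<inter> chart_inv c -` V)"
    using inv_continuous[OF c] open_img[OF c] V(1) continuous_on_open_vimage[of "img c" "chart_inv c"]
    by (metis Int_commute)
  ultimately show ?thesis by simp
qed

lemma open_ov: "c \<in> A \<Longrightarrow> c' \<in> A \<Longrightarrow> open (ov c c')"
  by (intro open_snd_image) (auto simp: open_dom)

lemma hol_change: "c \<in> A \<Longrightarrow> c' \<in> A \<Longrightarrow> hol_change (ov c c') (tr c c')"
  using open_ov mfd by unfold_locales (auto simp: complex_manifold_def)

lemma blockJ: "c \<in> A \<Longrightarrow> c' \<in> A \<Longrightarrow> z \<in> ov c c' \<Longrightarrow> blockJ (J c c' z)"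
  by (rule hol_change.jac_block[OF hol_change])

lemma J_flip: "c \<in> A \<Longrightarrow> c' \<in> A \<Longrightarrow> z \<in> ov c c' \<Longrightarrow> J c c' z (flip a) (flip b) = cnj (J c c' z a b)"
  by (rule hol_change.jac_flip[OF hol_change])

text \<open>\<open>smooth_form\<close> without the normalization off the coordinate images.
  Operators such as \<open>fun_form\<close> and \<open>D01\<close> are not normalized there, so this
  is the class that they preserve; \<open>nrm\<close> restores the convention.\<close>

definition sform :: "('a, 'n) form \<Rightarrow> bool" where
  "sform u \<longleftrightarrow> (\<forall>c\<in>A. \<forall>z\<in>img c. alternating (u c z)) \<and> (\<forall>c\<in>A. lsm (img c) (u c)) \<and>
     (\<forall>c\<in>A. \<forall>c'\<in>A. \<forall>z\<in>ov c c'. u c z = pull (J c c' z) (u c' (tr c c' z)))"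

lemma sform_alt: "sform u \<Longrightarrow> c \<in> A \<Longrightarrow> z \<in> img c \<Longrightarrow> alternating (u c z)"
  and sform_lsm: "sform u \<Longrightarrow> c \<in> A \<Longrightarrow> lsm (img c) (u c)"
  and sform_pull: "sform u \<Longrightarrow> c \<in> A \<Longrightarrow> c' \<in> A \<Longrightarrow> z \<in> ov c c' \<Longrightarrow> u c z = pull (J c c' z) (u c' (tr c c' z))"
  unfolding sform_def by blast+

lemma sform_ldf: "sform u \<Longrightarrow> c \<in> A \<Longrightarrow> z \<in> img c \<Longrightarrow> ldf (u c) z"
  by (rule lsm_ldf[OF sform_lsm])

lemma sformI:
  assumes "\<And>c z. c \<in> A \<Longrightarrow> z \<in> img c \<Longrightarrow> alternating (u c z)" "\<And>c. c \<in> A \<Longrightarrow> lsm (img c) (u c)"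
    "\<And>c c' z. c \<in> A \<Longrightarrow> c' \<in> A \<Longrightarrow> z \<in> ov c c' \<Longrightarrow> u c z = pull (J c c' z) (u c' (tr c c' z))"
  shows "sform u"
  using assms by (auto simp: sform_def)

lemma smooth_form_iff: "smooth_form A u \<longleftrightarrow> sform u \<and> (\<forall>c z. c \<notin> A \<or> z \<notin> img c \<longrightarrow> u c z = 0)"
proof -
  have "(\<forall>c\<in>A. \<forall>c'\<in>A. \<forall>x\<in>cdom c \<inter> cdom c'. \<forall>as.
        u c (snd c x) as = (\<Sum>bs\<in>{bs. length bs = length as}.
             (\<Prod>i<length as. chart_jac c c' x (as ! i) (bs ! i)) * u c' (snd c' x) bs)) \<longleftrightarrow>
     (\<forall>c\<in>A. \<forall>c'\<in>A. \<forall>z\<in>ov c c'. u c z = pull (J c c' z) (u c' (tr c c' z)))"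
    by (auto simp: fun_eq_iff pull_def chart_jac_def jac_def inv_snd)
  then show ?thesis unfolding smooth_form_def sform_def lsm_def zero_fun_def by auto
qed

lemma form_eq_sform:
  assumes u: "sform u" and e: "form_eq A u v"
  shows "sform v"
proof (rule sformI)
  have e: "u c z = v c z" if "c \<in> A" "z \<in> img c" for c z using e that by (auto simp: form_eq_def)
  fix c assume c: "c \<in> A"
  show "lsm (img c) (v c)"
    using smooth_on_cong[OF open_img[OF c]] sform_lsm[OF u c] e[OF c] unfolding lsm_def by metis
  show "alternating (v c z)" if "z \<in> img c" for z using sform_alt[OF u c that] e[OF c that] by simp
  show "v c z = pull (J c c' z) (v c' (tr c c' z))" if "c' \<in> A" "z \<in> ov c c'" for c' z
    using sform_pull[OF u c that] e[OF c ov_img[OF c that(2)]] e[OF that(1) tr_img[OF c that]] by simp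
qed

definition nrm :: "('a, 'n) form \<Rightarrow> ('a, 'n) form" where
  "nrm u c z = (if c \<in> A \<and> z \<in> img c then u c z else 0)"

lemma form_eq_nrm: "form_eq A u (nrm u)"
  by (auto simp: form_eq_def nrm_def)

lemma form_eq_iff: "form_eq A u v \<longleftrightarrow> nrm u = nrm v"
  by (auto simp: form_eq_def nrm_def fun_eq_iff[where 'a = "('a, 'n) chart"] fun_eq_iff[where 'a = "complex ^ 'n"])

lemma smooth_nrm: "sform u \<Longrightarrow> smooth_form A (nrm u)"
  using form_eq_sform[OF _ form_eq_nrm] by (auto simp: smooth_form_iff nrm_def)

lemma smooth_sform: "smooth_form A u \<Longrightarrow> sform u"
  by (simp add: smooth_form_iff)

lemma nrm_smooth: "smooth_form A u \<Longrightarrow> nrm u = u"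
  by (auto simp: smooth_form_iff nrm_def fun_eq_iff[where 'a = "('a, 'n) chart"] fun_eq_iff[where 'a = "complex ^ 'n"])

subsection \<open>The metric in coordinates\<close>

lemma \<omega>_Lop: "c \<in> A \<Longrightarrow> z \<in> img c \<Longrightarrow> cwedge (\<omega> c z) \<beta> = Lop (hm c z) \<beta>"
proof -
  assume c: "c \<in> A" "z \<in> img c"
  have "cpart 1 1 (\<omega> c z) = \<omega> c z" using \<omega>11 by (metis pq_part_def)
  then have "\<omega> c z = Lop (hm c z) cunit"
    using form11_eq sform_alt[OF smooth_sform[OF smooth_\<omega>] c] by blast
  then show ?thesis using cwedge_Lop_cunit by metis
qed

lemma posdef_hm:
  assumes c: "c \<in> A" "z \<in> img c"
  shows "posdef (hm c z)"
proof -
  have "cnj (hm c z $ i $ j) = hm c z $ j $ i" for i j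
  proof -
    have "\<omega> c z [Inl i, Inr j] = cconj (\<omega> c z) [Inl i, Inr j]" using \<omega>_real by (metis conj_form_def)
    then have "cnj (\<omega> c z [Inl i, Inr j]) = \<omega> c z [Inr i, Inl j]" by (simp add: cconj_def)
    also have "\<dots> = - \<omega> c z [Inl j, Inr i]"
      using sform_alt[OF smooth_sform[OF smooth_\<omega>] c] unfolding alternating_def by (metis append_Nil)
    finally show ?thesis by (simp add: hmat_def)
  qed
  then show ?thesis using herm c unfolding posdef_def hermitian_manifold_def by blast
qed

lemma lmetric: "c \<in> A \<Longrightarrow> lmetric (img c) (hm c)"
proof -
  assume c: "c \<in> A"
  have "lsm (img c) (\<omega> c)" by (rule sform_lsm[OF smooth_sform[OF smooth_\<omega>] c])
  then have "smooth_on (img c) (\<lambda>z. hm c z $ i $ j)" for i j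
    by (auto simp: lsm_def hmat_def intro!: smooth_on_minus smooth_on_mult smooth_on_const open_img[OF c])
  moreover have "cnj (hm c z $ i $ j) = hm c z $ j $ i" "det (hm c z) \<noteq> 0" if "z \<in> img c" for z i j
    using posdef_hm[OF c that] posdef_det_nonzero[OF posdef_hm[OF c that]] unfolding posdef_def by blast+
  ultimately show ?thesis using open_img[OF c] by unfold_locales
qed

lemma hmetric: "c \<in> A \<Longrightarrow> z \<in> img c \<Longrightarrow> hmetric (hm c z) (gm c z)"
  using lmetric.hmetric[OF lmetric, of c z] by (simp add: lmetric.g_def[OF lmetric])

lemma smooth_gm: "c \<in> A \<Longrightarrow> smooth_on (img c) (\<lambda>z. gm c z $ i $ j)"
  using lmetric.smooth_g[OF lmetric, of c] by (simp add: lmetric.g_def[OF lmetric])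

lemma det_hm: "c \<in> A \<Longrightarrow> z \<in> img c \<Longrightarrow> 0 < Re (det (hm c z))"
  "c \<in> A \<Longrightarrow> z \<in> img c \<Longrightarrow> det (hm c z) = of_real (Re (det (hm c z)))"
  using posdef_det_pos hermitian_det_real posdef_hm unfolding posdef_def by blast+

lemma hm_pull:
  assumes c: "c \<in> A" "c' \<in> A" "z \<in> ov c c'"
  defines "T \<equiv> \<chi> j a. J c c' z (Inl j) (Inl a)" and "B \<equiv> \<chi> b k. J c c' z (Inr k) (Inr b)"
  shows "hm c z = T ** hm c' (tr c c' z) ** B"
proof -
  have J0: "J c c' z (Inl j) (Inr k) = 0" "J c c' z (Inr j) (Inl k) = 0" for j k
    using blockJ[OF c] by (auto simp: blockJ_def)
  have "\<omega> c z [Inl j, Inr k] = (\<Sum>a\<in>UNIV. \<Sum>b\<in>UNIV. J c c' z (Inl j) (Inl a) * (J c c' z (Inr k) (Inr b) * \<omega> c' (tr c c' z) [Inl a, Inr b]))" for j k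
  proof -
    have "\<omega> c z [Inl j, Inr k] = pull (J c c' z) (\<omega> c' (tr c c' z)) [Inl j, Inr k]"
      using sform_pull[OF smooth_sform[OF smooth_\<omega>] c] by simp
    then show ?thesis
      unfolding apply_Cons by (simp add: iot_pull sum_fun_apply csc_apply sum_UNIV_sum J0 sum_distrib_left)
  qed
  then have "hm c z $ j $ k = (T ** hm c' (tr c c' z) ** B) $ j $ k" for j k
    unfolding matrix_mul_assoc[symmetric]
    by (simp add: T_def B_def hmat_def matrix_matrix_mult_def sum_distrib_left mult_ac)
  then show ?thesis by (simp add: vec_eq_iff)
qed

text \<open>The Jacobian matrix enters once through \<partial>z and once, conjugated, through its
  conjugate. The resulting squared modulus is exactly the real Jacobian determinant of the
  transition map, so the coordinate volumes agree on overlaps.\<close>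

lemma det_hm_pull:
  assumes c: "c \<in> A" "c' \<in> A" "z \<in> ov c c'"
  shows "Re (det (hm c z)) = (cmod (det (\<chi> j a. J c c' z (Inl j) (Inl a))))\<^sup>2 * Re (det (hm c' (tr c c' z)))"
proof -
  let ?T = "\<chi> j a. J c c' z (Inl j) (Inl a)" and ?B = "\<chi> b k. J c c' z (Inr k) (Inr b)"
  have "?B = transpose (\<chi> j a. cnj (?T $ j $ a))"
    using J_flip[OF c, of "Inl _" "Inl _"] by (simp add: transpose_def)
  then have B: "det ?B = cnj (det ?T)" by (simp only: det_transpose) (simp add: det_def)
  have "det (hm c z) = det ?T * det (hm c' (tr c c' z)) * cnj (det ?T)"
    unfolding hm_pull[OF c] det_mul B ..
  also have "\<dots> = of_real ((cmod (det ?T))\<^sup>2) * det (hm c' (tr c c' z))"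
    unfolding complex_norm_square by (simp add: mult_ac)
  also have "\<dots> = of_real ((cmod (det ?T))\<^sup>2 * Re (det (hm c' (tr c c' z))))"
    by (subst det_hm(2)[OF c(2) tr_img[OF c]]) simp
  finally show ?thesis by (metis Re_complex_of_real)
qed

lemma gm_pull:
  assumes c: "c \<in> A" "c' \<in> A" "z \<in> ov c c'"
  shows "gm c' (tr c c' z) $ b' $ k' =
    (\<Sum>b\<in>UNIV. \<Sum>k\<in>UNIV. J c c' z (Inr b) (Inr b') * gm c z $ b $ k * J c c' z (Inl k) (Inl k'))"
proof -
  let ?T = "\<chi> j a. J c c' z (Inl j) (Inl a)" and ?B = "\<chi> b k. J c c' z (Inr k) (Inr b)"
  let ?h = "hm c z" and ?h' = "hm c' (tr c c' z)" and ?g = "gm c z" and ?g' = "gm c' (tr c c' z)"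
  have h: "?h = ?T ** ?h' ** ?B" by (rule hm_pull[OF c])
  have "det ?h \<noteq> 0" using posdef_det_nonzero[OF posdef_hm[OF c(1) ov_img[OF c(1,3)]]] .
  then have dB: "det ?B \<noteq> 0" unfolding h det_mul by simp
  have "?g ** (?T ** ?h' ** ?B) = mat 1" using matrix_inv_det(2)[OF \<open>det ?h \<noteq> 0\<close>] unfolding h .
  moreover have "?h' ** ?g' = mat 1"
    by (rule matrix_inv_det(1)[OF posdef_det_nonzero[OF posdef_hm[OF c(2) tr_img[OF c]]]])
  ultimately have "?g' = ?B ** (?g ** ?T)" using congruence_inverse dB by blast
  from arg_cong[OF this, of "\<lambda>m. m $ b' $ k'"] show ?thesis
    by (simp add: matrix_matrix_mult_def[of ?B] matrix_matrix_mult_def[of ?g] sum_distrib_left mult_ac)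
qed

lemma hin_pull':
  assumes c: "c \<in> A" "c' \<in> A" "z \<in> ov c c'"
  shows "hin (met (gm c z)) (pull (J c c' z) \<alpha>) (pull (J c c' z) \<beta>) = hin (met (gm c' (tr c c' z))) \<alpha> \<beta>"
proof (rule hin_pull)
  fix a b
  have J0: "J c c' z (Inl j) (Inr k) = 0" "J c c' z (Inr j) (Inl k) = 0" for j k
    using blockJ[OF c] by (auto simp: blockJ_def)
  have f: "cnj (J c c' z (Inl j) (Inl k)) = J c c' z (Inr j) (Inr k)"
    "cnj (J c c' z (Inr j) (Inr k)) = J c c' z (Inl j) (Inl k)" for j k
    using J_flip[OF c, of "Inl j" "Inl k"] J_flip[OF c, of "Inr j" "Inr k"] by simp_all
  show "met (gm c' (tr c c' z)) a b = (\<Sum>aa\<in>UNIV. \<Sum>ba\<in>UNIV. J c c' z aa a * met (gm c z) aa ba * cnj (J c c' z ba b))"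
    by (cases a; cases b) (simp_all add: sum_UNIV_sum gm_pull[OF c] f J0, subst sum.swap, simp add: mult_ac)
qed

lemma lam_pull':
  assumes c: "c \<in> A" "c' \<in> A" "z \<in> ov c c'"
  shows "lam (gm c z) (pull (J c c' z) \<alpha>) = pull (J c c' z) (lam (gm c' (tr c c' z)) \<alpha>)"
  by (rule lam_pull[OF blockJ[OF c] gm_pull[OF c]])

subsection \<open>Operations on smooth forms\<close>

lemma form_apply: "(u + v) c z = u c z + v c z" "(u - v) c z = u c z - v c z" "(- u) c z = - u c z"
  "(0 :: ('a, 'n) form) c z = 0"
  for u v :: "('a, 'n) form"
  by (simp_all add: plus_fun_def fun_diff_def fun_Compl_def zero_fun_def)

text \<open>For fibrewise operators: naturality under the Jacobian gives the transformation law, and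
  it need only be checked on alternating forms.\<close>

lemma sform_pointwise:
  assumes "sform u" "\<And>c z. c \<in> A \<Longrightarrow> z \<in> img c \<Longrightarrow> v c z = \<Phi> c z (u c z)"
    and "\<And>c z \<alpha>. c \<in> A \<Longrightarrow> z \<in> img c \<Longrightarrow> alternating \<alpha> \<Longrightarrow> alternating (\<Phi> c z \<alpha>)"
    and "\<And>c U. c \<in> A \<Longrightarrow> lsm (img c) U \<Longrightarrow> lsm (img c) (\<lambda>z. \<Phi> c z (U z))"
    and "\<And>c c' z \<alpha>. c \<in> A \<Longrightarrow> c' \<in> A \<Longrightarrow> z \<in> ov c c' \<Longrightarrow> alternating \<alpha> \<Longrightarrow>
       \<Phi> c z (pull (J c c' z) \<alpha>) = pull (J c c' z) (\<Phi> c' (tr c c' z) \<alpha>)"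
  shows "sform v"
proof -
  have "sform (\<lambda>c z. \<Phi> c z (u c z))"
    using assms(3)[OF _ _ sform_alt[OF assms(1)]] assms(4)[OF _ sform_lsm[OF assms(1)]]
  proof (rule sformI)
    fix c c' z assume c: "c \<in> A" "c' \<in> A" "z \<in> ov c c'"
    show "\<Phi> c z (u c z) = pull (J c c' z) (\<Phi> c' (tr c c' z) (u c' (tr c c' z)))"
      unfolding sform_pull[OF assms(1) c] by (rule assms(5)[OF c sform_alt[OF assms(1) c(2) tr_img[OF c]]])
  qed auto
  then show ?thesis by (rule form_eq_sform) (simp add: form_eq_def assms(2))
qed

lemma sform_add: "sform u \<Longrightarrow> sform v \<Longrightarrow> sform (u + v)"
proof (rule sformI)
  assume u: "sform u" "sform v"
  fix c assume c: "c \<in> A"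
  have "(u + v) c = (\<lambda>z. u c z + v c z)" by (simp add: plus_fun_def)
  then show "lsm (img c) ((u + v) c)" using lsm_add[OF open_img[OF c] sform_lsm[OF u(1) c] sform_lsm[OF u(2) c]] by (simp only:)
qed (simp_all add: form_apply sform_alt flip: sform_pull)

lemma sform_smooth_scale:
  assumes "sform u" "smooth_fun A f" "\<And>c z. c \<in> A \<Longrightarrow> z \<in> img c \<Longrightarrow> v c z = csc (f (chart_inv c z)) (u c z)"
  shows "sform v"
  by (rule sform_pointwise[where u = u and v = v and \<Phi> = "\<lambda>c z. csc (f (chart_inv c z))", OF assms(1,3)])
    (use assms(2) in \<open>auto simp: smooth_fun_def inv_tr intro!: lsm_csc open_img\<close>)

lemma fmult_csc: "fmult f u c z = csc (f (chart_inv c z)) (u c z)"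
  by (auto simp: fmult_def csc_def)

lemma sform_fmult: "sform u \<Longrightarrow> smooth_fun A f \<Longrightarrow> sform (fmult f u)"
  by (rule sform_smooth_scale) (auto simp: fmult_csc)

lemma smooth_fun_const: "smooth_fun A (\<lambda>_. k)"
  by (auto simp: smooth_fun_def intro: smooth_on_const open_img)

lemma sform_minus: "sform u \<Longrightarrow> sform (- u)"
  using sform_smooth_scale[OF _ smooth_fun_const[of "-1"], of u "- u"] by (simp add: form_apply csc_m1)

lemma sform_diff: "sform u \<Longrightarrow> sform v \<Longrightarrow> sform (u - v)"
  using sform_add[of u "- v"] sform_minus[of v] by simp

lemma sform_wedge: "sform u \<Longrightarrow> sform v \<Longrightarrow> sform (wedge u v)"
proof (rule sformI)
  assume u: "sform u" "sform v"
  fix c assume c: "c \<in> A"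
  have "wedge u v c = (\<lambda>z. cwedge (u c z) (v c z))" by (simp add: wedge_def fun_eq_iff)
  then show "lsm (img c) (wedge u v c)"
    using lsm_cwedge[OF open_img[OF c] sform_lsm[OF u(1) c] sform_lsm[OF u(2) c]] by (simp only:)
qed (simp_all add: wedge_def sform_alt pull_cwedge flip: sform_pull)

lemma sform_conj: "sform u \<Longrightarrow> sform (conj_form u)"
  by (rule sform_pointwise[where \<Phi> = "\<lambda>c z. cconj"])
    (auto simp: conj_form_def cconj_pull J_flip intro: lsm_cconj open_img)

lemma sform_np: "sform u \<Longrightarrow> sform (\<lambda>c z. np (u c z))"
  by (rule sform_pointwise[where \<Phi> = "\<lambda>c z. np"]) (auto simp: np_pull blockJ intro: lsm_np open_img)

lemma sform_lam: "sform u \<Longrightarrow> sform (\<lambda>c z. lam (gm c z) (u c z))"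
  by (rule sform_pointwise[where \<Phi> = "\<lambda>c z. lam (gm c z)"])
    (auto simp: lam_pull' intro: lsm_lam open_img smooth_gm)

lemma sform_ld:
  assumes u: "sform u" and P: "P = isl \<or> P = (\<lambda>a. \<not> isl a)"
  shows "sform (\<lambda>c. ld P (u c))"
proof (rule sformI)
  fix c assume c: "c \<in> A"
  show "lsm (img c) (ld P (u c))" by (rule lsm_ld[OF open_img[OF c] sform_lsm[OF u c]])
  show "alternating (ld P (u c) z)" if "z \<in> img c" for z
    by (rule alternating_ld[OF sform_alt[OF u c] open_img[OF c] that sform_ldf[OF u c that]])
  show "ld P (u c) z = pull (J c c' z) (ld P (u c') (tr c c' z))" if c': "c' \<in> A" and z: "z \<in> ov c c'" for c' z
  proof -
    have "ld P (u c) z = ld P (\<lambda>w. pull (J c c' w) (u c' (tr c c' w))) z"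
      by (rule ld_cong[OF open_ov[OF c c'] z sform_pull[OF u c c'] sform_ldf[OF u c ov_img[OF c z]]])
    also have "\<dots> = pull (J c c' z) (ld P (u c') (tr c c' z))"
      by (rule hol_change.ld_pull[OF hol_change[OF c c'] z
        sform_ldf[OF u c' tr_img[OF c c' z]] sform_alt[OF u c' tr_img[OF c c' z]] P])
    finally show ?thesis .
  qed
qed

lemma sform_del: "sform u \<Longrightarrow> sform (del u)" and sform_delbar: "sform u \<Longrightarrow> sform (delbar u)"
  by (rule form_eq_sform[OF sform_ld[where P = isl]], auto simp: form_eq_def del_ld)
    (rule form_eq_sform[OF sform_ld[where P = "\<lambda>a. \<not> isl a"]], auto simp: form_eq_def delbar_ld)

lemma fun_form_cunit: "fun_form f c z = csc (f (chart_inv c z)) cunit"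
  by (auto simp: fun_form_def csc_def cunit_def)

lemma sform_fun_form:
  assumes "smooth_fun A f"
  shows "sform (fun_form f)"
proof -
  have "pull J' cunit = cunit" for J' :: "'n + 'n \<Rightarrow> _" by (rule cform_eqI) (auto simp: iot_pull)
  then have "sform (\<lambda>c z. cunit)"
    by (intro sformI) (auto simp: lsm_def smooth_on_const open_img)
  then show ?thesis by (rule sform_smooth_scale[OF _ assms]) (simp add: fun_form_cunit)
qed

lemma smooth_\<omega>': "sform \<omega>" by (rule smooth_sform[OF smooth_\<omega>])

end

section \<open>Integration\<close>

lemma integrable_compact_support:
  fixes f :: "'v::euclidean_space \<Rightarrow> complex"
  assumes "continuous_on K f" "compact K" "\<And>z. z \<notin> K \<Longrightarrow> f z = 0"
  shows "integrable lborel f"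
proof -
  have "(\<lambda>z. indicator K z *\<^sub>R f z) = f" using assms(3) by (auto simp: indicator_def fun_eq_iff)
  then show ?thesis using borel_integrable_compact[OF assms(2,1)] by simp
qed

lemma fd_eq_0:
  fixes f :: "'v::euclidean_space \<Rightarrow> complex"
  assumes "closed K" "\<And>z. z \<notin> K \<Longrightarrow> f z = 0" "z \<notin> K"
  shows "fd f z v = 0"
proof -
  have "(f has_derivative (\<lambda>_. 0)) (at z)"
    by (rule has_derivative_transform_within_open[where f = "\<lambda>_. 0" and s = "- K"])
      (use assms in \<open>auto simp: open_Compl\<close>)
  then show ?thesis by (metis frechet_derivative_at)
qed

text \<open>By translation invariance every difference quotient has integral 0, and dominated
  convergence passes this on to the derivative. No iterated integrals are needed.\<close>

lemma integral_fd_zero: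
  fixes f :: "'v::euclidean_space \<Rightarrow> complex"
  assumes f: "smooth_on UNIV f" and K: "compact K" and f0: "\<And>z. z \<notin> K \<Longrightarrow> f z = 0"
  shows "integrable lborel (\<lambda>z. fd f z v)" "(LINT z|lborel. fd f z v) = 0"
proof -
  have cf: "continuous_on UNIV f" and cd: "continuous_on UNIV (\<lambda>z. fd f z v)"
    using f smooth_on_deriv by (auto intro: smooth_on_continuous)
  have d0: "fd f z v = 0" if "z \<notin> K" for z by (rule fd_eq_0[OF compact_imp_closed[OF K] f0 that])
  have D: "(f has_derivative fd f z) (at z)" for z by (rule smooth_onD[OF f]) simp
  show int_d: "integrable lborel (\<lambda>z. fd f z v)"
    by (rule integrable_compact_support[OF continuous_on_subset[OF cd] K d0]) auto
  have int_f: "integrable lborel f"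
    by (rule integrable_compact_support[OF continuous_on_subset[OF cf] K f0]) auto
  show "(LINT z|lborel. fd f z v) = 0"
  proof (cases "v = 0")
    case True
    have "fd f z 0 = 0" for z using D[of z] by (simp add: has_derivative_def bounded_linear.linear linear_0)
    then show ?thesis using True by simp
  next
    case v: False
    obtain B where B: "\<And>z. norm (fd f z v) \<le> B" "B \<ge> 0"
    proof -
      have "bounded ((\<lambda>z. fd f z v) ` K)"
        by (intro compact_imp_bounded compact_continuous_image continuous_on_subset[OF cd] K) auto
      then obtain b where b: "\<And>z. z \<in> K \<Longrightarrow> norm (fd f z v) \<le> b" by (auto simp: bounded_iff)
      have "norm (fd f z v) \<le> max b 0" for z using b[of z] d0[of z] by (cases "z \<in> K") auto
      then show ?thesis using that[of "max b 0"] by auto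
    qed
    have bound: "norm (f (z + t *\<^sub>R v) - f z) \<le> B * t" if "t \<ge> 0" for z t
    proof -
      have "norm (f (z + t *\<^sub>R v) - f (z + 0 *\<^sub>R v)) \<le> B * norm (t - 0)"
      proof (rule differentiable_bound[where S = "{0..t}" and f = "\<lambda>s. f (z + s *\<^sub>R v)"])
        fix s assume "s \<in> {0..t}"
        have "((\<lambda>s. f (z + s *\<^sub>R v)) has_derivative (\<lambda>h. fd f (z + s *\<^sub>R v) (h *\<^sub>R v))) (at s within {0..t})"
          by (rule has_derivative_compose[OF _ D]) (auto intro!: derivative_eq_intros)
        moreover have "fd f w (h *\<^sub>R v) = h *\<^sub>R fd f w v" for w h
          using D[of w] by (simp add: has_derivative_def bounded_linear.linear linear_cmul)
        ultimately show "((\<lambda>s. f (z + s *\<^sub>R v)) has_derivative (\<lambda>h. h *\<^sub>R fd f (z + s *\<^sub>R v) v)) (at s within {0..t})" by simp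
        show "onorm (\<lambda>h. h *\<^sub>R fd f (z + s *\<^sub>R v) v) \<le> B"
          by (rule onorm_le) (use B in \<open>simp add: mult.commute[of B] mult_left_mono\<close>)
      qed (use that in auto)
      then show ?thesis using that by simp
    qed
    define h where "h = (\<lambda>i. (1 / real (Suc i)) *\<^sub>R v)"
    define s where "s = (\<lambda>i z. real (Suc i) *\<^sub>R (f (z + h i) - f z))"
    obtain R where R: "\<And>z. z \<in> K \<Longrightarrow> norm z \<le> R"
      using compact_imp_bounded[OF K] by (auto simp: bounded_iff)
    have trans: "integrable lborel (\<lambda>z. f (z + c))" "(LINT z|lborel. f (z + c)) = (LINT z|lborel. f z)" for c
    proof -
      have m: "(+) c \<in> measurable lborel borel" by simp
      have fm: "f \<in> borel_measurable borel" using cf by (rule borel_measurable_continuous_onI)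
      have "integrable (distr lborel borel ((+) c)) f" using int_f by (simp add: lborel_distr_plus)
      then show "integrable lborel (\<lambda>z. f (z + c))" by (simp add: integrable_distr_eq[OF m fm] add.commute)
      have "(LINT z|distr lborel borel ((+) c). f z) = (LINT z|lborel. f (c + z))" by (rule integral_distr[OF m fm])
      then show "(LINT z|lborel. f (z + c)) = (LINT z|lborel. f z)" by (simp add: lborel_distr_plus add.commute)
    qed
    have "(\<lambda>i. LINT z|lborel. s i z) \<longlonglongrightarrow> (LINT z|lborel. fd f z v)"
    \<comment> \<open>The mean value bound gives the constant B. The increments \<open>h i\<close>
      are no longer than \<open>v\<close>, so all quotients vanish outside the ball of radius
      \<open>R + norm v\<close>.\<close>
    proof (rule integral_dominated_convergence[where w = "\<lambda>z. indicator (cball 0 (R + norm v)) z *\<^sub>R B"])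
      show "(\<lambda>z. fd f z v) \<in> borel_measurable lborel" using int_d by simp
      show "s i \<in> borel_measurable lborel" for i
        unfolding s_def using borel_measurable_integrable[OF trans(1)[of "h i"]] borel_measurable_integrable[OF int_f] by measurable
      show "integrable lborel (\<lambda>z. indicator (cball 0 (R + norm v)) z *\<^sub>R B)"
        by (rule borel_integrable_compact) auto
      show "AE z in lborel. (\<lambda>i. s i z) \<longlonglongrightarrow> fd f z v"
      proof (rule AE_I2)
        fix z
        have "filterlim h (at 0) sequentially"
        proof -
          have "h \<longlonglongrightarrow> 0 *\<^sub>R v" unfolding h_def by (intro tendsto_scaleR LIMSEQ_Suc[OF lim_1_over_n] tendsto_const)
          then show ?thesis using v by (auto simp: filterlim_at h_def)
        qed
        moreover have "((\<lambda>h. norm (f (z + h) - f z - fd f z h) / norm h) \<longlongrightarrow> 0) (at 0)"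
          using D[of z] by (simp add: has_derivative_at)
        ultimately have "(\<lambda>i. norm (f (z + h i) - f z - fd f z (h i)) / norm (h i)) \<longlonglongrightarrow> 0"
          by (rule filterlim_compose[rotated])
        then have "(\<lambda>i. norm (f (z + h i) - f z - fd f z (h i)) / norm (h i) * norm v) \<longlonglongrightarrow> 0 * norm v"
          by (intro tendsto_mult tendsto_const)
        moreover have "norm (f (z + h i) - f z - fd f z (h i)) / norm (h i) * norm v = norm (s i z - fd f z v)" for i
        proof -
          have "fd f z (h i) = (1 / real (Suc i)) *\<^sub>R fd f z v"
            unfolding h_def using D[of z] by (simp add: has_derivative_def bounded_linear.linear linear_cmul)
          then have "s i z - fd f z v = real (Suc i) *\<^sub>R (f (z + h i) - f z - fd f z (h i))"
            by (simp add: s_def scaleR_right_diff_distrib)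
          then have "norm (s i z - fd f z v) = real (Suc i) * norm (f (z + h i) - f z - fd f z (h i))"
            by (simp del: of_nat_Suc)
          moreover have "norm v = real (Suc i) * norm (h i)" by (simp add: h_def)
          moreover have "norm (h i) \<noteq> 0" using v by (simp add: h_def)
          ultimately show ?thesis by (simp only:) simp
        qed
        ultimately have "(\<lambda>i. norm (s i z - fd f z v)) \<longlonglongrightarrow> 0" by simp
        then show "(\<lambda>i. s i z) \<longlonglongrightarrow> fd f z v"
          unfolding tendsto_norm_zero_iff LIM_zero_iff .
      qed
      show "AE z in lborel. norm (s i z) \<le> indicator (cball 0 (R + norm v)) z *\<^sub>R B" for i
      proof (rule AE_I2)
        fix z
        have "norm (s i z) \<le> B"
          using bound[of "1 / real (Suc i)" z] by (simp add: s_def h_def pos_le_divide_eq mult.commute del: of_nat_Suc)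
        moreover have "s i z = 0" if "norm z > R + norm v"
        proof -
          have "norm (h i) \<le> norm v" by (simp add: h_def divide_le_eq mult_le_cancel_left1)
          then have "norm (z + h i) > R" using that norm_triangle_ineq4[of "z + h i" "h i"] by simp
          moreover have "norm z > R" using that norm_ge_zero[of v] by linarith
          ultimately have "z + h i \<notin> K" "z \<notin> K" using R[of "z + h i"] R[of z] by auto
          then show ?thesis by (simp add: s_def f0)
        qed
        ultimately show "norm (s i z) \<le> indicator (cball 0 (R + norm v)) z *\<^sub>R B"
          by (auto simp: indicator_def)
      qed
    qed
    moreover have "(LINT z|lborel. s i z) = 0" for i
      unfolding s_def using trans[of "h i"] int_f by (simp del: of_nat_Suc)
    ultimately show ?thesis by (simp add: LIMSEQ_const_iff)
  qed
qed

lemma integral_wirtinger_zero: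
  fixes f :: "complex ^ 'n::finite \<Rightarrow> complex"
  assumes "smooth_on UNIV f" "compact K" "\<And>z. z \<notin> K \<Longrightarrow> f z = 0"
  shows "integrable lborel (wirtinger a f)" "(LINT z|lborel. wirtinger a f z) = 0"
proof -
  note * = integral_fd_zero[OF assms]
  have "integrable lborel (\<lambda>z. wirtinger a f z) \<and> (LINT z|lborel. wirtinger a f z) = 0"
    using * by (cases a) (simp_all)
  then show "integrable lborel (wirtinger a f)" "(LINT z|lborel. wirtinger a f z) = 0" by auto
qed

context herm
begin

section \<open>The volume measure in charts\<close>

abbreviation "vol \<equiv> volume A \<omega>"

definition wt :: "('a, 'n) chart \<Rightarrow> complex ^ 'n \<Rightarrow> real" where
  "wt c z = 2 ^ CARD('n) * Re (det (hm c z))"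

lemma wt_pos: "c \<in> A \<Longrightarrow> z \<in> img c \<Longrightarrow> 0 < wt c z"
  by (simp add: wt_def det_hm(1))

lemma wt_continuous: "c \<in> A \<Longrightarrow> continuous_on (img c) (wt c)"
proof -
  assume c: "c \<in> A"
  have "smooth_on (img c) (\<lambda>z. det (hm c z))"
    by (rule smooth_on_det[OF open_img[OF c] lmetric.smooth_h[OF lmetric[OF c]]])
  then show ?thesis unfolding wt_def[abs_def] by (intro continuous_intros smooth_on_continuous)
qed

lemma chart_volume_wt: "chart_volume \<omega> c =
    distr (density (restrict_space lborel (img c)) (\<lambda>z. ennreal (wt c z))) borel (chart_inv c)"
  by (simp add: chart_volume_def wt_def)

lemma sets_chart_volume [simp]: "sets (chart_volume \<omega> c) = sets borel"
  by (simp add: chart_volume_def)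

lemma space_chart_volume [simp]: "space (chart_volume \<omega> c) = UNIV"
  by (simp add: chart_volume_def)

lemma inv_measurable: "c \<in> A \<Longrightarrow> chart_inv c \<in> borel_measurable (restrict_space lborel (img c))"
  using borel_measurable_continuous_on_restrict[OF inv_continuous]
  by (simp add: measurable_def space_restrict_space sets_restrict_space)

lemma wt_measurable: "c \<in> A \<Longrightarrow> wt c \<in> borel_measurable (restrict_space lborel (img c))"
  using borel_measurable_continuous_on_restrict[OF wt_continuous]
  by (simp add: measurable_def space_restrict_space sets_restrict_space)

lemma img_sets: "c \<in> A \<Longrightarrow> img c \<inter> space lborel \<in> sets lborel"
  using open_img by simp

lemma snd_image_sets: "c \<in> A \<Longrightarrow> B \<in> sets borel \<Longrightarrow> B \<subseteq> cdom c \<Longrightarrow> snd c ` B \<in> sets borel"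
proof -
  assume c: "c \<in> A" and B: "B \<in> sets borel" "B \<subseteq> cdom c"
  have "snd c ` B = chart_inv c -` B \<inter> space (restrict_space lborel (img c))"
  proof (intro equalityI subsetI)
    fix z assume "z \<in> chart_inv c -` B \<inter> space (restrict_space lborel (img c))"
    then show "z \<in> snd c ` B" using snd_inv[OF c, of z] by (auto simp: space_restrict_space intro: rev_image_eqI)
  qed (use B snd_img[OF c] inv_snd[OF c] in \<open>auto simp: space_restrict_space\<close>)
  moreover have "chart_inv c -` B \<inter> space (restrict_space lborel (img c)) \<in> sets (restrict_space lborel (img c))"
    by (rule measurable_sets[OF inv_measurable[OF c] B(1)])
  ultimately have "snd c ` B \<in> sets (restrict_space lborel (img c))" by simp
  then show ?thesis using img_sets[OF c] by (simp add: sets_restrict_space_iff)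
qed

lemma emeasure_chart_volume:
  assumes c: "c \<in> A" and B: "B \<in> sets borel"
  shows "emeasure (chart_volume \<omega> c) B = (\<integral>\<^sup>+z. ennreal (wt c z) * indicator (snd c ` (B \<inter> cdom c)) z \<partial>lborel)"
proof -
  let ?M = "restrict_space lborel (img c)"
  have m: "chart_inv c \<in> measurable (density ?M (\<lambda>z. ennreal (wt c z))) borel"
    using inv_measurable[OF c] by (simp add: measurable_def)
  have s: "chart_inv c -` B \<inter> space ?M \<in> sets ?M" by (rule measurable_sets[OF inv_measurable[OF c] B])
  have "emeasure (chart_volume \<omega> c) B = emeasure (density ?M (\<lambda>z. ennreal (wt c z))) (chart_inv c -` B \<inter> space ?M)"
    unfolding chart_volume_wt using emeasure_distr[OF m B] by simp
  also have "\<dots> = (\<integral>\<^sup>+z. ennreal (wt c z) * indicator (chart_inv c -` B \<inter> space ?M) z \<partial>?M)"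
    by (rule emeasure_density[OF _ s]) (use wt_measurable[OF c] in measurable)
  also have "\<dots> = (\<integral>\<^sup>+z. ennreal (wt c z) * indicator (chart_inv c -` B \<inter> space ?M) z * indicator (img c) z \<partial>lborel)"
    by (rule nn_integral_restrict_space[OF img_sets[OF c]])
  also have "\<dots> = (\<integral>\<^sup>+z. ennreal (wt c z) * indicator (snd c ` (B \<inter> cdom c)) z \<partial>lborel)"
  proof (rule nn_integral_cong)
    fix z
    have "z \<in> snd c ` (B \<inter> cdom c) \<longleftrightarrow> z \<in> img c \<and> chart_inv c z \<in> B"
    proof
      assume "z \<in> img c \<and> chart_inv c z \<in> B"
      then show "z \<in> snd c ` (B \<inter> cdom c)"
        using snd_inv[OF c, of z] inv_dom[OF c, of z] by (auto intro!: rev_image_eqI[of "chart_inv c z"])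
    qed (use snd_img[OF c] inv_snd[OF c] in auto)
    then show "ennreal (wt c z) * indicator (chart_inv c -` B \<inter> space ?M) z * indicator (img c) z
      = ennreal (wt c z) * indicator (snd c ` (B \<inter> cdom c)) z"
      by (auto simp: indicator_def space_restrict_space)
  qed
  finally show ?thesis .
qed

text \<open>The transition map changes Lebesgue measure by the factor by which \<open>det h\<close>
  changes in the opposite sense, so the two densities describe the same measure.\<close>

lemma chart_volume_overlap:
  assumes c: "c \<in> A" "c' \<in> A" and B: "B \<in> sets borel" "B \<subseteq> cdom c \<inter> cdom c'"
  shows "emeasure (chart_volume \<omega> c) B = emeasure (chart_volume \<omega> c') B"
proof -
  have Bc: "B \<inter> cdom c = B" "B \<inter> cdom c' = B" using B(2) by auto
  have im: "tr c c' ` (snd c ` B) = snd c' ` B"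
    unfolding image_image using B(2) inv_snd[OF c(1)] by (intro image_cong) auto
  have "homeomorphism (ov c c') (ov c' c) (tr c c') (tr c' c)"
    unfolding homeomorphism_def
  proof (intro conjI ballI)
    show "tr c' c (tr c c' z) = z" if "z \<in> ov c c'" for z
      using that inv_snd[OF c(1)] inv_snd[OF c(2)] by auto
    show "tr c c' (tr c' c z) = z" if "z \<in> ov c' c" for z
      using that inv_snd[OF c(1)] inv_snd[OF c(2)] by auto
    show "tr c c' ` ov c c' = ov c' c"
      unfolding image_image Int_commute[of "cdom c'"] using inv_snd[OF c(1)] by (intro image_cong) auto
    show "tr c' c ` ov c' c = ov c c'"
      unfolding image_image Int_commute[of "cdom c'"] using inv_snd[OF c(2)] by (intro image_cong) auto
    show "continuous_on (ov c c') (tr c c')" "continuous_on (ov c' c) (tr c' c)"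
      using hol_change.smooth_F[OF hol_change[OF c]] hol_change.smooth_F[OF hol_change[OF c(2,1)]]
      by (auto intro: smooth_on_continuous)
  qed
  note ho = this
  have "(\<integral>\<^sup>+w. ennreal (wt c' w) * indicator (snd c' ` B) w \<partial>lborel)
    = (\<integral>\<^sup>+z. ennreal ((cmod (det (\<chi> j k. J c c' z (Inl j) (Inl k))))\<^sup>2 * wt c' (tr c c' z)) * indicator (snd c ` B) z \<partial>lborel)"
    unfolding im[symmetric]
  proof (rule nn_integral_cov_holomorphic[OF hol_change.hol_F[OF hol_change[OF c]] ho open_ov[OF c] open_ov[OF c(2,1)]])
    show "snd c ` B \<subseteq> ov c c'" using B(2) by (intro image_mono) auto
    show "snd c ` B \<in> sets borel" using snd_image_sets[OF c(1) B(1)] B(2) by blast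
    show "continuous_on (ov c' c) (wt c')"
      by (rule continuous_on_subset[OF wt_continuous[OF c(2)]]) (use ov_img[OF c(2)] in blast)
    show "0 \<le> wt c' w" if "w \<in> ov c' c" for w
      using wt_pos[OF c(2) ov_img[OF c(2) that]] by simp
  qed
  also have "\<dots> = (\<integral>\<^sup>+z. ennreal (wt c z) * indicator (snd c ` B) z \<partial>lborel)"
  proof (rule nn_integral_cong)
    fix z
    show "ennreal ((cmod (det (\<chi> j k. J c c' z (Inl j) (Inl k))))\<^sup>2 * wt c' (tr c c' z)) * indicator (snd c ` B) z
      = ennreal (wt c z) * indicator (snd c ` B) z"
    proof (cases "z \<in> snd c ` B")
      case True
      then have "z \<in> ov c c'" using B(2) by auto
      from det_hm_pull[OF c this] show ?thesis by (simp add: wt_def mult_ac)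
    qed simp
  qed
  finally show ?thesis
    unfolding emeasure_chart_volume[OF c(1) B(1)] emeasure_chart_volume[OF c(2) B(1)] Bc by simp
qed

lemma sets_volume [simp]: "sets vol = sets borel"
proof -
  have "\<exists>c\<in>A. undefined \<in> cdom c" by (rule covers)
  then have ne: "A \<noteq> {}" by blast
  show ?thesis unfolding volume_def
    by (rule sets_SUP[where M = "chart_volume \<omega>", OF sets_chart_volume ne])
qed

lemma space_volume [simp]: "space vol = UNIV"
  using sets_eq_imp_space_eq[OF sets_volume] by simp

text \<open>An upper bound of the chart measures that restricts to each of them is glued from countably many
  of them along a partition.\<close>

lemma volume_chart:
  assumes c: "c \<in> A" and B: "B \<in> sets borel" "B \<subseteq> cdom c"
  shows "emeasure vol B = emeasure (chart_volume \<omega> c) B"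
proof -
  obtain F where F: "F \<subseteq> cdom ` A" "countable F" "\<Union>F = (\<Union>c\<in>A. cdom c)"
    by (rule Lindelof[of "cdom ` A"]) (use open_dom in auto)
  have U: "\<Union>F = UNIV" using F(3) covers by auto
  then have "F \<noteq> {}" by auto
  have "\<forall>i. \<exists>d\<in>A. cdom d = from_nat_into F i"
  proof
    fix i
    have "from_nat_into F i \<in> cdom ` A" using from_nat_into[OF \<open>F \<noteq> {}\<close>] F(1) by blast
    then show "\<exists>d\<in>A. cdom d = from_nat_into F i" by auto
  qed
  then obtain d where d: "\<And>i. d i \<in> A" "\<And>i. cdom (d i) = from_nat_into F i" by metis
  define P where "P = disjointed (\<lambda>i. cdom (d i))"
  have "(\<Union>i. cdom (d i)) = UNIV"
    using range_from_nat_into[OF \<open>F \<noteq> {}\<close> F(2)] U by (simp add: d(2))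
  then have P: "disjoint_family P" "(\<Union>i. P i) = UNIV" "\<And>i. P i \<subseteq> cdom (d i)"
    unfolding P_def UN_disjointed_eq
    by (auto simp: disjoint_family_disjointed disjointed_def)
  have Pm: "P i \<in> sets borel" for i
    unfolding P_def using open_dom[OF d(1)] by (auto simp: disjointed_def)
  \<comment> \<open>The sum over the pieces is written as an integral over the counting measure, so
    that exchanging it with the sum of countable additivity is
    \<open>nn_integral_suminf\<close>.\<close>
  define \<mu> where "\<mu> = (\<lambda>B. \<integral>\<^sup>+i. emeasure (chart_volume \<omega> (d i)) (B \<inter> P i) \<partial>count_space UNIV)"
  define N where "N = measure_of (UNIV :: 'a set) (sets borel) \<mu>"
  have sN: "sets N = sets borel" "space N = UNIV"
    unfolding N_def using sets.sets_measure_of_eq[of "borel :: 'a measure"] by simp_all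
  have emN: "emeasure N X = \<mu> X" if "X \<in> sets borel" for X
    unfolding N_def
  proof (rule emeasure_measure_of_sigma)
    show "sigma_algebra UNIV (sets (borel :: 'a measure))" using sets.sigma_algebra_axioms[of "borel :: 'a measure"] by simp
    show "positive (sets borel) \<mu>" by (simp add: positive_def \<mu>_def)
    show "countably_additive (sets borel) \<mu>"
      unfolding countably_additive_def
    proof (intro allI impI)
      fix X :: "nat \<Rightarrow> 'a set" assume X: "range X \<subseteq> sets borel" "disjoint_family X" "(\<Union>i. X i) \<in> sets borel"
      have "(\<Sum>n. \<mu> (X n)) = (\<integral>\<^sup>+i. (\<Sum>n. emeasure (chart_volume \<omega> (d i)) (X n \<inter> P i)) \<partial>count_space UNIV)"
        unfolding \<mu>_def by (rule nn_integral_suminf[symmetric]) simp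
      also have "\<dots> = \<mu> (\<Union>i. X i)"
        unfolding \<mu>_def
      proof (rule nn_integral_cong)
        fix i
        have "disjoint_family (\<lambda>n. X n \<inter> P i)" using X(2) by (auto simp: disjoint_family_on_def)
        then show "(\<Sum>n. emeasure (chart_volume \<omega> (d i)) (X n \<inter> P i)) = emeasure (chart_volume \<omega> (d i)) ((\<Union>n. X n) \<inter> P i)"
          using X(1) Pm by (subst suminf_emeasure) auto
      qed
      finally show "(\<Sum>n. \<mu> (X n)) = \<mu> (\<Union>i. X i)" .
    qed
  qed (rule that)
  have local: "\<mu> X = emeasure (chart_volume \<omega> c') X" if X: "c' \<in> A" "X \<in> sets borel" "X \<subseteq> cdom c'" for c' X
  proof -
    have "\<mu> X = (\<Sum>i. emeasure (chart_volume \<omega> (d i)) (X \<inter> P i))" unfolding \<mu>_def nn_integral_count_space_nat ..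
    also have "\<dots> = (\<Sum>i. emeasure (chart_volume \<omega> c') (X \<inter> P i))"
    proof (rule arg_cong[where f = suminf], rule ext)
      fix i show "emeasure (chart_volume \<omega> (d i)) (X \<inter> P i) = emeasure (chart_volume \<omega> c') (X \<inter> P i)"
        by (rule chart_volume_overlap[OF d(1) X(1)]) (use X Pm P(3)[of i] in auto)
    qed
    also have "\<dots> = emeasure (chart_volume \<omega> c') (\<Union>i. X \<inter> P i)"
      by (rule suminf_emeasure) (use X Pm in auto, rule disjoint_family_subset[OF P(1)], auto)
    also have "(\<Union>i. X \<inter> P i) = X" using P(2) by auto
    finally show ?thesis .
  qed
  have le: "chart_volume \<omega> c' \<le> N" if c': "c' \<in> A" for c'
    unfolding le_measure[of "chart_volume \<omega> c'" N, unfolded sets_chart_volume sN, OF refl]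
  proof
    fix X :: "'a set" assume X: "X \<in> sets borel"
    have Xc: "X \<inter> cdom c' \<in> sets borel" using X open_dom[OF c'] by auto
    have "emeasure (chart_volume \<omega> c') X = emeasure (chart_volume \<omega> c') (X \<inter> cdom c')"
      unfolding emeasure_chart_volume[OF c' X] emeasure_chart_volume[OF c' Xc] by (simp add: Int_assoc)
    also have "\<dots> = emeasure N (X \<inter> cdom c')" using local[OF c' Xc] emN[OF Xc] by simp
    also have "\<dots> \<le> emeasure N X" by (rule emeasure_mono) (use X sN in auto)
    finally show "emeasure (chart_volume \<omega> c') X \<le> emeasure N X" .
  qed
  have "vol \<le> N" unfolding volume_def using le by (rule SUP_least)
  then have "emeasure vol B \<le> emeasure N B" using B(1) le_measure[of vol N] sN by simp
  also have "\<dots> = emeasure (chart_volume \<omega> c) B" using emN[OF B(1)] local[OF c B] by simp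
  finally have 1: "emeasure vol B \<le> emeasure (chart_volume \<omega> c) B" .
  have "chart_volume \<omega> c \<le> vol" unfolding volume_def by (rule SUP_upper[OF c])
  then have "emeasure (chart_volume \<omega> c) B \<le> emeasure vol B" using B(1) le_measure[of "chart_volume \<omega> c" vol] by simp
  with 1 show ?thesis by (rule antisym)
qed

lemma integral_volume_chart:
  fixes f :: "'a \<Rightarrow> complex"
  assumes c: "c \<in> A" and f0: "\<And>x. x \<notin> cdom c \<Longrightarrow> f x = 0"
    and cont: "continuous_on (img c) (\<lambda>z. f (chart_inv c z))"
  shows "integrable vol f \<longleftrightarrow> integrable lborel (\<lambda>z. indicator (img c) z *\<^sub>R (wt c z *\<^sub>R f (chart_inv c z)))"
    "(LINT x|vol. f x) = (LINT z|lborel. indicator (img c) z *\<^sub>R (wt c z *\<^sub>R f (chart_inv c z)))"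
proof -
  let ?R = "restrict_space lborel (img c)" and ?V = "chart_volume \<omega> c"
  have U: "cdom c \<inter> space vol \<in> sets vol" "cdom c \<inter> space ?V \<in> sets ?V" using open_dom[OF c] by simp_all
  have "continuous_on (cdom c) (\<lambda>x. f (chart_inv c (snd c x)))"
    by (rule continuous_on_compose2[OF cont snd_continuous[OF c]]) (use snd_img[OF c] in auto)
  then have "continuous_on (cdom c) f" using inv_snd[OF c] by simp
  then have "(\<lambda>x. indicator (cdom c) x *\<^sub>R f x) \<in> borel_measurable borel"
    using open_dom[OF c] by (intro borel_measurable_continuous_on_indicator) auto
  moreover have fi: "(\<lambda>x. indicator (cdom c) x *\<^sub>R f x) = f" using f0 by (auto simp: fun_eq_iff indicator_def)
  ultimately have fm: "f \<in> borel_measurable borel" by simp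
  have rs: "restrict_space vol (cdom c) = restrict_space ?V (cdom c)"
  proof (rule measure_eqI)
    show "sets (restrict_space vol (cdom c)) = sets (restrict_space ?V (cdom c))" by (simp add: sets_restrict_space)
    fix X assume "X \<in> sets (restrict_space vol (cdom c))"
    then have X: "X \<subseteq> cdom c" "X \<in> sets borel" using U(1) by (auto simp: sets_restrict_space_iff)
    then show "emeasure (restrict_space vol (cdom c)) X = emeasure (restrict_space ?V (cdom c)) X"
      using volume_chart[OF c X(2,1)] U by (simp add: emeasure_restrict_space)
  qed
  have m: "chart_inv c \<in> measurable (density ?R (\<lambda>z. ennreal (wt c z))) borel"
    using inv_measurable[OF c] by (simp add: measurable_def)
  have fm': "(\<lambda>z. f (chart_inv c z)) \<in> borel_measurable ?R"
    using measurable_compose[OF inv_measurable[OF c] fm] .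
  have nn: "AE z in ?R. 0 \<le> wt c z" using wt_pos[OF c] by (intro AE_I2) (auto simp: space_restrict_space less_imp_le)
  have "integrable vol f \<longleftrightarrow> integrable (restrict_space vol (cdom c)) f"
    unfolding integrable_restrict_space[OF U(1)] fi ..
  also have "\<dots> \<longleftrightarrow> integrable ?V f"
    unfolding rs integrable_restrict_space[OF U(2)] fi ..
  also have "\<dots> \<longleftrightarrow> integrable ?R (\<lambda>z. wt c z *\<^sub>R f (chart_inv c z))"
    unfolding chart_volume_wt integrable_distr_eq[OF m fm] by (rule integrable_density[OF fm' wt_measurable[OF c] nn])
  also have "\<dots> \<longleftrightarrow> integrable lborel (\<lambda>z. indicator (img c) z *\<^sub>R (wt c z *\<^sub>R f (chart_inv c z)))"
    by (rule integrable_restrict_space[OF img_sets[OF c]])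
  finally show "integrable vol f \<longleftrightarrow> integrable lborel (\<lambda>z. indicator (img c) z *\<^sub>R (wt c z *\<^sub>R f (chart_inv c z)))" .
  have "(LINT x|vol. f x) = (LINT x|restrict_space vol (cdom c). f x)"
    unfolding integral_restrict_space[OF U(1)] fi ..
  also have "\<dots> = (LINT x|?V. f x)"
    unfolding rs integral_restrict_space[OF U(2)] fi ..
  also have "\<dots> = (LINT z|?R. wt c z *\<^sub>R f (chart_inv c z))"
    unfolding chart_volume_wt integral_distr[OF m fm] by (rule integral_density[OF fm' wt_measurable[OF c] nn])
  also have "\<dots> = (LINT z|lborel. indicator (img c) z *\<^sub>R (wt c z *\<^sub>R f (chart_inv c z)))"
    by (rule integral_restrict_space[OF img_sets[OF c]])
  finally show "(LINT x|vol. f x) = (LINT z|lborel. indicator (img c) z *\<^sub>R (wt c z *\<^sub>R f (chart_inv c z)))" .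
qed

end

section \<open>The formal adjoint\<close>

context herm
begin

subsection \<open>Supports and cut-off functions\<close>

definition supp_in :: "('a, 'n) form \<Rightarrow> 'a set \<Rightarrow> bool" where
  "supp_in u K \<longleftrightarrow> (\<forall>c\<in>A. \<forall>x\<in>cdom c. x \<notin> K \<longrightarrow> u c (snd c x) = 0)"

lemma supp_inD: "supp_in u K \<Longrightarrow> c \<in> A \<Longrightarrow> z \<in> img c \<Longrightarrow> chart_inv c z \<notin> K \<Longrightarrow> u c z = 0"
  using inv_dom[of c z] snd_inv[of c z] unfolding supp_in_def by metis

lemma compactly_supported_iff: "compactly_supported A u \<longleftrightarrow> (\<exists>K. compact K \<and> supp_in u K)"
proof
  let ?S = "{x. \<exists>c\<in>A. x \<in> cdom c \<and> u c (snd c x) \<noteq> (\<lambda>_. 0)}"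
  assume "compactly_supported A u"
  then have "compact (closure ?S)" by (simp add: compactly_supported_def)
  moreover have "supp_in u (closure ?S)"
    unfolding supp_in_def
  proof (intro ballI impI)
    fix c x assume "c \<in> A" "x \<in> cdom c" "x \<notin> closure ?S"
    then have "x \<notin> ?S" using closure_subset[of ?S] by (meson subsetD)
    then show "u c (snd c x) = 0" using \<open>c \<in> A\<close> \<open>x \<in> cdom c\<close> by (auto simp: zero_fun_def)
  qed
  ultimately show "\<exists>K. compact K \<and> supp_in u K" by blast
next
  let ?S = "{x. \<exists>c\<in>A. x \<in> cdom c \<and> u c (snd c x) \<noteq> (\<lambda>_. 0)}"
  assume "\<exists>K. compact K \<and> supp_in u K"
  then obtain K where K: "compact K" "supp_in u K" by blast
  have "?S \<subseteq> K" using K(2) by (auto simp: supp_in_def zero_fun_def)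
  then have "closure ?S \<subseteq> K" using K(1) by (simp add: closure_minimal compact_imp_closed)
  then have "closure ?S = K \<inter> closure ?S" by blast
  moreover have "compact (K \<inter> closure ?S)" by (rule compact_Int_closed[OF K(1) closed_closure])
  ultimately show "compactly_supported A u" by (simp add: compactly_supported_def)
qed

lemma compact_snd_image: "c \<in> A \<Longrightarrow> compact K \<Longrightarrow> K \<subseteq> cdom c \<Longrightarrow> compact (snd c ` K)"
  by (rule compact_continuous_image[OF continuous_on_subset[OF snd_continuous]])

lemma compact_inv_image: "c \<in> A \<Longrightarrow> compact L \<Longrightarrow> L \<subseteq> img c \<Longrightarrow> compact (chart_inv c ` L)"
  by (rule compact_continuous_image[OF continuous_on_subset[OF inv_continuous]])

lemma snd_image_notin: "c \<in> A \<Longrightarrow> z \<in> img c \<Longrightarrow> z \<notin> snd c ` K \<Longrightarrow> chart_inv c z \<notin> K"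
  using snd_inv[of c z] by (metis imageI)

lemma img_split: "c \<in> A \<Longrightarrow> cdom c \<subseteq> U \<union> V \<Longrightarrow> img c = snd c ` (cdom c \<inter> U) \<union> snd c ` (cdom c \<inter> V)"
  by (auto simp: chart_img_def chart_dom_def)

text \<open>The support is compact, hence closed in the Hausdorff space, so its complement and the
  chart domain form an open cover. The function is smooth on the first because it is 0 there, on the
  second by composition with a transition map.\<close>

lemma smooth_fun_extend:
  fixes f :: "complex ^ 'n \<Rightarrow> 'w::real_normed_vector"
  assumes c: "c \<in> A" and f: "smooth_on (img c) f" and L: "compact L" "L \<subseteq> img c"
    and f0: "\<And>z. z \<in> img c \<Longrightarrow> z \<notin> L \<Longrightarrow> f z = 0"
  shows "smooth_fun A (\<lambda>x. if x \<in> cdom c then f (snd c x) else 0)"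
  unfolding smooth_fun_def
proof
  fix c' assume c': "c' \<in> A"
  let ?K = "chart_inv c ` L" and ?f = "\<lambda>x. if x \<in> cdom c then f (snd c x) else 0"
  have K: "compact ?K" "?K \<subseteq> cdom c" using compact_inv_image[OF c L] L(2) inv_dom[OF c] by auto
  have 1: "open (ov c' c)" by (rule open_ov[OF c' c])
  have 2: "open (snd c' ` (cdom c' \<inter> - ?K))"
    by (rule open_snd_image[OF c']) (use open_dom[OF c'] compact_imp_closed[OF K(1)] in auto)
  have "smooth_on (ov c' c) (\<lambda>z. ?f (chart_inv c' z))"
  proof (rule smooth_on_cong[OF 1])
    show "smooth_on (ov c' c) (\<lambda>z. f (tr c' c z))"
      by (rule smooth_on_compose[OF 1 open_img[OF c] _ f hol_change.smooth_F[OF hol_change[OF c' c]]])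
        (use tr_img[OF c' c] in blast)
  qed (use ov_D[OF c'] in auto)
  moreover have "smooth_on (snd c' ` (cdom c' \<inter> - ?K)) (\<lambda>z. ?f (chart_inv c' z))"
  proof (rule smooth_on_cong[OF 2 smooth_on_const[OF 2, of 0]])
    fix z assume "z \<in> snd c' ` (cdom c' \<inter> - ?K)"
    then have "chart_inv c' z \<notin> ?K" using inv_snd[OF c'] by auto
    then have "snd c (chart_inv c' z) \<notin> L" if "chart_inv c' z \<in> cdom c"
      using inv_snd[OF c that] by (metis imageI)
    then show "0 = ?f (chart_inv c' z)" using f0 snd_img[OF c] by auto
  qed
  ultimately have "smooth_on (ov c' c \<union> snd c' ` (cdom c' \<inter> - ?K)) (\<lambda>z. ?f (chart_inv c' z))"
    by (rule smooth_on_Un[OF 1 2])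
  moreover have "img c' = ov c' c \<union> snd c' ` (cdom c' \<inter> - ?K)" by (rule img_split[OF c']) (use K(2) in auto)
  ultimately show "smooth_on (img c') (\<lambda>z. ?f (chart_inv c' z))" by simp
qed

definition cutoff :: "('a, 'n) chart \<Rightarrow> complex ^ 'n \<Rightarrow> real \<Rightarrow> 'a \<Rightarrow> complex" where
  "cutoff c p r x = (if x \<in> cdom c then of_real (bump r p (snd c x)) else 0)"

lemma smooth_cutoff:
  assumes "c \<in> A" "r > 0" "cball p r \<subseteq> img c"
  shows "smooth_fun A (cutoff c p r)"
  unfolding cutoff_def[abs_def]
proof (rule smooth_fun_extend[OF assms(1) _ compact_cball assms(3)])
  show "smooth_on (img c) (\<lambda>z. complex_of_real (bump r p z))"
    by (intro smooth_on_of_real open_img[OF assms(1)] smooth_on_subset[OF bump_smooth]) auto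
  show "complex_of_real (bump r p z) = 0" if "z \<notin> cball p r" for z
    using bump_eq_0[OF assms(2), of z p] that by auto
qed

lemma cutoff_support:
  assumes "c \<in> A" "r > 0" "cball p r \<subseteq> img c" "x \<notin> chart_inv c ` cball p r"
  shows "cutoff c p r x = 0"
proof (cases "x \<in> cdom c")
  case True
  then have "snd c x \<notin> cball p r" using assms(4) inv_snd[OF assms(1) True] by (metis imageI)
  then show ?thesis using bump_eq_0[OF assms(2), of "snd c x" p] by (auto simp: cutoff_def)
qed (simp add: cutoff_def)

lemma chart_ball:
  obtains c r where "c \<in> A" "x \<in> cdom c" "r > 0" "cball (snd c x) r \<subseteq> img c"
proof -
  obtain c where c: "c \<in> A" "x \<in> cdom c" using covers[of x] by blast
  then obtain r where "r > 0" "cball (snd c x) r \<subseteq> img c"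
    using open_contains_cball[of "img c"] open_img[OF c(1)] snd_img[OF c] by blast
  then show ?thesis using that c by blast
qed

definition local_form :: "('a, 'n) form \<Rightarrow> bool" where
  "local_form u \<longleftrightarrow> smooth_form A u \<and> (\<exists>c\<in>A. \<exists>K. compact K \<and> K \<subseteq> cdom c \<and> supp_in u K)"

lemma local_formI: "c \<in> A \<Longrightarrow> compact K \<Longrightarrow> K \<subseteq> cdom c \<Longrightarrow> supp_in u K \<Longrightarrow> smooth_form A u \<Longrightarrow> local_form u"
  unfolding local_form_def by blast

lemma local_form_cutoff:
  assumes "sform u" "c \<in> A" "r > 0" "cball p r \<subseteq> img c"
  shows "local_form (nrm (fmult (cutoff c p r) u))"
proof (rule local_formI[OF assms(2) compact_inv_image[OF assms(2) compact_cball assms(4)]])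
  show "chart_inv c ` cball p r \<subseteq> cdom c" using inv_dom[OF assms(2)] assms(4) by blast
  show "supp_in (nrm (fmult (cutoff c p r) u)) (chart_inv c ` cball p r)"
    unfolding supp_in_def by (simp add: nrm_def fmult_csc inv_snd cutoff_support[OF assms(2-4)])
  show "smooth_form A (nrm (fmult (cutoff c p r) u))"
    by (rule smooth_nrm[OF sform_fmult[OF assms(1) smooth_cutoff[OF assms(2-4)]]])
qed

text \<open>The form itself is partitioned, not the constant 1: the cut-off functions need to have a
  nonzero sum only on the support of u, which finitely many of them achieve by compactness.\<close>

lemma partition_of_form:
  assumes u: "smooth_form A u" and K: "compact K" "supp_in u K"
  obtains I :: "'a set" and U where "finite I" "u = (\<Sum>i\<in>I. U i)" "\<And>i. i \<in> I \<Longrightarrow> local_form (U i)"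
proof -
  have "\<forall>x. \<exists>c r. c \<in> A \<and> x \<in> cdom c \<and> r > 0 \<and> cball (snd c x) r \<subseteq> img c"
    using chart_ball by metis
  then obtain ch r where ch: "\<And>x. ch x \<in> A" "\<And>x. x \<in> cdom (ch x)" "\<And>x. r x > 0" "\<And>x. cball (snd (ch x) x) (r x) \<subseteq> img (ch x)"
    by metis
  define b where "b = (\<lambda>x. cutoff (ch x) (snd (ch x) x) (r x))"
  define W where "W = (\<lambda>x. cdom (ch x) \<inter> snd (ch x) -` ball (snd (ch x) x) (r x))"
  have "open (W x)" for x
    unfolding W_def Int_commute[of "cdom _"]
    using continuous_on_open_vimage[OF open_dom[OF ch(1)]] snd_continuous[OF ch(1)] open_ball by blast
  moreover have "x \<in> W x" for x using ch by (simp add: W_def)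
  ultimately obtain I where I: "finite I" "K \<subseteq> (\<Union>x\<in>I. W x)"
    by - (rule compactE_image[OF K(1), of K W], auto)
  have b_re: "b x y = of_real (Re (b x y))" "Re (b x y) \<ge> 0" for x y
    by (simp_all add: b_def cutoff_def bump_nonneg)
  define B where "B = (\<lambda>y. \<Sum>x\<in>I. b x y)"
  \<comment> \<open>\<open>u / B\<close>. Where B vanishes, so does u, and the convention
    \<open>inverse 0 = 0\<close> gives the right value.\<close>
  define w where "w = (\<lambda>c z. csc (inverse (B (chart_inv c z))) (u c z))"
  have B0: "B y \<noteq> 0" if "y \<in> K" for y
  proof -
    obtain x where x: "x \<in> I" "y \<in> W x" using I(2) \<open>y \<in> K\<close> by blast
    then have "y \<in> cdom (ch x)" "snd (ch x) y \<in> ball (snd (ch x) x) (r x)" by (simp_all add: W_def)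
    then have "Re (b x y) > 0"
      unfolding bump_pos_iff[OF ch(3), symmetric] by (simp add: b_def cutoff_def)
    then have "(\<Sum>x\<in>I. Re (b x y)) > 0" using I(1) x(1) b_re(2) by (intro sum_pos2) auto
    then show ?thesis unfolding B_def by (metis Re_sum less_irrefl zero_complex.simps(1))
  qed
  have sb: "smooth_fun A (b x)" for x unfolding b_def by (rule smooth_cutoff[OF ch(1,3,4)])
  have sB: "smooth_on (img c) (\<lambda>z. B (chart_inv c z))" if "c \<in> A" for c
    unfolding B_def using sb that by (intro smooth_on_sum open_img) (auto simp: smooth_fun_def)
  have us: "sform u" by (rule smooth_sform[OF u])
  have sw: "sform w"
  proof (rule sformI)
    fix c assume c: "c \<in> A"
    show "alternating (w c z)" if "z \<in> img c" for z using sform_alt[OF us c that] by (simp add: w_def)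
    show "w c z = pull (J c c' z) (w c' (tr c c' z))" if "c' \<in> A" "z \<in> ov c c'" for c' z
      by (simp add: w_def inv_tr[OF c that] flip: sform_pull[OF us c that])
    let ?U = "img c \<inter> (\<lambda>z. B (chart_inv c z)) -` (- {0})" and ?V = "snd c ` (cdom c - K)"
    have oU: "open ?U"
      unfolding Int_commute[of "img c"]
      using continuous_on_open_vimage[OF open_img[OF c]] smooth_on_continuous[OF sB[OF c]] open_Compl[OF closed_singleton[of 0]] by blast
    have oV: "open ?V" by (rule open_snd_image[OF c]) (use open_dom[OF c] compact_imp_closed[OF K(1)] in auto)
    have iUV: "img c = ?U \<union> ?V"
    proof
      show "img c \<subseteq> ?U \<union> ?V"
      proof
        fix z assume z: "z \<in> img c"
        show "z \<in> ?U \<union> ?V"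
        proof (cases "chart_inv c z \<in> K")
          case False
          then show ?thesis using inv_dom[OF c z] snd_inv[OF c z] by (auto intro!: rev_image_eqI[of "chart_inv c z"])
        qed (use z B0 in auto)
      qed
    qed (use snd_img[OF c] in auto)
    have "smooth_on ?U (\<lambda>z. w c z as)" for as
    proof -
      have "smooth_on ?U (\<lambda>z. inverse (B (chart_inv c z)) * u c z as)"
        using sform_lsm[OF us c]
        by (intro smooth_on_mult smooth_on_inverse oU smooth_on_subset[OF sB[OF c]]) (auto simp: lsm_def intro: smooth_on_subset)
      then show ?thesis by (simp add: w_def csc_apply)
    qed
    moreover have "smooth_on ?V (\<lambda>z. w c z as)" for as
    proof (rule smooth_on_cong[OF oV smooth_on_const[OF oV, of 0]])
      fix z assume "z \<in> ?V"
      then have "u c z = 0" using K(2) c by (auto simp: supp_in_def)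
      then show "0 = w c z as" by (simp add: w_def)
    qed
    ultimately show "lsm (img c) (w c)" unfolding lsm_def using smooth_on_Un[OF oU oV] iUV by metis
  qed
  let ?U = "\<lambda>x. nrm (fmult (b x) w)"
  have "u c z = (\<Sum>x\<in>I. ?U x) c z" for c z
  proof (cases "c \<in> A \<and> z \<in> img c")
    case True
    have "(\<Sum>x\<in>I. ?U x) c z = (\<Sum>x\<in>I. csc (b x (chart_inv c z)) (w c z))"
      using True by (simp add: sum_fun_apply nrm_def fmult_csc)
    also have "\<dots> = csc (B (chart_inv c z)) (w c z)" by (simp add: B_def csc_sum_left)
    also have "\<dots> = u c z"
    proof (cases "chart_inv c z \<in> K")
      case True then show ?thesis using B0 by (simp add: w_def)
    next
      case False
      then have "u c z = 0" using supp_inD[OF K(2)] \<open>c \<in> A \<and> z \<in> img c\<close> by blast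
      then show ?thesis by (simp add: w_def)
    qed
    finally show ?thesis by simp
  next
    case False
    then have "u c z = 0" using u unfolding smooth_form_iff by blast
    moreover have "(\<Sum>x\<in>I. ?U x) c z = 0" using False by (simp only: sum_fun_apply[of _ I] nrm_def if_False sum.neutral_const)
    ultimately show ?thesis by (simp only:)
  qed
  then have "u = (\<Sum>x\<in>I. ?U x)" by (simp add: fun_eq_iff)
  moreover have "local_form (?U x)" for x
    unfolding b_def by (rule local_form_cutoff[OF sw ch(1,3,4)])
  ultimately show ?thesis using that[OF I(1)] by blast
qed

subsection \<open>The inner product\<close>

abbreviation "hn c z \<equiv> hin (met (gm c z))"

lemma pt_inner_chart:
  assumes uv: "sform u" "sform v" and c: "c \<in> A" and x: "x \<in> cdom c"
  shows "pt_inner A \<omega> u v x = hn c (snd c x) (u c (snd c x)) (v c (snd c x))"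
proof -
  define c' where "c' = (SOME c. c \<in> A \<and> x \<in> cdom c)"
  have c': "c' \<in> A" "x \<in> cdom c'"
    using someI_ex[of "\<lambda>c. c \<in> A \<and> x \<in> cdom c"] covers[of x] unfolding c'_def by auto
  have z: "snd c' x \<in> ov c' c" using c' x by blast
  have t: "tr c' c (snd c' x) = snd c x" using inv_snd[OF c'] by simp
  have "pt_inner A \<omega> u v x = hn c' (snd c' x) (u c' (snd c' x)) (v c' (snd c' x))"
    by (simp add: pt_inner_def c'_def[symmetric] cinner_eq cometric_eq)
  also have "\<dots> = hn c (snd c x) (u c (snd c x)) (v c (snd c x))"
    unfolding sform_pull[OF uv(1) c'(1) c z] sform_pull[OF uv(2) c'(1) c z] hin_pull'[OF c'(1) c z] t ..
  finally show ?thesis .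
qed

lemma pt_inner_inv:
  "sform u \<Longrightarrow> sform v \<Longrightarrow> c \<in> A \<Longrightarrow> z \<in> img c \<Longrightarrow> pt_inner A \<omega> u v (chart_inv c z) = hn c z (u c z) (v c z)"
  using pt_inner_chart[of u v c "chart_inv c z"] inv_dom[of c z] snd_inv[of c z] by simp

lemma pt_inner_supp:
  assumes "sform u" "sform v" "supp_in u K" "x \<notin> K"
  shows "pt_inner A \<omega> u v x = 0"
proof -
  obtain c where c: "c \<in> A" "x \<in> cdom c" using covers[of x] by blast
  have "u c (snd c x) = 0" using assms(3,4) c by (simp add: supp_in_def)
  then show ?thesis using pt_inner_chart[OF assms(1,2) c] by (simp add: hin_0_left)
qed

lemma smooth_hn: "sform u \<Longrightarrow> sform v \<Longrightarrow> c \<in> A \<Longrightarrow> smooth_on (img c) (\<lambda>z. hn c z (u c z) (v c z))"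
  by (rule smooth_on_hin[OF open_img smooth_gm sform_lsm sform_lsm])

lemma L2_chart:
  assumes uv: "sform u" "sform v" and c: "c \<in> A" and K: "compact K" "K \<subseteq> cdom c" "supp_in u K"
  shows "integrable vol (pt_inner A \<omega> u v)"
    "integrable lborel (\<lambda>z. indicator (img c) z *\<^sub>R (wt c z *\<^sub>R hn c z (u c z) (v c z)))"
    "L2_inner A \<omega> u v = (LINT z|lborel. indicator (img c) z *\<^sub>R (wt c z *\<^sub>R hn c z (u c z) (v c z)))"
proof -
  let ?f = "pt_inner A \<omega> u v"
  have f0: "?f x = 0" if "x \<notin> cdom c" for x using pt_inner_supp[OF uv K(3)] K(2) that by blast
  have ind: "indicator (img c) z *\<^sub>R (wt c z *\<^sub>R ?f (chart_inv c z)) = indicator (img c) z *\<^sub>R (wt c z *\<^sub>R hn c z (u c z) (v c z))" for z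
    using pt_inner_inv[OF uv c, of z] by (cases "z \<in> img c") simp_all
  have ch: "continuous_on (img c) (\<lambda>z. hn c z (u c z) (v c z))" by (rule smooth_on_continuous[OF smooth_hn[OF uv c]])
  then have cont: "continuous_on (img c) (\<lambda>z. ?f (chart_inv c z))"
    by (rule continuous_on_eq) (simp add: pt_inner_inv[OF uv c])
  show int: "integrable lborel (\<lambda>z. indicator (img c) z *\<^sub>R (wt c z *\<^sub>R hn c z (u c z) (v c z)))"
  proof (rule integrable_compact_support[where K = "snd c ` K"])
    have KI: "snd c ` K \<subseteq> img c" using K(2) snd_img[OF c] by auto
    show "compact (snd c ` K)" by (rule compact_snd_image[OF c K(1,2)])
    have "continuous_on (snd c ` K) (\<lambda>z. wt c z *\<^sub>R hn c z (u c z) (v c z))"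
      by (intro continuous_on_scaleR continuous_on_subset[OF wt_continuous[OF c] KI] continuous_on_subset[OF ch KI])
    then show "continuous_on (snd c ` K) (\<lambda>z. indicator (img c) z *\<^sub>R (wt c z *\<^sub>R hn c z (u c z) (v c z)))"
      by (rule continuous_on_eq) (use KI in \<open>auto simp: indicator_def\<close>)
    show "indicator (img c) z *\<^sub>R (wt c z *\<^sub>R hn c z (u c z) (v c z)) = 0" if "z \<notin> snd c ` K" for z
      using supp_inD[OF K(3) c, of z] snd_image_notin[OF c, of z K] that by (cases "z \<in> img c") (auto simp: hin_0_left)
  qed
  show "integrable vol ?f" using integral_volume_chart(1)[OF c f0 cont] int unfolding ind by simp
  show "L2_inner A \<omega> u v = (LINT z|lborel. indicator (img c) z *\<^sub>R (wt c z *\<^sub>R hn c z (u c z) (v c z)))"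
    unfolding L2_inner_def using integral_volume_chart(2)[OF c f0 cont] unfolding ind .
qed

lemma pt_inner_diff_right: "pt_inner A \<omega> u (v - v') x = pt_inner A \<omega> u v x - pt_inner A \<omega> u v' x"
  by (simp_all add: pt_inner_def Let_def cinner_eq form_apply hin_lin)

lemma form_eq_pt_inner: "form_eq A u u' \<Longrightarrow> form_eq A v v' \<Longrightarrow> pt_inner A \<omega> u v = pt_inner A \<omega> u' v'"
proof
  assume e: "form_eq A u u'" "form_eq A v v'"
  fix x
  let ?c = "SOME c. c \<in> A \<and> x \<in> cdom c"
  have c: "?c \<in> A" "x \<in> cdom ?c"
    using someI_ex[of "\<lambda>c. c \<in> A \<and> x \<in> cdom c"] covers[of x] by auto
  then show "pt_inner A \<omega> u v x = pt_inner A \<omega> u' v' x"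
    using e snd_img[OF c] by (simp add: pt_inner_def form_eq_def)
qed

subsection \<open>Uniqueness of the adjoint\<close>

lemma wirtinger_coord: "wirtinger b (coord a) z = (if a = b then 1 else 0)"
proof -
  have "wirtinger b (coord a) z = wpart b (coord a)"
    by (rule wirtinger_eq[OF bounded_linear_imp_has_derivative[OF bounded_linear_coord]])
  also have "\<dots> = (if a = b then 1 else 0)" by (cases a; cases b) (auto simp: axis_def)
  finally show ?thesis .
qed

lemma ld_function: "ld P (\<lambda>z. csc (f z) cunit) z = (\<Sum>a\<in>{a. P a}. csc (wirtinger a f z) (ext a cunit))"
proof -
  have "wd a (\<lambda>z. csc (f z) cunit) z = csc (wirtinger a f z) cunit" for a
    by (auto simp: wd_def csc_def cunit_def fun_eq_iff simp del: wirtinger.simps)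
  then show ?thesis by (simp add: ld_eq)
qed

text \<open>Wedge products of differentials of cut-off coordinate functions are globally defined and
  give multiples of every monomial at \<open>z0\<close>. Without cutting off, a coordinate would be
  a function on its chart only.\<close>

lemma test_form:
  assumes c: "c \<in> A" and z0: "z0 \<in> img c"
  obtains u k where "sform u" "k \<noteq> 0" "u c z0 = csc k (foldr ext as cunit)"
proof -
  obtain r where r: "r > 0" "cball z0 r \<subseteq> img c" using open_contains_cball[of "img c"] open_img[OF c] z0 by blast
  \<comment> \<open>The second factor vanishes at \<open>z0\<close>, so the derivative of the bump
    function does not contribute there.\<close>
  define f where "f = (\<lambda>a z. of_real (bump r z0 z) * (coord a z - coord a z0))"
  define F where "F = (\<lambda>a x. if x \<in> cdom c then f a (snd c x) else 0)"
  define \<xi> :: "'n + 'n \<Rightarrow> ('a, 'n) form" where "\<xi> = (\<lambda>a. if isl a then del (fun_form (F a)) else delbar (fun_form (F a)))"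
  define \<kappa> where "\<kappa> = complex_of_real (bump r z0 z0)"
  have sb: "smooth_on (img c) (\<lambda>z. complex_of_real (bump r z0 z))"
    by (intro smooth_on_of_real open_img[OF c] smooth_on_subset[OF bump_smooth]) auto
  have sc: "smooth_on (img c) (\<lambda>z. coord a z - coord a z0)" for a
    using smooth_on_linear[OF bounded_linear_coord open_img[OF c] smooth_on_id[OF open_img[OF c]]]
    by (intro smooth_on_diff smooth_on_const open_img[OF c])
  have "smooth_fun A (F a)" for a
    unfolding F_def
  proof (rule smooth_fun_extend[OF c _ compact_cball r(2)])
    show "smooth_on (img c) (f a)" unfolding f_def by (rule smooth_on_mult[OF open_img[OF c] sb sc])
    show "f a z = 0" if "z \<notin> cball z0 r" for z using bump_eq_0[OF r(1), of z z0] that by (auto simp: f_def)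
  qed
  then have s\<xi>: "sform (\<xi> a)" for a by (simp add: \<xi>_def sform_del sform_delbar sform_fun_form)
  have \<xi>: "\<xi> a c z0 = csc \<kappa> (ext a cunit)" for a
  proof -
    have w: "wirtinger b (\<lambda>z. F a (chart_inv c z)) z0 = (if a = b then \<kappa> else 0)" for b
    proof -
      have "wirtinger b (\<lambda>z. F a (chart_inv c z)) z0 = wirtinger b (f a) z0"
      proof (rule wirtinger_cong[OF open_img[OF c] z0, symmetric])
        show "f a z = F a (chart_inv c z)" if "z \<in> img c" for z
          using that inv_dom[OF c that] snd_inv[OF c that] by (simp add: F_def)
        show "f a differentiable (at z0)"
          unfolding f_def by (rule smooth_on_differentiable[OF smooth_on_mult[OF open_img[OF c] sb sc] z0])
      qed
      also have "\<dots> = \<kappa> * wirtinger b (\<lambda>z. coord a z - coord a z0) z0"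
        unfolding f_def
        by (subst wirtinger_mult[OF smooth_on_differentiable[OF sb z0] smooth_on_differentiable[OF sc z0]]) (simp add: \<kappa>_def del: wirtinger.simps)
      also have "wirtinger b (\<lambda>z. coord a z - coord a z0) z0 = wirtinger b (coord a) z0"
        by (subst wirtinger_diff)
          (auto simp del: wirtinger.simps intro: bounded_linear_imp_differentiable[OF bounded_linear_coord])
      finally show ?thesis by (simp add: wirtinger_coord)
    qed
    have e: "fun_form (F a) c = (\<lambda>z. csc (F a (chart_inv c z)) cunit)" by (simp add: fun_form_cunit fun_eq_iff)
    show ?thesis
      unfolding \<xi>_def by (simp add: del_ld delbar_ld e ld_function w if_distrib[of "\<lambda>x. csc x _"] cong: if_cong)
  qed
  define u where "u = foldr (\<lambda>a v. wedge (\<xi> a) v) as (fun_form (\<lambda>_. 1))"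
  have "sform u" unfolding u_def
    by (induction as) (auto intro: sform_wedge s\<xi> sform_fun_form smooth_fun_const)
  moreover have "u c z0 = csc (\<kappa> ^ length as) (foldr ext as cunit)"
    unfolding u_def by (induction as) (simp_all add: fun_form_cunit wedge_def \<xi> cwedge_ext_left mult.commute)
  moreover have "\<kappa> \<noteq> 0" using bump_pos_iff[OF r(1), of z0 z0] r(1) by (simp add: \<kappa>_def)
  ultimately show ?thesis using that[of u "\<kappa> ^ length as"] by simp
qed

text \<open>The fundamental lemma of the calculus of variations: a test form which pairs
  nontrivially with w at one point is localized so that the pairing keeps its sign on the
  support.\<close>

lemma L2_nondegenerate:
  assumes w: "smooth_form A w" and L2: "\<And>u. local_form u \<Longrightarrow> L2_inner A \<omega> u w = 0"
  shows "w = 0"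
proof (rule ccontr)
  have sw: "sform w" by (rule smooth_sform[OF w])
  assume "w \<noteq> 0"
  then obtain c z0 where "w c z0 \<noteq> 0" by (auto simp: fun_eq_iff)
  then have c: "c \<in> A" and z0: "z0 \<in> img c" using w unfolding smooth_form_iff by blast+
  obtain as where as: "hn c z0 (foldr ext as cunit) (w c z0) \<noteq> 0"
    using hmetric.hin_zero_iff[OF hmetric[OF c z0], of "w c z0"] sform_alt[OF sw c z0] \<open>w c z0 \<noteq> 0\<close>
    unfolding cunit_def by blast
  obtain u k where u: "sform u" "k \<noteq> 0" "u c z0 = csc k (foldr ext as cunit)" by (rule test_form[OF c z0])
  define h where "h = (\<lambda>z. hn c z (u c z) (w c z))"
  have h0: "h z0 \<noteq> 0" using as u by (simp add: h_def hin_csc_left)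
  have ch: "continuous_on (img c) (\<lambda>z. Re (cnj (h z0) * h z))"
    unfolding h_def using smooth_on_continuous[OF smooth_hn[OF u(1) sw c]] by (intro continuous_intros)
  have "Re (cnj (h z0) * h z0) > 0" using h0 by (simp add: complex_eq_iff) (metis not_sum_power2_lt_zero power2_eq_square sum_power2_gt_zero_iff)
  then have "open (img c \<inter> (\<lambda>z. Re (cnj (h z0) * h z)) -` {0<..})" "z0 \<in> img c \<inter> (\<lambda>z. Re (cnj (h z0) * h z)) -` {0<..}"
    unfolding Int_commute[of "img c"]
    using continuous_on_open_vimage[OF open_img[OF c]] ch z0 open_greaterThan by (blast, simp)
  then obtain r where r: "r > 0" "cball z0 r \<subseteq> img c \<inter> (\<lambda>z. Re (cnj (h z0) * h z)) -` {0<..}"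
    using open_contains_cball by blast
  then have ri: "cball z0 r \<subseteq> img c" and rp: "\<And>z. z \<in> cball z0 r \<Longrightarrow> Re (cnj (h z0) * h z) > 0" by auto
  \<comment> \<open>The factor \<open>cnj (h z0)\<close> rotates the pairing so that its real part
    is positive near \<open>z0\<close>; the bump function then confines it to that
    neighbourhood.\<close>
  define v where "v = nrm (fmult (cutoff c z0 r) (fmult (\<lambda>_. cnj (h z0)) u))"
  have lv: "local_form v" unfolding v_def
    by (rule local_form_cutoff[OF sform_fmult[OF u(1) smooth_fun_const] c r(1) ri])
  then have sv: "sform v" by (simp add: local_form_def smooth_sform)
  let ?f = "\<lambda>z. indicator (img c) z *\<^sub>R (wt c z *\<^sub>R hn c z (v c z) (w c z))"
  have supp: "supp_in v (chart_inv c ` cball z0 r)"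
    unfolding supp_in_def v_def by (simp add: nrm_def fmult_csc inv_snd cutoff_support[OF c r(1) ri])
  have Kd: "chart_inv c ` cball z0 r \<subseteq> cdom c" using inv_dom[OF c] ri by blast
  note L = L2_chart[OF sv sw c compact_inv_image[OF c compact_cball ri] Kd supp]
  have Re: "Re (?f z) = indicator (img c) z * (wt c z * (bump r z0 z * Re (cnj (h z0) * h z)))" for z
  proof (cases "z \<in> img c")
    case True
    then have "v c z = csc (of_real (bump r z0 z)) (csc (cnj (h z0)) (u c z))"
      using c inv_dom[OF c True] snd_inv[OF c True] by (simp add: v_def nrm_def fmult_csc cutoff_def)
    then have "hn c z (v c z) (w c z) = of_real (bump r z0 z) * (cnj (h z0) * h z)"
      by (simp add: hin_csc_left h_def)
    then show ?thesis using True by simp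
  qed simp
  have nn: "0 \<le> Re (?f z)" for z
  proof (cases "z \<in> ball z0 r")
    case True
    then have "z \<in> cball z0 r" by auto
    then show ?thesis unfolding Re
      using rp[of z] ri wt_pos[OF c, of z] bump_nonneg[of r z0 z] by (auto intro!: mult_nonneg_nonneg)
  next
    case False
    then show ?thesis unfolding Re by (simp add: bump_eq_0[OF r(1)])
  qed
  have "(LINT z|lborel. Re (?f z)) = 0"
    using L(3) L2[OF lv] integral_Re[OF L(2)] by simp
  then have "AE z in lborel. Re (?f z) = 0"
    using integral_nonneg_eq_0_iff_AE[OF integrable_Re[OF L(2)]] nn by simp
  moreover have "Re (?f z) \<noteq> 0" if "z \<in> ball z0 r" for z
  proof -
    have "z \<in> cball z0 r" using that by auto
    then have "z \<in> img c" "Re (cnj (h z0) * h z) > 0" using ri rp by blast+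
    then show ?thesis unfolding Re
      using wt_pos[OF c, of z] bump_pos_iff[OF r(1), of z0 z] that by simp
  qed
  ultimately have "AE z in lborel. z \<notin> ball z0 r" by (auto elim!: eventually_mono)
  then have "emeasure lborel (ball z0 r) = 0"
    by (subst (asm) AE_iff_measurable[where N = "ball z0 r"]) auto
  then have "measure lborel (ball z0 r) = 0" by (simp add: measure_def)
  then show False using content_ball_pos[OF r(1), of z0] by simp
qed

lemma local_form_compact: "local_form u \<Longrightarrow> compactly_supported A u"
  unfolding local_form_def compactly_supported_iff by blast

lemma adj_eqI:
  assumes w: "smooth_form A w"
    and L2: "\<And>u. smooth_form A u \<Longrightarrow> compactly_supported A u \<Longrightarrow> L2_inner A \<omega> (P u) v = L2_inner A \<omega> u w"
  shows "adj A \<omega> P v = w"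
  unfolding adj_def
proof (rule the_equality)
  fix w' assume w': "smooth_form A w' \<and> (\<forall>u. smooth_form A u \<and> compactly_supported A u \<longrightarrow> L2_inner A \<omega> (P u) v = L2_inner A \<omega> u w')"
  have s: "sform w" "sform w'" using w w' by (auto intro: smooth_sform)
  have "w' - w = 0"
  proof (rule L2_nondegenerate)
    show "smooth_form A (w' - w)" using w w' sform_diff[OF s(2,1)] by (simp add: smooth_form_iff form_apply)
    fix u assume u: "local_form u"
    then obtain c K where c: "smooth_form A u" "c \<in> A" "compact K" "K \<subseteq> cdom c" "supp_in u K" unfolding local_form_def by blast
    note su = smooth_sform[OF c(1)]
    have "L2_inner A \<omega> u (w' - w) = L2_inner A \<omega> u w' - L2_inner A \<omega> u w"
      unfolding L2_inner_def pt_inner_diff_right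
      by (rule Bochner_Integration.integral_diff; rule L2_chart(1)[OF su _ c(2-5)]) (rule s)+
    then show "L2_inner A \<omega> u (w' - w) = 0"
      using w' L2[of u] c(1) local_form_compact[OF u] by simp
  qed
  then show "w' = w" by simp
qed (use w L2 in blast)

text \<open>The defining property of the adjoint as a relation, to be established for an explicit
  \<open>w\<close> before the definite description in \<open>adj\<close> is evaluated.\<close>

definition is_adj :: "('a, 'n) oper \<Rightarrow> ('a, 'n) form \<Rightarrow> ('a, 'n) form \<Rightarrow> bool" where
  "is_adj P v w \<longleftrightarrow> (\<forall>u. smooth_form A u \<longrightarrow> compactly_supported A u \<longrightarrow> L2_inner A \<omega> (P u) v = L2_inner A \<omega> u w)"

lemma is_adj_nrm: "is_adj P v (nrm w) \<longleftrightarrow> is_adj P v w"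
proof -
  have "L2_inner A \<omega> u (nrm w) = L2_inner A \<omega> u w" for u
    using form_eq_pt_inner[of u u "nrm w" w] form_eq_nrm[of w] by (simp add: L2_inner_def form_eq_def)
  then show ?thesis by (simp add: is_adj_def)
qed

lemma adj_is_adj: "sform w \<Longrightarrow> is_adj P v w \<Longrightarrow> adj A \<omega> P v = nrm w"
  using adj_eqI[OF smooth_nrm, of w P v] is_adj_nrm[of P v w] unfolding is_adj_def by blast

lemma is_adj_pointwise:
  assumes v: "sform v" and w: "sform w" and P: "\<And>u. smooth_form A u \<Longrightarrow> sform (P u)"
    and h: "\<And>u c z. smooth_form A u \<Longrightarrow> c \<in> A \<Longrightarrow> z \<in> img c \<Longrightarrow> hn c z (P u c z) (v c z) = hn c z (u c z) (w c z)"
  shows "is_adj P v w"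
  unfolding is_adj_def
proof (intro allI impI)
  fix u assume u: "smooth_form A u"
  have "pt_inner A \<omega> (P u) v x = pt_inner A \<omega> u w x" for x
  proof -
    obtain c where c: "c \<in> A" "x \<in> cdom c" using covers[of x] by blast
    show ?thesis
      unfolding pt_inner_chart[OF P[OF u] v c] pt_inner_chart[OF smooth_sform[OF u] w c]
      by (rule h[OF u c(1) snd_img[OF c]])
  qed
  then show "L2_inner A \<omega> (P u) v = L2_inner A \<omega> u w" by (simp add: L2_inner_def)
qed

subsection \<open>Integration by parts\<close>

abbreviation "tth c \<equiv> lmetric.th (hm c)"

text \<open>By the divergence formula, \<open>det h\<close> times \<open>defect u v\<close> is an exact divergence, so a first order operator
  has an adjoint as soon as it satisfies the pointwise identity in \<open>is_adj_first_order\<close>.\<close>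

definition defect :: "('a, 'n) form \<Rightarrow> ('a, 'n) form \<Rightarrow> ('a, 'n) chart \<Rightarrow> complex ^ 'n \<Rightarrow> complex" where
  "defect u v c z = hn c z (ld isl (u c) z) (v c z)
      - hn c z (u c z) (csc \<i> (lam (gm c z) (ld (\<lambda>a. \<not> isl a) (v c) z) - ld (\<lambda>a. \<not> isl a) (\<lambda>w. lam (gm c w) (v c w)) z))
      + hn c z (ocomm (lam (gm c z)) (tri (\<lambda>j p q. tth c (Inl j) z $ p $ q)) (u c z)) (v c z)"

lemma integral_defect:
  assumes u: "sform u" "supp_in u K" "compact K" "K \<subseteq> cdom c" and c: "c \<in> A" and v: "sform v"
  shows "(LINT z|lborel. indicator (img c) z *\<^sub>R (wt c z *\<^sub>R defect u v c z)) = 0"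
proof -
  define f where "f = (\<lambda>j z. if z \<in> img c then det (hm c z) * hn c z (u c z) (est (met (gm c z)) (Inl j) (v c z)) else 0)"
  let ?K = "snd c ` K"
  have KI: "?K \<subseteq> img c" using u(4) snd_img[OF c] by auto
  have cK: "compact ?K" by (rule compact_snd_image[OF c u(3,4)])
  have f0: "f j z = 0" if "z \<notin> ?K" for j z
    using supp_inD[OF u(2) c, of z] snd_image_notin[OF c, of z K] that by (auto simp: f_def hin_0_left)
  have sf: "smooth_on UNIV (f j)" for j
  proof -
    have o: "open (- ?K)" using compact_imp_closed[OF cK] by auto
    have "smooth_on (img c) (\<lambda>z. det (hm c z) * hn c z (u c z) (est (met (gm c z)) (Inl j) (v c z)))"
      by (intro smooth_on_mult smooth_on_det smooth_on_hin lsm_est open_img[OF c] smooth_gm[OF c] sform_lsm[OF u(1) c]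
          sform_lsm[OF v c] lmetric.smooth_h[OF lmetric[OF c]])
    then have "smooth_on (img c) (f j)" by (rule smooth_on_cong[OF open_img[OF c]]) (simp add: f_def)
    moreover have "smooth_on (- ?K) (f j)"
      by (rule smooth_on_cong[OF o smooth_on_const[OF o, of 0]]) (use f0 in auto)
    ultimately have "smooth_on (img c \<union> - ?K) (f j)" by (rule smooth_on_Un[OF open_img[OF c] o])
    moreover have "img c \<union> - ?K = UNIV" using KI by auto
    ultimately show ?thesis by simp
  qed
  have eq: "indicator (img c) z *\<^sub>R (wt c z *\<^sub>R defect u v c z) = 2 ^ CARD('n) * (\<Sum>j\<in>UNIV. wirtinger (Inl j) (f j) z)" for z
  proof (cases "z \<in> img c")
    case True
    have "wirtinger (Inl j) (f j) z = wirtinger (Inl j) (\<lambda>z. det (hm c z) * hn c z (u c z) (est (met (gm c z)) (Inl j) (v c z))) z" for j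
      by (rule wirtinger_cong[OF open_img[OF c] True]) (use smooth_on_differentiable[OF sf] in \<open>auto simp: f_def\<close>)
    then have "(\<Sum>j\<in>UNIV. wirtinger (Inl j) (f j) z) = det (hm c z) * defect u v c z"
      using lmetric.divergence[OF lmetric[OF c] True sform_ldf[OF u(1) c True] sform_ldf[OF v c True] sform_alt[OF u(1) c] sform_alt[OF v c]]
      unfolding lmetric.g_def[OF lmetric[OF c]] defect_def by (simp del: wirtinger.simps)
    also have "\<dots> = of_real (Re (det (hm c z))) * defect u v c z"
      by (subst det_hm(2)[OF c True]) simp
    finally show ?thesis using True by (simp add: wt_def scaleR_conv_of_real del: wirtinger.simps)
  next
    case False
    then have "z \<notin> ?K" using KI by auto
    then have "fd (f j) z v = 0" for j v using fd_eq_0[OF compact_imp_closed[OF cK], of "f j" z v] f0 by blast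
    then show ?thesis using False by simp
  qed
  have "(LINT z|lborel. 2 ^ CARD('n) * (\<Sum>j\<in>UNIV. wirtinger (Inl j) (f j) z)) = 0"
    using integral_wirtinger_zero[OF sf cK f0]
    by (simp add: Bochner_Integration.integral_sum del: wirtinger.simps)
  then show ?thesis unfolding eq .
qed

text \<open>A compactly supported u splits into pieces, each supported in a chart, where the error
  \<open>defect\<close> integrates to 0. Locality keeps the image under P of a piece in the same
  chart, and additivity puts the pieces together again.\<close>

lemma is_adj_first_order:
  assumes v: "sform v" and w: "sform w" and P: "\<And>u. smooth_form A u \<Longrightarrow> sform (P u)"
    and add: "\<And>u u'. smooth_form A u \<Longrightarrow> smooth_form A u' \<Longrightarrow> form_eq A (P (u + u')) (P u + P u')"
    and zero: "form_eq A (P 0) 0"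
    and loc: "\<And>u K. smooth_form A u \<Longrightarrow> compact K \<Longrightarrow> supp_in u K \<Longrightarrow> supp_in (P u) K"
    and h: "\<And>u c z. smooth_form A u \<Longrightarrow> c \<in> A \<Longrightarrow> z \<in> img c \<Longrightarrow>
       hn c z (P u c z) (v c z) - hn c z (u c z) (w c z) = defect u v c z"
  shows "is_adj P v w"
  unfolding is_adj_def
proof (intro allI impI)
  have loc_eq: "integrable vol (pt_inner A \<omega> (P u) v) \<and> integrable vol (pt_inner A \<omega> u w) \<and> L2_inner A \<omega> (P u) v = L2_inner A \<omega> u w"
    if u: "local_form u" for u
  proof -
    obtain c K where c: "smooth_form A u" "c \<in> A" "compact K" "K \<subseteq> cdom c" "supp_in u K" using u unfolding local_form_def by blast
    note L1 = L2_chart[OF P[OF c(1)] v c(2-4) loc[OF c(1,3,5)]] and L2 = L2_chart[OF smooth_sform[OF c(1)] w c(2-5)]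
    have "L2_inner A \<omega> (P u) v - L2_inner A \<omega> u w = (LINT z|lborel. indicator (img c) z *\<^sub>R (wt c z *\<^sub>R hn c z (P u c z) (v c z))
      - indicator (img c) z *\<^sub>R (wt c z *\<^sub>R hn c z (u c z) (w c z)))"
      unfolding L1(3) L2(3) by (rule Bochner_Integration.integral_diff[symmetric, OF L1(2) L2(2)])
    also have "\<dots> = (LINT z|lborel. indicator (img c) z *\<^sub>R (wt c z *\<^sub>R defect u v c z))"
    proof (rule Bochner_Integration.integral_cong[OF refl])
      fix z
      show "indicator (img c) z *\<^sub>R (wt c z *\<^sub>R hn c z (P u c z) (v c z)) - indicator (img c) z *\<^sub>R (wt c z *\<^sub>R hn c z (u c z) (w c z))
        = indicator (img c) z *\<^sub>R (wt c z *\<^sub>R defect u v c z)"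
        using h[OF c(1,2), of z] by (cases "z \<in> img c") (simp_all flip: scaleR_right_diff_distrib)
    qed
    also have "\<dots> = 0" by (rule integral_defect[OF smooth_sform[OF c(1)] c(5,3,4,2) v])
    finally show ?thesis using L1(1) L2(1) by simp
  qed
  fix u assume u: "smooth_form A u" "compactly_supported A u"
  then obtain K where "compact K" "supp_in u K" unfolding compactly_supported_iff by blast
  then obtain I :: "'a set" and U where I: "finite I" "u = (\<Sum>i\<in>I. U i)" "\<And>i. i \<in> I \<Longrightarrow> local_form (U i)"
    using partition_of_form[OF u(1)] by metis
  have sm: "smooth_form A (U i)" if "i \<in> I" for i using I(3)[OF that] by (simp add: local_form_def)
  \<comment> \<open>Additivity is available only for smooth forms and up to \<open>form_eq\<close>,
    so the induction carries smoothness of the partial sums along.\<close>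
  have sum: "smooth_form A (\<Sum>i\<in>I'. U i) \<and> form_eq A (P (\<Sum>i\<in>I'. U i)) (\<Sum>i\<in>I'. P (U i)) \<and> sform (\<Sum>i\<in>I'. P (U i))" if "I' \<subseteq> I" for I'
    using finite_subset[OF that I(1)] that
  proof (induction I' rule: finite_induct)
    case empty
    have "smooth_form A 0" using sform_diff[OF smooth_\<omega>' smooth_\<omega>'] by (simp add: smooth_form_iff form_apply)
    then show ?case unfolding sum.empty using zero smooth_sform by blast
  next
    case (insert i I')
    then have ih: "smooth_form A (\<Sum>i\<in>I'. U i)" "form_eq A (P (\<Sum>i\<in>I'. U i)) (\<Sum>i\<in>I'. P (U i))" "sform (\<Sum>i\<in>I'. P (U i))" and i: "smooth_form A (U i)"
      using sm by auto
    have "smooth_form A (U i + (\<Sum>i\<in>I'. U i))"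
      using i ih(1) sform_add[of "U i"] by (simp add: smooth_form_iff form_apply)
    moreover have "form_eq A (P (U i + (\<Sum>i\<in>I'. U i))) (P (U i) + (\<Sum>i\<in>I'. P (U i)))"
      using add[OF i ih(1)] ih(2) by (simp add: form_eq_def form_apply)
    ultimately show ?case
      unfolding sum.insert[OF insert.hyps(1,2)] using sform_add[OF P[OF i] ih(3)] by blast
  qed
  have sum_pt: "pt_inner A \<omega> (\<Sum>i\<in>I. F i) v' x = (\<Sum>i\<in>I. pt_inner A \<omega> (F i) v' x)" for F :: "'a \<Rightarrow> ('a, 'n) form" and v' x
    by (simp add: pt_inner_def Let_def cinner_eq sum_fun_apply[of _ I] hin_sum_left)
  have "L2_inner A \<omega> (P u) v = (LINT x|vol. (\<Sum>i\<in>I. pt_inner A \<omega> (P (U i)) v x))"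
  proof -
    have "form_eq A (P u) (\<Sum>i\<in>I. P (U i))" using sum[of I] I(2) by simp
    then have "pt_inner A \<omega> (P u) v = pt_inner A \<omega> (\<Sum>i\<in>I. P (U i)) v" by (rule form_eq_pt_inner) (simp add: form_eq_def)
    then show ?thesis unfolding L2_inner_def sum_pt[symmetric] by simp
  qed
  also have "\<dots> = (\<Sum>i\<in>I. L2_inner A \<omega> (P (U i)) v)"
    unfolding L2_inner_def using loc_eq I(3) by (intro Bochner_Integration.integral_sum) blast
  also have "\<dots> = (\<Sum>i\<in>I. L2_inner A \<omega> (U i) w)" using loc_eq I(3) by (intro sum.cong) auto
  also have "\<dots> = (LINT x|vol. (\<Sum>i\<in>I. pt_inner A \<omega> (U i) w x))"
    unfolding L2_inner_def using loc_eq I(3) by (intro Bochner_Integration.integral_sum[symmetric]) blast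
  also have "\<dots> = L2_inner A \<omega> u w" unfolding L2_inner_def I(2) sum_pt ..
  finally show "L2_inner A \<omega> (P u) v = L2_inner A \<omega> u w" .
qed

end

section \<open>The operators of the identity\<close>

lemma nq_par_simps: "nq (thl \<theta> \<alpha>) = thl \<theta> (nq \<alpha>)" "np (thr \<theta> \<alpha>) = thr \<theta> (np \<alpha>)"
  by (simp_all add: thl_def thr_def nq_ext np_ext)

lemma cconj_thr: "cconj (thr \<theta> \<alpha>) = thl \<theta> (cconj \<alpha>)"
  using arg_cong[OF cconj_thl[of \<theta> "cconj \<alpha>"], of cconj] by simp

lemma cconj_trib: "cconj (trib t \<alpha>) = tri t (cconj \<alpha>)"
  using arg_cong[OF cconj_tri[of t "cconj \<alpha>"], of cconj] by simp

lemma cwedge_tri: "cwedge (tri t \<alpha>) \<beta> = tri t (cwedge \<alpha> \<beta>)"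
  by (simp add: tri_def cwedge_ext_left)

lemma cwedge_thr: "cwedge (thr \<theta> \<alpha>) \<beta> = thr \<theta> (cwedge \<alpha> \<beta>)"
  by (simp add: thr_def cwedge_ext_left)

lemma cwedge_par_thr: "cwedge (par \<alpha>) (thr \<theta> \<beta>) = thr \<theta> (cwedge \<alpha> \<beta>)"
  by (simp add: thr_def cwedge_ext_right)

lemma par_tri_cunit: "par (tri t cunit) = - tri t cunit"
  by (simp add: tri_def par_ext sum_negf csc_minus csc_minus1)

lemma thl_Lop: "thl \<theta> (Lop h \<alpha>) = tri (\<lambda>j p q. \<theta> j * h $ p $ q) \<alpha>"
  by (simp add: thl_def Lop_def tri_def csc_sum mult_ac)

lemma tri_diff: "tri (\<lambda>j p q. s j p q - t j p q) \<alpha> = tri s \<alpha> - tri t \<alpha>"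
  by (simp add: tri_def right_diff_distrib csc_diff_left sum_subtractf)

lemma length_filter_distinct:
  fixes as :: "('n::finite + 'n) list"
  assumes "distinct as"
  shows "length (filter isl as) \<le> CARD('n)" "length (filter (Not \<circ> isl) as) \<le> CARD('n)"
proof -
  have "length (filter isl as) = card (set (filter isl as))"
    by (rule distinct_card[OF distinct_filter[OF assms], symmetric])
  also have "\<dots> \<le> card (range (Inl :: 'n \<Rightarrow> 'n + 'n))"
    by (rule card_mono) (auto simp: isl_def)
  also have "\<dots> = CARD('n)" by (simp add: card_image)
  finally show "length (filter isl as) \<le> CARD('n)" .
  have "length (filter (Not \<circ> isl) as) = card (set (filter (Not \<circ> isl) as))"
    by (rule distinct_card[OF distinct_filter[OF assms], symmetric])
  also have "\<dots> \<le> card (range (Inr :: 'n \<Rightarrow> 'n + 'n))"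
    by (rule card_mono) (auto simp: isl_def image_iff, metis sumE)
  also have "\<dots> = CARD('n)" by (simp add: card_image)
  finally show "length (filter (Not \<circ> isl) as) \<le> CARD('n)" .
qed

text \<open>Cutting the sums off at n loses nothing: on distinct indices neither type occurs more
  than n times, and alternating forms vanish on all other lists.\<close>

lemma sum_cpart_np:
  fixes \<alpha> :: "'n::finite cform"
  assumes "alternating \<alpha>"
  shows "(\<Sum>p\<le>CARD('n). \<Sum>q\<le>CARD('n). csc (of_nat p) (cpart p q \<alpha>)) = np \<alpha>"
proof
  fix as :: "('n + 'n) list"
  let ?p = "length (filter isl as)" and ?q = "length (filter (Not \<circ> isl) as)"
  have "(\<Sum>p\<le>CARD('n). \<Sum>q\<le>CARD('n). csc (of_nat p) (cpart p q \<alpha>)) as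
    = (\<Sum>p\<le>CARD('n). \<Sum>q\<le>CARD('n). if ?p = p then (if ?q = q then of_nat p * \<alpha> as else 0) else 0)"
    unfolding sum_fun_apply by (intro sum.cong[OF refl]) (simp add: csc_apply cpart_def)
  also have "\<dots> = (if ?p \<le> CARD('n) \<and> ?q \<le> CARD('n) then of_nat ?p * \<alpha> as else 0)"
    by (simp add: sum_if_const)
  also have "\<dots> = np \<alpha> as"
    using length_filter_distinct[of as] alternating_not_distinct[OF assms, of as] by (auto simp: np_def)
  finally show "(\<Sum>p\<le>CARD('n). \<Sum>q\<le>CARD('n). csc (of_nat p) (cpart p q \<alpha>)) as = np \<alpha> as" .
qed

locale herm_eta = herm A \<omega>
  for A :: "('a::{t2_space,second_countable_topology}, 'n::finite) chart set" and \<omega> :: "('a, 'n) form" +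
  fixes \<eta> :: "'a \<Rightarrow> real"
  assumes smooth_\<eta>: "smooth_fun A \<eta>" and \<eta>_nonzero: "\<eta> x \<noteq> 0"
begin

abbreviation "\<eta>C \<equiv> \<lambda>x. complex_of_real (\<eta> x)"
abbreviation "\<eta>c \<equiv> \<lambda>c z. complex_of_real (\<eta> (chart_inv c z))"

definition \<theta> :: "('a, 'n) chart \<Rightarrow> complex ^ 'n \<Rightarrow> 'n \<Rightarrow> complex" where
  "\<theta> c z j = wirtinger (Inl j) (\<eta>c c) z / \<eta>c c z"

text \<open>The coefficients of \<alpha> in the format of \<open>tri\<close>: derivatives of h minus
  the twist, where the weight q is 1 on \<omega>. They need not be antisymmetric in \<open>j\<close>
  and \<open>p\<close>, because \<open>tri\<close> antisymmetrizes.\<close>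

definition tt :: "('a, 'n) chart \<Rightarrow> complex ^ 'n \<Rightarrow> 'n \<Rightarrow> 'n \<Rightarrow> 'n \<Rightarrow> complex" where
  "tt c z j p q = tth c (Inl j) z $ p $ q - \<theta> c z j * hm c z $ p $ q"

lemma smooth_\<eta>C: "smooth_fun A \<eta>C"
  using smooth_\<eta> by (auto simp: smooth_fun_def intro: smooth_on_of_real open_img)

lemma smooth_inverse_\<eta>: "smooth_fun A (\<lambda>x. inverse (\<eta>C x))"
  using smooth_\<eta>C \<eta>_nonzero by (auto simp: smooth_fun_def intro!: smooth_on_inverse open_img)

lemma fun_form_\<eta>: "fun_form \<eta>C c = (\<lambda>z. csc (\<eta>c c z) cunit)"
  by (simp add: fun_form_cunit fun_eq_iff)

lemma wirtinger_\<eta>: "wirtinger (Inl j) (\<eta>c c) z = \<eta>c c z * \<theta> c z j"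
  and wirtinger_\<eta>b: "c \<in> A \<Longrightarrow> z \<in> img c \<Longrightarrow> wirtinger (Inr j) (\<eta>c c) z = \<eta>c c z * cnj (\<theta> c z j)"
proof -
  show 1: "wirtinger (Inl j) (\<eta>c c) z = \<eta>c c z * \<theta> c z j" for j
    using \<eta>_nonzero by (simp add: \<theta>_def del: wirtinger.simps)
  assume c: "c \<in> A" "z \<in> img c"
  have "\<eta>c c differentiable (at z)"
    using smooth_\<eta>C c by (auto simp: smooth_fun_def intro: smooth_on_differentiable)
  from wirtinger_cnj[OF this, of "Inr j"] show "wirtinger (Inr j) (\<eta>c c) z = \<eta>c c z * cnj (\<theta> c z j)"
    by (simp add: 1 del: wirtinger.simps)
qed

lemma wedge_del_\<eta>: "cwedge (del (fun_form \<eta>C) c z) \<beta> = csc (\<eta>c c z) (thl (\<theta> c z) \<beta>)"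
proof -
  have Pl: "(\<Sum>a\<in>{a. isl a}. f a) = (\<Sum>j\<in>UNIV. f (Inl j))" for f :: "'n + 'n \<Rightarrow> 'n cform"
    by (rule sum.reindex_bij_witness[of _ Inl projl]) auto
  show ?thesis
    unfolding del_ld fun_form_\<eta> ld_function Pl wirtinger_\<eta>
    by (simp add: thl_def csc_sum cwedge_ext_left)
qed

lemma wedge_delbar_\<eta>: "c \<in> A \<Longrightarrow> z \<in> img c \<Longrightarrow> cwedge (delbar (fun_form \<eta>C) c z) \<beta> = csc (\<eta>c c z) (thr (\<theta> c z) \<beta>)"
proof -
  assume c: "c \<in> A" "z \<in> img c"
  have Pr: "(\<Sum>a\<in>{a. \<not> isl a}. f a) = (\<Sum>j\<in>UNIV. f (Inr j))" for f :: "'n + 'n \<Rightarrow> 'n cform"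
    by (rule sum.reindex_bij_witness[of _ Inr projr]) auto
  show ?thesis
    unfolding delbar_ld fun_form_\<eta> ld_function Pr wirtinger_\<eta>b[OF c]
    by (simp add: thr_def csc_sum cwedge_ext_left)
qed

lemma sform_thl: "sform u \<Longrightarrow> sform (\<lambda>c z. thl (\<theta> c z) (u c z))"
  using sform_smooth_scale[OF sform_wedge[OF sform_del[OF sform_fun_form[OF smooth_\<eta>C]]] smooth_inverse_\<eta>] \<eta>_nonzero
  by (simp add: wedge_def wedge_del_\<eta>)

lemma sform_thr: "sform u \<Longrightarrow> sform (\<lambda>c z. thr (\<theta> c z) (u c z))"
  using sform_smooth_scale[OF sform_wedge[OF sform_delbar[OF sform_fun_form[OF smooth_\<eta>C]]] smooth_inverse_\<eta>] \<eta>_nonzero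
  by (simp add: wedge_def wedge_delbar_\<eta>)

lemma D01_eq:
  assumes "c \<in> A" "z \<in> img c" "alternating (u c z)"
  shows "D01 \<eta> u c z = ld (\<lambda>a. \<not> isl a) (u c) z - thr (\<theta> c z) (np (u c z))"
proof -
  have "fmult (\<lambda>x. of_nat p / \<eta>C x) (wedge (delbar (fun_form \<eta>C)) (pq_part p q u)) c z
    = thr (\<theta> c z) (csc (of_nat p) (cpart p q (u c z)))" for p q
    using \<eta>_nonzero by (simp add: fmult_csc wedge_def wedge_delbar_\<eta>[OF assms(1,2)] pq_part_def)
  then have "D01 \<eta> u c z = ld (\<lambda>a. \<not> isl a) (u c) z
    - (\<Sum>p\<le>CARD('n). \<Sum>q\<le>CARD('n). thr (\<theta> c z) (csc (of_nat p) (cpart p q (u c z))))"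
    unfolding D01_def form_apply delbar_ld by (simp add: sum_fun_apply[of _ "{.._}"])
  also have "(\<Sum>p\<le>CARD('n). \<Sum>q\<le>CARD('n). thr (\<theta> c z) (csc (of_nat p) (cpart p q (u c z))))
    = thr (\<theta> c z) (np (u c z))"
    unfolding sum_cpart_np[OF assms(3), symmetric] clin_sum[OF clin_thr] ..
  finally show ?thesis .
qed

lemma conj_D01_eq:
  assumes "c \<in> A" "z \<in> img c" "alternating (u c z)" "ldf (u c) z"
  shows "conj_op (D01 \<eta>) u c z = ld isl (u c) z - thl (\<theta> c z) (nq (u c z))"
proof -
  have e: "conj_form u c = (\<lambda>w. cconj (u c w))" by (simp add: conj_form_def fun_eq_iff)
  have "conj_op (D01 \<eta>) u c z = cconj (ld (\<lambda>a. \<not> isl a) (\<lambda>w. cconj (u c w)) z - thr (\<theta> c z) (np (cconj (u c z))))"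
    unfolding conj_op_def conj_form_def[of "D01 \<eta> _"]
    using D01_eq[OF assms(1,2), of "conj_form u"] assms(3) by (simp add: e)
  then show ?thesis
    by (simp add: ld_cconj[OF assms(4)] cconj_thr flip: cconj_nq)
qed

subsection \<open>Normalized operators\<close>

text \<open>Normalized to 0 off the coordinate images, equality up to \<open>form_eq\<close> becomes equality.  With \<open>D\<close> short for
  \<open>D01 \<eta>\<close>, the operators \<open>Db\<close> and \<open>Dd\<close> are \<open>D\<close> and its conjugate, \<open>Lm\<close> is \<open>\<Lambda>\<close>, \<open>Aw\<close> and \<open>Bw\<close> are the wedge products
  with \<open>\<alpha> = Dd \<omega>\<close> and its conjugate, \<open>Hl\<close> and \<open>Hr\<close> those with \<open>\<partial>\<eta> / \<eta>\<close> and its conjugate.\<close>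

definition Db :: "('a, 'n) oper" where
  "Db u = nrm (\<lambda>c z. ld (\<lambda>a. \<not> isl a) (u c) z - thr (\<theta> c z) (np (u c z)))"

definition Dd :: "('a, 'n) oper" where
  "Dd u = nrm (\<lambda>c z. ld isl (u c) z - thl (\<theta> c z) (nq (u c z)))"

definition Lm :: "('a, 'n) oper" where "Lm u = (\<lambda>c z. lam (gm c z) (u c z))"
definition Aw :: "('a, 'n) oper" where "Aw u = (\<lambda>c z. tri (tt c z) (u c z))"
definition Bw :: "('a, 'n) oper" where "Bw u = (\<lambda>c z. trib (tt c z) (u c z))"
definition Hl :: "('a, 'n) oper" where "Hl u = (\<lambda>c z. thl (\<theta> c z) (u c z))"
definition Hr :: "('a, 'n) oper" where "Hr u = (\<lambda>c z. thr (\<theta> c z) (u c z))"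
definition sc :: "complex \<Rightarrow> ('a, 'n) oper" where "sc k u = (\<lambda>c z. csc k (u c z))"

abbreviation "V \<equiv> smooth_form A"

lemma V_I: "sform u \<Longrightarrow> (\<And>c z. c \<notin> A \<or> z \<notin> img c \<Longrightarrow> u c z = 0) \<Longrightarrow> V u"
  by (simp add: smooth_form_iff)

lemma V_out: "V u \<Longrightarrow> c \<notin> A \<or> z \<notin> img c \<Longrightarrow> u c z = 0"
  unfolding smooth_form_iff by blast

lemma nrm_at: "c \<in> A \<Longrightarrow> z \<in> img c \<Longrightarrow> nrm u c z = u c z"
  by (simp add: nrm_def)

lemma V_eqI: "V u \<Longrightarrow> V v \<Longrightarrow> (\<And>c z. c \<in> A \<Longrightarrow> z \<in> img c \<Longrightarrow> u c z = v c z) \<Longrightarrow> u = v"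
  using nrm_smooth[of u] nrm_smooth[of v] form_eq_iff[of u v] by (simp add: form_eq_def)

lemma V_pointwise: "V u \<Longrightarrow> sform v \<Longrightarrow> (\<And>c z. u c z = 0 \<Longrightarrow> v c z = 0) \<Longrightarrow> V v"
  using V_I V_out by blast

lemma V_add: "V u \<Longrightarrow> V v \<Longrightarrow> V (u + v)"
  and V_diff: "V u \<Longrightarrow> V v \<Longrightarrow> V (u - v)"
  by (rule V_I, auto simp: form_apply V_out[of u] V_out[of v] intro: sform_add sform_diff smooth_sform)+

lemma V_sc: "V u \<Longrightarrow> V (sc k u)"
  by (rule V_pointwise, assumption, rule sform_smooth_scale[OF smooth_sform smooth_fun_const[of k]]) (auto simp: sc_def)

lemma V_Lm: "V u \<Longrightarrow> V (Lm u)"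
  by (rule V_pointwise, assumption) (auto intro: sform_lam smooth_sform simp: Lm_def)

lemma V_Hl: "V u \<Longrightarrow> V (Hl u)" and V_Hr: "V u \<Longrightarrow> V (Hr u)"
  by (rule V_pointwise, assumption, auto intro: sform_thl sform_thr smooth_sform simp: Hl_def Hr_def)+

lemma sform_nq: "sform u \<Longrightarrow> sform (\<lambda>c z. nq (u c z))"
  using sform_conj[OF sform_np[OF sform_conj], of u] by (simp add: conj_form_def[abs_def] cconj_np)

lemma V_Db: "sform u \<Longrightarrow> V (Db u)"
  unfolding Db_def
  using sform_diff[OF sform_ld sform_thr[OF sform_np], of u "\<lambda>a. \<not> isl a" u]
  by (intro smooth_nrm) (simp add: fun_diff_def[where 'a = "('a, 'n) chart"] fun_diff_def[where 'a = "complex ^ 'n"])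

lemma V_Dd: "sform u \<Longrightarrow> V (Dd u)"
  unfolding Dd_def
  using sform_diff[OF sform_ld sform_thl[OF sform_nq], of u isl u]
  by (intro smooth_nrm) (simp add: fun_diff_def[where 'a = "('a, 'n) chart"] fun_diff_def[where 'a = "complex ^ 'n"])

lemma V_\<omega>: "V \<omega>" by (rule smooth_\<omega>)

lemma Dd_\<omega>:
  assumes c: "c \<in> A" "z \<in> img c"
  shows "Dd \<omega> c z = tri (tt c z) cunit"
proof -
  have Pl: "(\<Sum>a\<in>{a. isl a}. f a) = (\<Sum>j\<in>UNIV. f (Inl j))" for f :: "'n + 'n \<Rightarrow> 'n cform"
    by (rule sum.reindex_bij_witness[of _ Inl projl]) auto
  have \<omega>L: "\<omega> c w = Lop (hm c w) cunit" if "w \<in> img c" for w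
  proof -
    have "cpart 1 1 (\<omega> c w) = \<omega> c w" using \<omega>11 by (metis pq_part_def)
    then show ?thesis using form11_eq sform_alt[OF smooth_\<omega>' c(1) that] by blast
  qed
  have dh: "(\<lambda>w. \<i> * hm c w $ p $ q) differentiable (at z)" for p q
    by (intro differentiable_mult differentiable_const lmetric.dh[OF lmetric[OF c(1)] c(2)])
  have l0: "ldf (\<lambda>w. \<alpha>) z" for \<alpha> :: "'n cform" by (simp add: ldf_def)
  have w0: "wd a (\<lambda>w. \<alpha>) z = 0" for a and \<alpha> :: "'n cform" by (simp add: wd_def fun_eq_iff del: wirtinger.simps)
  have lL: "ldf (\<lambda>w. Lop (hm c w) cunit) z"
    unfolding Lop_def by (intro ldf_sum ldf_csc dh l0)
  have wi: "wirtinger a (\<lambda>w. \<i> * hm c w $ p $ q) z = \<i> * tth c a z $ p $ q" for a p q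
    by (subst wirtinger_cmult[OF lmetric.dh[OF lmetric[OF c(1)] c(2)]])
      (simp add: lmetric.th_def[OF lmetric[OF c(1)]] del: wirtinger.simps)
  have "ld isl (\<omega> c) z = ld isl (\<lambda>w. Lop (hm c w) cunit) z"
    by (rule ld_cong[OF open_img[OF c(1)] c(2) \<omega>L sform_ldf[OF smooth_\<omega>' c]])
  also have "\<dots> = tri (\<lambda>j p q. tth c (Inl j) z $ p $ q) cunit"
  proof -
    have "wd a (\<lambda>w. Lop (hm c w) cunit) z = (\<Sum>p\<in>UNIV. \<Sum>q\<in>UNIV. csc (\<i> * tth c a z $ p $ q) (ext (Inl p) (ext (Inr q) cunit)))" for a
    proof -
      have 1: "wd a (\<lambda>w. csc (\<i> * hm c w $ p $ q) \<alpha>) z = csc (\<i> * tth c a z $ p $ q) \<alpha>" for p q \<alpha>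
        using wd_csc[OF dh l0, of a p q \<alpha>] unfolding w0 wi by simp
      have 2: "wd a (\<lambda>w. \<Sum>q\<in>UNIV. csc (\<i> * hm c w $ p $ q) (ext (Inl p) (ext (Inr q) cunit))) z
        = (\<Sum>q\<in>UNIV. csc (\<i> * tth c a z $ p $ q) (ext (Inl p) (ext (Inr q) cunit)))" for p
        unfolding 1[symmetric] by (rule wd_sum[OF ldf_csc[OF dh l0]])
      show ?thesis unfolding Lop_def 2[symmetric] by (rule wd_sum[OF ldf_sum[OF ldf_csc[OF dh l0]]])
    qed
    then show ?thesis unfolding ld_eq Pl tri_def by simp
  qed
  finally have 1: "ld isl (\<omega> c) z = tri (\<lambda>j p q. tth c (Inl j) z $ p $ q) cunit" .
  have nq: "nq (\<omega> c z) = \<omega> c z"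
  proof
    fix as
    have "\<omega> c z as = cpart 1 1 (\<omega> c z) as" using \<omega>11 by (metis pq_part_def)
    then show "nq (\<omega> c z) as = \<omega> c z as" by (auto simp: nq_def cpart_def split: if_splits)
  qed
  have 2: "thl (\<theta> c z) (nq (\<omega> c z)) = tri (\<lambda>j p q. \<theta> c z j * hm c z $ p $ q) cunit"
    unfolding nq by (subst \<omega>L[OF c(2)]) (rule thl_Lop)
  have "Dd \<omega> c z = ld isl (\<omega> c) z - thl (\<theta> c z) (nq (\<omega> c z))" unfolding Dd_def by (rule nrm_at[OF c])
  also have "\<dots> = tri (tt c z) cunit" unfolding 1 2 tt_def[abs_def] tri_diff ..
  finally show ?thesis .
qed

lemma wedge_Dd_\<omega>: "c \<in> A \<Longrightarrow> z \<in> img c \<Longrightarrow> cwedge (Dd \<omega> c z) \<beta> = tri (tt c z) \<beta>"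
  by (simp add: Dd_\<omega> cwedge_tri)

lemma Aw_wedge: "V u \<Longrightarrow> Aw u = wedge (Dd \<omega>) u"
proof (intro ext[where 'a = "('a, 'n) chart"] ext[where 'a = "complex ^ 'n"])
  fix c z assume "V u"
  then show "Aw u c z = wedge (Dd \<omega>) u c z"
    using V_out[of u c z] wedge_Dd_\<omega>[of c z "u c z"] by (cases "c \<in> A \<and> z \<in> img c") (auto simp: Aw_def wedge_def)
qed

lemma V_wedge: "sform \<alpha> \<Longrightarrow> V u \<Longrightarrow> V (wedge \<alpha> u)"
  by (rule V_pointwise, assumption) (auto intro: sform_wedge smooth_sform simp: wedge_def)

lemma V_Aw: "V u \<Longrightarrow> V (Aw u)"
  unfolding Aw_wedge by (rule V_wedge[OF smooth_sform[OF V_Dd[OF smooth_\<omega>']]])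

lemma V_conj: "V u \<Longrightarrow> V (conj_form u)"
  by (rule V_pointwise, assumption) (auto intro: sform_conj smooth_sform simp: conj_form_def)

lemma conj_conj [simp]: "conj_form (conj_form u) = u"
  by (intro ext) (simp add: conj_form_def)

lemma Bw_conj: "Bw u = conj_form (Aw (conj_form u))"
  by (intro ext) (simp add: Bw_def Aw_def conj_form_def cconj_tri)

lemma V_Bw: "V u \<Longrightarrow> V (Bw u)"
  unfolding Bw_conj by (intro V_conj V_Aw)

lemmas V_intros = V_add V_diff V_sc V_Lm V_Hl V_Hr V_Aw V_Bw V_conj V_Db[OF smooth_sform] V_Dd[OF smooth_sform]

lemma D01_Db: "sform u \<Longrightarrow> nrm (D01 \<eta> u) = Db u"
  unfolding Db_def form_eq_iff[symmetric] form_eq_def by (simp add: D01_eq sform_alt)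

lemma conj_D01_Dd: "sform u \<Longrightarrow> nrm (conj_op (D01 \<eta>) u) = Dd u"
  unfolding Dd_def form_eq_iff[symmetric] form_eq_def by (simp add: conj_D01_eq sform_alt sform_ldf)

lemma Db_cong:
  assumes u: "sform u" and e: "form_eq A u v"
  shows "Db u = Db v"
  unfolding Db_def form_eq_iff[symmetric] form_eq_def
proof (intro ballI)
  fix c z assume c: "c \<in> A" "z \<in> img c"
  have e: "u c w = v c w" if "w \<in> img c" for w using e c(1) that by (simp add: form_eq_def)
  show "ld (\<lambda>a. \<not> isl a) (u c) z - thr (\<theta> c z) (np (u c z)) = ld (\<lambda>a. \<not> isl a) (v c) z - thr (\<theta> c z) (np (v c z))"
    using ld_cong[OF open_img[OF c(1)] c(2) e sform_ldf[OF u c]] by (simp only: e[OF c(2)])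
qed

lemma Dd_cong:
  assumes u: "sform u" and e: "form_eq A u v"
  shows "Dd u = Dd v"
  unfolding Dd_def form_eq_iff[symmetric] form_eq_def
proof (intro ballI)
  fix c z assume c: "c \<in> A" "z \<in> img c"
  have e: "u c w = v c w" if "w \<in> img c" for w using e c(1) that by (simp add: form_eq_def)
  show "ld isl (u c) z - thl (\<theta> c z) (nq (u c z)) = ld isl (v c) z - thl (\<theta> c z) (nq (v c z))"
    using ld_cong[OF open_img[OF c(1)] c(2) e sform_ldf[OF u c]] by (simp only: e[OF c(2)])
qed

end

lemma ocomm_tri_diff: "ocomm (lam g) (tri (\<lambda>j p q. s j p q - t j p q)) \<alpha> = ocomm (lam g) (tri s) \<alpha> - ocomm (lam g) (tri t) \<alpha>"
  by (simp add: ocomm_def tri_diff)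

context hmetric
begin

text \<open>\<open>double_lam\<close> for the conjugate forms. As \<Lambda> is real, conjugation
  merely exchanges \<open>tri\<close> and \<open>trib\<close> and changes the sign of \<i>.\<close>

lemma double_lam_conj:
  assumes uv: "alternating u" "alternating v"
  shows "H u (ocomm (lam g) (ocomm (lam g) (trib t)) v) = - 2 * \<i> * H (ocomm (lam g) (tri t) u) v"
proof -
  have c1: "cconj (ocomm (lam g) (ocomm (lam g) (trib t)) v) = ocomm (lam g) (ocomm (lam g) (tri t)) (cconj v)"
  proof -
    have c0: "cconj (ocomm (lam g) (trib t) w) = ocomm (lam g) (tri t) (cconj w)" if "alternating w" for w
      using that by (simp add: ocomm_def cconj_lam cconj_trib)
    have "alternating (ocomm (lam g) (trib t) v)" using uv by (simp add: ocomm_def)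
    then show ?thesis
      unfolding ocomm_def[of _ "ocomm _ _"] cconj_diff cconj_lam[OF \<open>alternating (ocomm (lam g) (trib t) v)\<close>]
      using uv(2) by (simp only: c0 alternating_lam cconj_lam)
  qed
  have c2: "cconj (ocomm (lam g) (tri t) u) = ocomm (lam g) (trib t) (cconj u)"
    using uv by (simp add: ocomm_def cconj_lam cconj_tri)
  have "cnj (H u (ocomm (lam g) (ocomm (lam g) (trib t)) v)) = 2 * \<i> * cnj (H (ocomm (lam g) (tri t) u) v)"
    unfolding hin_cconj[symmetric] c1 c2 by (rule double_lam) (use uv in auto)
  from arg_cong[OF this, of cnj] show ?thesis by simp
qed

lemma hin_tau: "alternating u \<Longrightarrow> alternating v \<Longrightarrow>
    H (ocomm (lam g) (tri t) u) v = H u (csc (- \<i> / 2) (ocomm (lam g) (ocomm (lam g) (trib t)) v))"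
  by (simp add: hin_csc_right double_lam_conj)

text \<open>The adjoint of \<open>Lop_ocomm_tri\<close>, divided by 3. It expresses the adjoint of
  the wedge product through \<Lambda> and the conjugate wedge product, hence by operators already
  known to preserve smooth forms.\<close>

lemma hin_tri:
  fixes t :: "'n \<Rightarrow> 'n \<Rightarrow> 'n \<Rightarrow> complex"
  assumes uv: "alternating u" "alternating v"
  defines "s \<equiv> \<lambda>x. csc (- \<i> / 2) (ocomm (lam g) (ocomm (lam g) (trib t)) x)"
  shows "H (tri t u) v = H u (csc (1 / 3) (s (lam g v) - lam g (s v)))"
proof -
  have alt: "alternating (s v)" "alternating (s (lam g v))" unfolding s_def ocomm_def
    by (intro alternating_csc alternating_diff alternating_lam alternating_trib uv)+
  have "3 * H (tri t u) v = H (Lop h (ocomm (lam g) (tri t) u)) v - H (ocomm (lam g) (tri t) (Lop h u)) v"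
    unfolding hin_csc_left[symmetric] hin_diff_left[symmetric] Lop_ocomm_tri[OF uv(1)] ..
  also have "\<dots> = H (ocomm (lam g) (tri t) u) (lam g v) - H (Lop h u) (s v)"
    using uv by (simp add: hin_Lop hin_tau s_def)
  also have "\<dots> = H u (s (lam g v)) - H u (lam g (s v))"
    using uv alt hin_tau[of u "lam g v" t] by (simp add: hin_Lop s_def)
  finally show ?thesis by (simp add: hin_csc_right hin_diff_right field_simps)
qed

lemma thls_lam: "csc (- \<i>) (lam g (thr \<theta> \<alpha>) - thr \<theta> (lam g \<alpha>)) = thls \<theta> \<alpha>"
  by (simp add: lam_thr)

lemma thrs_lam: "csc \<i> (lam g (thl \<theta> \<alpha>) - thl \<theta> (lam g \<alpha>)) = thrs \<theta> \<alpha>"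
  by (simp add: lam_thl csc_minus)

lemma lam_thls: "alternating \<alpha> \<Longrightarrow> lam g (thls \<theta> \<alpha>) = thls \<theta> (lam g \<alpha>)"
  by (simp add: thls_def lam_est)

end

section \<open>Adjoints of the operators\<close>

context herm_eta
begin

text \<open>The adjoints of \<open>[\<Lambda>, \<alpha>]\<close>, its conjugate, \<open>Aw\<close>, \<open>Hl\<close>, \<open>Hr\<close>, \<open>Dd\<close> and \<open>Db\<close>.  Expressed through \<open>\<Lambda>\<close>, wedge products
  and \<open>D\<close>, they map smooth forms to smooth forms for free.\<close>

definition Ts :: "('a, 'n) oper" where "Ts u = sc (- \<i> / 2) (ocomm Lm (ocomm Lm Bw) u)"
definition Tsb :: "('a, 'n) oper" where "Tsb u = sc (\<i> / 2) (ocomm Lm (ocomm Lm Aw) u)"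
definition As :: "('a, 'n) oper" where "As u = sc (1 / 3) (Ts (Lm u) - Lm (Ts u))"
definition Th :: "('a, 'n) oper" where "Th u = sc (- \<i>) (Lm (Hr u) - Hr (Lm u))"
definition Thb :: "('a, 'n) oper" where "Thb u = sc \<i> (Lm (Hl u) - Hl (Lm u))"
definition Es :: "('a, 'n) oper" where
  "Es u = sc \<i> (Lm (Db u) - Db (Lm u)) - Ts u - sc (of_nat CARD('n)) (Th u)"
definition Ds :: "('a, 'n) oper" where
  "Ds u = sc (- \<i>) (Lm (Dd u) - Dd (Lm u)) - Tsb u - sc (of_nat CARD('n)) (Thb u)"

lemma V_Ts: "V u \<Longrightarrow> V (Ts u)" and V_Tsb: "V u \<Longrightarrow> V (Tsb u)"
  unfolding Ts_def Tsb_def ocomm_def by (intro V_intros; assumption)+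

lemma V_As: "V u \<Longrightarrow> V (As u)" and V_Th: "V u \<Longrightarrow> V (Th u)" and V_Thb: "V u \<Longrightarrow> V (Thb u)"
  unfolding As_def Th_def Thb_def by (intro V_intros V_Ts; assumption)+

lemma V_Es: "V u \<Longrightarrow> V (Es u)" and V_Ds: "V u \<Longrightarrow> V (Ds u)"
  unfolding Es_def Ds_def by (intro V_intros V_Ts V_Tsb V_Th V_Thb; assumption)+

lemmas V_all = V_intros V_Ts V_Tsb V_As V_Th V_Thb V_Es V_Ds

lemma V_alt: "V u \<Longrightarrow> c \<in> A \<Longrightarrow> z \<in> img c \<Longrightarrow> alternating (u c z)"
  by (rule sform_alt[OF smooth_sform])

lemma op_at:
  "Lm u c z = lam (gm c z) (u c z)" "Aw u c z = tri (tt c z) (u c z)" "Bw u c z = trib (tt c z) (u c z)"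
  "Hl u c z = thl (\<theta> c z) (u c z)" "Hr u c z = thr (\<theta> c z) (u c z)" "sc k u c z = csc k (u c z)"
  by (simp_all add: Lm_def Aw_def Bw_def Hl_def Hr_def sc_def)

lemma Ts_at: "Ts u c z = csc (- \<i> / 2) (ocomm (lam (gm c z)) (ocomm (lam (gm c z)) (trib (tt c z))) (u c z))"
  by (simp add: Ts_def ocomm_def op_at form_apply)

lemma Th_at: "c \<in> A \<Longrightarrow> z \<in> img c \<Longrightarrow> Th u c z = hmetric.thls (gm c z) (\<theta> c z) (u c z)"
  by (simp add: Th_def op_at form_apply hmetric.thls_lam[OF hmetric])

lemma Thb_at: "c \<in> A \<Longrightarrow> z \<in> img c \<Longrightarrow> Thb u c z = hmetric.thrs (gm c z) (\<theta> c z) (u c z)"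
  by (simp add: Thb_def op_at form_apply hmetric.thrs_lam[OF hmetric])

lemma Db_at: "c \<in> A \<Longrightarrow> z \<in> img c \<Longrightarrow> Db u c z = ld (\<lambda>a. \<not> isl a) (u c) z - thr (\<theta> c z) (np (u c z))"
  and Dd_at: "c \<in> A \<Longrightarrow> z \<in> img c \<Longrightarrow> Dd u c z = ld isl (u c) z - thl (\<theta> c z) (nq (u c z))"
  by (simp_all only: Db_def Dd_def nrm_at)

lemma is_adj_Lm: "V v \<Longrightarrow> is_adj (wedge \<omega>) v (Lm v)"
  by (rule is_adj_pointwise)
    (simp_all add: smooth_sform V_Lm sform_wedge smooth_\<omega>' wedge_def \<omega>_Lop op_at hmetric.hin_Lop[OF hmetric] V_alt)

lemma is_adj_Tp: "V v \<Longrightarrow> is_adj (ocomm Lm Aw) v (Ts v)"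
proof (rule is_adj_pointwise)
  fix u c z assume *: "V v" "V u" "c \<in> A" "z \<in> img c"
  have "ocomm Lm Aw u c z = ocomm (lam (gm c z)) (tri (tt c z)) (u c z)" by (simp add: ocomm_def op_at form_apply)
  then show "hn c z (ocomm Lm Aw u c z) (v c z) = hn c z (u c z) (Ts v c z)"
    unfolding Ts_at using hmetric.hin_tau[OF hmetric[OF *(3,4)] V_alt[OF *(2-4)] V_alt[OF *(1,3,4)]] by simp
qed (auto simp: ocomm_def intro!: smooth_sform V_all)

lemma is_adj_Aw: "V v \<Longrightarrow> is_adj Aw v (As v)"
proof (rule is_adj_pointwise)
  fix u c z assume *: "V v" "V u" "c \<in> A" "z \<in> img c"
  have "As v c z = csc (1 / 3) (csc (- \<i> / 2) (ocomm (lam (gm c z)) (ocomm (lam (gm c z)) (trib (tt c z))) (lam (gm c z) (v c z)))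
    - lam (gm c z) (csc (- \<i> / 2) (ocomm (lam (gm c z)) (ocomm (lam (gm c z)) (trib (tt c z))) (v c z))))"
    unfolding As_def op_at form_apply Ts_at ..
  then show "hn c z (Aw u c z) (v c z) = hn c z (u c z) (As v c z)"
    unfolding op_at using hmetric.hin_tri[OF hmetric[OF *(3,4)] V_alt[OF *(2-4)] V_alt[OF *(1,3,4)]] by (simp only:)
qed (auto intro!: smooth_sform V_all)

lemma is_adj_Hl: "V v \<Longrightarrow> is_adj (wedge (del (fun_form \<eta>C))) v (fmult \<eta>C (Th v))"
proof (rule is_adj_pointwise)
  fix u c z assume *: "V v" "V u" "c \<in> A" "z \<in> img c"
  show "hn c z (wedge (del (fun_form \<eta>C)) u c z) (v c z) = hn c z (u c z) (fmult \<eta>C (Th v) c z)"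
    by (simp add: wedge_def wedge_del_\<eta> hin_csc_left hin_csc_right fmult_csc Th_at *(3,4)
        hmetric.hin_thl[OF hmetric[OF *(3,4)] V_alt[OF *(1,3,4)]])
qed (rule smooth_sform sform_fmult[OF smooth_sform[OF V_Th] smooth_\<eta>C] sform_wedge[OF sform_del[OF sform_fun_form[OF smooth_\<eta>C]] smooth_sform]; assumption)+

lemma is_adj_Hr: "V v \<Longrightarrow> is_adj (wedge (delbar (fun_form \<eta>C))) v (fmult \<eta>C (Thb v))"
proof (rule is_adj_pointwise)
  fix u c z assume *: "V v" "V u" "c \<in> A" "z \<in> img c"
  show "hn c z (wedge (delbar (fun_form \<eta>C)) u c z) (v c z) = hn c z (u c z) (fmult \<eta>C (Thb v) c z)"
    by (simp add: wedge_def wedge_delbar_\<eta> hin_csc_left hin_csc_right fmult_csc Thb_at *(3,4)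
        hmetric.hin_thr[OF hmetric[OF *(3,4)] V_alt[OF *(1,3,4)]])
qed (rule smooth_sform sform_fmult[OF smooth_sform[OF V_Thb] smooth_\<eta>C] sform_wedge[OF sform_delbar[OF sform_fun_form[OF smooth_\<eta>C]] smooth_sform]; assumption)+

section \<open>Adjoints of the first order operators\<close>

lemma Dd_add: "V u \<Longrightarrow> V v \<Longrightarrow> Dd (u + v) = Dd u + Dd v"
  and Db_add: "V u \<Longrightarrow> V v \<Longrightarrow> Db (u + v) = Db u + Db v"
proof -
  assume uv: "V u" "V v"
  have l: "ld P ((u + v) c) z = ld P (u c) z + ld P (v c) z" if "c \<in> A" "z \<in> img c" for P c z
    using ld_add[OF sform_ldf[OF smooth_sform[OF uv(1)] that] sform_ldf[OF smooth_sform[OF uv(2)] that]]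
    by (simp add: plus_fun_def[of "u c" "v c"])
  show "Dd (u + v) = Dd u + Dd v"
  proof (rule V_eqI)
    fix c z assume c: "c \<in> A" "z \<in> img c"
    show "Dd (u + v) c z = (Dd u + Dd v) c z"
      unfolding Dd_at[OF c] form_apply l[OF c] by simp
  qed (use uv in \<open>auto intro: V_all\<close>)
  show "Db (u + v) = Db u + Db v"
  proof (rule V_eqI)
    fix c z assume c: "c \<in> A" "z \<in> img c"
    show "Db (u + v) c z = (Db u + Db v) c z"
      unfolding Db_at[OF c] form_apply l[OF c] by simp
  qed (use uv in \<open>auto intro: V_all\<close>)
qed

lemma Dd_sc: "V u \<Longrightarrow> Dd (sc k u) = sc k (Dd u)"
  and Db_sc: "V u \<Longrightarrow> Db (sc k u) = sc k (Db u)"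
proof -
  assume u: "V u"
  have l: "ld P (sc k u c) z = csc k (ld P (u c) z)" if "c \<in> A" "z \<in> img c" for P c z
  proof -
    have "wd a (sc k u c) z = csc k (wd a (u c) z)" for a
      using sform_ldf[OF smooth_sform[OF u] that]
      by (auto simp: wd_def sc_def csc_def ldf_def wirtinger_cmult fun_eq_iff simp del: wirtinger.simps)
    then show ?thesis by (simp add: ld_eq csc_sum)
  qed
  show "Dd (sc k u) = sc k (Dd u)"
    by (rule V_eqI) (use u in \<open>auto intro: V_all simp: Dd_at l op_at csc_diff\<close>)
  show "Db (sc k u) = sc k (Db u)"
    by (rule V_eqI) (use u in \<open>auto intro: V_all simp: Db_at l op_at csc_diff\<close>)
qed

lemma Dd_supp:
  assumes u: "V u" and K: "compact K" "supp_in u K"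
  shows "supp_in (Dd u) K"
  unfolding supp_in_def
proof (intro ballI impI)
  fix c x assume c: "c \<in> A" "x \<in> cdom c" and x: "x \<notin> K"
  let ?S = "snd c ` (cdom c - K)"
  have oS: "open ?S" by (rule open_snd_image[OF c(1)]) (use open_dom[OF c(1)] compact_imp_closed[OF K(1)] in auto)
  have zS: "snd c x \<in> ?S" using c x by blast
  have u0: "u c w = 0" if "w \<in> ?S" for w using that K(2) c(1) by (auto simp: supp_in_def)
  have "ld isl (u c) (snd c x) = ld isl (\<lambda>_. 0) (snd c x)"
    by (rule ld_cong[OF oS zS u0 sform_ldf[OF smooth_sform[OF u] c(1) snd_img[OF c]]])
  also have "\<dots> = 0" by (auto simp: ld_def fun_eq_iff simp del: wirtinger.simps)
  finally show "Dd u c (snd c x) = 0" using c snd_img[OF c] u0[OF zS] by (simp add: Dd_at)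
qed

text \<open>\<open>divergence\<close> handles the part without \<eta>. The weight terms of
  \<open>Dd\<close> and \<open>Db\<close> do not correspond under the adjoint; \<open>twist\<close>
  converts one into the other at the price of the \<eta>-part of the torsion, which completes
  \<open>tt\<close>, and of \<open>n\<close> times \<open>Th\<close>.\<close>

lemma is_adj_Dd: "V v \<Longrightarrow> is_adj Dd v (Es v)"
proof (rule is_adj_first_order)
  fix u c z assume *: "V v" "V u" "c \<in> A" "z \<in> img c"
  interpret hz: hmetric "hm c z" "gm c z" by (rule hmetric[OF *(3,4)])
  note alt = V_alt[OF *(2-4)] V_alt[OF *(1,3,4)]
  let ?H = "hn c z (u c z)" and ?l = "lam (gm c z)" and ?u = "u c z" and ?v = "v c z" and ?t = "\<theta> c z"
  let ?db = "ld (\<lambda>a. \<not> isl a) (v c) z" and ?dl = "ld (\<lambda>a. \<not> isl a) (\<lambda>w. lam (gm c w) (v c w)) z"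
  have Lc: "Lm v c = (\<lambda>w. lam (gm c w) (v c w))" by (simp add: Lm_def)
  have "Es v c z = csc \<i> (?l (?db - thr ?t (np ?v)) - (?dl - thr ?t (np (?l ?v)))) - Ts v c z
      - csc (of_nat CARD('n)) (hz.thls ?t ?v)"
    unfolding Es_def form_apply op_at(1,6) Db_at[OF *(3,4)] Lc Th_at[OF *(3,4)] ..
  also have "\<dots> = csc \<i> (?l ?db - ?dl) - csc \<i> (?l (np (thr ?t ?v)) - np (thr ?t (?l ?v))) - Ts v c z
      - csc (of_nat CARD('n)) (hz.thls ?t ?v)"
    by (simp add: nq_par_simps csc_diff)
  finally have "?H (Es v c z) = ?H (csc \<i> (?l ?db - ?dl)) - ?H (csc \<i> (?l (np (thr ?t ?v)) - np (thr ?t (?l ?v))))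
      - ?H (Ts v c z) - of_nat CARD('n) * ?H (hz.thls ?t ?v)"
    by (simp only: hin_diff_right hin_csc_right complex_cnj_of_nat)
  moreover have "?H (Ts v c z) = hn c z (ocomm ?l (tri (tt c z)) ?u) ?v"
    unfolding Ts_at by (rule hz.hin_tau[OF alt, symmetric])
  moreover have "ocomm ?l (tri (tt c z)) ?u = ocomm ?l (tri (\<lambda>j p q. tth c (Inl j) z $ p $ q)) ?u
      - ocomm ?l (\<lambda>\<alpha>. thl ?t (Lop (hm c z) \<alpha>)) ?u"
    unfolding tt_def[abs_def] ocomm_tri_diff thl_Lop ..
  moreover have "?H (hz.thls ?t ?v) = hn c z (thl ?t ?u) ?v"
    by (rule hz.hin_thl[OF alt(2), symmetric])
  moreover have "hn c z (Dd u c z) ?v = hn c z (ld isl (u c) z) ?v - hn c z (nq (thl ?t ?u)) ?v"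
    unfolding Dd_at[OF *(3,4)] nq_par_simps hin_diff_left ..
  ultimately show "hn c z (Dd u c z) (v c z) - hn c z (u c z) (Es v c z) = defect u v c z"
    unfolding defect_def hz.twist[OF alt] by (simp add: hin_diff_left)
next
  show "form_eq A (Dd 0) 0"
    using Dd_add[of 0 0] V_diff[OF V_\<omega> V_\<omega>] by (simp add: form_eq_def)
qed (auto intro: smooth_sform V_all Dd_supp simp: Dd_add form_eq_def)

subsection \<open>Conjugation\<close>

lemma conj_simps: "conj_form (u + v) = conj_form u + conj_form v" "conj_form (u - v) = conj_form u - conj_form v"
  "conj_form (sc k u) = sc (cnj k) (conj_form u)" "conj_form (Aw u) = Bw (conj_form u)" "conj_form (Bw u) = Aw (conj_form u)"
  "conj_form (Hl u) = Hr (conj_form u)" "conj_form (Hr u) = Hl (conj_form u)" "conj_form (wedge u v) = wedge (conj_form u) (conj_form v)"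
  for u v :: "('a, 'n) form"
  by (intro ext; simp add: conj_form_def form_apply op_at cconj_tri cconj_trib cconj_thl cconj_thr wedge_def cconj_cwedge)+

lemma conj_Lm: "V u \<Longrightarrow> conj_form (Lm u) = Lm (conj_form u)"
  by (rule V_eqI) (auto intro: V_all simp: conj_form_def op_at hmetric.cconj_lam[OF hmetric] V_alt)

lemma conj_Db: "V u \<Longrightarrow> conj_form (Db u) = Dd (conj_form u)"
proof (rule V_eqI)
  fix c z assume *: "V u" "c \<in> A" "z \<in> img c"
  have e: "conj_form u c = (\<lambda>w. cconj (u c w))" by (simp add: conj_form_def fun_eq_iff)
  show "conj_form (Db u) c z = Dd (conj_form u) c z"
    unfolding conj_form_def[of "Db u"] Db_at[OF *(2,3)] Dd_at[OF *(2,3)] e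
    using sform_ldf[OF smooth_sform[OF *(1)] *(2,3)] by (simp add: ld_cconj cconj_thr cconj_np)
qed (auto intro: V_all)

lemma conj_Dd: "V u \<Longrightarrow> conj_form (Dd u) = Db (conj_form u)"
  using arg_cong[OF conj_Db[OF V_conj, of u], of conj_form] by simp

lemma Ds_conj: "V v \<Longrightarrow> Ds v = conj_form (Es (conj_form v))"
  by (simp add: Es_def Ds_def Ts_def Tsb_def Th_def Thb_def ocomm_def conj_simps conj_Lm conj_Db conj_Dd V_all)

lemma L2_conj:
  assumes "sform u" "sform v"
  shows "L2_inner A \<omega> (conj_form u) (conj_form v) = cnj (L2_inner A \<omega> u v)"
proof -
  have "pt_inner A \<omega> (conj_form u) (conj_form v) x = cnj (pt_inner A \<omega> u v x)" for x
  proof -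
    obtain c where c: "c \<in> A" "x \<in> cdom c" using covers[of x] by blast
    show ?thesis
      unfolding pt_inner_chart[OF sform_conj[OF assms(1)] sform_conj[OF assms(2)] c] pt_inner_chart[OF assms c] conj_form_def
      by (rule hmetric.hin_cconj[OF hmetric[OF c(1) snd_img[OF c]]])
  qed
  then show ?thesis by (simp add: L2_inner_def)
qed

lemma supp_compact: "compactly_supported A u \<Longrightarrow> (\<And>K. compact K \<Longrightarrow> supp_in u K \<Longrightarrow> supp_in v K) \<Longrightarrow> compactly_supported A v"
  unfolding compactly_supported_iff by blast

lemma conj_compact: "compactly_supported A u \<Longrightarrow> compactly_supported A (conj_form u)"
  by (erule supp_compact) (auto simp: supp_in_def conj_form_def)

text \<open>Conjugation is antiunitary and exchanges \<open>Db\<close> with \<open>Dd\<close>, so a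
  second integration by parts is avoided.\<close>

lemma is_adj_Db: "V v \<Longrightarrow> is_adj Db v (Ds v)"
  unfolding is_adj_def
proof (intro allI impI)
  fix u assume v: "V v" and u: "V u" "compactly_supported A u"
  have s: "sform (Db u)" "sform v" "sform u" "sform (Es (conj_form v))" "sform (Ds v)"
    using u v by (auto intro!: smooth_sform V_all)
  have "cnj (L2_inner A \<omega> (Db u) v) = L2_inner A \<omega> (Dd (conj_form u)) (conj_form v)"
    using L2_conj[OF s(1,2)] conj_Db[OF u(1)] by simp
  also have "\<dots> = L2_inner A \<omega> (conj_form u) (Es (conj_form v))"
    using is_adj_Dd[OF V_conj[OF v]] V_conj[OF u(1)] conj_compact[OF u(2)] unfolding is_adj_def by blast
  also have "\<dots> = cnj (L2_inner A \<omega> u (Ds v))"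
    using L2_conj[OF s(3,5)] Ds_conj[OF v] by simp
  finally show "L2_inner A \<omega> (Db u) v = L2_inner A \<omega> u (Ds v)" by simp
qed

subsection \<open>Commutation relations\<close>

lemma Db_wedge:
  assumes \<alpha>: "V \<alpha>" and u: "V u" and c: "c \<in> A" "z \<in> img c"
  shows "Db (wedge \<alpha> u) c z = cwedge (Db \<alpha> c z) (u c z) + cwedge (par (\<alpha> c z)) (Db u c z)"
proof -
  have e: "wedge \<alpha> u c = (\<lambda>w. cwedge (\<alpha> c w) (u c w))" by (simp add: wedge_def fun_eq_iff)
  note l = ld_cwedge[OF sform_ldf[OF smooth_sform[OF \<alpha>] c] sform_ldf[OF smooth_sform[OF u] c]]
  show ?thesis
    unfolding Db_at[OF c] e l np_cwedge thr_lin cwedge_lin cwedge_thr cwedge_par_thr by simp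
qed

lemma Dd_wedge:
  assumes \<alpha>: "V \<alpha>" and u: "V u" and c: "c \<in> A" "z \<in> img c"
  shows "Dd (wedge \<alpha> u) c z = cwedge (Dd \<alpha> c z) (u c z) + cwedge (par (\<alpha> c z)) (Dd u c z)"
proof -
  have "conj_form (Dd (wedge \<alpha> u)) = Db (wedge (conj_form \<alpha>) (conj_form u))"
    using \<alpha> u by (simp add: conj_Dd conj_simps V_wedge smooth_sform)
  then have "cconj (Dd (wedge \<alpha> u) c z) = Db (wedge (conj_form \<alpha>) (conj_form u)) c z"
    by (metis conj_form_def)
  also have "\<dots> = cwedge (cconj (Dd \<alpha> c z)) (cconj (u c z)) + cwedge (par (cconj (\<alpha> c z))) (cconj (Dd u c z))"
    unfolding Db_wedge[OF V_conj[OF \<alpha>] V_conj[OF u] c] conj_Dd[OF \<alpha>, symmetric] conj_Dd[OF u, symmetric] conj_form_def ..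
  finally have "cconj (Dd (wedge \<alpha> u) c z) = cconj (cwedge (Dd \<alpha> c z) (u c z) + cwedge (par (\<alpha> c z)) (Dd u c z))"
    by (simp only: cconj_cwedge cconj_add cconj_par)
  from arg_cong[OF this, of cconj] show ?thesis by (simp only: cconj_cconj)
qed

text \<open>The signs in the next two lemmas come from the degrees 2 of \<open>\<omega>\<close> and 3 of \<open>\<alpha>\<close>.\<close>

lemma Aw_commutator: "V u \<Longrightarrow> Aw u = Dd (wedge \<omega> u) - wedge \<omega> (Dd u)"
proof (rule V_eqI)
  fix c z assume *: "V u" "c \<in> A" "z \<in> img c"
  have "\<omega> c z as = 0" if "length as \<noteq> 2" for as
  proof -
    have "\<omega> c z as = cpart 1 1 (\<omega> c z) as" using \<omega>11 by (metis pq_part_def)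
    moreover have "\<not> (length (filter isl as) = 1 \<and> length (filter (Not \<circ> isl) as) = 1)"
      using that sum_length_filter_compl[of isl as] by (simp add: o_def)
    ultimately show ?thesis unfolding cpart_def by presburger
  qed
  then have "(-1) ^ length as * \<omega> c z as = \<omega> c z as" for as
    by (cases "length as = 2") simp_all
  then have "par (\<omega> c z) = \<omega> c z" unfolding par_def by (rule ext)
  then show "Aw u c z = (Dd (wedge \<omega> u) - wedge \<omega> (Dd u)) c z"
    unfolding form_apply Dd_wedge[OF V_\<omega> *] wedge_Dd_\<omega>[OF *(2,3)] by (simp add: op_at wedge_def)
qed (auto intro: V_all V_wedge smooth_\<omega>')

lemma Db_Aw:
  assumes u: "V u"
  shows "wedge (Db (Dd \<omega>)) u = Db (Aw u) + Aw (Db u)"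
proof (rule V_eqI)
  fix c z assume c: "c \<in> A" "z \<in> img c"
  have V\<alpha>: "V (Dd \<omega>)" by (rule V_Dd[OF smooth_\<omega>'])
  have p: "par (Dd \<omega> c z) = - Dd \<omega> c z" unfolding Dd_\<omega>[OF c] by (rule par_tri_cunit)
  have "Db (Aw u) c z = cwedge (Db (Dd \<omega>) c z) (u c z) + cwedge (par (Dd \<omega> c z)) (Db u c z)"
    unfolding Aw_wedge[OF u] by (rule Db_wedge[OF V\<alpha> u c])
  also have "\<dots> = wedge (Db (Dd \<omega>)) u c z - Aw (Db u) c z"
    unfolding p cwedge_lin wedge_Dd_\<omega>[OF c] op_at wedge_def by simp
  finally show "wedge (Db (Dd \<omega>)) u c z = (Db (Aw u) + Aw (Db u)) c z" unfolding form_apply by simp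
qed (use u in \<open>auto intro!: V_all V_wedge smooth_sform V_\<omega>\<close>)

lemma Lm_Th: "V u \<Longrightarrow> Lm (Th u) = Th (Lm u)"
  by (rule V_eqI) (auto intro: V_all simp: op_at Th_at V_alt hmetric.lam_thls[OF hmetric])

text \<open>Integrals of differences can be split only when both parts are integrable; compact
  support provides this by reduction to charts.\<close>

lemma integrable_pt_inner:
  assumes u: "V u" "compactly_supported A u" and v: "sform v"
  shows "integrable vol (pt_inner A \<omega> u v)"
proof -
  obtain K where "compact K" "supp_in u K" using u(2) unfolding compactly_supported_iff by blast
  then obtain I :: "'a set" and U where I: "finite I" "u = (\<Sum>i\<in>I. U i)" "\<And>i. i \<in> I \<Longrightarrow> local_form (U i)"
    using partition_of_form[OF u(1)] by metis
  have e: "pt_inner A \<omega> u v = (\<lambda>x. \<Sum>i\<in>I. pt_inner A \<omega> (U i) v x)"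
    unfolding I(2) by (rule ext) (simp add: pt_inner_def Let_def cinner_eq sum_fun_apply[of _ I] hin_sum_left)
  show ?thesis
    unfolding e
  proof (rule Bochner_Integration.integrable_sum)
    fix i assume "i \<in> I"
    then obtain c K where "V (U i)" "c \<in> A" "compact K" "K \<subseteq> cdom c" "supp_in (U i) K" using I(3) unfolding local_form_def by blast
    then show "integrable vol (pt_inner A \<omega> (U i) v)" using L2_chart(1)[OF smooth_sform v] by blast
  qed
qed

lemma is_adj_unique: "V w \<Longrightarrow> V w' \<Longrightarrow> is_adj P v w \<Longrightarrow> is_adj P v w' \<Longrightarrow> w = w'"
  using adj_is_adj[OF smooth_sform, of w P v] adj_is_adj[OF smooth_sform, of w' P v] by (simp add: nrm_smooth)

text \<open>This is the adjoint of \<open>Aw_commutator\<close>.\<close>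

lemma Lm_Es: "V v \<Longrightarrow> Lm (Es v) - Es (Lm v) = As v"
proof (rule is_adj_unique[OF _ _ _ is_adj_Aw])
  assume v: "V v"
  show "is_adj Aw v (Lm (Es v) - Es (Lm v))"
    unfolding is_adj_def
  proof (intro allI impI)
    fix u assume u: "V u" "compactly_supported A u"
    have Vs: "V (wedge \<omega> u)" "V (Dd u)" "V (Dd (wedge \<omega> u))" "V (wedge \<omega> (Dd u))"
      using u(1) by (auto intro!: V_all V_wedge smooth_\<omega>' smooth_sform)
    have sL: "supp_in w K \<Longrightarrow> supp_in (wedge \<omega> w) K" for w K by (simp add: supp_in_def wedge_def)
    have c: "compactly_supported A (wedge \<omega> u)" "compactly_supported A (Dd u)"
      using supp_compact[OF u(2)] sL Dd_supp[OF u(1)] by blast+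
    have c2: "compactly_supported A (Dd (wedge \<omega> u))" "compactly_supported A (wedge \<omega> (Dd u))"
      using supp_compact[OF c(1)] supp_compact[OF c(2)] sL Dd_supp[OF Vs(1)] by blast+
    have sv: "sform v" "sform (Lm v)" "sform (Es v)" "sform (Lm (Es v))" "sform (Es (Lm v))"
      using v by (auto intro!: smooth_sform V_all)
    have pd: "pt_inner A \<omega> (a - b) w x = pt_inner A \<omega> a w x - pt_inner A \<omega> b w x" for a b w x
      by (simp add: pt_inner_def Let_def cinner_eq form_apply hin_lin)
    have "L2_inner A \<omega> (Aw u) v = L2_inner A \<omega> (Dd (wedge \<omega> u)) v - L2_inner A \<omega> (wedge \<omega> (Dd u)) v"
      unfolding Aw_commutator[OF u(1)] L2_inner_def pd
      by (rule Bochner_Integration.integral_diff) (intro integrable_pt_inner Vs c2 sv)+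
    also have "\<dots> = L2_inner A \<omega> (wedge \<omega> u) (Es v) - L2_inner A \<omega> (Dd u) (Lm v)"
      using is_adj_Dd[OF v] is_adj_Lm[OF v] Vs c unfolding is_adj_def by simp
    also have "\<dots> = L2_inner A \<omega> u (Lm (Es v)) - L2_inner A \<omega> u (Es (Lm v))"
      using is_adj_Lm[OF V_Es[OF v]] is_adj_Dd[OF V_Lm[OF v]] u unfolding is_adj_def by simp
    also have "\<dots> = L2_inner A \<omega> u (Lm (Es v) - Es (Lm v))"
      unfolding L2_inner_def pt_inner_diff_right
      by (rule Bochner_Integration.integral_diff[symmetric]) (intro integrable_pt_inner u sv)+
    finally show "L2_inner A \<omega> (Aw u) v = L2_inner A \<omega> u (Lm (Es v) - Es (Lm v))" .
  qed
qed (auto intro: V_all)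

end

section \<open>The refined Bochner-Kodaira-Nakano identity\<close>

context herm_eta
begin

lemma Lm_lin: "Lm (u + v) = Lm u + Lm v" "Lm (u - v) = Lm u - Lm v" "Lm (sc k u) = sc k (Lm u)"
  and Aw_lin: "Aw (u + v) = Aw u + Aw v" "Aw (u - v) = Aw u - Aw v" "Aw (sc k u) = sc k (Aw u)"
  and Bw_lin: "Bw (u + v) = Bw u + Bw v" "Bw (u - v) = Bw u - Bw v" "Bw (sc k u) = sc k (Bw u)"
  and Hl_lin: "Hl (u + v) = Hl u + Hl v" "Hl (u - v) = Hl u - Hl v" "Hl (sc k u) = sc k (Hl u)"
  and Hr_lin: "Hr (u + v) = Hr u + Hr v" "Hr (u - v) = Hr u - Hr v" "Hr (sc k u) = sc k (Hr u)"
  and sc_lin: "sc k (u + v) = sc k u + sc k v" "sc k (u - v) = sc k u - sc k v" "sc k (sc l u) = sc (k * l) u"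
  and wedge_lin: "wedge \<beta> (u + v) = wedge \<beta> u + wedge \<beta> v" "wedge \<beta> (u - v) = wedge \<beta> u - wedge \<beta> v"
    "wedge \<beta> (sc k u) = sc k (wedge \<beta> u)"
  by (intro ext; simp only: op_at form_apply wedge_def lam_lin tri_lin trib_lin thl_lin thr_lin cwedge_lin csc_csc csc_add csc_diff mult.commute)+

lemma Db_diff: "V u \<Longrightarrow> V v \<Longrightarrow> Db (u - v) = Db u - Db v"
  using Db_add[of "u - v" v] by (simp add: V_diff algebra_simps)

lemma Dd_diff: "V u \<Longrightarrow> V v \<Longrightarrow> Dd (u - v) = Dd u - Dd v"
  using Dd_add[of "u - v" v] by (simp add: V_diff algebra_simps)

lemmas op_lin = Lm_lin Aw_lin Bw_lin Hl_lin Hr_lin sc_lin wedge_lin Db_add Db_diff Db_sc Dd_add Dd_diff Dd_sc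

text \<open>By the definition of \<open>Es\<close>, this is the adjoint of \<open>Dd + [\<Lambda>, \<alpha>] + n Hl\<close>.\<close>

definition Ys :: "('a, 'n) oper" where "Ys u = sc \<i> (Lm (Db u) - Db (Lm u))"

lemma Ys_eq: "Es u + Ts u + sc (of_nat CARD('n)) (Th u) = Ys u"
  by (simp add: Es_def Ys_def)

lemma Ys_add: "V u \<Longrightarrow> V v \<Longrightarrow> Ys (u + v) = Ys u + Ys v"
  by (simp only: Ys_def op_lin V_all) (simp add: algebra_simps)

lemma form_ext: "(\<And>c z as. u c z as = v c z as) \<Longrightarrow> u = v" for u v :: "('a, 'n) form"
  by (intro ext)

lemma form_at: "(u + v) c z as = u c z as + v c z as" "(u - v) c z as = u c z as - v c z as" "sc k u c z as = k * u c z as"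
  for u v :: "('a, 'n) form"
  by (simp_all add: form_apply op_at csc_apply)

text \<open>Commuting the three parts of \<open>Ys\<close> with \<Lambda> gives \<open>As\<close>
  from \<open>Es\<close>, minus three times \<open>As\<close> from \<open>Ts\<close>, and nothing
  from \<open>Th\<close>: in total \<open>- 2\<close> times \<open>As\<close>. This removes
  \<open>As\<close> in favour of words in \<open>Lm\<close> and \<open>Db\<close>.\<close>

lemma As_Ys:
  assumes u: "V u"
  shows "As u = sc (- 1 / 2) (Lm (Ys u) - Ys (Lm u))"
proof -
  have "Lm (Ys u) - Ys (Lm u) = (Lm (Es u) - Es (Lm u)) + (Lm (Ts u) - Ts (Lm u))
     + sc (of_nat CARD('n)) (Lm (Th u) - Th (Lm u))"
    unfolding Ys_eq[symmetric] Lm_lin sc_lin by (simp add: algebra_simps)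
  also have "\<dots> = As u + (Lm (Ts u) - Ts (Lm u)) + sc (of_nat CARD('n)) 0"
    unfolding Lm_Es[OF u] Lm_Th[OF u] by simp
  finally have e: "Lm (Ys u) - Ys (Lm u) = As u + (Lm (Ts u) - Ts (Lm u)) + sc (of_nat CARD('n)) 0" .
  show ?thesis
  proof (rule form_ext)
    fix c z as
    have "As u c z as = 1 / 3 * (Ts (Lm u) c z as - Lm (Ts u) c z as)"
      unfolding As_def form_at ..
    moreover have "(Lm (Ys u) - Ys (Lm u)) c z as = As u c z as + (Lm (Ts u) c z as - Ts (Lm u) c z as)"
      unfolding e form_at by (simp add: form_apply)
    moreover have "a = - 1 / 2 * r" if "a = 1 / 3 * (s - t)" "r = a + (t - s)" for a r s t :: complex
    proof -
      have "s - t = 3 * a" unfolding that(1) by simp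
      then have "t - s = - 3 * a" by (metis minus_diff_eq mult_minus_left)
      then show ?thesis using that(2) by simp
    qed
    ultimately show "As u c z as = sc (- 1 / 2) (Lm (Ys u) - Ys (Lm u)) c z as"
      unfolding form_at(3) by blast
  qed
qed

abbreviation "Tp \<equiv> ocomm Lm Aw"
abbreviation "W \<equiv> wedge (Db (Dd \<omega>))"

text \<open>The operator T of the theorem in normalized form. In its last term the graded commutator
  of two odd operators has become an anticommutator.\<close>

definition TT :: "('a, 'n) oper" where
  "TT u = sc (- (\<i> / 2)) (Lm (ocomm Lm W u) - ocomm Lm W (Lm u)) - (Aw (As u) + As (Aw u))"

text \<open>The Jacobi identities are applied implicitly: once \<open>As\<close> is eliminated by \<open>As_Ys\<close> and \<open>W\<close> by \<open>Db_Aw\<close>, both sides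
  expand to the same linear combination of words in \<open>Db\<close>, \<open>Dd\<close>, \<open>Lm\<close> and \<open>Aw\<close>.\<close>

lemma words_identity:
  assumes u: "V u"
  shows "Db (sc (- \<i>) (Lm (Dd u) - Dd (Lm u)) - Tsb u) + (sc (- \<i>) (Lm (Dd (Db u)) - Dd (Lm (Db u))) - Tsb (Db u))
    = (Dd (Ys u) + Tp (Ys u)) + (Ys (Dd u) + Ys (Tp u)) + TT u
      + sc \<i> ((Db (Dd (Lm u)) + Dd (Db (Lm u))) - Lm (Db (Dd u) + Dd (Db u)))"
proof -
  have a: "As (Aw u) = sc (- 1 / 2) (Lm (Ys (Aw u)) - Ys (Lm (Aw u)))" "As u = sc (- 1 / 2) (Lm (Ys u) - Ys (Lm u))"
    using u by (simp_all only: As_Ys V_all)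
  have w: "W v = Db (Aw v) + Aw (Db v)" if "V v" for v by (rule Db_Aw[OF that])
  show ?thesis
    unfolding TT_def a ocomm_def Tsb_def
    using u by (simp only: w Ys_def op_lin V_all ocomm_def)
      (rule form_ext, simp only: form_at, simp add: field_simps)
qed

text \<open>Only a regrouping of \<open>words_identity\<close>. The first term with n completes
  \<open>Es + Ts\<close> to \<open>Ys\<close> in both orders of the anticommutator; the second is
  the \<open>Thb\<close> part of \<open>Ds\<close>.\<close>

lemma main_identity:
  assumes u: "V u"
  shows "Db (Ds u) + Ds (Db u)
    = (Dd (Es u + Ts u) + Tp (Es u + Ts u)) + (Es (Dd u + Tp u) + Ts (Dd u + Tp u)) + TT u
      + sc \<i> ((Db (Dd (Lm u)) + Dd (Db (Lm u))) - Lm (Db (Dd u) + Dd (Db u)))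
      + sc (of_nat CARD('n)) ((Dd (Th u) + Tp (Th u)) + Th (Dd u + Tp u)) - sc (of_nat CARD('n)) (Db (Thb u) + Thb (Db u))"
proof -
  have VT: "V (Tp v)" if "V v" for v unfolding ocomm_def using that by (intro V_intros)
  have Tp_add: "Tp (v + w) = Tp v + Tp w" "Tp (sc k v) = sc k (Tp v)" for v w k
    by (simp_all only: ocomm_def op_lin) (simp_all add: algebra_simps)
  have 1: "(Dd (Es u + Ts u) + Tp (Es u + Ts u)) + sc (of_nat CARD('n)) (Dd (Th u) + Tp (Th u)) = Dd (Ys u) + Tp (Ys u)"
  proof -
    have "Dd (Ys u) + Tp (Ys u) = Dd (Es u + Ts u) + sc (of_nat CARD('n)) (Dd (Th u)) + (Tp (Es u + Ts u) + sc (of_nat CARD('n)) (Tp (Th u)))"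
      unfolding Ys_eq[symmetric] using u by (simp only: Dd_add[of "Es u + Ts u"] Dd_sc Tp_add(1)[of "Es u + Ts u"] Tp_add(2) V_all)
    then show ?thesis by (simp only: sc_lin add_ac)
  qed
  have 2: "Es (Dd u + Tp u) + Ts (Dd u + Tp u) + sc (of_nat CARD('n)) (Th (Dd u + Tp u)) = Ys (Dd u) + Ys (Tp u)"
    unfolding Ys_eq using u by (simp only: Ys_add V_all VT)
  have 3: "Db (Ds u) + Ds (Db u) = Db (sc (- \<i>) (Lm (Dd u) - Dd (Lm u)) - Tsb u) + (sc (- \<i>) (Lm (Dd (Db u)) - Dd (Lm (Db u))) - Tsb (Db u))
      - sc (of_nat CARD('n)) (Db (Thb u) + Thb (Db u))"
  proof -
    have "Db (Ds u) = Db (sc (- \<i>) (Lm (Dd u) - Dd (Lm u)) - Tsb u) - sc (of_nat CARD('n)) (Db (Thb u))"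
      unfolding Ds_def[of u] using u
      by (simp only: Db_diff[of "sc (- \<i>) (Lm (Dd u) - Dd (Lm u)) - Tsb u"] Db_sc[of "Thb u"] V_all)
    then show ?thesis unfolding Ds_def[of "Db u"] sc_lin by (simp only: add_diff_eq diff_add_eq diff_diff_eq add_ac)
  qed
  have "Db (Ds u) + Ds (Db u) = (Dd (Ys u) + Tp (Ys u)) + (Ys (Dd u) + Ys (Tp u)) + TT u
      + sc \<i> ((Db (Dd (Lm u)) + Dd (Db (Lm u))) - Lm (Db (Dd u) + Dd (Db u))) - sc (of_nat CARD('n)) (Db (Thb u) + Thb (Db u))"
    unfolding 3 words_identity[OF u] ..
  then show ?thesis unfolding 1[symmetric] 2[symmetric] by (simp only: sc_lin add_ac)
qed

subsection \<open>Representation by normalized operators\<close>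

text \<open>X is an operator as the theorem states it, with arbitrary values off the coordinate
  images, and Y its normalized counterpart. The relation is compatible with sums, compositions and
  graded commutators, so both sides of the identity are translated following their syntax.\<close>

definition rep :: "('a, 'n) oper \<Rightarrow> ('a, 'n) oper \<Rightarrow> bool" where
  "rep X Y \<longleftrightarrow> (\<forall>v. sform v \<longrightarrow> sform (X v) \<and> nrm (X v) = Y (nrm v))"

lemma sform_nrm_iff: "sform (nrm u) \<longleftrightarrow> sform u"
proof
  have "form_eq A (nrm u) u" using form_eq_nrm[of u] by (simp add: form_eq_def)
  then show "sform u" if "sform (nrm u)" using form_eq_sform[OF that] by blast
qed (rule smooth_sform[OF smooth_nrm])

lemma repI: "(\<And>v. sform v \<Longrightarrow> V (Y (nrm v)) \<and> nrm (X v) = Y (nrm v)) \<Longrightarrow> rep X Y"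
  unfolding rep_def using sform_nrm_iff smooth_sform by metis

lemma repD: "rep X Y \<Longrightarrow> sform v \<Longrightarrow> sform (X v)" "rep X Y \<Longrightarrow> sform v \<Longrightarrow> nrm (X v) = Y (nrm v)"
  by (auto simp: rep_def)

lemma rep_cong: "rep X Y \<Longrightarrow> (\<And>v. V v \<Longrightarrow> Y v = Z v) \<Longrightarrow> rep X Z"
  unfolding rep_def using smooth_nrm by metis

lemma nrm_ops: "nrm (u + v) = nrm u + nrm v" "nrm (u - v) = nrm u - nrm v" "nrm (fmult f u) = fmult f (nrm u)"
  "nrm (conj_form u) = conj_form (nrm u)" "nrm (wedge u v) = wedge (nrm u) (nrm v)"
  by (intro ext; simp add: nrm_def form_apply fmult_csc conj_form_def wedge_def)+

lemma rep_comp: "rep X Y \<Longrightarrow> rep X' Y' \<Longrightarrow> rep (\<lambda>v. X (X' v)) (\<lambda>v. Y (Y' v))"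
  by (auto simp: rep_def)

lemma rep_add: "rep X Y \<Longrightarrow> rep X' Y' \<Longrightarrow> rep (X + X') (\<lambda>v. Y v + Y' v)"
  by (simp add: rep_def sform_add nrm_ops)

lemma rep_diff: "rep X Y \<Longrightarrow> rep X' Y' \<Longrightarrow> rep (X - X') (\<lambda>v. Y v - Y' v)"
  unfolding rep_def fun_diff_def[of X X'] by (simp add: sform_diff nrm_ops)

lemma rep_scale: "rep X Y \<Longrightarrow> smooth_fun A f \<Longrightarrow> rep (f \<odot> X) (\<lambda>v. fmult f (Y v))"
  by (simp add: rep_def scale_op_def sform_fmult nrm_ops)

lemma fmult_const: "fmult (\<lambda>_. k) u = sc k u"
  by (intro ext) (simp add: fmult_csc op_at)

lemma rep_scale_const: "rep X Y \<Longrightarrow> rep ((\<lambda>_. k) \<odot> X) (\<lambda>v. sc k (Y v))"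
  using rep_scale[OF _ smooth_fun_const[of k]] by (simp add: fmult_const)

lemma rep_gcomm: "rep P Y \<Longrightarrow> rep Q Z \<Longrightarrow> rep (gcomm a b P Q) (\<lambda>v. Y (Z v) - sc ((-1) powi (a * b)) (Z (Y v)))"
  unfolding rep_def gcomm_def fmult_const[symmetric]
  by (simp add: sform_diff sform_fmult smooth_fun_const nrm_ops)

lemma rep_conj: "rep X Y \<Longrightarrow> rep (conj_op X) (\<lambda>v. conj_form (Y (conj_form v)))"
  by (simp add: rep_def conj_op_def sform_conj nrm_ops)

lemma rep_wedge: "sform \<alpha> \<Longrightarrow> rep (wedge \<alpha>) (wedge (nrm \<alpha>))"
  by (simp add: rep_def sform_wedge nrm_ops)

lemma wedge_nrm:
  assumes "V v"
  shows "wedge (nrm \<alpha>) v = wedge \<alpha> v"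
proof (intro ext[where 'a = "('a, 'n) chart"] ext[where 'a = "complex ^ 'n"])
  fix c z
  show "wedge (nrm \<alpha>) v c z = wedge \<alpha> v c z"
    using V_out[OF assms, of c z] by (cases "c \<in> A \<and> z \<in> img c") (auto simp: wedge_def nrm_def)
qed

lemma rep_D01: "rep (D01 \<eta>) Db"
proof (rule repI)
  fix v assume v: "sform v"
  then have "Db (nrm v) = Db v" using Db_cong[OF v form_eq_nrm] by simp
  then show "V (Db (nrm v)) \<and> nrm (D01 \<eta> v) = Db (nrm v)" using D01_Db[OF v] V_Db[OF v] by simp
qed

lemma rep_conj_D01: "rep (conj_op (D01 \<eta>)) Dd"
proof (rule repI)
  fix v assume v: "sform v"
  then have "Dd (nrm v) = Dd v" using Dd_cong[OF v form_eq_nrm] by simp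
  then show "V (Dd (nrm v)) \<and> nrm (conj_op (D01 \<eta>) v) = Dd (nrm v)" using conj_D01_Dd[OF v] V_Dd[OF v] by simp
qed

text \<open>An integral over the manifold sees forms only up to \<open>form_eq\<close>, so P may be
  replaced by Y under the adjoint; uniqueness then evaluates the definite description.\<close>

lemma rep_adj:
  assumes P: "rep P Y" and adj: "\<And>v. V v \<Longrightarrow> V (Z v)" "\<And>v. V v \<Longrightarrow> is_adj Y v (Z v)"
  shows "rep (adj A \<omega> P) Z"
proof (rule repI)
  fix v assume v: "sform v"
  then have Vv: "V (nrm v)" by (rule smooth_nrm)
  have "L2_inner A \<omega> (P u) v = L2_inner A \<omega> (Y u) (nrm v)" if "V u" for u
  proof -
    have "nrm (P u) = Y u" using repD(2)[OF P smooth_sform[OF that]] nrm_smooth[OF that] by simp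
    then have "form_eq A (P u) (Y u)" using form_eq_nrm[of "P u"] by simp
    then show ?thesis using form_eq_pt_inner[OF _ form_eq_nrm] by (simp add: L2_inner_def)
  qed
  then have "is_adj P v (Z (nrm v))" using adj(2)[OF Vv] unfolding is_adj_def by metis
  then have "adj A \<omega> P v = Z (nrm v)" using adj_is_adj[OF smooth_sform[OF adj(1)[OF Vv]]] nrm_smooth[OF adj(1)[OF Vv]] by simp
  then show "V (Z (nrm v)) \<and> nrm (adj A \<omega> P v) = Z (nrm v)" using adj(1)[OF Vv] nrm_smooth[OF adj(1)[OF Vv]] by simp
qed

lemma rep_Lam: "rep (Lam A \<omega>) Lm"
  unfolding Lam_def by (rule rep_adj[OF rep_wedge[OF smooth_\<omega>'] V_Lm]) (simp_all add: nrm_smooth[OF V_\<omega>] is_adj_Lm)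

text \<open>\<Lambda> and \<omega> are real, so conjugating the commutator with
  \<open>D01 \<eta> \<omega>\<close> gives the commutator with \<alpha>.\<close>

lemma rep_tau: "rep (conj_op (tau01 A \<omega> \<eta>)) Tp"
proof -
  have "nrm (D01 \<eta> \<omega>) = Db \<omega>" using repD(2)[OF rep_D01 smooth_\<omega>'] nrm_smooth[OF V_\<omega>] by simp
  then have "rep (wedge (D01 \<eta> \<omega>)) (wedge (Db \<omega>))" using rep_wedge[OF repD(1)[OF rep_D01 smooth_\<omega>']] by simp
  moreover have "wedge (Db \<omega>) v = Bw v" if "V v" for v
    using conj_Dd[OF V_\<omega>] Aw_wedge[OF V_conj[OF that]] \<omega>_real by (simp add: Bw_conj conj_simps)
  ultimately have "rep (wedge (D01 \<eta> \<omega>)) Bw" by (rule rep_cong)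
  from rep_conj[OF rep_gcomm[OF rep_Lam this, of "-2" 3]] show ?thesis
    unfolding tau01_def
  proof (rule rep_cong)
    fix v assume v: "V v"
    have "conj_form (Lm (Bw (conj_form v))) = Lm (Aw v)" "conj_form (Bw (Lm (conj_form v))) = Aw (Lm v)"
      using v by (simp_all add: conj_Lm V_all conj_simps)
    then show "conj_form (Lm (Bw (conj_form v)) - sc ((-1) powi (-2 * 3)) (Bw (Lm (conj_form v)))) = Tp v"
      by (simp add: conj_simps(2,3) ocomm_def power_int_def) (simp add: sc_def)
  qed
qed

lemma rep_Aw: "rep (wedge (conj_op (D01 \<eta>) \<omega>)) Aw"
proof -
  have "nrm (conj_op (D01 \<eta>) \<omega>) = Dd \<omega>" using repD(2)[OF rep_conj_D01 smooth_\<omega>'] nrm_smooth[OF V_\<omega>] by simp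
  then have "rep (wedge (conj_op (D01 \<eta>) \<omega>)) (wedge (Dd \<omega>))" using rep_wedge[OF repD(1)[OF rep_conj_D01 smooth_\<omega>']] by simp
  then show ?thesis by (rule rep_cong) (simp add: Aw_wedge)
qed

lemma rep_W: "rep (wedge (D01 \<eta> (conj_op (D01 \<eta>) \<omega>))) W"
proof -
  note r = rep_comp[OF rep_D01 rep_conj_D01]
  have "nrm (D01 \<eta> (conj_op (D01 \<eta>) \<omega>)) = Db (Dd \<omega>)" using repD(2)[OF r smooth_\<omega>'] nrm_smooth[OF V_\<omega>] by simp
  then show ?thesis using rep_wedge[OF repD(1)[OF r smooth_\<omega>']] by simp
qed

lemma V_fmult: "V u \<Longrightarrow> smooth_fun A f \<Longrightarrow> V (fmult f u)"
  by (rule V_pointwise, assumption) (auto intro: sform_fmult smooth_sform simp: fmult_csc)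

lemma smooth_divide_\<eta>: "smooth_fun A (\<lambda>x. 1 / \<eta>C x)"
  using smooth_inverse_\<eta> by (simp add: inverse_eq_divide)

lemma divide_\<eta>: "fmult (\<lambda>x. 1 / \<eta>C x) (fmult \<eta>C u) = u"
  using \<eta>_nonzero by (intro ext) (simp add: fmult_csc)

text \<open>The wedge product with \<partial>\<eta> is \<eta> times \<open>Hl\<close>. As \<eta> is
  real, its adjoint carries the same factor, which the division in the theorem cancels.\<close>

lemma rep_Th: "rep ((\<lambda>x. 1 / \<eta>C x) \<odot> adj A \<omega> (wedge (del (fun_form \<eta>C)))) Th"
proof -
  have s: "sform (del (fun_form \<eta>C))" by (intro sform_del sform_fun_form smooth_\<eta>C)
  have "rep (adj A \<omega> (wedge (del (fun_form \<eta>C)))) (\<lambda>v. fmult \<eta>C (Th v))"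
  proof (rule rep_adj)
    show "rep (wedge (del (fun_form \<eta>C))) (wedge (del (fun_form \<eta>C)))"
      by (rule rep_cong[OF rep_wedge[OF s] wedge_nrm])
  qed (use V_fmult[OF V_Th smooth_\<eta>C] is_adj_Hl in auto)
  from rep_scale[OF this smooth_divide_\<eta>] show ?thesis by (simp add: divide_\<eta>)
qed

lemma rep_Thb: "rep ((\<lambda>x. 1 / \<eta>C x) \<odot> adj A \<omega> (wedge (delbar (fun_form \<eta>C)))) Thb"
proof -
  have s: "sform (delbar (fun_form \<eta>C))" by (intro sform_delbar sform_fun_form smooth_\<eta>C)
  have "rep (adj A \<omega> (wedge (delbar (fun_form \<eta>C)))) (\<lambda>v. fmult \<eta>C (Thb v))"
  proof (rule rep_adj)
    show "rep (wedge (delbar (fun_form \<eta>C))) (wedge (delbar (fun_form \<eta>C)))"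
      by (rule rep_cong[OF rep_wedge[OF s] wedge_nrm])
  qed (use V_fmult[OF V_Thb smooth_\<eta>C] is_adj_Hr in auto)
  from rep_scale[OF this smooth_divide_\<eta>] show ?thesis by (simp add: divide_\<eta>)
qed

lemma powi_signs: "(-1 :: complex) powi (1 * -1) = -1" "(-1 :: complex) powi (3 * -3) = -1" "(-1 :: complex) powi (-2 * 2) = 1"
  "(-1 :: complex) powi (-2 * 4) = 1" "(-1 :: complex) powi (2 * -2) = 1" "(-1 :: complex) powi (1 * 1) = -1"
  by (simp_all add: power_int_def)

lemma sc_signs: "u - sc (-1) v = u + v" "u - sc 1 v = u - v"
  by (intro ext; simp add: form_apply op_at csc_m1)+

lemma rep_T: "rep (T_op A \<omega> \<eta>) TT"
proof -
  have r2: "rep (adj A \<omega> (wedge (conj_op (D01 \<eta>) \<omega>))) As"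
    by (rule rep_adj[OF rep_Aw V_As is_adj_Aw])
  note r1 = rep_scale_const[OF rep_gcomm[OF rep_Lam rep_gcomm[OF rep_Lam rep_W, of "-2" 4], of "-2" 2], of "- (\<i> / 2)"]
  from rep_diff[OF r1 rep_gcomm[OF rep_Aw r2, of 3 "-3"], unfolded powi_signs sc_signs]
  show ?thesis unfolding T_op_def by (rule rep_cong) (simp only: TT_def ocomm_def)
qed

text \<open>Here \<open>As\<close> is unfolded by its definition through \<open>Ts\<close> and not
  by \<open>As_Ys\<close>: that way \<open>TT\<close> is a word in the fibrewise operators
  \<open>Lm\<close>, \<open>Aw\<close>, \<open>Bw\<close> and \<open>W\<close>, and no derivative of
  the argument occurs.\<close>

lemma zeroth_order_T: "zeroth_order A (T_op A \<omega> \<eta>)"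
proof -
  have lin: "TT (u + v) = TT u + TT v" for u v
    by (simp only: TT_def As_def Ts_def ocomm_def op_lin) (simp add: algebra_simps)
  have f: "Lm (fmult f u) = fmult f (Lm u)" "Aw (fmult f u) = fmult f (Aw u)" "Bw (fmult f u) = fmult f (Bw u)"
    "W (fmult f u) = fmult f (W u)" "sc k (fmult f u) = fmult f (sc k u)"
    "fmult f u - fmult f v = fmult f (u - v)" "fmult f u + fmult f v = fmult f (u + v)" for f u v k
    by (intro ext; simp add: fmult_csc op_at wedge_def form_apply csc_add csc_diff mult.commute)+
  have fm: "TT (fmult f u) = fmult f (TT u)" for f u
    by (simp only: TT_def As_def Ts_def ocomm_def f)
  have T: "nrm (T_op A \<omega> \<eta> u) = TT u" if "V u" for u
    using repD(2)[OF rep_T smooth_sform[OF that]] nrm_smooth[OF that] by simp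
  show ?thesis
    unfolding zeroth_order_def form_eq_iff
    by (auto simp: nrm_ops T V_add V_fmult lin fm)
qed

lemma identity:
  assumes u: "V u"
  shows "form_eq A (Laplace01 A \<omega> \<eta> u)
    ((gcomm 1 (-1) (conj_op (D01 \<eta>) + conj_op (tau01 A \<omega> \<eta>)) (adj A \<omega> (conj_op (D01 \<eta>)) + adj A \<omega> (conj_op (tau01 A \<omega> \<eta>)))
      + T_op A \<omega> \<eta>
      + (\<lambda>_. \<i>) \<odot> gcomm 2 (-2) (gcomm 1 1 (D01 \<eta>) (conj_op (D01 \<eta>))) (Lam A \<omega>)
      + (\<lambda>_. (of_nat CARD('n))) \<odot> gcomm 1 (-1) (conj_op (D01 \<eta>) + conj_op (tau01 A \<omega> \<eta>))
            ((\<lambda>x. 1 / \<eta>C x) \<odot> adj A \<omega> (wedge (del (fun_form \<eta>C))))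
      - (\<lambda>_. (of_nat CARD('n))) \<odot> gcomm 1 (-1) (D01 \<eta>)
            ((\<lambda>x. 1 / \<eta>C x) \<odot> adj A \<omega> (wedge (delbar (fun_form \<eta>C))))) u)"
proof -
  have rDs: "rep (adj A \<omega> (D01 \<eta>)) Ds" by (rule rep_adj[OF rep_D01 V_Ds is_adj_Db])
  have rEs: "rep (adj A \<omega> (conj_op (D01 \<eta>))) Es" by (rule rep_adj[OF rep_conj_D01 V_Es is_adj_Dd])
  have rTs: "rep (adj A \<omega> (conj_op (tau01 A \<omega> \<eta>))) Ts" by (rule rep_adj[OF rep_tau V_Ts is_adj_Tp])
  \<comment> \<open>From here on both sides are assembled from the \<open>rep\<close> rules in the
    order of the syntax of the theorem; the degrees given to \<open>rep_gcomm\<close> determine the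
    signs.\<close>
  note rD = rep_add[OF rep_conj_D01 rep_tau]
  note L = rep_gcomm[OF rep_D01 rDs, of 1 "-1", unfolded powi_signs sc_signs]
  note R = rep_diff[OF rep_add[OF rep_add[OF rep_add[OF
      rep_gcomm[OF rD rep_add[OF rEs rTs], of 1 "-1", unfolded powi_signs sc_signs]
      rep_T]
      rep_scale_const[OF rep_gcomm[OF rep_gcomm[OF rep_D01 rep_conj_D01, of 1 1] rep_Lam, of 2 "-2", unfolded powi_signs sc_signs], of \<i>]]
      rep_scale_const[OF rep_gcomm[OF rD rep_Th, of 1 "-1", unfolded powi_signs sc_signs], of "of_nat CARD('n)"]]
      rep_scale_const[OF rep_gcomm[OF rep_D01 rep_Thb, of 1 "-1", unfolded powi_signs sc_signs], of "of_nat CARD('n)"]]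
  show ?thesis
    unfolding form_eq_iff Laplace01_def repD(2)[OF L smooth_sform[OF u]] repD(2)[OF R smooth_sform[OF u]] nrm_smooth[OF u]
    by (rule main_identity[OF u])
qed

end

theorem theorem4p6:
  fixes A :: "('a::{t2_space,second_countable_topology}, 'n::finite) chart set"
    and \<omega> :: "('a, 'n) form"
    and \<eta> :: "'a \<Rightarrow> real"
    and k :: nat
  assumes "hermitian_manifold A \<omega>"
    and "CARD('n) \<ge> 2"
    and "smooth_fun A \<eta>"
    and "(\<forall>x. \<eta> x > 0) \<or> (\<forall>x. \<eta> x < 0)"
    and "k \<le> 2 * CARD('n)"
  shows "zeroth_order A (T_op A \<omega> \<eta>) \<and>
    (\<forall>u. smooth_form A u \<and> has_degree k u \<longrightarrow>
      (let n = of_nat CARD('n);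
           \<eta>C = (\<lambda>x. complex_of_real (\<eta> x));
           D = D01 \<eta>;
           Dbar = conj_op D;
           taubar = conj_op (tau01 A \<omega> \<eta>)
       in form_eq A
         (Laplace01 A \<omega> \<eta> u)
         ((gcomm 1 (-1) (Dbar + taubar) (adj A \<omega> Dbar + adj A \<omega> taubar)
           + T_op A \<omega> \<eta>
           + (\<lambda>_. \<i>) \<odot> gcomm 2 (-2) (gcomm 1 1 D Dbar) (Lam A \<omega>)
           + (\<lambda>_. n) \<odot> gcomm 1 (-1) (Dbar + taubar)
                 ((\<lambda>x. 1 / \<eta>C x) \<odot> adj A \<omega> (wedge (del (fun_form \<eta>C))))
           - (\<lambda>_. n) \<odot> gcomm 1 (-1) D
                 ((\<lambda>x. 1 / \<eta>C x) \<odot> adj A \<omega> (wedge (delbar (fun_form \<eta>C))))) u)))"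
proof -
  interpret herm_eta A \<omega> \<eta>
  proof
    show "\<eta> x \<noteq> 0" for x using assms(4) by (metis less_irrefl)
  qed (use assms in auto)
  show ?thesis unfolding Let_def using zeroth_order_T identity by blast
qed

end
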